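(* For each $n\ge 1$ let $p_n\in(0,1)$ with $p_n\to 0$, $r_n:=1/p_n$, let $X_1,\dots,X_n$ be i.i.d. $\mathrm{Ber}(p_n)$, and let $G_n$ be a simple undirected graph on $n$ vertices with adjacency matrix $(a_{uv}(G_n))$ such that $\mathbb E[T_n]=|E(G_n)|p_n^2=\Theta(1)$, where $T_n:=\frac12\sum_{1\le u,v\le n}a_{uv}(G_n)X_uX_v$. Assume the vertices of $G_n$ are labelled $\{1,\dots,n\}$ in non-increasing order of the degrees and that the following hold: (a) $\lim_{K\to\infty}\lim_{n\to\infty}\frac12\int_K^\infty\int_K^\infty W_{G_n}(x,y)\,dx\,dy=\lambda_0$. (b) There exists $W\in\mathcal W$ such that for all $K>0$ large enough, $\lim_{n\to\infty}\|W_{G_n}-W\|_{\square([0,K]^2)}=0$. (c) There exists a function $d:[0,\infty)\to[0,\infty)$ in $L_1([0,\infty))$ such that for all $K,M>0$ large enough, $$\lim_{n\to\infty}\int_0^K\left|d_{W_{G_n}}(x)\mathbf 1\{d_{W_{G_n}}(x)\le M\}-d(x)\mathbf 1\{d(x)\le M\}\right|dx=0.$$ Then $\int_{[0,\infty)^2}W(x,y)\,dx\,dy<\infty$ and $T_n$ converges in distribution to $Q_1+Q_2+Q_3$, where $Q_3\sim\mathrm{Pois}(\lambda_0)$ is independent of $(Q_1,Q_2)$, and the joint moment generating function of $(Q_1,Q_2)$ is given, for $t_1,t_2\ge 0$, by $$\mathbb E\exp\{-t_1Q_1-t_2Q_2\}=\mathbb E\exp\left\{\frac12\int_0^\infty\int_0^\infty\phi_{W,t_1}(x,y)\,dN(x)\,dN(y)-(1-e^{-t_2})\int_0^\infty\Delta(x)\,dN(x)\right\},$$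 where $\Delta(x):=d(x)-\int_0^\infty W(x,y)\,dy$, $\phi_{W,t_1}(x,y):=\log(1-W(x,y)+W(x,y)e^{-t_1})$, and $\{N(t),t\ge0\}$ is a homogeneous Poisson process of rate $1$.
   Context: $\Theta(1)$ means bounded above and below by positive constants for all large $n$. $\mathrm{Pois}(0)$ is the point mass at $0$. $\mathcal W$ is the set of symmetric measurable functions $[0,\infty)^2\to[0,1]$. For a graph $G_n$ on vertex set $\{1,\dots,n\}$, $W_{G_n}\in\mathcal W$ is $W_{G_n}(x,y)=\mathbf 1\{(\lceil xr_n\rceil,\lceil yr_n\rceil)\in E(G_n)\}$ for $x,y\in[0,n/r_n]$ and $0$ otherwise; $d_{W_{G_n}}(x):=\int_0^\infty W_{G_n}(x,y)\,dy$. Cut-distance: $\|W_1-W_2\|_{\square([0,K]^2)}:=\sup_{f,g:[0,K]\to[-1,1]}\left|\int_{[0,K]^2}(W_1(x,y)-W_2(x,y))f(x)g(y)\,dx\,dy\right|$. Double limits: $\lim_{K\to\infty}\lim_{n\to\infty}a_{n,K}=a$ means $\limsup_{K}\limsup_{n}a_{n,K}=\liminf_{K}\liminf_{n}a_{n,K}=a$. Stochastic integrals: let $N(A)$ be the number of points of the rate-1 Poisson process in the Borel set $A\subseteq[0,\infty)$. If $f=\sum_{i_1,\dots,i_k=1}^m a_{i_1\dots i_k}\mathbf 1_{A_{i_1}\times\cdots\times A_{i_k}}\in L_1([0,\infty)^k)$ with $A_1,\dots,A_m$ pairwise disjoint Borel sets and $a_{i_1\dots i_k}=0$ whenever two indices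 coincide, then $\int f\prod_j dN(x_j):=\sum a_{i_1\dots i_k}N(A_{i_1})\cdots N(A_{i_k})$. For general $f\in L_1([0,\infty)^k)$ the integral is the $L_1(\Omega)$-limit of the integrals of any sequence of such elementary functions converging to $f$ in $L_1$ (the limit exists and does not depend on the sequence). *)

theory Defs
  imports "HOL-Probability.Probability" "HOL-Library.Landau_Symbols"
begin

section \<open>Graphs, graphons and the cut-distance\<close>

text \<open>A graph on the vertex set \<open>{1..n}\<close> is given by its set of edges, each edge being
  the set of its two end points.\<close>

definition simple_graph :: "nat \<Rightarrow> nat set set \<Rightarrow> bool" where
  "simple_graph n E \<longleftrightarrow> (\<forall>e\<in>E. e \<subseteq> {1..n} \<and> card e = 2)"

definition adj :: "nat set set \<Rightarrow> nat \<Rightarrow> nat \<Rightarrow> real" where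
  "adj E u v = of_bool ({u, v} \<in> E)"

definition vertex_degree :: "nat set set \<Rightarrow> nat \<Rightarrow> nat" where
  "vertex_degree E v = card {e \<in> E. v \<in> e}"

definition edge_count_stat :: "nat \<Rightarrow> nat set set \<Rightarrow> (nat \<Rightarrow> 'a \<Rightarrow> real) \<Rightarrow> 'a \<Rightarrow> real" where
  "edge_count_stat n E X \<omega> = 1/2 * (\<Sum>u=1..n. \<Sum>v=1..n. adj E u v * X u \<omega> * X v \<omega>)"

text \<open>Functions on \<open>[0,\<infinity>)\<close> and \<open>[0,\<infinity>)\<^sup>2\<close> are represented by functions on all reals whose
  values outside these sets are never used.\<close>

definition graphons :: "(real \<Rightarrow> real \<Rightarrow> real) set" where
  "graphons = {W. (\<lambda>(x, y). W x y) \<in> borel_measurable (restrict_space borel ({0..} \<times> {0..}))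
     \<and> (\<forall>x\<ge>0. \<forall>y\<ge>0. W x y = W y x \<and> 0 \<le> W x y \<and> W x y \<le> 1)}"

text \<open>For \<open>x = 0\<close> the value \<open>\<lceil>x * r\<rceil> = 0\<close> is not a vertex.\<close>

definition graph_graphon :: "nat \<Rightarrow> real \<Rightarrow> nat set set \<Rightarrow> real \<Rightarrow> real \<Rightarrow> real" where
  "graph_graphon n r E x y =
     (if x \<in> {0..real n / r} \<and> y \<in> {0..real n / r}
      then of_bool ({nat \<lceil>x * r\<rceil>, nat \<lceil>y * r\<rceil>} \<in> E) else 0)"

definition graphon_degree :: "(real \<Rightarrow> real \<Rightarrow> real) \<Rightarrow> real \<Rightarrow> real" where
  "graphon_degree W x = (LINT y:{0..}|lborel. W x y)"

definition cut_test_functions :: "real \<Rightarrow> (real \<Rightarrow> real) set" where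
  "cut_test_functions K =
     {f. f \<in> borel_measurable (restrict_space borel {0..K}) \<and> f ` {0..K} \<subseteq> {-1..1}}"

definition cut_dist ::
  "real \<Rightarrow> (real \<Rightarrow> real \<Rightarrow> real) \<Rightarrow> (real \<Rightarrow> real \<Rightarrow> real) \<Rightarrow> real" where
  "cut_dist K W1 W2 =
     (SUP (f, g) \<in> cut_test_functions K \<times> cut_test_functions K.
        \<bar>LINT z:{0..K} \<times> {0..K}|lborel.
           (W1 (fst z) (snd z) - W2 (fst z) (snd z)) * f (fst z) * g (snd z)\<bar>)"

definition double_limit :: "(real \<Rightarrow> nat \<Rightarrow> real) \<Rightarrow> real \<Rightarrow> bool" where
  "double_limit a l \<longleftrightarrow>
     Limsup at_top (\<lambda>K. limsup (\<lambda>n. ereal (a K n))) = ereal l \<and>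
     Liminf at_top (\<lambda>K. liminf (\<lambda>n. ereal (a K n))) = ereal l"


section \<open>The Poisson distribution and the Poisson process of rate 1\<close>

text \<open>The library's \<^const>\<open>poisson_pmf\<close> is specified only for positive rates.\<close>

definition pois :: "real \<Rightarrow> nat pmf" where
  "pois \<mu> = (if \<mu> = 0 then return_pmf 0 else poisson_pmf \<mu>)"

text \<open>\<open>S \<omega>\<close> is the random, locally finite set of points of the process, so that
  \<open>N(t) = num_points S {0..t}\<close>. If \<open>A\<close> contains infinitely many points, then
  \<^const>\<open>card\<close> gives \<open>0\<close>; almost surely this affects only sets \<open>A\<close> of infinite measure.
  In the elementary integrals below this agrees almost surely with the convention
  \<open>0 * \<infinity> = 0\<close>, because integrability of the elementary function forces every product that
  involves such a set to have a zero coefficient or a factor that vanishes almost surely.\<close>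

definition num_points :: "('w \<Rightarrow> real set) \<Rightarrow> real set \<Rightarrow> 'w \<Rightarrow> nat" where
  "num_points S A \<omega> = card (S \<omega> \<inter> A)"

definition poisson_process :: "'w measure \<Rightarrow> ('w \<Rightarrow> real set) \<Rightarrow> bool" where
  "poisson_process P S \<longleftrightarrow>
     prob_space P \<and>
     (\<forall>\<omega>\<in>space P. S \<omega> \<subseteq> {0..} \<and> (\<forall>t. finite (S \<omega> \<inter> {0..t}))) \<and>
     (\<forall>A\<in>sets borel. A \<subseteq> {0..} \<longrightarrow> emeasure lborel A < \<infinity> \<longrightarrow>
        num_points S A \<in> measurable P (count_space UNIV) \<and>
        distr P (count_space UNIV) (num_points S A) = measure_pmf (pois (measure lborel A))) \<and>
     (\<forall>(m::nat) A. (\<forall>i<m. A i \<in> sets borel \<and> A i \<subseteq> {0..} \<and> emeasure lborel (A i) < \<infinity>) \<longrightarrow>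
        disjoint_family_on A {..<m} \<longrightarrow>
        prob_space.indep_vars P (\<lambda>_. count_space UNIV) (\<lambda>i. num_points S (A i)) {..<m})"


section \<open>Stochastic integrals of orders one and two\<close>

definition disjoint_borel_sets :: "nat \<Rightarrow> (nat \<Rightarrow> real set) \<Rightarrow> bool" where
  "disjoint_borel_sets m A \<longleftrightarrow>
     (\<forall>i<m. A i \<in> sets borel \<and> A i \<subseteq> {0..}) \<and> disjoint_family_on A {..<m}"

definition elem_fun1 :: "nat \<Rightarrow> (nat \<Rightarrow> real set) \<Rightarrow> (nat \<Rightarrow> real) \<Rightarrow> real \<Rightarrow> real" where
  "elem_fun1 m A a x = (\<Sum>i<m. a i * indicator (A i) x)"

definition elem_fun2 ::
  "nat \<Rightarrow> (nat \<Rightarrow> real set) \<Rightarrow> (nat \<Rightarrow> nat \<Rightarrow> real) \<Rightarrow> real \<Rightarrow> real \<Rightarrow> real" where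
  "elem_fun2 m A a x y = (\<Sum>i<m. \<Sum>j<m. a i j * indicator (A i \<times> A j) (x, y))"

definition elem_int1 ::
  "('w \<Rightarrow> real set) \<Rightarrow> nat \<Rightarrow> (nat \<Rightarrow> real set) \<Rightarrow> (nat \<Rightarrow> real) \<Rightarrow> 'w \<Rightarrow> real" where
  "elem_int1 S m A a \<omega> = (\<Sum>i<m. a i * real (num_points S (A i) \<omega>))"

definition elem_int2 ::
  "('w \<Rightarrow> real set) \<Rightarrow> nat \<Rightarrow> (nat \<Rightarrow> real set) \<Rightarrow> (nat \<Rightarrow> nat \<Rightarrow> real) \<Rightarrow> 'w \<Rightarrow> real" where
  "elem_int2 S m A a \<omega> =
     (\<Sum>i<m. \<Sum>j<m. a i j * real (num_points S (A i) \<omega>) * real (num_points S (A j) \<omega>))"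

text \<open>The integrals are the limits in \<open>L\<^sub>1(\<Omega>)\<close> of the elementary integrals along every
  approximating sequence; they are determined up to almost sure equality.\<close>

definition is_stoch_int1 ::
  "'w measure \<Rightarrow> ('w \<Rightarrow> real set) \<Rightarrow> (real \<Rightarrow> real) \<Rightarrow> ('w \<Rightarrow> real) \<Rightarrow> bool" where
  "is_stoch_int1 P S f I \<longleftrightarrow>
     integrable P I \<and>
     (\<forall>m A a.
        (\<forall>l::nat. disjoint_borel_sets (m l) (A l) \<and>
                  set_integrable lborel {0..} (elem_fun1 (m l) (A l) (a l))) \<longrightarrow>
        (\<lambda>l. \<integral>\<^sup>+x\<in>{0..}. ennreal \<bar>elem_fun1 (m l) (A l) (a l) x - f x\<bar> \<partial>lborel)
          \<longlonglongrightarrow> 0 \<longrightarrow>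
        (\<lambda>l. \<integral>\<^sup>+\<omega>. ennreal \<bar>elem_int1 S (m l) (A l) (a l) \<omega> - I \<omega>\<bar> \<partial>P) \<longlonglongrightarrow> 0)"

definition is_stoch_int2 ::
  "'w measure \<Rightarrow> ('w \<Rightarrow> real set) \<Rightarrow> (real \<Rightarrow> real \<Rightarrow> real) \<Rightarrow> ('w \<Rightarrow> real) \<Rightarrow> bool" where
  "is_stoch_int2 P S f I \<longleftrightarrow>
     integrable P I \<and>
     (\<forall>m A a.
        (\<forall>l::nat. disjoint_borel_sets (m l) (A l) \<and> (\<forall>i. a l i i = 0) \<and>
                  set_integrable lborel ({0..} \<times> {0..})
                    (\<lambda>(x, y). elem_fun2 (m l) (A l) (a l) x y)) \<longrightarrow>
        (\<lambda>l. \<integral>\<^sup>+z\<in>{0..} \<times> {0..}.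
               ennreal \<bar>elem_fun2 (m l) (A l) (a l) (fst z) (snd z) - f (fst z) (snd z)\<bar> \<partial>lborel)
          \<longlonglongrightarrow> 0 \<longrightarrow>
        (\<lambda>l. \<integral>\<^sup>+\<omega>. ennreal \<bar>elem_int2 S (m l) (A l) (a l) \<omega> - I \<omega>\<bar> \<partial>P) \<longlonglongrightarrow> 0)"

definition stoch_int1 ::
  "'w measure \<Rightarrow> ('w \<Rightarrow> real set) \<Rightarrow> (real \<Rightarrow> real) \<Rightarrow> 'w \<Rightarrow> real" where
  "stoch_int1 P S f = (SOME I. is_stoch_int1 P S f I)"

definition stoch_int2 ::
  "'w measure \<Rightarrow> ('w \<Rightarrow> real set) \<Rightarrow> (real \<Rightarrow> real \<Rightarrow> real) \<Rightarrow> 'w \<Rightarrow> real" where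
  "stoch_int2 P S f = (SOME I. is_stoch_int2 P S f I)"

definition phi :: "(real \<Rightarrow> real \<Rightarrow> real) \<Rightarrow> real \<Rightarrow> real \<Rightarrow> real \<Rightarrow> real" where
  "phi W t x y = ln (1 - W x y + W x y * exp (-t))"

definition Delta :: "(real \<Rightarrow> real \<Rightarrow> real) \<Rightarrow> (real \<Rightarrow> real) \<Rightarrow> real \<Rightarrow> real" where
  "Delta W d x = d x - graphon_degree W x"

end

(* By the non-increasing degrees, a cut-off kappa tending to infinity slowly separates the
   kappa / p vertices of largest degree (the "big" ones) from the rest.  The edges among the big
   vertices, between big and remaining vertices, and among the remaining vertices give Q1, Q2, Q3.
   Conditionally on the big vertices, the other edges present depend on each other so weakly that
   the Laplace transform of their number factorises, and what remains is a Gibbs-type functional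
   of the random set of big vertices.  That functional is Lipschitz in its kernel for the cut
   distance, because the derivative in the kernel is a bilinear form in test functions with values
   in [0,1]; hence the graph may be replaced by the averages of W over the cells of side p.  As a
   cell of length p contains a Poisson point with probability close to p, the functional is then,
   up to o(1), the expectation of an elementary stochastic integral, and these converge.
   Convergence of all the generating functions on (0,1] together with tightness yields the limit
   law. *)
theory Submission imports Defs begin

section \<open>Random subsets\<close>

text \<open>The obstacle: the cut distance controls \<open>W\<close> only through bilinear forms,
  and (c) controls only truncated degrees, so neither kernel nor degrees need converge in L1. Every
  functional is arranged to need no more. The kernel enters through derivatives of
  \<open>gibbs\<close>, whose coefficients are products over the two ends of a pair; degrees enter
  through \<open>exp (- c * x)\<close>, which is bounded and Lipschitz, so that errors capped at 1
  suffice. Test functions equal to signs of row integrals turn the cut norm into an L1 bound for row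
  sums over the big square, which yields the field \<open>Delta\<close>. The cut-off \<kappa> meets
  two demands: \<kappa> p tends to 0, so that among the roughly \<kappa> / p cells of length p a
  doubly occupied one becomes unlikely, and \<kappa> tends to infinity, because beyond the cut-off p
  times a degree is at most 2C / \<kappa>, where C bounds the mean edge count. A diagonal argument
  merges the limits in n and K. The stochastic integrals are chosen by \<open>SOME\<close>, so their
  existence is a genuine step: elementary integration is an L1 contraction and extends by
  density.\<close>

lemma abs_mult_le_of_le_one:
  fixes x y e :: real
  assumes "0 \<le> x" "x \<le> 1" "\<bar>y\<bar> \<le> e"
  shows "\<bar>x * y\<bar> \<le> e"
  using mult_mono[OF assms(2,3)] assms by (simp add: abs_mult)

lemma abs_diff_le_add:
  fixes x y a b :: real
  shows "\<bar>x\<bar> \<le> a \<Longrightarrow> \<bar>y\<bar> \<le> b \<Longrightarrow> \<bar>x - y\<bar> \<le> a + b"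
  by linarith

lemma abs_add3_le:
  fixes x y z a b c :: real
  shows "\<bar>x\<bar> \<le> a \<Longrightarrow> \<bar>y\<bar> \<le> b \<Longrightarrow> \<bar>z\<bar> \<le> c \<Longrightarrow> \<bar>x + y + z\<bar> \<le> a + (b + c)"
  by linarith

text \<open>A finite weighted sum instead of an integral: conditioning on part of \<open>V\<close>
  becomes the algebra of \<open>bern_Un\<close>, and no integrability question arises. The parameter
  stays free because both p and 1 - exp (- p) occur. The link to actual random variables is
  \<open>indep_events_bern\<close>.\<close>

definition bern :: "real \<Rightarrow> 'v set \<Rightarrow> ('v set \<Rightarrow> real) \<Rightarrow> real" where
  "bern p V f = (\<Sum>A\<in>Pow V. p ^ card A * (1 - p) ^ card (V - A) * f A)"

lemma bern_empty [simp]: "bern p {} f = f {}"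
  by (simp add: bern_def)

lemma bern_insert:
  assumes "finite V" "v \<notin> V"
  shows "bern p (insert v V) f = p * bern p V (\<lambda>A. f (insert v A)) + (1 - p) * bern p V f"
proof -
  have inj: "inj_on (insert v) (Pow V)"
    using assms(2) by (auto simp: inj_on_def)
  have disj: "Pow V \<inter> insert v ` Pow V = {}"
    using assms(2) by auto
  have 1: "card (insert v V - A) = Suc (card (V - A))" if "A \<in> Pow V" for A
    using that assms by (subst insert_Diff_if) auto
  have 2: "card (insert v A) = Suc (card A)" if "A \<in> Pow V" for A
    using that assms finite_subset by (subst card_insert_disjoint) auto
  have 3: "insert v V - insert v A = V - A" if "A \<in> Pow V" for A
    using that assms by auto
  have "bern p (insert v V) f = (\<Sum>A\<in>Pow V. p ^ card A * (1 - p) ^ card (insert v V - A) * f A)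
     + (\<Sum>A\<in>insert v ` Pow V. p ^ card A * (1 - p) ^ card (insert v V - A) * f A)"
    unfolding bern_def Pow_insert using assms disj by (subst sum.union_disjoint) auto
  also have "(\<Sum>A\<in>insert v ` Pow V. p ^ card A * (1 - p) ^ card (insert v V - A) * f A)
     = p * bern p V (\<lambda>A. f (insert v A))"
    unfolding bern_def sum_distrib_left
    by (subst sum.reindex[OF inj], intro sum.cong refl) (simp only: o_def 2 3 power_Suc mult_ac)
  also have "(\<Sum>A\<in>Pow V. p ^ card A * (1 - p) ^ card (insert v V - A) * f A) = (1 - p) * bern p V f"
    by (simp add: bern_def sum_distrib_left 1 mult_ac)
  finally show ?thesis by simp
qed

lemma bern_cong: "(\<And>A. A \<subseteq> V \<Longrightarrow> f A = g A) \<Longrightarrow> bern p V f = bern p V g"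
  by (simp add: bern_def)

lemma bern_add: "bern p V (\<lambda>A. f A + g A) = bern p V f + bern p V g"
  by (simp add: bern_def sum.distrib algebra_simps)

lemma bern_diff: "bern p V (\<lambda>A. f A - g A) = bern p V f - bern p V g"
  by (simp add: bern_def sum_subtractf algebra_simps)

lemma bern_cmult: "bern p V (\<lambda>A. c * f A) = c * bern p V f"
  by (simp add: bern_def sum_distrib_left mult_ac)

lemma bern_cmult_right: "bern p V (\<lambda>A. f A * c) = bern p V f * c"
  using bern_cmult[of p V c f] by (simp add: mult.commute)

lemma bern_sum: "bern p V (\<lambda>A. \<Sum>i\<in>I. f i A) = (\<Sum>i\<in>I. bern p V (f i))"
  unfolding bern_def sum_distrib_left by (rule sum.swap)

lemma bern_const [simp]: "finite V \<Longrightarrow> bern p V (\<lambda>_. c) = c"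
  by (induction V rule: finite_induct) (auto simp: bern_insert algebra_simps)

lemma bern_mono:
  assumes "0 \<le> p" "p \<le> 1" "\<And>A. A \<subseteq> V \<Longrightarrow> f A \<le> g A"
  shows "bern p V f \<le> bern p V g"
  unfolding bern_def using assms by (intro sum_mono mult_left_mono) auto

lemma bern_nonneg:
  assumes "0 \<le> p" "p \<le> 1" "\<And>A. A \<subseteq> V \<Longrightarrow> 0 \<le> f A"
  shows "0 \<le> bern p V f"
  unfolding bern_def using assms by (intro sum_nonneg mult_nonneg_nonneg) auto

lemma bern_le:
  assumes "finite V" "0 \<le> p" "p \<le> 1" "\<And>A. A \<subseteq> V \<Longrightarrow> f A \<le> c"
  shows "bern p V f \<le> c"
  using bern_mono[OF assms(2,3), of V f "\<lambda>_. c"] assms by simp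

lemma bern_abs_le:
  assumes "0 \<le> p" "p \<le> 1" "\<And>A. A \<subseteq> V \<Longrightarrow> \<bar>f A\<bar> \<le> g A"
  shows "\<bar>bern p V f\<bar> \<le> bern p V g"
proof -
  have "bern p V f \<le> bern p V g"
    by (rule bern_mono) (use assms abs_le_iff in auto)
  moreover have "bern p V (\<lambda>A. - 1 * f A) \<le> bern p V g"
    by (rule bern_mono) (use assms abs_le_iff in auto)
  ultimately show ?thesis unfolding bern_cmult by auto
qed

text \<open>Fubini for the product law; this is the form in which one conditions on the big
  vertices.\<close>

lemma bern_Un:
  assumes "finite V" "finite U" "V \<inter> U = {}"
  shows "bern p (V \<union> U) f = bern p V (\<lambda>A. bern p U (\<lambda>B. f (A \<union> B)))"
  using assms
proof (induction V arbitrary: f rule: finite_induct)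
  case (insert v V)
  have "bern p (insert v V \<union> U) f = p * bern p (V \<union> U) (\<lambda>A. f (insert v A)) + (1 - p) * bern p (V \<union> U) f"
    using insert by (simp add: bern_insert)
  also have "\<dots> = bern p (insert v V) (\<lambda>A. bern p U (\<lambda>B. f (A \<union> B)))"
    using insert by (simp add: bern_insert)
  finally show ?case .
qed simp

lemma bern_restrict:
  assumes "finite V" "U \<subseteq> V" "\<And>A B. A \<subseteq> U \<Longrightarrow> B \<subseteq> V - U \<Longrightarrow> f (A \<union> B) = g A"
  shows "bern p V f = bern p U g"
proof -
  have "bern p V f = bern p (U \<union> (V - U)) f"
    using assms(2) by (simp add: Un_absorb1)
  also have "\<dots> = bern p U (\<lambda>A. bern p (V - U) (\<lambda>B. f (A \<union> B)))"
    using assms(1,2) finite_subset by (intro bern_Un) auto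
  also have "\<dots> = bern p U (\<lambda>A. bern p (V - U) (\<lambda>B. g A))"
    by (intro bern_cong) (use assms(3) in auto)
  also have "\<dots> = bern p U g"
    using assms(1) by simp
  finally show ?thesis .
qed

lemma bern_all_in:
  assumes "finite V" "W \<subseteq> V"
  shows "bern p V (\<lambda>A. of_bool (W \<subseteq> A) * f A) = p ^ card W * bern p (V - W) (\<lambda>A. f (A \<union> W))"
proof -
  have fin: "finite W" using assms finite_subset by auto
  have "bern p V (\<lambda>A. of_bool (W \<subseteq> A) * f A) = bern p (W \<union> (V - W)) (\<lambda>A. of_bool (W \<subseteq> A) * f A)"
    using assms(2) by (simp add: Un_absorb1)
  also have "\<dots> = bern p W (\<lambda>A. bern p (V - W) (\<lambda>B. of_bool (W \<subseteq> A \<union> B) * f (A \<union> B)))"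
    using assms(1) fin by (intro bern_Un) auto
  also have "\<dots> = bern p W (\<lambda>A. of_bool (A = W) * bern p (V - W) (\<lambda>B. f (A \<union> B)))"
  proof (intro bern_cong)
    fix A assume A: "A \<subseteq> W"
    have "bern p (V - W) (\<lambda>B. of_bool (W \<subseteq> A \<union> B) * f (A \<union> B))
        = bern p (V - W) (\<lambda>B. of_bool (A = W) * f (A \<union> B))"
      using A by (intro bern_cong) (auto simp: of_bool_def)
    then show "bern p (V - W) (\<lambda>B. of_bool (W \<subseteq> A \<union> B) * f (A \<union> B))
        = of_bool (A = W) * bern p (V - W) (\<lambda>B. f (A \<union> B))"
      by (simp add: bern_cmult)
  qed
  also have "\<dots> = (\<Sum>A\<in>Pow W. if A = W then p ^ card W * bern p (V - W) (\<lambda>B. f (W \<union> B)) else 0)"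
    unfolding bern_def[of p W] by (intro sum.cong) auto
  also have "\<dots> = p ^ card W * bern p (V - W) (\<lambda>A. f (A \<union> W))"
    using fin by (simp add: Un_commute)
  finally show ?thesis .
qed

lemma bern_all_out:
  assumes "finite V" "W \<subseteq> V"
  shows "bern p V (\<lambda>A. of_bool (A \<inter> W = {}) * f A) = (1 - p) ^ card W * bern p (V - W) f"
proof -
  have fin: "finite W" using assms finite_subset by auto
  have "bern p V (\<lambda>A. of_bool (A \<inter> W = {}) * f A) = bern p (W \<union> (V - W)) (\<lambda>A. of_bool (A \<inter> W = {}) * f A)"
    using assms(2) by (simp add: Un_absorb1)
  also have "\<dots> = bern p W (\<lambda>A. bern p (V - W) (\<lambda>B. of_bool ((A \<union> B) \<inter> W = {}) * f (A \<union> B)))"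
    using assms(1) fin by (intro bern_Un) auto
  also have "\<dots> = bern p W (\<lambda>A. of_bool (A = {}) * bern p (V - W) (\<lambda>B. f (A \<union> B)))"
  proof (intro bern_cong)
    fix A assume A: "A \<subseteq> W"
    have "bern p (V - W) (\<lambda>B. of_bool ((A \<union> B) \<inter> W = {}) * f (A \<union> B))
        = bern p (V - W) (\<lambda>B. of_bool (A = {}) * f (A \<union> B))"
    proof (intro bern_cong)
      fix B assume "B \<subseteq> V - W"
      then have "(A \<union> B) \<inter> W = {} \<longleftrightarrow> A = {}" using A by auto
      then show "of_bool ((A \<union> B) \<inter> W = {}) * f (A \<union> B) = of_bool (A = {}) * f (A \<union> B)"
        by simp
    qed
    then show "bern p (V - W) (\<lambda>B. of_bool ((A \<union> B) \<inter> W = {}) * f (A \<union> B))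
        = of_bool (A = {}) * bern p (V - W) (\<lambda>B. f (A \<union> B))"
      by (simp add: bern_cmult)
  qed
  also have "\<dots> = (\<Sum>A\<in>Pow W. if A = {} then (1 - p) ^ card W * bern p (V - W) f else 0)"
    unfolding bern_def[of p W] by (intro sum.cong) auto
  also have "\<dots> = (1 - p) ^ card W * bern p (V - W) f"
    using fin by simp
  finally show ?thesis .
qed

lemma bern_prob_all_in:
  assumes "finite V" "W \<subseteq> V"
  shows "bern p V (\<lambda>A. of_bool (W \<subseteq> A)) = p ^ card W"
  using bern_all_in[OF assms, of p "\<lambda>_. 1"] assms by simp

text \<open>The parameter is changed for one element at a time; as the values lie in [0,1], each
  change costs at most |p - q|. The estimate is needed because a Poisson cell of length p is
  occupied with probability 1 - exp (- p) rather than p.\<close>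

lemma bern_param_diff:
  assumes "finite V" "0 \<le> p" "p \<le> 1" "0 \<le> q" "q \<le> 1" "\<And>A. A \<subseteq> V \<Longrightarrow> 0 \<le> f A \<and> f A \<le> 1"
  shows "\<bar>bern p V f - bern q V f\<bar> \<le> real (card V) * \<bar>p - q\<bar>"
  using assms(1,6)
proof (induction V arbitrary: f rule: finite_induct)
  case (insert v V)
  define f1 where "f1 = (\<lambda>A. f (insert v A))"
  have f1: "0 \<le> f1 A \<and> f1 A \<le> 1" if "A \<subseteq> V" for A
    using insert.prems[of "insert v A"] that by (auto simp: f1_def)
  have f0: "0 \<le> f A \<and> f A \<le> 1" if "A \<subseteq> V" for A
    using insert.prems[of A] that by auto
  have *: "bern p (insert v V) f - bern q (insert v V) f
     = (p - q) * (bern q V f1 - bern q V f) + p * (bern p V f1 - bern q V f1)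
       + (1 - p) * (bern p V f - bern q V f)"
    using insert.hyps by (simp add: bern_insert f1_def algebra_simps)
  have "0 \<le> bern q V f1" "bern q V f1 \<le> 1" "0 \<le> bern q V f" "bern q V f \<le> 1"
    using f0 f1 assms insert.hyps by (auto intro!: bern_nonneg bern_le)
  then have t1: "\<bar>(p - q) * (bern q V f1 - bern q V f)\<bar> \<le> \<bar>p - q\<bar> * 1"
    unfolding abs_mult by (intro mult_left_mono) auto
  have t2: "\<bar>p * (bern p V f1 - bern q V f1)\<bar> \<le> p * (real (card V) * \<bar>p - q\<bar>)"
    unfolding abs_mult using assms insert.IH[OF f1] by (auto intro!: mult_mono)
  have t3: "\<bar>(1 - p) * (bern p V f - bern q V f)\<bar> \<le> (1 - p) * (real (card V) * \<bar>p - q\<bar>)"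
    unfolding abs_mult using assms insert.IH[OF f0] by (auto intro!: mult_mono)
  have "\<bar>bern p (insert v V) f - bern q (insert v V) f\<bar> \<le> \<bar>p - q\<bar> + real (card V) * \<bar>p - q\<bar>"
    unfolding * by (rule order_trans[OF abs_add3_le[OF t1 t2 t3]]) (simp add: algebra_simps)
  then show ?case using insert.hyps by (simp add: algebra_simps)
qed simp

subsection \<open>Poisson approximation for weakly dependent indicators\<close>

lemma prod_one_minus_bounds:
  assumes "finite J" "\<And>j. j \<in> J \<Longrightarrow> 0 \<le> x j \<and> x j \<le> (1::real)"
  shows "0 \<le> (\<Prod>j\<in>J. 1 - x j)" "(\<Prod>j\<in>J. 1 - x j) \<le> 1" "1 - (\<Prod>j\<in>J. 1 - x j) \<le> (\<Sum>j\<in>J. x j)"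
proof -
  show "0 \<le> (\<Prod>j\<in>J. 1 - x j)" using assms by (intro prod_nonneg) auto
  show "(\<Prod>j\<in>J. 1 - x j) \<le> 1" using assms by (intro prod_le_1) auto
  show "1 - (\<Prod>j\<in>J. 1 - x j) \<le> (\<Sum>j\<in>J. x j)"
    using assms
  proof (induction J rule: finite_induct)
    case (insert a J)
    have "(\<Prod>j\<in>J. 1 - x j) \<le> 1" using insert by (intro prod_le_1) auto
    moreover have "0 \<le> (\<Prod>j\<in>J. 1 - x j)" using insert by (intro prod_nonneg) auto
    ultimately have "x a * (\<Prod>j\<in>J. 1 - x j) \<le> x a * 1"
      using insert.prems[of a] by (intro mult_left_mono) auto
    then show ?case using insert by (auto simp: algebra_simps)
  qed simp
qed

text \<open>A dependency-graph bound, proved by adding one index \<open>a\<close> at a time. The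
  factors whose sets miss \<open>Vs a\<close> are independent of the event
  \<open>Vs a \<subseteq> S\<close>. Those whose sets meet it are dropped before the event is split
  off and restored afterwards; a union bound prices the first move at p to the size of the union and
  the second at the product of the two probabilities.\<close>

lemma bern_dependency:
  fixes p :: real and c :: "'k \<Rightarrow> real" and Vs :: "'k \<Rightarrow> 'v set"
  assumes "finite J" and "finite U" and p: "0 \<le> p" "p \<le> 1"
    and c: "\<And>k. k \<in> J \<Longrightarrow> 0 \<le> c k \<and> c k \<le> 1"
    and V: "\<And>k. k \<in> J \<Longrightarrow> Vs k \<subseteq> U"
  shows "\<bar>bern p U (\<lambda>S. \<Prod>k\<in>J. 1 - c k * of_bool (Vs k \<subseteq> S)) - (\<Prod>k\<in>J. 1 - c k * p ^ card (Vs k))\<bar>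
     \<le> (\<Sum>(j, k)\<in>{(j, k). j \<in> J \<and> k \<in> J \<and> j \<noteq> k \<and> Vs j \<inter> Vs k \<noteq> {}}.
          p ^ card (Vs j \<union> Vs k) + p ^ (card (Vs j) + card (Vs k)))"
  using assms(1) c V
proof (induction J rule: finite_induct)
  case (insert a J)
  define Z where "Z = (\<lambda>J S. \<Prod>k\<in>J. 1 - c k * of_bool (Vs k \<subseteq> S))"
  define R where "R = {j \<in> J. Vs j \<inter> Vs a = {}}"
  define D where "D = {j \<in> J. Vs j \<inter> Vs a \<noteq> {}}"
  define err where "err = (\<Sum>j\<in>D. p ^ card (Vs j \<union> Vs a) + p ^ (card (Vs j) + card (Vs a)))"
  define err' where "err' = (\<lambda>J. \<Sum>(j, k)\<in>{(j, k). j \<in> J \<and> k \<in> J \<and> j \<noteq> k \<and> Vs j \<inter> Vs k \<noteq> {}}.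
          p ^ card (Vs j \<union> Vs k) + p ^ (card (Vs j) + card (Vs k)))"
  have finR: "finite R" "finite D" using insert.hyps by (auto simp: R_def D_def)
  have J: "J = R \<union> D" "R \<inter> D = {}" by (auto simp: R_def D_def)
  have cJ: "0 \<le> c k * of_bool (Vs k \<subseteq> S) \<and> c k * of_bool (Vs k \<subseteq> S) \<le> 1" if "k \<in> insert a J" for k S
    using insert.prems(1)[OF that] by auto
  have Z01: "0 \<le> Z K S" "Z K S \<le> 1" if "K \<subseteq> insert a J" for K S
  proof -
    have "finite K" using that insert.hyps finite_subset by blast
    moreover have "\<And>k. k \<in> K \<Longrightarrow> 0 \<le> c k * of_bool (Vs k \<subseteq> S) \<and> c k * of_bool (Vs k \<subseteq> S) \<le> 1"
      using cJ that by blast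
    ultimately show "0 \<le> Z K S" "Z K S \<le> 1"
      unfolding Z_def by (simp_all only: prod_one_minus_bounds(1,2))
  qed
  have ZR: "\<bar>Z R S - Z J S\<bar> \<le> (\<Sum>j\<in>D. of_bool (Vs j \<subseteq> S))" for S
  proof -
    have "Z J S = Z R S * Z D S"
      unfolding Z_def by (subst J(1), rule prod.union_disjoint[OF finR J(2)])
    then have eq: "Z R S - Z J S = Z R S * (1 - Z D S)" by (simp add: algebra_simps)
    have "1 - Z D S \<le> (\<Sum>j\<in>D. c j * of_bool (Vs j \<subseteq> S))"
      unfolding Z_def using finR cJ by (intro prod_one_minus_bounds(3)) (auto simp: D_def)
    also have "\<dots> \<le> (\<Sum>j\<in>D. of_bool (Vs j \<subseteq> S))"
      using insert.prems(1) by (intro sum_mono) (auto simp: D_def of_bool_def)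
    finally have "1 - Z D S \<le> (\<Sum>j\<in>D. of_bool (Vs j \<subseteq> S))" .
    moreover have "Z D S \<le> 1" "0 \<le> Z R S" "Z R S \<le> 1"
      using Z01[of D S] Z01[of R S] by (auto simp: D_def R_def)
    ultimately show ?thesis
      unfolding eq by (intro abs_mult_le_of_le_one) auto
  qed
  have Va: "Vs a \<subseteq> U" using insert.prems(2) by auto
  \<comment> \<open>The factors in R depend only on the part of S outside \<open>Vs a\<close>, so
    forcing \<open>Vs a\<close> into S does not affect them.\<close>
  have indep: "bern p U (\<lambda>S. of_bool (Vs a \<subseteq> S) * Z R S) = p ^ card (Vs a) * bern p U (Z R)"
  proof -
    have *: "Z R (S \<union> T) = Z R S" if "T \<subseteq> Vs a" "S \<subseteq> U - Vs a" for S T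
      unfolding Z_def
    proof (intro prod.cong refl)
      fix k assume "k \<in> R"
      then have "Vs k \<subseteq> S \<union> T \<longleftrightarrow> Vs k \<subseteq> S" using that by (auto simp: R_def)
      then show "1 - c k * of_bool (Vs k \<subseteq> S \<union> T) = 1 - c k * of_bool (Vs k \<subseteq> S)" by simp
    qed
    have "bern p U (\<lambda>S. of_bool (Vs a \<subseteq> S) * Z R S) = p ^ card (Vs a) * bern p (U - Vs a) (\<lambda>S. Z R (S \<union> Vs a))"
      by (rule bern_all_in[OF assms(2) Va])
    also have "bern p (U - Vs a) (\<lambda>S. Z R (S \<union> Vs a)) = bern p (U - Vs a) (Z R)"
      by (intro bern_cong *) auto
    also have "\<dots> = bern p U (Z R)"
    proof (rule bern_restrict[symmetric])
      fix A B assume "A \<subseteq> U - Vs a" "B \<subseteq> U - (U - Vs a)"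
      then show "Z R (A \<union> B) = Z R A" using Va by (intro *) auto
    qed (use assms(2) in auto)
    finally show ?thesis .
  qed
  have fst_err: "\<bar>bern p U (\<lambda>S. of_bool (Vs a \<subseteq> S) * Z R S) - bern p U (\<lambda>S. of_bool (Vs a \<subseteq> S) * Z J S)\<bar>
      \<le> (\<Sum>j\<in>D. p ^ card (Vs j \<union> Vs a))"
  proof -
    have "\<bar>bern p U (\<lambda>S. of_bool (Vs a \<subseteq> S) * Z R S) - bern p U (\<lambda>S. of_bool (Vs a \<subseteq> S) * Z J S)\<bar>
       = \<bar>bern p U (\<lambda>S. of_bool (Vs a \<subseteq> S) * (Z R S - Z J S))\<bar>"
      by (simp add: bern_diff[symmetric] algebra_simps)
    also have "\<dots> \<le> bern p U (\<lambda>S. \<Sum>j\<in>D. of_bool (Vs j \<union> Vs a \<subseteq> S))"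
    proof (rule bern_abs_le[OF p])
      fix S
      show "\<bar>of_bool (Vs a \<subseteq> S) * (Z R S - Z J S)\<bar> \<le> (\<Sum>j\<in>D. of_bool (Vs j \<union> Vs a \<subseteq> S))"
        using ZR[of S] by (cases "Vs a \<subseteq> S") auto
    qed
    also have "\<dots> = (\<Sum>j\<in>D. p ^ card (Vs j \<union> Vs a))"
      unfolding bern_sum using insert.prems(2) Va assms(2)
      by (intro sum.cong refl bern_prob_all_in) (auto simp: D_def)
    finally show ?thesis .
  qed
  have snd_err: "\<bar>bern p U (Z R) - bern p U (Z J)\<bar> \<le> (\<Sum>j\<in>D. p ^ card (Vs j))"
  proof -
    have "\<bar>bern p U (Z R) - bern p U (Z J)\<bar> = \<bar>bern p U (\<lambda>S. Z R S - Z J S)\<bar>"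
      by (simp add: bern_diff)
    also have "\<dots> \<le> bern p U (\<lambda>S. \<Sum>j\<in>D. of_bool (Vs j \<subseteq> S))"
      using ZR by (intro bern_abs_le[OF p]) auto
    also have "\<dots> = (\<Sum>j\<in>D. p ^ card (Vs j))"
      unfolding bern_sum using insert.prems(2) assms(2)
      by (intro sum.cong refl bern_prob_all_in) (auto simp: D_def)
    finally show ?thesis .
  qed
  have p_pow: "0 \<le> p ^ card (Vs a)" "p ^ card (Vs a) \<le> 1" using p by (auto simp: power_le_one)
  have "\<bar>p ^ card (Vs a) * (bern p U (Z R) - bern p U (Z J))\<bar> \<le> p ^ card (Vs a) * (\<Sum>j\<in>D. p ^ card (Vs j))"
    unfolding abs_mult using p_pow snd_err by (auto intro!: mult_left_mono)
  also have "\<dots> = (\<Sum>j\<in>D. p ^ (card (Vs j) + card (Vs a)))"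
    by (simp add: sum_distrib_left power_add mult_ac)
  finally have snd_err': "\<bar>p ^ card (Vs a) * (bern p U (Z R) - bern p U (Z J))\<bar> \<le> (\<Sum>j\<in>D. p ^ (card (Vs j) + card (Vs a)))" .
  have err: "\<bar>bern p U (\<lambda>S. of_bool (Vs a \<subseteq> S) * Z J S) - p ^ card (Vs a) * bern p U (Z J)\<bar> \<le> err"
    using fst_err snd_err' unfolding err_def sum.distrib indep right_diff_distrib by linarith
  have step: "bern p U (Z (insert a J)) = bern p U (Z J) - c a * bern p U (\<lambda>S. of_bool (Vs a \<subseteq> S) * Z J S)"
  proof -
    have "Z (insert a J) S = Z J S - c a * (of_bool (Vs a \<subseteq> S) * Z J S)" for S
      unfolding Z_def using insert.hyps by (simp add: algebra_simps)
    then have "Z (insert a J) = (\<lambda>S. Z J S - c a * (of_bool (Vs a \<subseteq> S) * Z J S))" by auto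
    then show ?thesis by (simp only: bern_diff bern_cmult)
  qed
  have IH: "\<bar>bern p U (Z J) - (\<Prod>k\<in>J. 1 - c k * p ^ card (Vs k))\<bar> \<le> err' J"
    unfolding Z_def err'_def by (rule insert.IH) (use insert.prems in auto)
  have ca: "0 \<le> c a" "c a \<le> 1" using insert.prems(1) by auto
  \<comment> \<open>The old error is multiplied by a number in [0,1], so the errors of the
    successive steps add up without growing.\<close>
  have eq: "bern p U (Z (insert a J)) - (\<Prod>k\<in>insert a J. 1 - c k * p ^ card (Vs k))
     = (1 - c a * p ^ card (Vs a)) * (bern p U (Z J) - (\<Prod>k\<in>J. 1 - c k * p ^ card (Vs k)))
       - c a * (bern p U (\<lambda>S. of_bool (Vs a \<subseteq> S) * Z J S) - p ^ card (Vs a) * bern p U (Z J))"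
    unfolding step using insert.hyps by (simp add: algebra_simps)
  have cp: "0 \<le> c a * p ^ card (Vs a)" "c a * p ^ card (Vs a) \<le> 1"
    using ca p_pow by (auto intro: mult_le_one)
  have "\<bar>(1 - c a * p ^ card (Vs a)) * (bern p U (Z J) - (\<Prod>k\<in>J. 1 - c k * p ^ card (Vs k)))\<bar> \<le> err' J"
    using IH cp by (intro abs_mult_le_of_le_one) auto
  moreover have "\<bar>c a * (bern p U (\<lambda>S. of_bool (Vs a \<subseteq> S) * Z J S) - p ^ card (Vs a) * bern p U (Z J))\<bar> \<le> err"
    using err ca by (intro abs_mult_le_of_le_one) auto
  ultimately have "\<bar>bern p U (Z (insert a J)) - (\<Prod>k\<in>insert a J. 1 - c k * p ^ card (Vs k))\<bar> \<le> err' J + err"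
    unfolding eq by (intro abs_diff_le_add)
  also have "\<dots> \<le> err' (insert a J)"
  proof -
    \<comment> \<open>The new index contributes the ordered pairs (j, a); all other terms of the
      enlarged sum are nonnegative.\<close>
    define P where "P = (\<lambda>J. {(j, k). j \<in> J \<and> k \<in> J \<and> j \<noteq> k \<and> Vs j \<inter> Vs k \<noteq> {}})"
    have fin: "finite (P (insert a J))"
      by (rule finite_subset[of _ "insert a J \<times> insert a J"]) (use insert.hyps in \<open>auto simp: P_def\<close>)
    have sub: "P J \<union> (\<lambda>j. (j, a)) ` D \<subseteq> P (insert a J)" using insert.hyps by (auto simp: P_def D_def)
    have dis: "P J \<inter> (\<lambda>j. (j, a)) ` D = {}" using insert.hyps by (auto simp: P_def)
    have finP: "finite (P J)" using fin sub finite_subset by blast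
    have "err' J + err = (\<Sum>(j, k)\<in>P J. p ^ card (Vs j \<union> Vs k) + p ^ (card (Vs j) + card (Vs k)))
       + (\<Sum>(j, k)\<in>(\<lambda>j. (j, a)) ` D. p ^ card (Vs j \<union> Vs k) + p ^ (card (Vs j) + card (Vs k)))"
      unfolding err'_def err_def P_def by (subst sum.reindex) (auto simp: inj_on_def)
    also have "\<dots> = (\<Sum>(j, k)\<in>P J \<union> (\<lambda>j. (j, a)) ` D. p ^ card (Vs j \<union> Vs k) + p ^ (card (Vs j) + card (Vs k)))"
      using finP finR dis by (subst sum.union_disjoint) auto
    also have "\<dots> \<le> err' (insert a J)"
    proof -
      have "{(j, k). j \<in> insert a J \<and> k \<in> insert a J \<and> j \<noteq> k \<and> Vs j \<inter> Vs k \<noteq> {}} = P (insert a J)"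
        by (simp add: P_def)
      then show ?thesis
        unfolding err'_def by (simp only:) (rule sum_mono2[OF fin sub], use p in auto)
    qed
    finally show ?thesis .
  qed
  finally show ?case unfolding Z_def err'_def .
qed (simp add: assms(2))

text \<open>All factors on both sides lie in [0,1], so the difference of the products is at most the
  sum of the differences of the factors, and |1 - y - exp (- y)| \<le> y^2 on [0,1].\<close>

lemma prod_one_minus_exp:
  assumes "finite J" "\<And>j. j \<in> J \<Longrightarrow> 0 \<le> x j \<and> x j \<le> (1::real)"
  shows "\<bar>(\<Prod>j\<in>J. 1 - x j) - exp (- (\<Sum>j\<in>J. x j))\<bar> \<le> (\<Sum>j\<in>J. (x j)\<^sup>2)"
proof -
  have one: "\<bar>(1 - y) - exp (- y)\<bar> \<le> y\<^sup>2" if "0 \<le> y" "y \<le> 1" for y :: real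
  proof -
    have "1 - y \<le> exp (- y)" using exp_ge_add_one_self[of "- y"] by simp
    moreover have "exp (- y) \<le> 1 - y + y\<^sup>2"
    proof -
      have "1 \<le> exp y * (1 - y + y\<^sup>2)"
      proof -
        \<comment> \<open>The product equals 1 + y^3.\<close>
        have "1 \<le> (1 + y) * (1 - y + y\<^sup>2)"
          using that by (simp add: algebra_simps power2_eq_square)
        also have "\<dots> \<le> exp y * (1 - y + y\<^sup>2)"
        proof (rule mult_right_mono)
          show "1 + y \<le> exp y" using exp_ge_add_one_self[of y] by simp
          show "0 \<le> 1 - y + y\<^sup>2" using that by auto
        qed
        finally show ?thesis .
      qed
      then show ?thesis by (simp add: exp_minus field_simps)
    qed
    ultimately show ?thesis by auto
  qed
  have "\<bar>(\<Prod>j\<in>J. 1 - x j) - (\<Prod>j\<in>J. exp (- x j))\<bar> \<le> (\<Sum>j\<in>J. (x j)\<^sup>2)"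
  proof -
    have "norm ((\<Prod>j\<in>J. 1 - x j) - (\<Prod>j\<in>J. exp (- x j))) \<le> (\<Sum>j\<in>J. norm ((1 - x j) - exp (- x j)))"
      using assms(2) by (intro norm_prod_diff) auto
    also have "\<dots> \<le> (\<Sum>j\<in>J. (x j)\<^sup>2)"
      using assms(2) one by (intro sum_mono) auto
    finally show ?thesis by simp
  qed
  then show ?thesis using assms(1) by (simp add: exp_sum flip: sum_negf)
qed

subsection \<open>Dependence on the kernel\<close>

definition pairs :: "'v set \<Rightarrow> 'v set set" where
  "pairs B = {e. e \<subseteq> B \<and> card e = 2}"

lemma finite_pairs: "finite B \<Longrightarrow> finite (pairs B)"
  by (simp add: pairs_def)

lemma pairs_insert:
  assumes "u \<notin> A" "finite A"
  shows "pairs (insert u A) = pairs A \<union> (\<lambda>w. {u, w}) ` A" "pairs A \<inter> (\<lambda>w. {u, w}) ` A = {}"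
proof -
  show "pairs (insert u A) = pairs A \<union> (\<lambda>w. {u, w}) ` A"
  proof (intro set_eqI iffI)
    fix e assume e: "e \<in> pairs (insert u A)"
    show "e \<in> pairs A \<union> (\<lambda>w. {u, w}) ` A"
    proof (cases "u \<in> e")
      case True
      from e obtain x y where "e = {x, y}" "x \<noteq> y" by (auto simp: pairs_def card_2_iff)
      with True e show ?thesis by (auto simp: pairs_def)
    next
      case False
      with e show ?thesis by (auto simp: pairs_def)
    qed
  next
    fix e assume "e \<in> pairs A \<union> (\<lambda>w. {u, w}) ` A"
    then show "e \<in> pairs (insert u A)"
      using assms by (auto simp: pairs_def card_insert_if)
  qed
  show "pairs A \<inter> (\<lambda>w. {u, w}) ` A = {}"
    using assms by (auto simp: pairs_def)
qed

lemma prod_pairs_insert: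
  assumes "u \<notin> A" "finite A"
  shows "(\<Prod>e\<in>pairs (insert u A). f e) = (\<Prod>e\<in>pairs A. f e) * (\<Prod>w\<in>A. f {u, w})"
proof -
  have inj: "inj_on (\<lambda>w. {u, w}) A" by (auto simp: inj_on_def doubleton_eq_iff)
  have "(\<Prod>e\<in>pairs (insert u A). f e) = (\<Prod>e\<in>pairs A. f e) * (\<Prod>e\<in>(\<lambda>w. {u, w}) ` A. f e)"
    unfolding pairs_insert(1)[OF assms] using finite_pairs assms pairs_insert(2)[OF assms]
    by (subst prod.union_disjoint) auto
  then show ?thesis by (simp add: prod.reindex[OF inj])
qed

text \<open>Once the pair {u, v} itself is removed, no factor couples u and v. What is left splits
  into a part inside A and one function of each of u and v, which is the product form that a cut
  norm can test.\<close>

lemma prod_pairs_remove: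
  assumes "u \<noteq> v" "u \<notin> A" "v \<notin> A" "finite A"
  shows "(\<Prod>e\<in>pairs (A \<union> {u, v}) - {{u, v}}. f e)
     = (\<Prod>e\<in>pairs A. f e) * (\<Prod>w\<in>A. f {u, w}) * (\<Prod>w\<in>A. f {v, w})"
proof -
  let ?X = "pairs (insert v A)"
  have fin: "finite ?X" "finite A" using assms finite_pairs by auto
  have un: "pairs (A \<union> {u, v}) - {{u, v}} = ?X \<union> (\<lambda>w. {u, w}) ` A"
  proof -
    have "pairs (A \<union> {u, v}) = ?X \<union> (\<lambda>w. {u, w}) ` (insert v A)"
      using pairs_insert(1)[of u "insert v A"] assms by (simp add: insert_commute)
    moreover have "{u, v} \<notin> ?X" "{u, v} \<notin> (\<lambda>w. {u, w}) ` A"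
      using assms by (auto simp: pairs_def doubleton_eq_iff)
    ultimately show ?thesis by auto
  qed
  have dis: "?X \<inter> (\<lambda>w. {u, w}) ` A = {}" using assms by (auto simp: pairs_def)
  have inj: "inj_on (\<lambda>w. {u, w}) A" by (auto simp: inj_on_def doubleton_eq_iff)
  show ?thesis
    unfolding un using fin dis
    by (simp add: prod.union_disjoint prod.reindex[OF inj] prod_pairs_insert assms mult_ac)
qed

text \<open>A Mecke formula for pairs: a sum over the pairs of the random set becomes a sum over all
  pairs of \<open>V\<close>, with the pair added to the set. The factor (1 - p)^2 is the probability
  of avoiding e; it trades the random subset of V - e for a random subset of \<open>V\<close>, so
  that one law serves all e.\<close>

lemma bern_sum_pairs:
  assumes "finite V"
  shows "(1 - p)\<^sup>2 * bern p V (\<lambda>B. \<Sum>e\<in>pairs B. g e B)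
       = (\<Sum>e\<in>pairs V. p\<^sup>2 * bern p V (\<lambda>A. of_bool (A \<inter> e = {}) * g e (A \<union> e)))"
proof -
  have "bern p V (\<lambda>B. \<Sum>e\<in>pairs B. g e B) = bern p V (\<lambda>B. \<Sum>e\<in>pairs V. of_bool (e \<subseteq> B) * g e B)"
  proof (intro bern_cong)
    fix B assume "B \<subseteq> V"
    then show "(\<Sum>e\<in>pairs B. g e B) = (\<Sum>e\<in>pairs V. of_bool (e \<subseteq> B) * g e B)"
      using assms by (intro sum.mono_neutral_cong_left) (auto simp: pairs_def)
  qed
  also have "\<dots> = (\<Sum>e\<in>pairs V. p\<^sup>2 * bern p (V - e) (\<lambda>A. g e (A \<union> e)))"
    unfolding bern_sum
  proof (intro sum.cong refl)
    fix e assume "e \<in> pairs V"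
    then have "e \<subseteq> V" "card e = 2" by (auto simp: pairs_def)
    then show "bern p V (\<lambda>B. of_bool (e \<subseteq> B) * g e B) = p\<^sup>2 * bern p (V - e) (\<lambda>A. g e (A \<union> e))"
      using bern_all_in[OF assms, of e p "g e"] by simp
  qed
  finally have "(1 - p)\<^sup>2 * bern p V (\<lambda>B. \<Sum>e\<in>pairs B. g e B)
     = (\<Sum>e\<in>pairs V. p\<^sup>2 * ((1 - p)\<^sup>2 * bern p (V - e) (\<lambda>A. g e (A \<union> e))))"
    by (simp add: sum_distrib_left mult_ac)
  also have "\<dots> = (\<Sum>e\<in>pairs V. p\<^sup>2 * bern p V (\<lambda>A. of_bool (A \<inter> e = {}) * g e (A \<union> e)))"
  proof (intro sum.cong refl)
    fix e assume "e \<in> pairs V"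
    then have "e \<subseteq> V" "card e = 2" by (auto simp: pairs_def)
    then show "p\<^sup>2 * ((1 - p)\<^sup>2 * bern p (V - e) (\<lambda>A. g e (A \<union> e)))
       = p\<^sup>2 * bern p V (\<lambda>A. of_bool (A \<inter> e = {}) * g e (A \<union> e))"
      using bern_all_out[OF assms, of e p "\<lambda>A. g e (A \<union> e)"] by simp
  qed
  finally show ?thesis .
qed

text \<open>With K the indicator of an edge set and c = 1 - exp (- t), the pair factors multiply to
  exp (- t) raised to the number of edges inside the random set; fractional K occur for graphons.
  The field \<open>h\<close> will carry what a big vertex contributes through its edges to small
  vertices.\<close>

definition gibbs :: "real \<Rightarrow> 'v set \<Rightarrow> real \<Rightarrow> ('v set \<Rightarrow> real) \<Rightarrow> ('v \<Rightarrow> real) \<Rightarrow> real" where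
  "gibbs p V c K h = bern p V (\<lambda>B. (\<Prod>e\<in>pairs B. 1 - c * K e) * (\<Prod>u\<in>B. h u))"

text \<open>Differentiating \<^const>\<open>gibbs\<close> in the kernel pins down one pair \<open>e\<close>. Requiring that the remaining
  random set avoids \<open>e\<close> makes the integrand a product over the two elements of \<open>e\<close>, so the
  derivative is controlled by the cut norm.\<close>

lemma gibbs_kernel_diff:
  fixes V :: "'v set"
  assumes V: "finite V" and p: "0 \<le> p" "p \<le> 1" and c: "0 \<le> c" "c \<le> 1"
    and K0: "\<And>e. e \<in> pairs V \<Longrightarrow> 0 \<le> K0 e \<and> K0 e \<le> 1"
    and K1: "\<And>e. e \<in> pairs V \<Longrightarrow> 0 \<le> K1 e \<and> K1 e \<le> 1"
    and h: "\<And>u. u \<in> V \<Longrightarrow> 0 \<le> h u \<and> h u \<le> 1"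
    and eta: "\<And>a. (\<And>u. 0 \<le> a u \<and> a u \<le> 1) \<Longrightarrow>
       \<bar>\<Sum>e\<in>pairs V. p\<^sup>2 * (K1 e - K0 e) * (\<Prod>u\<in>e. a u)\<bar> \<le> \<eta>"
  shows "(1 - p)\<^sup>2 * \<bar>gibbs p V c K1 h - gibbs p V c K0 h\<bar> \<le> \<eta>"
proof -
  define D where "D = (\<lambda>e. K1 e - K0 e)"
  \<comment> \<open>Linear interpolation from K0 to K1; the mean value theorem reduces the claim to
    a bound for the derivative at one s in (0,1).\<close>
  define Ks where "Ks = (\<lambda>s e. 1 - c * (K0 e + s * D e))"
  define g where "g = (\<lambda>s e B. (- c * D e * (\<Prod>e'\<in>pairs B - {e}. Ks s e')) * (\<Prod>u\<in>B. h u))"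
  define f where "f = (\<lambda>s. bern p V (\<lambda>B. (\<Prod>e\<in>pairs B. Ks s e) * (\<Prod>u\<in>B. h u)))"
  define f' where "f' = (\<lambda>s. bern p V (\<lambda>B. \<Sum>e\<in>pairs B. g s e B))"
  have der: "(f has_real_derivative f' s) (at s)" for s
  proof -
    have KD: "((\<lambda>s. Ks s e) has_real_derivative - c * D e) (at s)" for e
      unfolding Ks_def by (auto intro!: derivative_eq_intros)
    have "((\<lambda>s. (\<Prod>e\<in>pairs B. Ks s e) * (\<Prod>u\<in>B. h u)) has_real_derivative (\<Sum>e\<in>pairs B. g s e B)) (at s)" for B
      unfolding g_def sum_distrib_right[symmetric]
      by (intro DERIV_cmult_right has_field_derivative_prod KD)
    then show ?thesis
      unfolding f_def f'_def bern_def by (intro DERIV_sum DERIV_cmult)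
  qed
  have bound: "(1 - p)\<^sup>2 * \<bar>f' s\<bar> \<le> \<eta>" if s: "0 \<le> s" "s \<le> 1" for s
  proof -
    have Ks01: "0 \<le> Ks s e \<and> Ks s e \<le> 1" if "e \<in> pairs V" for e
    proof -
      have eq: "K0 e + s * D e = (1 - s) * K0 e + s * K1 e" by (simp add: D_def algebra_simps)
      have nn: "0 \<le> (1 - s) * K0 e + s * K1 e" using K0[OF that] K1[OF that] s by simp
      have "(1 - s) * K0 e + s * K1 e \<le> (1 - s) * 1 + s * 1"
        using K0[OF that] K1[OF that] s by (intro add_mono mult_left_mono) auto
      then have "c * ((1 - s) * K0 e + s * K1 e) \<le> 1 * 1" using nn c by (intro mult_mono) auto
      then show ?thesis unfolding Ks_def eq using nn c by simp
    qed
    \<comment> \<open>For fixed A, \<open>R A\<close> collects the factors free of e, and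
      \<open>a A\<close> is the test function on single vertices. Since \<open>a A\<close> is 0 on
      A, the terms with e meeting A vanish by themselves, and the sum over e runs over all pairs of
      V, as the hypothesis on \<eta> demands.\<close>
    define R where "R = (\<lambda>A. (\<Prod>e\<in>pairs A. Ks s e) * (\<Prod>u\<in>A. h u))"
    define a where "a = (\<lambda>A u. of_bool (u \<in> V - A) * h u * (\<Prod>w\<in>A. Ks s {u, w}))"
    have a01: "0 \<le> a A u \<and> a A u \<le> 1" if "A \<subseteq> V" for A u
    proof (cases "u \<in> V - A")
      case True
      have "0 \<le> Ks s {u, w} \<and> Ks s {u, w} \<le> 1" if "w \<in> A" for w
        using True that \<open>A \<subseteq> V\<close> by (intro Ks01) (auto simp: pairs_def card_insert_if)
      then have "0 \<le> (\<Prod>w\<in>A. Ks s {u, w}) \<and> (\<Prod>w\<in>A. Ks s {u, w}) \<le> 1"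
        by (auto intro: prod_nonneg prod_le_1)
      then show ?thesis using h[of u] True by (auto simp: a_def intro: mult_le_one)
    qed (auto simp: a_def)
    have R01: "0 \<le> R A \<and> R A \<le> 1" if "A \<subseteq> V" for A
    proof -
      have "0 \<le> (\<Prod>e\<in>pairs A. Ks s e) \<and> (\<Prod>e\<in>pairs A. Ks s e) \<le> 1"
        using that Ks01 by (auto intro!: prod_nonneg prod_le_1 simp: pairs_def)
      moreover have "0 \<le> (\<Prod>u\<in>A. h u) \<and> (\<Prod>u\<in>A. h u) \<le> 1"
        using that h by (auto intro!: prod_nonneg prod_le_1)
      ultimately show ?thesis unfolding R_def by (auto intro: mult_le_one)
    qed
    have key: "of_bool (A \<inter> e = {}) * g s e (A \<union> e) = - c * R A * (D e * (\<Prod>u\<in>e. a A u))"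
      if A: "A \<subseteq> V" and e: "e \<in> pairs V" for A e
    proof -
      obtain u v where uv: "e = {u, v}" "u \<noteq> v" "u \<in> V" "v \<in> V"
        using e by (auto simp: pairs_def card_2_iff)
      have fin: "finite A" using A V finite_subset by blast
      show ?thesis
      proof (cases "A \<inter> e = {}")
        case True
        then have n: "u \<notin> A" "v \<notin> A" using uv by auto
        have "(\<Prod>u\<in>A \<union> e. h u) = (\<Prod>u\<in>A. h u) * (h u * h v)"
          unfolding uv using n uv fin by (subst prod.union_disjoint) auto
        then show ?thesis
          using True n uv fin unfolding g_def uv(1)
          by (subst prod_pairs_remove) (auto simp: R_def a_def)
      next
        case False
        then have "(\<Prod>u\<in>e. a A u) = 0" using uv by (auto simp: a_def)
        then show ?thesis using False by simp
      qed
    qed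
    have "(1 - p)\<^sup>2 * f' s = (\<Sum>e\<in>pairs V. p\<^sup>2 * bern p V (\<lambda>A. of_bool (A \<inter> e = {}) * g s e (A \<union> e)))"
      unfolding f'_def by (rule bern_sum_pairs[OF V])
    also have "\<dots> = (\<Sum>e\<in>pairs V. bern p V (\<lambda>A. - c * R A * (p\<^sup>2 * D e * (\<Prod>u\<in>e. a A u))))"
      unfolding bern_cmult[symmetric] using key by (intro sum.cong bern_cong) (auto simp: mult_ac)
    also have "\<dots> = bern p V (\<lambda>A. - c * R A * (\<Sum>e\<in>pairs V. p\<^sup>2 * D e * (\<Prod>u\<in>e. a A u)))"
      by (simp add: bern_sum[symmetric] sum_distrib_left)
    finally have eq: "(1 - p)\<^sup>2 * f' s = bern p V (\<lambda>A. - c * R A * (\<Sum>e\<in>pairs V. p\<^sup>2 * D e * (\<Prod>u\<in>e. a A u)))" .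
    have "\<bar>(1 - p)\<^sup>2 * f' s\<bar> \<le> bern p V (\<lambda>A. \<eta>)"
      unfolding eq
    proof (rule bern_abs_le[OF p])
      fix A assume A: "A \<subseteq> V"
      have "\<bar>(c * R A) * (- (\<Sum>e\<in>pairs V. p\<^sup>2 * D e * (\<Prod>u\<in>e. a A u)))\<bar> \<le> \<eta>"
      proof (rule abs_mult_le_of_le_one)
        show "\<bar>- (\<Sum>e\<in>pairs V. p\<^sup>2 * D e * (\<Prod>u\<in>e. a A u))\<bar> \<le> \<eta>"
          using eta[of "a A"] a01[OF A] by (simp add: D_def)
      qed (use R01[OF A] c in \<open>auto intro: mult_le_one\<close>)
      then show "\<bar>- c * R A * (\<Sum>e\<in>pairs V. p\<^sup>2 * D e * (\<Prod>u\<in>e. a A u))\<bar> \<le> \<eta>" by simp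
    qed
    then show ?thesis using V by (simp add: abs_mult)
  qed
  have "\<exists>z>0. z < 1 \<and> f 1 - f 0 = (1 - 0) * f' z"
    using der by (intro MVT2) auto
  then obtain z where z: "0 < z" "z < 1" "f 1 - f 0 = f' z" by auto
  have "f 1 = gibbs p V c K1 h" "f 0 = gibbs p V c K0 h"
    by (simp_all add: f_def gibbs_def Ks_def D_def)
  then show ?thesis using bound[of z] z by simp
qed

text \<open>Only points of the random set feel the change, and each point belongs to it with
  probability p. The bound is therefore a Riemann sum on a mesh of side p, and L1 closeness of the
  fields suffices.\<close>

lemma gibbs_field_diff:
  fixes V :: "'v set"
  assumes V: "finite V" and p: "0 \<le> p" "p \<le> 1" and c: "0 \<le> c" "c \<le> 1"
    and K: "\<And>e. e \<in> pairs V \<Longrightarrow> 0 \<le> K e \<and> K e \<le> 1"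
    and h: "\<And>u. u \<in> V \<Longrightarrow> 0 \<le> h u \<and> h u \<le> 1"
    and h': "\<And>u. u \<in> V \<Longrightarrow> 0 \<le> h' u \<and> h' u \<le> 1"
  shows "\<bar>gibbs p V c K h - gibbs p V c K h'\<bar> \<le> (\<Sum>u\<in>V. p * \<bar>h u - h' u\<bar>)"
proof -
  have "\<bar>gibbs p V c K h - gibbs p V c K h'\<bar> \<le> bern p V (\<lambda>B. \<Sum>u\<in>V. of_bool ({u} \<subseteq> B) * \<bar>h u - h' u\<bar>)"
    unfolding gibbs_def bern_diff[symmetric]
  proof (rule bern_abs_le[OF p])
    fix B assume B: "B \<subseteq> V"
    have "0 \<le> 1 - c * K e \<and> 1 - c * K e \<le> 1" if "e \<in> pairs B" for e
      using K[of e] c that B by (auto simp: pairs_def intro: mult_le_one)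
    then have P: "0 \<le> (\<Prod>e\<in>pairs B. 1 - c * K e) \<and> (\<Prod>e\<in>pairs B. 1 - c * K e) \<le> 1"
      by (auto intro!: prod_nonneg prod_le_1)
    have "norm ((\<Prod>u\<in>B. h u) - (\<Prod>u\<in>B. h' u)) \<le> (\<Sum>u\<in>B. norm (h u - h' u))"
      using B h h' by (intro norm_prod_diff) fastforce+
    also have "\<dots> = (\<Sum>u\<in>V. of_bool ({u} \<subseteq> B) * \<bar>h u - h' u\<bar>)"
      using V B by (intro sum.mono_neutral_cong_left) auto
    finally have "\<bar>(\<Prod>e\<in>pairs B. 1 - c * K e) * ((\<Prod>u\<in>B. h u) - (\<Prod>u\<in>B. h' u))\<bar>
        \<le> (\<Sum>u\<in>V. of_bool ({u} \<subseteq> B) * \<bar>h u - h' u\<bar>)"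
      using P by (intro abs_mult_le_of_le_one) auto
    then show "\<bar>(\<Prod>e\<in>pairs B. 1 - c * K e) * (\<Prod>u\<in>B. h u) - (\<Prod>e\<in>pairs B. 1 - c * K e) * (\<Prod>u\<in>B. h' u)\<bar>
        \<le> (\<Sum>u\<in>V. of_bool ({u} \<subseteq> B) * \<bar>h u - h' u\<bar>)"
      by (simp add: right_diff_distrib)
  qed
  also have "\<dots> = (\<Sum>u\<in>V. p * \<bar>h u - h' u\<bar>)"
    unfolding bern_sum bern_cmult_right using bern_prob_all_in[OF V, of "{_}" p] by (intro sum.cong) auto
  finally show ?thesis .
qed

subsection \<open>Edges with at least one end of small degree\<close>

lemma exp_neg_card: "exp (- t * real (card X)) = (1 - (1 - exp (- t))) ^ card X"
  by (simp add: exp_of_nat_mult[symmetric] mult.commute)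

lemma exp_neg_card_eq_prod:
  assumes "finite Y"
  shows "exp (- t * real (card {e \<in> Y. P e})) = (\<Prod>e\<in>Y. 1 - (1 - exp (- t)) * of_bool (P e))"
proof -
  have "(\<Prod>e\<in>Y. 1 - (1 - exp (- t)) * of_bool (P e)) = (\<Prod>e\<in>{e \<in> Y. P e}. 1 - (1 - exp (- t)))"
    using assms by (intro prod.mono_neutral_cong_right) auto
  then show ?thesis by (simp only: prod_constant exp_neg_card)
qed

lemma card_eq_card_Int_add:
  assumes "finite e" "e \<subseteq> A \<union> U" "A \<inter> U = {}"
  shows "card e = card (e \<inter> A) + card (e \<inter> U)"
proof -
  have "card ((e \<inter> A) \<union> (e \<inter> U)) = card (e \<inter> A) + card (e \<inter> U)"
    using assms by (intro card_Un_disjoint) auto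
  moreover have "(e \<inter> A) \<union> (e \<inter> U) = e" using assms by auto
  ultimately show ?thesis by simp
qed

text \<open>Fix the random subset A of the big vertices. An edge reaching into \<open>U\<close> is
  then present exactly when its big end, if any, lies in A and its part in \<open>U\<close> is
  selected, so \<open>bern_dependency\<close> and \<open>prod_one_minus_exp\<close> replace these
  edges by the exponential of a conditional mean. That mean is a sum over A plus a constant, which
  gives the field of \<open>gibbs\<close> and the last factor. The errors are averaged over A at the
  end.\<close>

lemma bern_small_part:
  fixes E :: "'v set set" and t1 t2 t3 :: real
  assumes fin: "finite Bg" "finite U" and disj: "Bg \<inter> U = {}"
    and E: "\<And>e. e \<in> E \<Longrightarrow> e \<subseteq> Bg \<union> U \<and> card e = 2"
    and p: "0 \<le> p" "p \<le> 1" and t: "0 \<le> t1" "0 \<le> t2" "0 \<le> t3"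
  shows "\<bar>bern p (Bg \<union> U) (\<lambda>A. exp (- t1 * card {e \<in> E. e \<subseteq> A \<and> e \<subseteq> Bg}
             - t2 * card {e \<in> E. e \<subseteq> A \<and> e \<inter> Bg \<noteq> {} \<and> e \<inter> U \<noteq> {}}
             - t3 * card {e \<in> E. e \<subseteq> A \<and> e \<subseteq> U}))
      - gibbs p Bg (1 - exp (- t1)) (\<lambda>e. of_bool (e \<in> E))
          (\<lambda>u. exp (- (1 - exp (- t2)) * (p * card {e \<in> E. u \<in> e \<and> e \<inter> U \<noteq> {}})))
        * exp (- (1 - exp (- t3)) * (p\<^sup>2 * card {e \<in> E. e \<subseteq> U}))\<bar>
     \<le> 2 * p ^ 3 * (\<Sum>v\<in>U. (real (card {e \<in> E. v \<in> e}))\<^sup>2) + p ^ 3 * card E"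
    (is "\<bar>?law - _\<bar> \<le> _")
proof -
  define c1 c2 c3 where "c1 = 1 - exp (- t1)" and "c2 = 1 - exp (- t2)" and "c3 = 1 - exp (- t3)"
  have c: "0 \<le> c1" "c1 \<le> 1" "0 \<le> c2" "c2 \<le> 1" "0 \<le> c3" "c3 \<le> 1"
    using t by (auto simp: c1_def c2_def c3_def)
  define c where "c = (\<lambda>e. if e \<subseteq> U then c3 else c2)"
  have c01: "0 \<le> c e \<and> c e \<le> 1" for e using \<open>0 \<le> c2\<close> \<open>c2 \<le> 1\<close> \<open>0 \<le> c3\<close> \<open>c3 \<le> 1\<close> by (auto simp: c_def)
  have finE: "finite E"
    by (rule finite_subset[of _ "Pow (Bg \<union> U)"]) (use E fin in auto)
  have fine: "finite e" if "e \<in> E" for e using E[OF that] by (metis card.infinite zero_neq_numeral)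
  \<comment> \<open>The edges that are still undecided once A is known; \<open>e\<close> occurs
    exactly when \<open>e \<inter> U \<subseteq> S\<close>.\<close>
  define J where "J = (\<lambda>A. {e \<in> E. e \<subseteq> A \<union> U \<and> e \<inter> U \<noteq> {}})"
  have finJ: "finite (J A)" for A using finE by (simp add: J_def)
  define h where "h = (\<lambda>u. exp (- c2 * (p * card {e \<in> E. u \<in> e \<and> e \<inter> U \<noteq> {}})))"
  define P where "P = (\<lambda>A. \<Prod>e\<in>pairs A. 1 - c1 * of_bool (e \<in> E))"
  define Q where "Q = {(e, f). e \<in> E \<and> f \<in> E \<and> e \<noteq> f \<and> e \<inter> f \<inter> U \<noteq> {}}"
  have finQ: "finite Q" by (rule finite_subset[of _ "E \<times> E"]) (use finE in \<open>auto simp: Q_def\<close>)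
  have split: "exp (- t1 * card {e \<in> E. e \<subseteq> A \<union> S \<and> e \<subseteq> Bg}
             - t2 * card {e \<in> E. e \<subseteq> A \<union> S \<and> e \<inter> Bg \<noteq> {} \<and> e \<inter> U \<noteq> {}}
             - t3 * card {e \<in> E. e \<subseteq> A \<union> S \<and> e \<subseteq> U})
     = P A * (\<Prod>e\<in>J A. 1 - c e * of_bool (e \<inter> U \<subseteq> S))" if A: "A \<subseteq> Bg" and S: "S \<subseteq> U" for A S
  proof -
    have finA: "finite A" using A fin finite_subset by blast
    have 1: "exp (- t1 * card {e \<in> E. e \<subseteq> A \<union> S \<and> e \<subseteq> Bg}) = P A"
    proof -
      have "{e \<in> E. e \<subseteq> A \<union> S \<and> e \<subseteq> Bg} = {e \<in> pairs A. e \<in> E}"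
        using E A S disj unfolding pairs_def by blast
      then show ?thesis
        unfolding P_def c1_def by (simp only: exp_neg_card_eq_prod[OF finite_pairs[OF finA]])
    qed
    have 2: "exp (- t2 * card {e \<in> E. e \<subseteq> A \<union> S \<and> e \<inter> Bg \<noteq> {} \<and> e \<inter> U \<noteq> {}})
       = (\<Prod>e\<in>J A. 1 - c2 * of_bool (e \<inter> U \<subseteq> S \<and> \<not> e \<subseteq> U))"
    proof -
      have "{e \<in> E. e \<subseteq> A \<union> S \<and> e \<inter> Bg \<noteq> {} \<and> e \<inter> U \<noteq> {}} = {e \<in> J A. e \<inter> U \<subseteq> S \<and> \<not> e \<subseteq> U}"
        using E A S disj by (auto simp: J_def)
      then show ?thesis
        unfolding c2_def by (simp only: exp_neg_card_eq_prod[OF finJ])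
    qed
    have 3: "exp (- t3 * card {e \<in> E. e \<subseteq> A \<union> S \<and> e \<subseteq> U})
       = (\<Prod>e\<in>J A. 1 - c3 * of_bool (e \<inter> U \<subseteq> S \<and> e \<subseteq> U))"
    proof -
      have "e \<inter> U \<noteq> {}" if "e \<in> E" "e \<subseteq> U" for e
        using E[OF that(1)] that(2) by (auto simp: Int_absorb2)
      then have "{e \<in> E. e \<subseteq> A \<union> S \<and> e \<subseteq> U} = {e \<in> J A. e \<inter> U \<subseteq> S \<and> e \<subseteq> U}"
        using E A S disj by (auto simp: J_def)
      then show ?thesis
        unfolding c3_def by (simp only: exp_neg_card_eq_prod[OF finJ])
    qed
    have "exp (- t1 * card {e \<in> E. e \<subseteq> A \<union> S \<and> e \<subseteq> Bg}
             - t2 * card {e \<in> E. e \<subseteq> A \<union> S \<and> e \<inter> Bg \<noteq> {} \<and> e \<inter> U \<noteq> {}}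
             - t3 * card {e \<in> E. e \<subseteq> A \<union> S \<and> e \<subseteq> U})
      = exp (- t1 * card {e \<in> E. e \<subseteq> A \<union> S \<and> e \<subseteq> Bg})
        * (exp (- t2 * card {e \<in> E. e \<subseteq> A \<union> S \<and> e \<inter> Bg \<noteq> {} \<and> e \<inter> U \<noteq> {}})
        * exp (- t3 * card {e \<in> E. e \<subseteq> A \<union> S \<and> e \<subseteq> U}))"
      by (simp only: exp_add[symmetric]) (simp add: algebra_simps)
    also have "\<dots> = P A * (\<Prod>e\<in>J A. 1 - c e * of_bool (e \<inter> U \<subseteq> S))"
      unfolding 1 2 3 prod.distrib[symmetric]
      by (intro arg_cong[of _ _ "(*) (P A)"] prod.cong refl) (auto simp: c_def)
    finally show ?thesis .
  qed
  \<comment> \<open>A mixed edge has exactly one end in A and is counted there, which produces the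
    product of the \<open>h u\<close>; edges inside U do not involve A.\<close>
  have mean: "exp (- (\<Sum>e\<in>J A. c e * p ^ card (e \<inter> U)))
     = (\<Prod>u\<in>A. h u) * exp (- c3 * (p\<^sup>2 * card {e \<in> E. e \<subseteq> U}))" if A: "A \<subseteq> Bg" for A
  proof -
    have finA: "finite A" using A fin finite_subset by blast
    define Jm where "Jm = {e \<in> J A. \<not> e \<subseteq> U}"
    have JU: "J A = Jm \<union> {e \<in> E. e \<subseteq> U}" "Jm \<inter> {e \<in> E. e \<subseteq> U} = {}"
      using E[of "{}"] by (auto simp: Jm_def J_def Int_absorb2)
    have fJ: "finite Jm" "finite {e \<in> E. e \<subseteq> U}" using finJ finE by (auto simp: Jm_def)
    have m: "card (e \<inter> U) = 1 \<and> card (e \<inter> A) = 1" if "e \<in> Jm" for e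
    proof -
      have e: "e \<in> E" "e \<subseteq> A \<union> U" "e \<inter> U \<noteq> {}" "\<not> e \<subseteq> U" using that by (auto simp: Jm_def J_def)
      have "A \<inter> U = {}" using A disj by auto
      then have "card (e \<inter> A) + card (e \<inter> U) = 2"
        using card_eq_card_Int_add[OF fine[OF e(1)] e(2)] E[OF e(1)] by simp
      moreover have "card (e \<inter> A) \<noteq> 0" "card (e \<inter> U) \<noteq> 0"
        using e fine[OF e(1)] by auto
      ultimately show ?thesis by linarith
    qed
    have cardJm: "card Jm = (\<Sum>u\<in>A. card {e \<in> E. u \<in> e \<and> e \<inter> U \<noteq> {}})"
    proof -
      have sets: "{e \<in> E. u \<in> e \<and> e \<inter> U \<noteq> {}} = {e \<in> Jm. u \<in> e}" if u: "u \<in> A" for u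
      proof
        show "{e \<in> E. u \<in> e \<and> e \<inter> U \<noteq> {}} \<subseteq> {e \<in> Jm. u \<in> e}"
        proof
          fix e assume e: "e \<in> {e \<in> E. u \<in> e \<and> e \<inter> U \<noteq> {}}"
          then obtain w where w: "w \<in> e" "w \<in> U" by auto
          have "w \<noteq> u" using w u A disj by auto
          then have "e = {u, w}" using e w E[of e] by (auto simp: card_2_iff)
          then show "e \<in> {e \<in> Jm. u \<in> e}" using e w u A disj by (auto simp: Jm_def J_def)
        qed
        show "{e \<in> Jm. u \<in> e} \<subseteq> {e \<in> E. u \<in> e \<and> e \<inter> U \<noteq> {}}" by (auto simp: Jm_def J_def)
      qed
      have "(\<Sum>u\<in>A. card {e \<in> E. u \<in> e \<and> e \<inter> U \<noteq> {}}) = (\<Sum>u\<in>A. \<Sum>e\<in>Jm. of_bool (u \<in> e))"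
        using fJ by (intro sum.cong refl) (simp only: sets, simp add: sum.If_cases of_bool_def Int_def)
      also have "\<dots> = (\<Sum>e\<in>Jm. \<Sum>u\<in>A. of_bool (u \<in> e))" by (rule sum.swap)
      also have "\<dots> = (\<Sum>e\<in>Jm. card (e \<inter> A))"
        using finA by (intro sum.cong refl) (simp add: of_bool_def sum.If_cases Int_def conj_commute)
      also have "\<dots> = card Jm" using m by simp
      finally show ?thesis by simp
    qed
    have "(\<Sum>e\<in>J A. c e * p ^ card (e \<inter> U)) = (\<Sum>e\<in>Jm. c e * p ^ card (e \<inter> U)) + (\<Sum>e\<in>{e \<in> E. e \<subseteq> U}. c e * p ^ card (e \<inter> U))"
      unfolding JU(1) by (rule sum.union_disjoint[OF fJ JU(2)])
    also have "(\<Sum>e\<in>Jm. c e * p ^ card (e \<inter> U)) = (\<Sum>e\<in>Jm. c2 * p)"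
      using m by (intro sum.cong refl) (auto simp: c_def Jm_def)
    also have "\<dots> = c2 * p * card Jm" by simp
    also have "(\<Sum>e\<in>{e \<in> E. e \<subseteq> U}. c e * p ^ card (e \<inter> U)) = (\<Sum>e\<in>{e \<in> E. e \<subseteq> U}. c3 * p\<^sup>2)"
      using E by (intro sum.cong refl) (auto simp: c_def Int_absorb2)
    also have "\<dots> = c3 * p\<^sup>2 * card {e \<in> E. e \<subseteq> U}" by simp
    finally have s: "(\<Sum>e\<in>J A. c e * p ^ card (e \<inter> U)) = c2 * p * card Jm + c3 * p\<^sup>2 * card {e \<in> E. e \<subseteq> U}" .
    have "(\<Prod>u\<in>A. h u) = exp (\<Sum>u\<in>A. - c2 * (p * card {e \<in> E. u \<in> e \<and> e \<inter> U \<noteq> {}}))"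
      unfolding h_def using finA by (simp add: exp_sum)
    also have "(\<Sum>u\<in>A. - c2 * (p * card {e \<in> E. u \<in> e \<and> e \<inter> U \<noteq> {}})) = - c2 * p * card Jm"
      unfolding cardJm by (simp add: sum_distrib_left mult.assoc)
    finally show ?thesis unfolding s by (simp add: exp_add[symmetric] algebra_simps)
  qed
  \<comment> \<open>The condition that the big ends lie in A is kept as an indicator. Averaging over
    A turns it into the powers of p that bring every error term down to order p^3.\<close>
  define err where "err = (\<lambda>A. (\<Sum>(e, f)\<in>Q. of_bool ((e \<union> f) \<inter> Bg \<subseteq> A) * (p ^ card ((e \<union> f) \<inter> U) + p ^ (card (e \<inter> U) + card (f \<inter> U))))
       + (\<Sum>e\<in>{e \<in> E. e \<inter> U \<noteq> {}}. of_bool (e \<inter> Bg \<subseteq> A) * p ^ (2 * card (e \<inter> U))))"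
  have cond: "\<bar>bern p U (\<lambda>S. \<Prod>e\<in>J A. 1 - c e * of_bool (e \<inter> U \<subseteq> S)) - exp (- (\<Sum>e\<in>J A. c e * p ^ card (e \<inter> U)))\<bar> \<le> err A"
    if A: "A \<subseteq> Bg" for A
  proof -
    have JA: "e \<in> J A \<longleftrightarrow> e \<in> E \<and> e \<inter> Bg \<subseteq> A \<and> e \<inter> U \<noteq> {}" for e
      using E[of e] A disj by (auto simp: J_def)
    have x01: "0 \<le> c e * p ^ card (e \<inter> U) \<and> c e * p ^ card (e \<inter> U) \<le> 1" for e
      using c01 p by (auto intro!: mult_le_one power_le_one)
    have "\<bar>bern p U (\<lambda>S. \<Prod>e\<in>J A. 1 - c e * of_bool (e \<inter> U \<subseteq> S)) - (\<Prod>e\<in>J A. 1 - c e * p ^ card (e \<inter> U))\<bar>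
       \<le> (\<Sum>(e, f)\<in>{(e, f). e \<in> J A \<and> f \<in> J A \<and> e \<noteq> f \<and> (e \<inter> U) \<inter> (f \<inter> U) \<noteq> {}}.
             p ^ card (e \<inter> U \<union> f \<inter> U) + p ^ (card (e \<inter> U) + card (f \<inter> U)))"
      by (rule bern_dependency) (use finJ fin p c01 in auto)
    also have "\<dots> = (\<Sum>(e, f)\<in>Q. of_bool ((e \<union> f) \<inter> Bg \<subseteq> A) * (p ^ card ((e \<union> f) \<inter> U) + p ^ (card (e \<inter> U) + card (f \<inter> U))))"
      using finQ by (intro sum.mono_neutral_cong_left)
        (auto simp: Q_def JA Int_Un_distrib2)
    finally have a: "\<bar>bern p U (\<lambda>S. \<Prod>e\<in>J A. 1 - c e * of_bool (e \<inter> U \<subseteq> S)) - (\<Prod>e\<in>J A. 1 - c e * p ^ card (e \<inter> U))\<bar> \<le> \<dots>" .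
    have "\<bar>(\<Prod>e\<in>J A. 1 - c e * p ^ card (e \<inter> U)) - exp (- (\<Sum>e\<in>J A. c e * p ^ card (e \<inter> U)))\<bar>
       \<le> (\<Sum>e\<in>J A. (c e * p ^ card (e \<inter> U))\<^sup>2)"
      by (rule prod_one_minus_exp[OF finJ x01])
    also have "\<dots> \<le> (\<Sum>e\<in>J A. p ^ (2 * card (e \<inter> U)))"
    proof (intro sum_mono)
      fix e
      have "(c e)\<^sup>2 * (p ^ card (e \<inter> U))\<^sup>2 \<le> 1 * (p ^ card (e \<inter> U))\<^sup>2"
        using c01[of e] by (intro mult_right_mono) (auto simp: power_le_one)
      then show "(c e * p ^ card (e \<inter> U))\<^sup>2 \<le> p ^ (2 * card (e \<inter> U))"
        by (simp add: power_mult_distrib power_mult[symmetric] mult.commute)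
    qed
    also have "\<dots> = (\<Sum>e\<in>{e \<in> E. e \<inter> U \<noteq> {}}. of_bool (e \<inter> Bg \<subseteq> A) * p ^ (2 * card (e \<inter> U)))"
      using finE by (intro sum.mono_neutral_cong_left) (auto simp: JA)
    finally show ?thesis using a unfolding err_def by linarith
  qed
  have "?law
    = bern p Bg (\<lambda>A. bern p U (\<lambda>S. P A * (\<Prod>e\<in>J A. 1 - c e * of_bool (e \<inter> U \<subseteq> S))))"
    unfolding bern_Un[OF fin disj] by (intro bern_cong) (simp only: split)
  also have "\<dots> = bern p Bg (\<lambda>A. P A * bern p U (\<lambda>S. \<Prod>e\<in>J A. 1 - c e * of_bool (e \<inter> U \<subseteq> S)))"
    by (simp only: bern_cmult)
  finally have L: "?law = \<dots>" .
  have "gibbs p Bg c1 (\<lambda>e. of_bool (e \<in> E)) h * exp (- c3 * (p\<^sup>2 * card {e \<in> E. e \<subseteq> U}))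
     = bern p Bg (\<lambda>A. P A * exp (- (\<Sum>e\<in>J A. c e * p ^ card (e \<inter> U))))"
    unfolding gibbs_def bern_cmult_right[symmetric] by (intro bern_cong) (simp only: mean P_def mult.assoc)
  then have "\<bar>?law
       - gibbs p Bg c1 (\<lambda>e. of_bool (e \<in> E)) h * exp (- c3 * (p\<^sup>2 * card {e \<in> E. e \<subseteq> U}))\<bar>
     = \<bar>bern p Bg (\<lambda>A. P A * (bern p U (\<lambda>S. \<Prod>e\<in>J A. 1 - c e * of_bool (e \<inter> U \<subseteq> S))
           - exp (- (\<Sum>e\<in>J A. c e * p ^ card (e \<inter> U)))))\<bar>"
    unfolding L by (simp only: bern_diff[symmetric] right_diff_distrib)
  also have "\<dots> \<le> bern p Bg err"
  proof (rule bern_abs_le[OF p])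
    fix A assume A: "A \<subseteq> Bg"
    have "0 \<le> P A" "P A \<le> 1"
      unfolding P_def using \<open>0 \<le> c1\<close> \<open>c1 \<le> 1\<close> by (auto intro!: prod_nonneg prod_le_1)
    then show "\<bar>P A * (bern p U (\<lambda>S. \<Prod>e\<in>J A. 1 - c e * of_bool (e \<inter> U \<subseteq> S))
           - exp (- (\<Sum>e\<in>J A. c e * p ^ card (e \<inter> U))))\<bar> \<le> err A"
      using cond[OF A] by (intro abs_mult_le_of_le_one) auto
  qed
  also have "\<dots> = (\<Sum>(e, f)\<in>Q. p ^ card ((e \<union> f) \<inter> Bg) * (p ^ card ((e \<union> f) \<inter> U) + p ^ (card (e \<inter> U) + card (f \<inter> U))))
       + (\<Sum>e\<in>{e \<in> E. e \<inter> U \<noteq> {}}. p ^ card (e \<inter> Bg) * p ^ (2 * card (e \<inter> U)))"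
    unfolding err_def bern_add bern_sum case_prod_unfold bern_cmult_right
    by (simp only: bern_prob_all_in[OF fin(1) Int_lower2])
  \<comment> \<open>Two distinct edges span at least three vertices, so each pair costs at most
    twice p^3. For a single edge the exponent is the number of big ends plus twice the number of
    small ends, again at least 3.\<close>
  also have "\<dots> \<le> (\<Sum>(e, f)\<in>Q. 2 * p ^ 3) + (\<Sum>e\<in>{e \<in> E. e \<inter> U \<noteq> {}}. p ^ 3)"
  proof (intro add_mono sum_mono)
    fix x assume "x \<in> Q"
    then obtain e f where x: "x = (e, f)" and ef: "e \<in> E" "f \<in> E" "e \<noteq> f" by (auto simp: Q_def)
    have fe: "finite (e \<union> f)" using fine ef by auto
    have "\<not> f \<subseteq> e" using card_subset_eq[of e f] ef E[of e] E[of f] fine[of e] by auto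
    then have "e \<subset> e \<union> f" by auto
    then have c3: "3 \<le> card (e \<union> f)" using psubset_card_mono[OF fe] E[OF ef(1)] by fastforce
    have cc: "card (e \<union> f) = card ((e \<union> f) \<inter> Bg) + card ((e \<union> f) \<inter> U)"
      using E[OF ef(1)] E[OF ef(2)] by (intro card_eq_card_Int_add fe disj) auto
    have "card ((e \<union> f) \<inter> U) \<le> card (e \<inter> U) + card (f \<inter> U)"
      unfolding Int_Un_distrib2 by (rule card_Un_le)
    then have "p ^ (card ((e \<union> f) \<inter> Bg) + card ((e \<union> f) \<inter> U)) \<le> p ^ 3"
      "p ^ (card ((e \<union> f) \<inter> Bg) + (card (e \<inter> U) + card (f \<inter> U))) \<le> p ^ 3"
      using cc c3 p by (auto intro!: power_decreasing)
    then show "(case x of (e, f) \<Rightarrow> p ^ card ((e \<union> f) \<inter> Bg) * (p ^ card ((e \<union> f) \<inter> U) + p ^ (card (e \<inter> U) + card (f \<inter> U))))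
       \<le> (case x of (e, f) \<Rightarrow> 2 * p ^ 3)"
      unfolding x by (simp add: power_add algebra_simps)
  next
    fix e assume e: "e \<in> {e \<in> E. e \<inter> U \<noteq> {}}"
    have fe: "finite e" using fine e by auto
    have "card (e \<inter> Bg) + card (e \<inter> U) = 2"
      using card_eq_card_Int_add[OF fe _ disj] E[of e] e by auto
    moreover have "card (e \<inter> U) \<noteq> 0" using e fe by auto
    ultimately have "p ^ (card (e \<inter> Bg) + 2 * card (e \<inter> U)) \<le> p ^ 3"
      using p by (intro power_decreasing) auto
    then show "p ^ card (e \<inter> Bg) * p ^ (2 * card (e \<inter> U)) \<le> p ^ 3" by (simp add: power_add)
  qed
  also have "\<dots> \<le> 2 * p ^ 3 * (\<Sum>v\<in>U. (real (card {e \<in> E. v \<in> e}))\<^sup>2) + p ^ 3 * card E"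
  proof (intro add_mono)
    \<comment> \<open>The two edges of a pair in Q share a vertex of U. Counting by this vertex
      gives squared degrees of small vertices only; those of big vertices could be too
      large.\<close>
    have "Q \<subseteq> (\<Union>v\<in>U. {e \<in> E. v \<in> e} \<times> {e \<in> E. v \<in> e})" by (auto simp: Q_def)
    then have "card Q \<le> card (\<Union>v\<in>U. {e \<in> E. v \<in> e} \<times> {e \<in> E. v \<in> e})"
      using fin finE by (intro card_mono) auto
    also have "\<dots> \<le> (\<Sum>v\<in>U. card ({e \<in> E. v \<in> e} \<times> {e \<in> E. v \<in> e}))"
      by (rule card_UN_le[OF fin(2)])
    finally have "real (card Q) \<le> (\<Sum>v\<in>U. (real (card {e \<in> E. v \<in> e}))\<^sup>2)"
      unfolding card_cartesian_product power2_eq_square of_nat_mult[symmetric] of_nat_sum[symmetric]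
      by (rule of_nat_mono)
    then have "2 * p ^ 3 * real (card Q) \<le> 2 * p ^ 3 * (\<Sum>v\<in>U. (real (card {e \<in> E. v \<in> e}))\<^sup>2)"
      using p by (intro mult_left_mono) auto
    then show "(\<Sum>(e, f)\<in>Q. 2 * p ^ 3) \<le> 2 * p ^ 3 * (\<Sum>v\<in>U. (real (card {e \<in> E. v \<in> e}))\<^sup>2)"
      by (simp add: mult_ac)
    have "card {e \<in> E. e \<inter> U \<noteq> {}} \<le> card E" using finE by (intro card_mono) auto
    then show "(\<Sum>e\<in>{e \<in> E. e \<inter> U \<noteq> {}}. p ^ 3) \<le> p ^ 3 * card E"
      using p by (simp add: mult.commute[of "p ^ 3"] mult_right_mono)
  qed
  finally show ?thesis unfolding h_def c1_def c2_def c3_def .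
qed

section \<open>Averages over shrinking cells\<close>

text \<open>The conditional expectation given the cells, set to 0 off their union.\<close>

definition avg :: "'i set \<Rightarrow> ('i \<Rightarrow> 'a set) \<Rightarrow> ('a::euclidean_space \<Rightarrow> real) \<Rightarrow> 'a \<Rightarrow> real" where
  "avg I C f x = (\<Sum>i\<in>I. (LINT y:C i|lborel. f y) / measure lborel (C i) * indicator (C i) x)"

definition cells :: "'i set \<Rightarrow> ('i \<Rightarrow> 'a::euclidean_space set) \<Rightarrow> bool" where
  "cells I C \<longleftrightarrow> finite I \<and> disjoint_family_on C I \<and> (\<forall>i\<in>I. C i \<in> sets lborel \<and> 0 < measure lborel (C i))"

lemma emeasure_less_top_of_measure_pos: "0 < measure M A \<Longrightarrow> emeasure M A < top"
  by (metis enn2real_top less_irrefl measure_def top.not_eq_extremum)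

lemma set_integrable_lborel:
  fixes f :: "'a::euclidean_space \<Rightarrow> real"
  assumes "integrable lborel f" "A \<in> sets lborel"
  shows "set_integrable lborel A f"
  using assms integrable_mult_indicator unfolding set_integrable_def by blast

lemma avg_integrable: "cells I C \<Longrightarrow> integrable lborel (avg I C f)"
  unfolding avg_def cells_def
  by (intro Bochner_Integration.integrable_sum integrable_mult_right integrable_real_indicator)
     (auto intro: emeasure_less_top_of_measure_pos)

lemma avg_diff:
  assumes "cells I C" "integrable lborel f" "integrable lborel g"
  shows "avg I C (\<lambda>x. f x - g x) x = avg I C f x - avg I C g x"
proof -
  have "(LINT y:C i|lborel. f y - g y) = (LINT y:C i|lborel. f y) - (LINT y:C i|lborel. g y)" if "i \<in> I" for i
    using assms that by (intro set_integral_diff(2) set_integrable_lborel) (auto simp: cells_def)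
  then show ?thesis
    unfolding avg_def sum_subtractf[symmetric]
    by (intro sum.cong refl) (simp add: diff_divide_distrib left_diff_distrib)
qed

lemma avg_eq:
  assumes "cells I C" "i \<in> I" "x \<in> C i"
  shows "avg I C f x = (LINT y:C i|lborel. f y) / measure lborel (C i)"
proof -
  have "avg I C f x = (\<Sum>j\<in>I. if j = i then (LINT y:C i|lborel. f y) / measure lborel (C i) else 0)"
    unfolding avg_def
  proof (intro sum.cong refl)
    fix j assume "j \<in> I"
    then have "j \<noteq> i \<Longrightarrow> x \<notin> C j"
      using assms by (auto simp: cells_def disjoint_family_on_def)
    then show "(LINT y:C j|lborel. f y) / measure lborel (C j) * indicator (C j) x
        = (if j = i then (LINT y:C i|lborel. f y) / measure lborel (C i) else 0)"
      using assms by auto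
  qed
  then show ?thesis using assms by (simp add: cells_def)
qed

lemma avg_eq_0: "x \<notin> (\<Union>i\<in>I. C i) \<Longrightarrow> avg I C f x = 0"
  unfolding avg_def by (intro sum.neutral) auto

text \<open>The triangle inequality within each cell, then disjointness of the cells. This
  contraction is what lets density arguments pass through averaging.\<close>

lemma avg_contract:
  assumes "cells I C" "integrable lborel f"
  shows "(LINT x|lborel. \<bar>avg I C f x\<bar>) \<le> (LINT x|lborel. \<bar>f x\<bar>)"
proof -
  have fin: "finite I" and C: "\<And>i. i \<in> I \<Longrightarrow> C i \<in> sets lborel \<and> 0 < measure lborel (C i)"
    and dis: "disjoint_family_on C I"
    using assms(1) by (auto simp: cells_def)
  have intind: "integrable lborel (\<lambda>x. a * indicator (C i) x :: real)" if "i \<in> I" for a i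
    using C[OF that] by (intro integrable_mult_right integrable_real_indicator)
      (auto intro: emeasure_less_top_of_measure_pos)
  have "(LINT x|lborel. \<bar>avg I C f x\<bar>)
      \<le> (LINT x|lborel. (\<Sum>i\<in>I. \<bar>LINT y:C i|lborel. f y\<bar> / measure lborel (C i) * indicator (C i) x))"
  proof (rule integral_mono)
    show "integrable lborel (\<lambda>x. \<bar>avg I C f x\<bar>)" using avg_integrable[OF assms(1)] by simp
    show "integrable lborel (\<lambda>x. \<Sum>i\<in>I. \<bar>LINT y:C i|lborel. f y\<bar> / measure lborel (C i) * indicator (C i) x)"
      by (intro Bochner_Integration.integrable_sum intind)
    show "\<bar>avg I C f x\<bar> \<le> (\<Sum>i\<in>I. \<bar>LINT y:C i|lborel. f y\<bar> / measure lborel (C i) * indicator (C i) x)" for x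
      unfolding avg_def by (rule order_trans[OF sum_abs]) (simp add: abs_mult)
  qed
  also have "\<dots> = (\<Sum>i\<in>I. LINT x|lborel. \<bar>LINT y:C i|lborel. f y\<bar> / measure lborel (C i) * indicator (C i) x)"
    by (intro Bochner_Integration.integral_sum intind)
  also have "\<dots> = (\<Sum>i\<in>I. \<bar>LINT y:C i|lborel. f y\<bar>)"
  proof (intro sum.cong refl)
    fix i assume "i \<in> I"
    then show "(LINT x|lborel. \<bar>LINT y:C i|lborel. f y\<bar> / measure lborel (C i) * indicator (C i) x) = \<bar>LINT y:C i|lborel. f y\<bar>"
      using C[of i] by simp
  qed
  also have "\<dots> \<le> (\<Sum>i\<in>I. LINT y|lborel. indicator (C i) y * \<bar>f y\<bar>)"
  proof (intro sum_mono)
    fix i assume i: "i \<in> I"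
    have "\<bar>LINT y:C i|lborel. f y\<bar> \<le> (LINT y:C i|lborel. \<bar>f y\<bar>)"
      unfolding set_lebesgue_integral_def
      by (rule order_trans[OF integral_abs_bound]) (simp add: abs_mult)
    then show "\<bar>LINT y:C i|lborel. f y\<bar> \<le> (LINT y|lborel. indicator (C i) y * \<bar>f y\<bar>)"
      by (simp add: set_lebesgue_integral_def)
  qed
  also have "\<dots> = (LINT y|lborel. (\<Sum>i\<in>I. indicator (C i) y * \<bar>f y\<bar>))"
  proof (rule Bochner_Integration.integral_sum[symmetric])
    fix i assume "i \<in> I"
    then show "integrable lborel (\<lambda>y. indicator (C i) y * \<bar>f y\<bar>)"
      using set_integrable_lborel[OF integrable_abs[OF assms(2)], of "C i"] C by (simp add: set_integrable_def)
  qed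
  also have "\<dots> \<le> (LINT y|lborel. \<bar>f y\<bar>)"
  proof (rule integral_mono)
    show "integrable lborel (\<lambda>y. \<Sum>i\<in>I. indicator (C i) y * \<bar>f y\<bar>)"
      using set_integrable_lborel[OF integrable_abs[OF assms(2)]] C
      by (intro Bochner_Integration.integrable_sum) (auto simp: set_integrable_def)
    show "integrable lborel (\<lambda>y. \<bar>f y\<bar>)" using assms(2) by simp
    fix y
    have "(\<Sum>i\<in>I. indicator (C i) y :: real) = indicator (\<Union>i\<in>I. C i) y"
      using fin dis by (simp add: indicator_UN_disjoint)
    then show "(\<Sum>i\<in>I. indicator (C i) y * \<bar>f y\<bar>) \<le> \<bar>f y\<bar>"
      by (simp add: sum_distrib_right[symmetric] indicator_def)
  qed
  finally show ?thesis .
qed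

text \<open>By contraction, the functions whose averages converge form a class closed in L1: the
  error f - g enters once as it is and once averaged, and both times costs at most its L1
  norm.\<close>

lemma avg_tendsto_L1_approx:
  fixes C :: "nat \<Rightarrow> 'i \<Rightarrow> 'a::euclidean_space set" and f :: "'a \<Rightarrow> real"
  assumes C: "\<And>n. cells (I n) (C n)" and f: "integrable lborel f"
    and ap: "\<And>e::real. 0 < e \<Longrightarrow> \<exists>g. integrable lborel g \<and> (LINT x|lborel. \<bar>f x - g x\<bar>) < e
       \<and> (\<lambda>n. LINT x|lborel. \<bar>avg (I n) (C n) g x - g x\<bar>) \<longlonglongrightarrow> 0"
  shows "(\<lambda>n. LINT x|lborel. \<bar>avg (I n) (C n) f x - f x\<bar>) \<longlonglongrightarrow> 0"
proof (rule LIMSEQ_I)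
  fix r :: real assume r: "0 < r"
  obtain g where g: "integrable lborel g" "(LINT x|lborel. \<bar>f x - g x\<bar>) < r / 3"
    "(\<lambda>n. LINT x|lborel. \<bar>avg (I n) (C n) g x - g x\<bar>) \<longlonglongrightarrow> 0"
    using ap[of "r / 3"] r by auto
  obtain no where no: "\<And>n. n \<ge> no \<Longrightarrow> \<bar>LINT x|lborel. \<bar>avg (I n) (C n) g x - g x\<bar>\<bar> < r / 3"
    using LIMSEQ_D[OF g(3), of "r / 3"] r by auto
  show "\<exists>no. \<forall>n\<ge>no. norm ((LINT x|lborel. \<bar>avg (I n) (C n) f x - f x\<bar>) - 0) < r"
  proof (intro exI allI impI)
    fix n assume n: "no \<le> n"
    have i: "integrable lborel (avg (I n) (C n) f)" "integrable lborel (avg (I n) (C n) g)"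
      "integrable lborel (avg (I n) (C n) (\<lambda>x. f x - g x))"
      using avg_integrable[OF C] by auto
    have "(LINT x|lborel. \<bar>avg (I n) (C n) f x - f x\<bar>)
       \<le> (LINT x|lborel. \<bar>avg (I n) (C n) (\<lambda>x. f x - g x) x\<bar> + \<bar>avg (I n) (C n) g x - g x\<bar> + \<bar>f x - g x\<bar>)"
      using i f g(1) by (intro integral_mono) (auto simp: avg_diff[OF C f g(1)])
    also have "\<dots> = (LINT x|lborel. \<bar>avg (I n) (C n) (\<lambda>x. f x - g x) x\<bar>) + (LINT x|lborel. \<bar>avg (I n) (C n) g x - g x\<bar>)
         + (LINT x|lborel. \<bar>f x - g x\<bar>)"
      using i f g(1) by simp
    also have "\<dots> \<le> (LINT x|lborel. \<bar>f x - g x\<bar>) + (LINT x|lborel. \<bar>avg (I n) (C n) g x - g x\<bar>)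
         + (LINT x|lborel. \<bar>f x - g x\<bar>)"
      using f g(1) by (intro add_mono avg_contract[OF C]) auto
    also have "\<dots> < r" using g(2) no[OF n] by linarith
    finally show "norm ((LINT x|lborel. \<bar>avg (I n) (C n) f x - f x\<bar>) - 0) < r" by simp
  qed
qed

text \<open>For an open set \<open>U\<close> the averages of the indicator tend to \<open>1\<close> on \<open>U\<close>; since averaging preserves
  mass, nothing is left for the complement, so the boundary of \<open>U\<close> need not be null.\<close>

lemma avg_indicator_open:
  fixes C :: "nat \<Rightarrow> 'i \<Rightarrow> 'a::euclidean_space set"
  assumes C: "\<And>n. cells (I n) (C n)" and sub: "\<And>n i. i \<in> I n \<Longrightarrow> C n i \<subseteq> \<Omega>"
    and \<Omega>: "\<Omega> \<in> sets lborel"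
    and shrink: "AE x in lborel. x \<in> \<Omega> \<longrightarrow> (\<forall>e>0. \<forall>\<^sub>F n in sequentially. \<exists>i\<in>I n. x \<in> C n i \<and> C n i \<subseteq> ball x e)"
    and U: "open U" "emeasure lborel U < \<infinity>"
  shows "(\<lambda>n. LINT x|lborel. \<bar>avg (I n) (C n) (indicator (U \<inter> \<Omega>)) x - indicator (U \<inter> \<Omega>) x\<bar>) \<longlonglongrightarrow> 0"
proof -
  define B where "B = U \<inter> \<Omega>"
  have Bm: "B \<in> sets lborel" using U \<Omega> by (auto simp: B_def)
  have "emeasure lborel B \<le> emeasure lborel U" using U by (intro emeasure_mono) (auto simp: B_def)
  then have Bf: "emeasure lborel B < \<infinity>" using U(2) by auto
  have iB: "integrable lborel (indicator B :: _ \<Rightarrow> real)" using Bm Bf by auto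
  define a where "a = (\<lambda>n. avg (I n) (C n) (indicator B))"
  have ia: "integrable lborel (a n)" for n unfolding a_def by (rule avg_integrable[OF C])
  have a01: "0 \<le> a n x \<and> a n x \<le> 1" for n x
  proof (cases "x \<in> (\<Union>i\<in>I n. C n i)")
    case True
    then obtain i where i: "i \<in> I n" "x \<in> C n i" by auto
    then have Ci: "C n i \<in> sets lborel" "0 < measure lborel (C n i)" using C by (auto simp: cells_def)
    have eq: "(LINT y:C n i|lborel. indicator B y) = measure lborel (B \<inter> C n i)"
      by (simp add: set_lebesgue_integral_def indicator_inter_arith[symmetric] Int_commute)
    have "measure lborel (B \<inter> C n i) \<le> measure lborel (C n i)"
      using Ci Bm emeasure_less_top_of_measure_pos[OF Ci(2)]
      by (intro measure_mono_fmeasurable) (auto simp: fmeasurable_def)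
    then show ?thesis unfolding a_def avg_eq[OF C i] eq using Ci by (auto simp: divide_le_eq)
  next
    case False
    then show ?thesis by (simp add: a_def avg_eq_0)
  qed
  have lim: "AE x in lborel. (\<lambda>n. indicator B x * (1 - a n x)) \<longlonglongrightarrow> 0"
    using shrink
  proof eventually_elim
    case (elim x)
    show ?case
    proof (cases "x \<in> B")
      case True
      then obtain e where e: "e > 0" "ball x e \<subseteq> U" using U(1) unfolding B_def open_contains_ball by auto
      have "\<forall>\<^sub>F n in sequentially. \<exists>i\<in>I n. x \<in> C n i \<and> C n i \<subseteq> ball x e"
        using elim True e by (auto simp: B_def)
      then have "\<forall>\<^sub>F n in sequentially. indicator B x * (1 - a n x) = 0"
      proof eventually_elim
        case (elim n)
        then obtain i where i: "i \<in> I n" "x \<in> C n i" "C n i \<subseteq> ball x e" by auto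
        then have "C n i \<subseteq> B" using sub e by (auto simp: B_def)
        then have eq: "C n i \<inter> B = C n i" by auto
        have "(LINT y:C n i|lborel. indicator B y) = measure lborel (C n i)"
          by (simp add: set_lebesgue_integral_def indicator_inter_arith[symmetric] eq)
        then have "a n x = 1"
          unfolding a_def avg_eq[OF C i(1,2)] using C[of n] i(1) by (auto simp: cells_def)
        then show ?case by simp
      qed
      then show ?thesis by (rule tendsto_eventually)
    qed simp
  qed
  have "(\<lambda>n. LINT x|lborel. indicator B x * (1 - a n x)) \<longlonglongrightarrow> (LINT x::'a|lborel. (0::real))"
  proof (rule integral_dominated_convergence[where w = "indicator B :: _ \<Rightarrow> real"])
    show "AE x in lborel. norm (indicator B x * (1 - a n x)) \<le> indicator B x" for n
      using a01[of n] by (auto simp: indicator_def)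
  qed (use lim iB ia Bm in auto)
  then have l0: "(\<lambda>n. 2 * (LINT x|lborel. indicator B x * (1 - a n x))) \<longlonglongrightarrow> 0"
    using tendsto_mult_right_zero by force
  \<comment> \<open>For values in [0,1] the distance to the indicator is the signed difference plus
    twice the deficit on B. The signed part has nonpositive integral by \<open>avg_contract\<close>,
    so only the deficit has to vanish.\<close>
  have le: "(LINT x|lborel. \<bar>a n x - indicator B x\<bar>) \<le> 2 * (LINT x|lborel. indicator B x * (1 - a n x))" for n
  proof -
    have i1: "integrable lborel (\<lambda>x. indicator B x * (1 - a n x))"
      by (rule Bochner_Integration.integrable_bound[OF iB]) (use ia Bm a01 in \<open>auto simp: indicator_def\<close>)
    have "(LINT x|lborel. \<bar>a n x - indicator B x\<bar>) = (LINT x|lborel. (a n x - indicator B x) + 2 * (indicator B x * (1 - a n x)))"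
      using a01 by (intro Bochner_Integration.integral_cong refl) (auto simp: indicator_def)
    also have "\<dots> = (LINT x|lborel. a n x) - (LINT x|lborel. indicator B x) + 2 * (LINT x|lborel. indicator B x * (1 - a n x))"
      using ia iB i1 by simp
    also have "(LINT x|lborel. a n x) \<le> (LINT x|lborel. indicator B x)"
    proof -
      have "\<bar>a n x\<bar> = a n x" for x using a01 by simp
      moreover have "(LINT x|lborel. \<bar>a n x\<bar>) \<le> (LINT x|lborel. \<bar>indicator B x\<bar>)"
        unfolding a_def by (rule avg_contract[OF C iB])
      ultimately show ?thesis by simp
    qed
    finally show ?thesis by simp
  qed
  have "(\<lambda>n. LINT x|lborel. \<bar>a n x - indicator B x\<bar>) \<longlonglongrightarrow> 0"
    by (rule tendsto_sandwich[OF _ _ tendsto_const l0]) (auto intro!: always_eventually le)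
  then show ?thesis unfolding a_def B_def .
qed

text \<open>Density takes the place of a differentiation theorem: open sets are covered by
  \<open>avg_indicator_open\<close>, Borel sets by outer regularity, and general integrands by
  additivity and L1 closedness along \<open>integrable_induct\<close>.\<close>

theorem avg_tendsto_L1:
  fixes C :: "nat \<Rightarrow> 'i \<Rightarrow> 'a::euclidean_space set" and f :: "'a \<Rightarrow> real"
  assumes C: "\<And>n. cells (I n) (C n)" and sub: "\<And>n i. i \<in> I n \<Longrightarrow> C n i \<subseteq> \<Omega>"
    and \<Omega>: "\<Omega> \<in> sets lborel"
    and shrink: "AE x in lborel. x \<in> \<Omega> \<longrightarrow> (\<forall>e>0. \<forall>\<^sub>F n in sequentially. \<exists>i\<in>I n. x \<in> C n i \<and> C n i \<subseteq> ball x e)"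
    and f: "integrable lborel f" and f0: "\<And>x. x \<notin> \<Omega> \<Longrightarrow> f x = 0"
  shows "(\<lambda>n. LINT x|lborel. \<bar>avg (I n) (C n) f x - f x\<bar>) \<longlonglongrightarrow> 0"
proof -
  let ?P = "\<lambda>f. (\<lambda>n. LINT x|lborel. \<bar>avg (I n) (C n) f x - f x\<bar>) \<longlonglongrightarrow> 0"
  have iO: "integrable lborel (\<lambda>x. indicator \<Omega> x * g x)" if "integrable lborel g" for g :: "'a \<Rightarrow> real"
    using set_integrable_lborel[OF that \<Omega>] by (simp add: set_integrable_def)
  have "?P (\<lambda>x. indicator \<Omega> x * f x)"
    using f
  proof (induction f rule: integrable_induct)
    case (base A c)
    have iA: "integrable lborel (\<lambda>x. indicator A x *\<^sub>R c :: real)" using base by auto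
    show ?case
    proof (rule avg_tendsto_L1_approx[OF C iO[OF iA]])
      fix e :: real assume e: "0 < e"
      \<comment> \<open>Adding 1 to the denominator keeps |c| e' < e valid for c = 0 as
        well.\<close>
      define e' where "e' = e / (\<bar>c\<bar> + 1)"
      have e': "0 < e'" using e by (simp add: e'_def)
      obtain U where U: "open U" "A \<subseteq> U" "emeasure lborel (U - A) < e'"
        using outer_regular_lborel[OF _ e', of A] base(1) by auto
      have Um: "U \<in> sets lborel" using U by auto
      have "emeasure lborel U = emeasure lborel A + emeasure lborel (U - A)"
        using U base Um by (subst plus_emeasure) (auto simp: Un_absorb1)
      also have "\<dots> < \<infinity>" using U(3) base(2) by (simp add: order_less_trans)
      finally have Uf: "emeasure lborel U < \<infinity>" .
      define g where "g = (\<lambda>x. c * indicator (U \<inter> \<Omega>) x :: real)"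
      have "emeasure lborel (U \<inter> \<Omega>) \<le> emeasure lborel U" using U Um by (intro emeasure_mono) auto
      then have UO: "integrable lborel (indicator (U \<inter> \<Omega>) :: _ \<Rightarrow> real)"
        using Um \<Omega> Uf by (intro integrable_real_indicator) auto
      have gi: "integrable lborel g" unfolding g_def using UO by (rule integrable_mult_right)
      have m: "measure lborel (U - A) < e'"
        using U(3) e' unfolding measure_def
        by (smt (verit) enn2real_less_iff ennreal_less_top order_less_trans)
      have UAi: "integrable lborel (\<lambda>x. \<bar>c\<bar> * indicator (U - A) x :: real)"
        using U(3) Um base(1) by (intro integrable_mult_right integrable_real_indicator) (auto simp: order_less_trans)
      have "(LINT x|lborel. \<bar>indicator \<Omega> x * (indicator A x *\<^sub>R c) - g x\<bar>) \<le> (LINT x|lborel. \<bar>c\<bar> * indicator (U - A) x)"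
        using U(2) by (intro integral_mono integrable_abs Bochner_Integration.integrable_diff iO iA gi UAi)
          (auto simp: g_def indicator_def)
      also have "\<dots> = \<bar>c\<bar> * measure lborel (U - A)" by simp
      also have "\<dots> \<le> \<bar>c\<bar> * e'" using m by (intro mult_left_mono) auto
      also have "\<dots> < e" using e by (simp add: e'_def field_simps)
      finally have d: "(LINT x|lborel. \<bar>indicator \<Omega> x * (indicator A x *\<^sub>R c) - g x\<bar>) < e" .
      have avg_g: "avg (I n) (C n) g x = c * avg (I n) (C n) (indicator (U \<inter> \<Omega>)) x" for n x
        unfolding avg_def g_def sum_distrib_left by (intro sum.cong refl) simp
      have "(\<lambda>n. \<bar>c\<bar> * (LINT x|lborel. \<bar>avg (I n) (C n) (indicator (U \<inter> \<Omega>)) x - indicator (U \<inter> \<Omega>) x\<bar>)) \<longlonglongrightarrow> \<bar>c\<bar> * 0"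
        by (intro tendsto_mult tendsto_const avg_indicator_open[OF C sub \<Omega> shrink U(1) Uf])
      then have "?P g"
        unfolding avg_g unfolding g_def by (simp add: right_diff_distrib[symmetric] abs_mult)
      then show "\<exists>g. integrable lborel g \<and> (LINT x|lborel. \<bar>indicator \<Omega> x * (indicator A x *\<^sub>R c) - g x\<bar>) < e \<and> ?P g"
        using d gi by blast
    qed
  next
    case (add f g)
    \<comment> \<open>The sum is written as a difference so that \<open>avg_diff\<close>
      applies.\<close>
    have eq: "indicator \<Omega> x * (f x + g x) = indicator \<Omega> x * f x - - (indicator \<Omega> x * g x)" for x :: 'a
      by (simp add: algebra_simps)
    have neg: "avg (I n) (C n) (\<lambda>x. - h x) y = - avg (I n) (C n) h y" for n h y
      unfolding avg_def sum_negf[symmetric]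
      by (intro sum.cong refl) (simp add: set_lebesgue_integral_def)
    have if1: "integrable lborel (\<lambda>x. indicator \<Omega> x * f x)" and ig1: "integrable lborel (\<lambda>x. - (indicator \<Omega> x * g x))"
      using iO add(1,2) by auto
    have "(\<lambda>n. (LINT x|lborel. \<bar>avg (I n) (C n) (\<lambda>x. indicator \<Omega> x * f x) x - indicator \<Omega> x * f x\<bar>)
       + (LINT x|lborel. \<bar>avg (I n) (C n) (\<lambda>x. indicator \<Omega> x * g x) x - indicator \<Omega> x * g x\<bar>)) \<longlonglongrightarrow> 0 + 0"
      using add by (intro tendsto_add) auto
    then have l: "(\<lambda>n. (LINT x|lborel. \<bar>avg (I n) (C n) (\<lambda>x. indicator \<Omega> x * f x) x - indicator \<Omega> x * f x\<bar>)
       + (LINT x|lborel. \<bar>avg (I n) (C n) (\<lambda>x. indicator \<Omega> x * g x) x - indicator \<Omega> x * g x\<bar>)) \<longlonglongrightarrow> 0" by simp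
    show ?case
    proof (rule tendsto_sandwich[OF _ _ tendsto_const l], goal_cases)
      case 2
      show ?case
      proof (intro always_eventually allI)
        fix n
        have "(LINT x|lborel. \<bar>avg (I n) (C n) (\<lambda>x. indicator \<Omega> x * (f x + g x)) x - indicator \<Omega> x * (f x + g x)\<bar>)
          \<le> (LINT x|lborel. \<bar>avg (I n) (C n) (\<lambda>x. indicator \<Omega> x * f x) x - indicator \<Omega> x * f x\<bar>
              + \<bar>avg (I n) (C n) (\<lambda>x. indicator \<Omega> x * g x) x - indicator \<Omega> x * g x\<bar>)"
          unfolding eq avg_diff[OF C if1 ig1] neg
          using if1 ig1 avg_integrable[OF C] iO add(1,2) by (intro integral_mono) auto
        also have "\<dots> = (LINT x|lborel. \<bar>avg (I n) (C n) (\<lambda>x. indicator \<Omega> x * f x) x - indicator \<Omega> x * f x\<bar>)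
           + (LINT x|lborel. \<bar>avg (I n) (C n) (\<lambda>x. indicator \<Omega> x * g x) x - indicator \<Omega> x * g x\<bar>)"
          using avg_integrable[OF C] iO add(1,2) by (intro Bochner_Integration.integral_add) auto
        finally show "(LINT x|lborel. \<bar>avg (I n) (C n) (\<lambda>x. indicator \<Omega> x * (f x + g x)) x - indicator \<Omega> x * (f x + g x)\<bar>) \<le> \<dots>" .
      qed
    qed auto
  next
    case (lim f s)
    show ?case
    proof (rule avg_tendsto_L1_approx[OF C iO[OF lim(4)]])
      fix e :: real assume e: "0 < e"
      have "(\<lambda>i. LINT x|lborel. \<bar>f x - s i x\<bar>) \<longlonglongrightarrow> (LINT x::'a|lborel. (0::real))"
      proof (rule integral_dominated_convergence[where w = "\<lambda>x. 3 * \<bar>f x\<bar>"])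
        show "AE x in lborel. (\<lambda>i. \<bar>f x - s i x\<bar>) \<longlonglongrightarrow> 0"
        proof (rule AE_I2)
          fix x :: 'a assume "x \<in> space lborel"
          then have "(\<lambda>i. \<bar>f x - s i x\<bar>) \<longlonglongrightarrow> \<bar>f x - f x\<bar>" by (intro tendsto_intros lim(2)) auto
          then show "(\<lambda>i. \<bar>f x - s i x\<bar>) \<longlonglongrightarrow> 0" by simp
        qed
        show "AE x in lborel. norm \<bar>f x - s i x\<bar> \<le> 3 * \<bar>f x\<bar>" for i
          using lim(3)[of _ i] by (intro AE_I2) (smt (verit) real_norm_def)
      qed (use lim(1,4) in auto)
      then have "(\<lambda>i. LINT x|lborel. \<bar>f x - s i x\<bar>) \<longlonglongrightarrow> 0" by simp
      from LIMSEQ_D[OF this e] obtain i where i: "\<bar>LINT x|lborel. \<bar>f x - s i x\<bar>\<bar> < e" by auto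
      have "(LINT x|lborel. \<bar>indicator \<Omega> x * f x - indicator \<Omega> x * s i x\<bar>) \<le> (LINT x|lborel. \<bar>f x - s i x\<bar>)"
        using lim(1,4) by (intro integral_mono integrable_abs Bochner_Integration.integrable_diff iO) (auto simp: indicator_def)
      then show "\<exists>g. integrable lborel g \<and> (LINT x|lborel. \<bar>indicator \<Omega> x * f x - g x\<bar>) < e \<and> ?P g"
        using i lim(1)[of i] lim(5)[of i] iO by (intro exI[of _ "\<lambda>x. indicator \<Omega> x * s i x"]) auto
    qed
  qed
  moreover have "indicator \<Omega> x * f x = f x" for x using f0 by (auto simp: indicator_def)
  ultimately show ?thesis by simp
qed

subsection \<open>The mesh of a graph\<close>

text \<open>For u \<ge> 1 this is the interval where the ceiling of x / p equals u, the part of the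
  line belonging to vertex u. Intersecting with the positive half-line makes cell 0 empty, so that
  index ranges may start at 0.\<close>

definition vcell :: "real \<Rightarrow> nat \<Rightarrow> real set" where
  "vcell p u = {real u * p - p<..real u * p} \<inter> {0<..}"

text \<open>Elementary integrands of order two must vanish on diagonal cells, so only off-diagonal
  rectangles are averaged over. Nothing is lost in the limit: a point (x, y) with x \<noteq> y lies
  in no diagonal cell once the mesh is finer than |x - y|.\<close>

definition offdiag :: "nat \<Rightarrow> (nat \<times> nat) set" where
  "offdiag N = {(u, v). u \<in> {1..N} \<and> v \<in> {1..N} \<and> u \<noteq> v}"

definition vcell2 :: "real \<Rightarrow> nat \<times> nat \<Rightarrow> (real \<times> real) set" where
  "vcell2 p = (\<lambda>(u, v). vcell p u \<times> vcell p v)"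

lemma finite_offdiag [simp]: "finite (offdiag N)"
  by (rule finite_subset[of _ "{1..N} \<times> {1..N}"]) (auto simp: offdiag_def)

lemma vcell_0 [simp]: "0 < p \<Longrightarrow> vcell p 0 = {}"
  by (auto simp: vcell_def)

lemma vcell_Suc: "0 < p \<Longrightarrow> 1 \<le> u \<Longrightarrow> vcell p u = {real u * p - p<..real u * p}"
proof -
  assume *: "0 < p" "1 \<le> u"
  have "1 * p \<le> real u * p" using * by (intro mult_right_mono) auto
  then have "0 < x" if "real u * p - p < x" for x using that by linarith
  then show ?thesis by (auto simp: vcell_def)
qed

text \<open>The condition 0 < x separates the empty cell 0 from the nonpositive arguments, which
  \<open>nat\<close> also sends to 0.\<close>

lemma vcell_iff:
  assumes "0 < p"
  shows "x \<in> vcell p u \<longleftrightarrow> 0 < x \<and> nat \<lceil>x / p\<rceil> = u"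
proof (cases "0 < x")
  case True
  then have "0 < x / p" using assms by simp
  then have "0 < \<lceil>x / p\<rceil>" by simp
  then have "nat \<lceil>x / p\<rceil> = u \<longleftrightarrow> \<lceil>x / p\<rceil> = int u" by auto
  also have "\<dots> \<longleftrightarrow> real u - 1 < x / p \<and> x / p \<le> real u" by (simp add: ceiling_eq_iff)
  also have "\<dots> \<longleftrightarrow> real u * p - p < x \<and> x \<le> real u * p"
    unfolding pos_less_divide_eq[OF assms] pos_divide_le_eq[OF assms] by (simp add: left_diff_distrib)
  finally show ?thesis using True by (auto simp: vcell_def)
qed (auto simp: vcell_def)

lemma vcell_borel [measurable, simp]: "vcell p u \<in> sets borel"
  by (simp add: vcell_def)

lemma vcell_nonneg: "vcell p u \<subseteq> {0..}"
  by (auto simp: vcell_def)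

lemma measure_vcell: "0 < p \<Longrightarrow> 1 \<le> u \<Longrightarrow> measure lborel (vcell p u) = p"
  by (simp add: vcell_Suc)

lemma emeasure_vcell: "0 < p \<Longrightarrow> emeasure lborel (vcell p u) = ennreal (if u = 0 then 0 else p)"
  by (cases "u = 0") (simp_all add: vcell_Suc)

lemma disjoint_vcell: "0 < p \<Longrightarrow> disjoint_family_on (vcell p) X"
  by (auto simp: disjoint_family_on_def vcell_iff)

lemma UN_vcell: "0 < p \<Longrightarrow> (\<Union>u\<in>{1..N}. vcell p u) = {0<..real N * p}"
proof (intro set_eqI iffI)
  fix x assume p: "0 < p" and "x \<in> (\<Union>u\<in>{1..N}. vcell p u)"
  then obtain u where u: "u \<in> {1..N}" "x \<in> vcell p u" by auto
  then have "real u * p \<le> real N * p" using p by (intro mult_right_mono) auto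
  moreover have "0 < x" "x \<le> real u * p" using u by (auto simp: vcell_def)
  ultimately have "0 < x \<and> x \<le> real N * p" by linarith
  then show "x \<in> {0<..real N * p}" by simp
next
  fix x assume p: "0 < p" and x: "x \<in> {0<..real N * p}"
  then have "x / p \<le> real N" "0 < x / p" by (auto simp: field_simps)
  define k where "k = \<lceil>x / p\<rceil>"
  have "k \<le> int N" "0 < k" using \<open>x / p \<le> real N\<close> \<open>0 < x / p\<close> by (simp_all add: k_def ceiling_le_iff)
  then have "nat k \<in> {1..N}" by auto
  then have "nat \<lceil>x / p\<rceil> \<in> {1..N}" by (simp add: k_def)
  then show "x \<in> (\<Union>u\<in>{1..N}. vcell p u)" using x p by (auto simp: vcell_iff)
qed

lemma vcell_ball: "0 < p \<Longrightarrow> x \<in> vcell p u \<Longrightarrow> y \<in> vcell p u \<Longrightarrow> \<bar>x - y\<bar> < p"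
  by (auto simp: vcell_def)

lemma cells_vcell: "0 < p \<Longrightarrow> cells {1..N} (vcell p)"
  by (auto simp: cells_def measure_vcell disjoint_vcell)

lemma measure_vcell2:
  assumes "0 < p" "i \<in> offdiag N"
  shows "measure lborel (vcell2 p i) = p\<^sup>2" "emeasure lborel (vcell2 p i) = ennreal (p\<^sup>2)"
proof -
  obtain u v where i: "i = (u, v)" "1 \<le> u" "1 \<le> v" using assms by (auto simp: offdiag_def)
  have "emeasure (lborel :: (real \<times> real) measure) (vcell p u \<times> vcell p v) = emeasure lborel (vcell p u) * emeasure lborel (vcell p v)"
    unfolding lborel_prod[symmetric] by (rule lborel.emeasure_pair_measure_Times) auto
  then show "emeasure lborel (vcell2 p i) = ennreal (p\<^sup>2)"
    using i assms by (simp add: vcell2_def emeasure_vcell ennreal_mult[symmetric] power2_eq_square)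
  then show "measure lborel (vcell2 p i) = p\<^sup>2" by (simp add: measure_def)
qed

lemma vcell2_borel [measurable, simp]: "vcell2 p i \<in> sets borel"
proof -
  show ?thesis by (simp add: vcell2_def case_prod_unfold borel_Times)
qed

lemma cells_vcell2: "0 < p \<Longrightarrow> cells (offdiag N) (vcell2 p)"
  unfolding cells_def
proof (intro conjI ballI)
  assume p: "0 < p"
  show "disjoint_family_on (vcell2 p) (offdiag N)"
    unfolding disjoint_family_on_def
  proof (intro ballI impI)
    fix m n :: "nat \<times> nat" assume "m \<noteq> n"
    then show "vcell2 p m \<inter> vcell2 p n = {}"
      by (cases m, cases n) (auto simp: vcell2_def vcell_iff[OF p])
  qed
  fix i assume "i \<in> offdiag N"
  then show "0 < measure lborel (vcell2 p i)" using measure_vcell2(1)[OF p] p by simp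
qed auto

lemma avg_vcell_tendsto:
  assumes p: "\<And>n. 0 < p n" "p \<longlonglongrightarrow> 0" and N: "filterlim (\<lambda>n. real (N n) * p n) at_top sequentially"
    and f: "integrable lborel f" "\<And>x. x < 0 \<Longrightarrow> f x = 0"
  shows "(\<lambda>n. LINT x|lborel. \<bar>avg {1..N n} (vcell (p n)) f x - f x\<bar>) \<longlonglongrightarrow> 0"
proof (rule avg_tendsto_L1[where \<Omega> = "{0..}"])
  show "AE x in lborel. x \<in> {0..} \<longrightarrow> (\<forall>e>0. \<forall>\<^sub>F n in sequentially. \<exists>i\<in>{1..N n}. x \<in> vcell (p n) i \<and> vcell (p n) i \<subseteq> ball x e)"
    using AE_lborel_singleton[of 0]
  proof eventually_elim
    case (elim x)
    show ?case
    proof (intro impI allI)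
      fix e :: real assume x: "x \<in> {0..}" and e: "0 < e"
      have "\<forall>\<^sub>F n in sequentially. x \<le> real (N n) * p n" using N by (simp add: filterlim_at_top)
      moreover have "\<forall>\<^sub>F n in sequentially. p n < e" using p(2) e by (rule order_tendstoD(2))
      ultimately show "\<forall>\<^sub>F n in sequentially. \<exists>i\<in>{1..N n}. x \<in> vcell (p n) i \<and> vcell (p n) i \<subseteq> ball x e"
      proof eventually_elim
        case (elim n)
        then have "x \<in> (\<Union>u\<in>{1..N n}. vcell (p n) u)" using UN_vcell[OF p(1)] x \<open>x \<noteq> 0\<close> by auto
        then obtain u where u: "u \<in> {1..N n}" "x \<in> vcell (p n) u" by blast
        have "vcell (p n) u \<subseteq> ball x e"
          using vcell_ball[OF p(1) u(2)] elim by (force simp: dist_real_def)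
        then show ?case using u by auto
      qed
    qed
  qed
qed (use assms cells_vcell vcell_nonneg in auto)

lemma AE_lborel_offdiag: "AE z in (lborel :: (real \<times> real) measure). fst z \<noteq> 0 \<and> snd z \<noteq> 0 \<and> fst z \<noteq> snd z"
proof -
  have "AE z in lborel \<Otimes>\<^sub>M (lborel :: real measure). fst z \<noteq> (0::real) \<and> snd z \<noteq> 0 \<and> fst z \<noteq> snd z"
  proof (rule lborel_pair.AE_pair_measure)
    show "AE x in lborel. AE y in lborel. fst (x, y) \<noteq> 0 \<and> snd (x, y) \<noteq> 0 \<and> fst (x, y) \<noteq> (snd (x, y) :: real)"
      using AE_lborel_singleton[of 0]
    proof eventually_elim
      case (elim x)
      show ?case using AE_lborel_singleton[of 0] AE_lborel_singleton[of x] by eventually_elim (use elim in auto)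
    qed
  qed measurable
  then show ?thesis unfolding lborel_prod .
qed

lemma avg_vcell2_tendsto:
  assumes p: "\<And>n. 0 < p n" "p \<longlonglongrightarrow> 0" and N: "filterlim (\<lambda>n. real (N n) * p n) at_top sequentially"
    and f: "integrable lborel f" "\<And>z. z \<notin> {0..} \<times> {0..} \<Longrightarrow> f z = 0"
  shows "(\<lambda>n. LINT z|lborel. \<bar>avg (offdiag (N n)) (vcell2 (p n)) f z - f z\<bar>) \<longlonglongrightarrow> 0"
proof (rule avg_tendsto_L1[where \<Omega> = "{0..} \<times> {0..}"])
  show "AE z in lborel. z \<in> {0..} \<times> {0..} \<longrightarrow>
     (\<forall>e>0. \<forall>\<^sub>F n in sequentially. \<exists>i\<in>offdiag (N n). z \<in> vcell2 (p n) i \<and> vcell2 (p n) i \<subseteq> ball z e)"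
    using AE_lborel_offdiag
  proof eventually_elim
    case (elim z)
    obtain x y where z: "z = (x, y)" by force
    show ?case
    proof (intro impI allI)
      fix e :: real assume "z \<in> {0..} \<times> {0..}" and e: "0 < e"
      then have xy: "0 < x" "0 < y" "x \<noteq> y" using elim z by auto
      have "\<forall>\<^sub>F n in sequentially. x \<le> real (N n) * p n" using N by (simp add: filterlim_at_top)
      moreover have "\<forall>\<^sub>F n in sequentially. y \<le> real (N n) * p n" using N by (simp add: filterlim_at_top)
      moreover have "\<forall>\<^sub>F n in sequentially. p n < e / 2" using p(2) e by (intro order_tendstoD(2)) auto
      moreover have "\<forall>\<^sub>F n in sequentially. p n < \<bar>x - y\<bar>" using p(2) xy by (intro order_tendstoD(2)) auto
      ultimately show "\<forall>\<^sub>F n in sequentially. \<exists>i\<in>offdiag (N n). z \<in> vcell2 (p n) i \<and> vcell2 (p n) i \<subseteq> ball z e"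
      proof eventually_elim
        case (elim n)
        have "x \<in> (\<Union>u\<in>{1..N n}. vcell (p n) u)" "y \<in> (\<Union>u\<in>{1..N n}. vcell (p n) u)"
          unfolding UN_vcell[OF p(1)] using xy elim by auto
        then obtain u v where uv: "u \<in> {1..N n}" "x \<in> vcell (p n) u" "v \<in> {1..N n}" "y \<in> vcell (p n) v" by blast
        have "u \<noteq> v" using vcell_ball[OF p(1), of x n u y] uv elim by auto
        moreover have "vcell2 (p n) (u, v) \<subseteq> ball z e"
        proof
          fix w assume "w \<in> vcell2 (p n) (u, v)"
          then obtain a b where w: "w = (a, b)" "a \<in> vcell (p n) u" "b \<in> vcell (p n) v" by (auto simp: vcell2_def)
          have "dist z w \<le> \<bar>x - a\<bar> + \<bar>y - b\<bar>"
            unfolding z w dist_Pair_Pair dist_real_def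
            using sqrt_sum_squares_le_sum_abs[of "x - a" "y - b"] by simp
          also have "\<dots> < e" using vcell_ball[OF p(1) uv(2) w(2)] vcell_ball[OF p(1) uv(4) w(3)] elim by linarith
          finally show "w \<in> ball z e" by simp
        qed
        ultimately show ?case using uv z by (intro bexI[of _ "(u, v)"]) (auto simp: offdiag_def vcell2_def)
      qed
    qed
  qed
  show "{0..} \<times> {0..} \<in> sets (lborel :: (real \<times> real) measure)"
    by (simp add: closed_Times borel_closed)
  show "vcell2 (p n) i \<subseteq> {0..} \<times> {0..}" for n i
    using vcell_nonneg by (auto simp: vcell2_def)
qed (use assms cells_vcell2 in auto)

section \<open>Moments of the Poisson process\<close>

lemma nn_integral_pois:
  assumes "0 \<le> \<mu>"
  shows "(\<integral>\<^sup>+k. of_nat k \<partial>measure_pmf (pois \<mu>)) = ennreal \<mu>"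
proof (cases "\<mu> = 0")
  case False
  then have \<mu>: "0 < \<mu>" using assms by simp
  have "(\<lambda>k. \<mu> * (\<mu> ^ k /\<^sub>R fact k * exp (- \<mu>))) sums (\<mu> * (exp \<mu> * exp (- \<mu>)))"
    by (intro sums_mult sums_mult2 exp_converges)
  moreover have "\<mu> ^ Suc k / fact (Suc k) * exp (- \<mu>) * real (Suc k) = \<mu> * (\<mu> ^ k /\<^sub>R fact k * exp (- \<mu>))" for k
    by (simp add: fact_Suc scaleR_conv_of_real field_simps del: of_nat_Suc)
  ultimately have "(\<lambda>k. \<mu> ^ Suc k / fact (Suc k) * exp (- \<mu>) * real (Suc k)) sums \<mu>"
    by (simp only: exp_minus) simp
  then have s: "(\<lambda>k. \<mu> ^ k / fact k * exp (- \<mu>) * real k) sums \<mu>"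
    by (subst (asm) sums_Suc_iff) simp
  have "(\<integral>\<^sup>+k. of_nat k \<partial>measure_pmf (pois \<mu>)) = (\<integral>\<^sup>+k. ennreal (\<mu> ^ k / fact k * exp (- \<mu>) * real k) \<partial>count_space UNIV)"
    using \<mu> by (simp add: pois_def nn_integral_measure_pmf ennreal_of_nat_eq_real_of_nat ennreal_mult[symmetric])
  also have "\<dots> = ennreal \<mu>"
    unfolding nn_integral_count_space_nat using s \<mu> by (intro suminf_ennreal_eq) auto
  finally show ?thesis .
qed (simp add: pois_def)

locale poisson_proc = prob_space P for P :: "'w measure" +
  fixes S :: "'w \<Rightarrow> real set"
  assumes proc: "poisson_process P S"
begin

abbreviation N :: "real set \<Rightarrow> 'w \<Rightarrow> nat" where "N \<equiv> num_points S"

lemma N_measurable: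
  "A \<in> sets borel \<Longrightarrow> A \<subseteq> {0..} \<Longrightarrow> emeasure lborel A < \<infinity> \<Longrightarrow> N A \<in> measurable P (count_space UNIV)"
  using proc unfolding poisson_process_def by blast

lemma N_distr:
  "A \<in> sets borel \<Longrightarrow> A \<subseteq> {0..} \<Longrightarrow> emeasure lborel A < \<infinity> \<Longrightarrow>
    distr P (count_space UNIV) (N A) = measure_pmf (pois (measure lborel A))"
  using proc unfolding poisson_process_def by blast

lemma finite_points: "\<omega> \<in> space P \<Longrightarrow> finite (S \<omega> \<inter> {0..t})" and points_nonneg: "\<omega> \<in> space P \<Longrightarrow> S \<omega> \<subseteq> {0..}"
  using proc unfolding poisson_process_def by blast+

lemma N_indep:
  fixes m :: nat
  assumes "\<And>i. i < m \<Longrightarrow> A i \<in> sets borel \<and> A i \<subseteq> {0..} \<and> emeasure lborel (A i) < \<infinity>"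
    "disjoint_family_on A {..<m}"
  shows "indep_vars (\<lambda>_. count_space UNIV) (\<lambda>i. N (A i)) {..<m}"
proof -
  have "\<forall>(m::nat) A. (\<forall>i<m. A i \<in> sets borel \<and> A i \<subseteq> {0..} \<and> emeasure lborel (A i) < \<infinity>) \<longrightarrow>
        disjoint_family_on A {..<m} \<longrightarrow> indep_vars (\<lambda>_. count_space UNIV) (\<lambda>i. N (A i)) {..<m}"
    using proc unfolding poisson_process_def by (elim conjE)
  from this[THEN spec[of _ m], THEN spec[of _ A], THEN mp, THEN mp] show ?thesis
    using assms by simp
qed

lemma nn_integral_N:
  assumes "A \<in> sets borel" "A \<subseteq> {0..}" "emeasure lborel A < \<infinity>"
  shows "(\<integral>\<^sup>+\<omega>. of_nat (N A \<omega>) \<partial>P) = emeasure lborel A"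
proof -
  have "(\<integral>\<^sup>+\<omega>. of_nat (N A \<omega>) \<partial>P) = (\<integral>\<^sup>+k. of_nat k \<partial>distr P (count_space UNIV) (N A))"
    using N_measurable[OF assms] by (subst nn_integral_distr) auto
  also have "\<dots> = ennreal (measure lborel A)" unfolding N_distr[OF assms] by (rule nn_integral_pois) simp
  also have "\<dots> = emeasure lborel A" using assms(3) by (simp add: emeasure_eq_ennreal_measure)
  finally show ?thesis .
qed

lemma nn_integral_N_mult:
  assumes A: "A \<in> sets borel" "A \<subseteq> {0..}" "emeasure lborel A < \<infinity>"
    and B: "B \<in> sets borel" "B \<subseteq> {0..}" "emeasure lborel B < \<infinity>" and disj: "A \<inter> B = {}"
  shows "(\<integral>\<^sup>+\<omega>. of_nat (N A \<omega>) * of_nat (N B \<omega>) \<partial>P) = emeasure lborel A * emeasure lborel B"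
proof -
  define F where "F = (\<lambda>i::nat. if i = 0 then A else B)"
  have "indep_vars (\<lambda>_. count_space UNIV) (\<lambda>i. N (F i)) {..<2}"
    using A B disj by (intro N_indep) (auto simp: F_def disjoint_family_on_def)
  then have iv: "indep_vars (\<lambda>_. borel) (\<lambda>i \<omega>. of_nat (N (F i) \<omega>) :: ennreal) {..<2}"
    by (rule indep_vars_compose2) simp
  have s: "{..<2::nat} = {0, 1}" by auto
  show ?thesis
    using indep_vars_nn_integral[OF _ iv] nn_integral_N[OF A] nn_integral_N[OF B] by (simp add: F_def s)
qed

text \<open>The count of an infinite set is 0, so additivity of counts needs finiteness first, and A
  may be unbounded. The counts in A cut off at k increase with k, and their means stay below the
  measure of A. By monotone convergence their supremum is almost surely finite, whereas infinitely
  many points in A would make it infinite.\<close>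

lemma AE_finite:
  assumes A: "A \<in> sets borel" "A \<subseteq> {0..}" "emeasure lborel A < \<infinity>"
  shows "AE \<omega> in P. finite (S \<omega> \<inter> A)"
proof -
  define Ak where "Ak = (\<lambda>k::nat. A \<inter> {0..real k})"
  have Ak: "Ak k \<in> sets borel" "Ak k \<subseteq> {0..}" "emeasure lborel (Ak k) \<le> emeasure lborel A" for k
    using A by (auto simp: Ak_def intro!: emeasure_mono)
  then have Akf: "emeasure lborel (Ak k) < \<infinity>" for k using A(3) order_le_less_trans by blast
  have inc: "incseq (\<lambda>k \<omega>. if \<omega> \<in> space P then of_nat (N (Ak k) \<omega>) else 0 :: ennreal)"
    unfolding incseq_def le_fun_def
  proof (intro allI impI)
    fix m n :: nat and \<omega> assume mn: "m \<le> n"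
    have "card (S \<omega> \<inter> Ak m) \<le> card (S \<omega> \<inter> Ak n)" if "\<omega> \<in> space P"
    proof (rule card_mono)
      show "finite (S \<omega> \<inter> Ak n)" using finite_points[OF that, of "real n"] by (rule rev_finite_subset) (auto simp: Ak_def)
      show "S \<omega> \<inter> Ak m \<subseteq> S \<omega> \<inter> Ak n" using mn by (auto simp: Ak_def)
    qed
    then show "(if \<omega> \<in> space P then of_nat (N (Ak m) \<omega>) else 0 :: ennreal) \<le> (if \<omega> \<in> space P then of_nat (N (Ak n) \<omega>) else 0)"
      by (auto simp: num_points_def)
  qed
  have m: "(\<lambda>\<omega>. if \<omega> \<in> space P then of_nat (N (Ak k) \<omega>) else 0 :: ennreal) \<in> borel_measurable P" for k
  proof -
    have "(\<lambda>\<omega>. of_nat (N (Ak k) \<omega>) :: ennreal) \<in> borel_measurable P"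
      using N_measurable[OF Ak(1,2) Akf] by measurable
    then show ?thesis by (subst measurable_cong) auto
  qed
  have "(\<integral>\<^sup>+\<omega>. (SUP k. (if \<omega> \<in> space P then of_nat (N (Ak k) \<omega>) else 0 :: ennreal)) \<partial>P)
     = (SUP k. \<integral>\<^sup>+\<omega>. (if \<omega> \<in> space P then of_nat (N (Ak k) \<omega>) else 0 :: ennreal) \<partial>P)"
    by (rule nn_integral_monotone_convergence_SUP[OF inc m])
  also have "\<dots> = (SUP k. emeasure lborel (Ak k))"
    using nn_integral_N[OF Ak(1,2) Akf] by (intro SUP_cong refl) (simp cong: nn_integral_cong)
  also have "\<dots> \<le> emeasure lborel A" using Ak(3) by (intro SUP_least) auto
  also have "\<dots> < \<infinity>" by fact
  finally have "AE \<omega> in P. (SUP k. (if \<omega> \<in> space P then of_nat (N (Ak k) \<omega>) else 0 :: ennreal)) \<noteq> \<infinity>"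
    using m by (intro nn_integral_PInf_AE borel_measurable_SUP) auto
  then show ?thesis
  proof (rule AE_mp, intro AE_I2 impI)
    fix \<omega> assume \<omega>: "\<omega> \<in> space P" and "(SUP k. (if \<omega> \<in> space P then of_nat (N (Ak k) \<omega>) else 0 :: ennreal)) \<noteq> \<infinity>"
    then have ne: "(SUP k. of_nat (N (Ak k) \<omega>) :: ennreal) \<noteq> \<infinity>" by simp
    show "finite (S \<omega> \<inter> A)"
    proof (rule ccontr)
      assume inf: "infinite (S \<omega> \<inter> A)"
      have "(of_nat j :: ennreal) \<le> (SUP k. of_nat (N (Ak k) \<omega>))" for j
      proof -
        obtain T where T: "T \<subseteq> S \<omega> \<inter> A" "finite T" "card T = j" using infinite_arbitrarily_large[OF inf] by metis
        obtain k :: nat where k: "Max (insert 0 T) \<le> real k" using real_arch_simple by blast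
        have "x \<le> real k" if "x \<in> T" for x
          using k that T(2) by (meson Max_ge finite_insert insertCI order_trans)
        then have "T \<subseteq> S \<omega> \<inter> Ak k" using T A(2) by (auto simp: Ak_def)
        moreover have "finite (S \<omega> \<inter> Ak k)"
          using finite_points[OF \<omega>, of "real k"] by (rule rev_finite_subset) (auto simp: Ak_def)
        ultimately have "j \<le> N (Ak k) \<omega>" unfolding num_points_def using T(3) card_mono by blast
        then show ?thesis by (intro SUP_upper2[of k]) auto
      qed
      moreover have "(SUP k. of_nat (N (Ak k) \<omega>) :: ennreal) < top"
        using ne unfolding infinity_ennreal_def by (rule top.not_eq_extremum[THEN iffD1])
      then obtain j where "(SUP k. of_nat (N (Ak k) \<omega>) :: ennreal) < of_nat j"
        by (rule exE[OF ennreal_Ex_less_of_nat])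
      ultimately show False using leD by blast
    qed
  qed
qed

lemma AE_N_null:
  assumes "A \<in> sets borel" "A \<subseteq> {0..}" "emeasure lborel A = 0"
  shows "AE \<omega> in P. N A \<omega> = 0"
proof -
  have "(\<integral>\<^sup>+\<omega>. of_nat (N A \<omega>) \<partial>P) = 0" using nn_integral_N[of A] assms by simp
  then have "AE \<omega> in P. (of_nat (N A \<omega>) :: ennreal) = 0"
    using N_measurable[of A] assms by (subst (asm) nn_integral_0_iff_AE) auto
  then show ?thesis by simp
qed

end

subsection \<open>Common refinements\<close>

text \<open>The set function is a parameter, so that one piece of algebra on refinements serves both
  the elementary functions (\<nu> an indicator at a point) and their integrals (\<nu> the number of
  points).\<close>

definition lin1 :: "'i set \<Rightarrow> ('i \<Rightarrow> real set) \<Rightarrow> ('i \<Rightarrow> real) \<Rightarrow> (real set \<Rightarrow> real) \<Rightarrow> real" where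
  "lin1 I A a \<nu> = (\<Sum>i\<in>I. a i * \<nu> (A i))"

definition lin2 :: "'i set \<Rightarrow> ('i \<Rightarrow> real set) \<Rightarrow> ('i \<Rightarrow> 'i \<Rightarrow> real) \<Rightarrow> (real set \<Rightarrow> real) \<Rightarrow> (real set \<Rightarrow> real) \<Rightarrow> real" where
  "lin2 I A a \<nu> \<nu>' = (\<Sum>i\<in>I. \<Sum>j\<in>I. a i j * \<nu> (A i) * \<nu>' (A j))"

text \<open>\<open>None\<close> stands for the rest of the half-line, so that finite partitions of
  different regions have a common refinement.\<close>

definition ext_cell :: "'i set \<Rightarrow> ('i \<Rightarrow> real set) \<Rightarrow> 'i option \<Rightarrow> real set" where
  "ext_cell I A i = (case i of None \<Rightarrow> {0..} - (\<Union>i\<in>I. A i) | Some i \<Rightarrow> A i)"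

definition opts :: "'i set \<Rightarrow> 'i option set" where
  "opts I = insert None (Some ` I)"

text \<open>The cell outside both partitions is left out: it may have infinite measure, and both
  coefficients vanish there.\<close>

definition ref_index :: "'i set \<Rightarrow> 'j set \<Rightarrow> ('i option \<times> 'j option) set" where
  "ref_index I J = opts I \<times> opts J - {(None, None)}"

definition ref_cell :: "'i set \<Rightarrow> ('i \<Rightarrow> real set) \<Rightarrow> 'j set \<Rightarrow> ('j \<Rightarrow> real set) \<Rightarrow> 'i option \<times> 'j option \<Rightarrow> real set" where
  "ref_cell I A J B k = ext_cell I A (fst k) \<inter> ext_cell J B (snd k)"

definition zero_ext :: "('i \<Rightarrow> real) \<Rightarrow> 'i option \<Rightarrow> real" where
  "zero_ext a i = (case i of None \<Rightarrow> 0 | Some i \<Rightarrow> a i)"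

definition fin_part :: "'i set \<Rightarrow> ('i \<Rightarrow> real set) \<Rightarrow> bool" where
  "fin_part I A \<longleftrightarrow> finite I \<and> disjoint_family_on A I
     \<and> (\<forall>i\<in>I. A i \<in> sets borel \<and> A i \<subseteq> {0..} \<and> emeasure lborel (A i) < \<infinity>)"

lemma finite_opts [simp]: "finite I \<Longrightarrow> finite (opts I)"
  by (simp add: opts_def)

lemma disjoint_ext_cell:
  "disjoint_family_on A I \<Longrightarrow> disjoint_family_on (ext_cell I A) (opts I)"
  unfolding disjoint_family_on_def
proof (intro ballI impI)
  fix x y assume *: "\<forall>m\<in>I. \<forall>n\<in>I. m \<noteq> n \<longrightarrow> A m \<inter> A n = {}"
    and "x \<in> opts I" "y \<in> opts I" "x \<noteq> y"
  then show "ext_cell I A x \<inter> ext_cell I A y = {}"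
    by (cases x; cases y) (auto simp: ext_cell_def opts_def)
qed

lemma disjoint_family_on_shrink:
  "disjoint_family_on g T \<Longrightarrow> (\<And>j. j \<in> T \<Longrightarrow> f j \<subseteq> g j) \<Longrightarrow> disjoint_family_on f T"
  unfolding disjoint_family_on_def by blast

lemma UN_ext_cell: "(\<And>i. i \<in> I \<Longrightarrow> A i \<subseteq> {0..}) \<Longrightarrow> (\<Union>i\<in>opts I. ext_cell I A i) = {0..}"
  by (auto simp: opts_def ext_cell_def)

lemma ext_cell_borel:
  assumes "fin_part I A" "i \<in> opts I"
  shows "ext_cell I A i \<in> sets borel" "ext_cell I A i \<subseteq> {0..}"
proof -
  have "(\<Union>i\<in>I. A i) \<in> sets borel" using assms(1) by (auto simp: fin_part_def)
  then show "ext_cell I A i \<in> sets borel"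
    using assms by (auto simp: fin_part_def ext_cell_def opts_def)
  have "A j \<subseteq> {0..}" if "j \<in> I" for j using assms(1) that by (auto simp: fin_part_def)
  then show "ext_cell I A i \<subseteq> {0..}"
    using assms(2) by (cases i) (auto simp: ext_cell_def opts_def)
qed

lemma fin_part_ref:
  assumes A: "fin_part I A" and B: "fin_part J B"
  shows "fin_part (ref_index I J) (ref_cell I A J B)"
  unfolding fin_part_def
proof (intro conjI ballI)
  show "finite (ref_index I J)" using assms by (simp add: ref_index_def fin_part_def)
  have "disjoint_family_on (ext_cell I A) (opts I)" "disjoint_family_on (ext_cell J B) (opts J)"
    using assms disjoint_ext_cell by (auto simp: fin_part_def)
  then have dis: "\<And>x y. x \<in> opts I \<Longrightarrow> y \<in> opts I \<Longrightarrow> x \<noteq> y \<Longrightarrow> ext_cell I A x \<inter> ext_cell I A y = {}"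
    "\<And>x y. x \<in> opts J \<Longrightarrow> y \<in> opts J \<Longrightarrow> x \<noteq> y \<Longrightarrow> ext_cell J B x \<inter> ext_cell J B y = {}"
    by (auto simp: disjoint_family_on_def)
  show "disjoint_family_on (ref_cell I A J B) (ref_index I J)"
    unfolding disjoint_family_on_def
  proof (intro ballI impI)
    fix k l assume kl: "k \<in> ref_index I J" "l \<in> ref_index I J" "k \<noteq> l"
    then have m: "fst k \<in> opts I" "fst l \<in> opts I" "snd k \<in> opts J" "snd l \<in> opts J"
      by (auto simp: ref_index_def)
    have "fst k \<noteq> fst l \<or> snd k \<noteq> snd l" using kl(3) by (auto simp: prod_eq_iff)
    then show "ref_cell I A J B k \<inter> ref_cell I A J B l = {}"
      using dis(1)[OF m(1,2)] dis(2)[OF m(3,4)] unfolding ref_cell_def by blast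
  qed
  fix k assume k: "k \<in> ref_index I J"
  obtain i j where ij0: "k = (i, j)" by force
  then have ij: "k = (i, j)" "i \<in> opts I" "j \<in> opts J" "i \<noteq> None \<or> j \<noteq> None"
    using k by (auto simp: ref_index_def)
  note eb = ext_cell_borel[OF A ij(2)] ext_cell_borel[OF B ij(3)]
  show m: "ref_cell I A J B k \<in> sets borel" and "ref_cell I A J B k \<subseteq> {0..}"
    using eb unfolding ref_cell_def ij by auto
  show "emeasure lborel (ref_cell I A J B k) < \<infinity>"
  proof (cases i)
    case (Some i')
    then have i': "i' \<in> I" using ij by (auto simp: opts_def)
    have "emeasure lborel (ref_cell I A J B k) \<le> emeasure lborel (A i')"
      using A i' by (intro emeasure_mono) (auto simp: ref_cell_def ij Some ext_cell_def fin_part_def)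
    then show ?thesis using A i' by (auto simp: fin_part_def order_le_less_trans)
  next
    case None
    then obtain j' where j': "j = Some j'" "j' \<in> J" using ij by (auto simp: opts_def)
    have "emeasure lborel (ref_cell I A J B k) \<le> emeasure lborel (B j')"
      using B j' by (intro emeasure_mono) (auto simp: ref_cell_def ij ext_cell_def fin_part_def)
    then show ?thesis using B j' by (auto simp: fin_part_def order_le_less_trans)
  qed
qed

text \<open>Exactly the instances of additivity that a refinement uses; for counts, additivity can
  fail on sets with infinitely many points.\<close>

definition additive_on :: "(real set \<Rightarrow> real) \<Rightarrow> 'i set \<Rightarrow> ('i \<Rightarrow> real set) \<Rightarrow> 'j set \<Rightarrow> ('j \<Rightarrow> real set) \<Rightarrow> bool" where
  "additive_on \<nu> I A J B \<longleftrightarrow> (\<forall>i\<in>I. \<nu> (A i) = (\<Sum>j\<in>opts J. \<nu> (ref_cell I A J B (Some i, j))))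
     \<and> (\<forall>j\<in>J. \<nu> (B j) = (\<Sum>i\<in>opts I. \<nu> (ref_cell I A J B (i, Some j))))"

lemma sum_ref_fst:
  assumes "finite I" "finite J" "additive_on \<nu> I A J B" "g None = (0::real)"
  shows "(\<Sum>k\<in>ref_index I J. g (fst k) * \<nu> (ref_cell I A J B k)) = (\<Sum>i\<in>I. g (Some i) * \<nu> (A i))"
proof -
  have "(\<Sum>k\<in>ref_index I J. g (fst k) * \<nu> (ref_cell I A J B k)) = (\<Sum>k\<in>Some ` I \<times> opts J. g (fst k) * \<nu> (ref_cell I A J B k))"
    using assms by (intro sum.mono_neutral_right) (auto simp: ref_index_def opts_def)
  also have "\<dots> = (\<Sum>i\<in>Some ` I. \<Sum>j\<in>opts J. g i * \<nu> (ref_cell I A J B (i, j)))"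
    by (simp add: sum.cartesian_product case_prod_unfold)
  also have "\<dots> = (\<Sum>i\<in>I. \<Sum>j\<in>opts J. g (Some i) * \<nu> (ref_cell I A J B (Some i, j)))"
    by (simp add: sum.reindex)
  also have "\<dots> = (\<Sum>i\<in>I. g (Some i) * \<nu> (A i))"
    using assms(3) by (intro sum.cong refl) (simp add: additive_on_def sum_distrib_left)
  finally show ?thesis .
qed

lemma sum_ref_snd:
  assumes "finite I" "finite J" "additive_on \<nu> I A J B" "g None = (0::real)"
  shows "(\<Sum>k\<in>ref_index I J. g (snd k) * \<nu> (ref_cell I A J B k)) = (\<Sum>j\<in>J. g (Some j) * \<nu> (B j))"
proof -
  have "(\<Sum>k\<in>ref_index I J. g (snd k) * \<nu> (ref_cell I A J B k)) = (\<Sum>k\<in>opts I \<times> Some ` J. g (snd k) * \<nu> (ref_cell I A J B k))"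
    using assms by (intro sum.mono_neutral_right) (auto simp: ref_index_def opts_def)
  also have "\<dots> = (\<Sum>i\<in>opts I. \<Sum>j\<in>Some ` J. g j * \<nu> (ref_cell I A J B (i, j)))"
    by (simp add: sum.cartesian_product case_prod_unfold)
  also have "\<dots> = (\<Sum>j\<in>Some ` J. \<Sum>i\<in>opts I. g j * \<nu> (ref_cell I A J B (i, j)))"
    by (rule sum.swap)
  also have "\<dots> = (\<Sum>j\<in>J. \<Sum>i\<in>opts I. g (Some j) * \<nu> (ref_cell I A J B (i, Some j)))"
    by (simp add: sum.reindex)
  also have "\<dots> = (\<Sum>j\<in>J. g (Some j) * \<nu> (B j))"
    using assms(3) by (intro sum.cong refl) (simp add: additive_on_def sum_distrib_left)
  finally show ?thesis .
qed

text \<open>The difference of two elementary forms is a single form on the common refinement, so a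
  norm bound for one form becomes a contraction estimate. \<open>lin2_refine\<close> does the same,
  collapsing the two variables one after the other.\<close>

lemma lin1_refine:
  assumes "finite I" "finite J" "additive_on \<nu> I A J B"
  shows "lin1 I A a \<nu> - lin1 J B b \<nu>
     = lin1 (ref_index I J) (ref_cell I A J B) (\<lambda>k. zero_ext a (fst k) - zero_ext b (snd k)) \<nu>"
  unfolding lin1_def left_diff_distrib sum_subtractf
  using sum_ref_fst[OF assms, of "zero_ext a"] sum_ref_snd[OF assms, of "zero_ext b"]
  by (simp add: zero_ext_def)

lemma lin2_refine:
  assumes fin: "finite I" "finite J" and \<nu>: "additive_on \<nu> I A J B" and \<nu>': "additive_on \<nu>' I A J B"
  shows "lin2 I A a \<nu> \<nu>' - lin2 J B b \<nu> \<nu>'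
     = lin2 (ref_index I J) (ref_cell I A J B)
         (\<lambda>k l. zero_ext (\<lambda>i. zero_ext (a i) (fst l)) (fst k) - zero_ext (\<lambda>j. zero_ext (b j) (snd l)) (snd k)) \<nu> \<nu>'"
proof -
  let ?K = "ref_index I J" and ?C = "ref_cell I A J B"
  have 1: "(\<Sum>k\<in>?K. \<Sum>l\<in>?K. zero_ext (\<lambda>i. zero_ext (a i) (fst l)) (fst k) * \<nu> (?C k) * \<nu>' (?C l)) = lin2 I A a \<nu> \<nu>'"
  proof -
    have "(\<Sum>k\<in>?K. \<Sum>l\<in>?K. zero_ext (\<lambda>i. zero_ext (a i) (fst l)) (fst k) * \<nu> (?C k) * \<nu>' (?C l))
       = (\<Sum>k\<in>?K. (\<Sum>l\<in>?K. zero_ext (\<lambda>i. zero_ext (a i) (fst l)) (fst k) * \<nu>' (?C l)) * \<nu> (?C k))"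
      by (simp add: sum_distrib_left mult_ac)
    also have "\<dots> = (\<Sum>i\<in>I. (\<Sum>l\<in>?K. zero_ext (a i) (fst l) * \<nu>' (?C l)) * \<nu> (A i))"
      using sum_ref_fst[OF fin \<nu>, of "\<lambda>q. \<Sum>l\<in>?K. zero_ext (\<lambda>i. zero_ext (a i) (fst l)) q * \<nu>' (?C l)"]
      by (simp add: zero_ext_def)
    also have "\<dots> = (\<Sum>i\<in>I. (\<Sum>j\<in>I. a i j * \<nu>' (A j)) * \<nu> (A i))"
      using sum_ref_fst[OF fin \<nu>', of "zero_ext (a _)"] by (simp add: zero_ext_def)
    finally show ?thesis by (simp add: lin2_def sum_distrib_left mult_ac)
  qed
  have 2: "(\<Sum>k\<in>?K. \<Sum>l\<in>?K. zero_ext (\<lambda>i. zero_ext (b i) (snd l)) (snd k) * \<nu> (?C k) * \<nu>' (?C l)) = lin2 J B b \<nu> \<nu>'"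
  proof -
    have "(\<Sum>k\<in>?K. \<Sum>l\<in>?K. zero_ext (\<lambda>i. zero_ext (b i) (snd l)) (snd k) * \<nu> (?C k) * \<nu>' (?C l))
       = (\<Sum>k\<in>?K. (\<Sum>l\<in>?K. zero_ext (\<lambda>i. zero_ext (b i) (snd l)) (snd k) * \<nu>' (?C l)) * \<nu> (?C k))"
      by (simp add: sum_distrib_left mult_ac)
    also have "\<dots> = (\<Sum>i\<in>J. (\<Sum>l\<in>?K. zero_ext (b i) (snd l) * \<nu>' (?C l)) * \<nu> (B i))"
      using sum_ref_snd[OF fin \<nu>, of "\<lambda>q. \<Sum>l\<in>?K. zero_ext (\<lambda>i. zero_ext (b i) (snd l)) q * \<nu>' (?C l)"]
      by (simp add: zero_ext_def)
    also have "\<dots> = (\<Sum>i\<in>J. (\<Sum>j\<in>J. b i j * \<nu>' (B j)) * \<nu> (B i))"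
      using sum_ref_snd[OF fin \<nu>', of "zero_ext (b _)"] by (simp add: zero_ext_def)
    finally show ?thesis by (simp add: lin2_def sum_distrib_left mult_ac)
  qed
  show ?thesis
    unfolding 1[symmetric] 2[symmetric] by (simp add: lin2_def left_diff_distrib sum_subtractf)
qed

lemma ref_cell_Some_left:
  assumes "i \<in> I" "\<And>i. i \<in> I \<Longrightarrow> A i \<subseteq> {0..}" "\<And>j. j \<in> J \<Longrightarrow> B j \<subseteq> {0..}"
  shows "A i = (\<Union>j\<in>opts J. ref_cell I A J B (Some i, j))"
  using UN_ext_cell[of J B] assms(1,3) assms(2)[OF assms(1)] by (auto simp: ref_cell_def ext_cell_def[of I])

lemma ref_cell_Some_right:
  assumes "j \<in> J" "\<And>i. i \<in> I \<Longrightarrow> A i \<subseteq> {0..}" "\<And>j. j \<in> J \<Longrightarrow> B j \<subseteq> {0..}"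
  shows "B j = (\<Union>i\<in>opts I. ref_cell I A J B (i, Some j))"
  using UN_ext_cell[of I A] assms(1,2) assms(3)[OF assms(1)] by (auto simp: ref_cell_def ext_cell_def[of J])

text \<open>Additivity is asked only for unions that are cells of one of the partitions, because
  these contain finitely many points almost surely. The sums run over sets of cells, and members of
  a disjoint family can coincide only when empty; this is where \<open>\<nu> {} = 0\<close>
  enters.\<close>

lemma additive_onI:
  assumes A: "fin_part I A" and B: "fin_part J B"
    and \<nu>: "\<And>(X::real set set). finite X \<Longrightarrow> disjoint X \<Longrightarrow> (\<exists>i\<in>I. \<Union>X = A i) \<or> (\<exists>j\<in>J. \<Union>X = B j) \<Longrightarrow> \<nu> (\<Union>X) = (\<Sum>Y\<in>X. \<nu> Y)"
    and \<nu>0: "\<nu> {} = 0"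
  shows "additive_on \<nu> I A J B"
proof -
  have img: "(\<Sum>Y\<in>f ` T. \<nu> Y) = (\<Sum>t\<in>T. \<nu> (f t))" if "finite T" "disjoint_family_on f T" for f :: "'c \<Rightarrow> real set" and T
  proof (rule sum.reindex_nontrivial[unfolded o_def])
    fix x y assume "x \<in> T" "y \<in> T" "x \<noteq> y" "f x = f y"
    then have "f x = {}" using that(2) by (auto simp: disjoint_family_on_def)
    then show "\<nu> (f x) = 0" using \<nu>0 by simp
  qed (use that in auto)
  have dI: "disjoint_family_on (ext_cell I A) (opts I)" "disjoint_family_on (ext_cell J B) (opts J)"
    using assms disjoint_ext_cell by (auto simp: fin_part_def)
  have fin: "finite (opts I)" "finite (opts J)" using A B by (auto simp: fin_part_def)
  have sub: "\<And>i. i \<in> I \<Longrightarrow> A i \<subseteq> {0..}" "\<And>j. j \<in> J \<Longrightarrow> B j \<subseteq> {0..}" using A B by (auto simp: fin_part_def)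
  show ?thesis
    unfolding additive_on_def
  proof (intro conjI ballI)
    fix i assume i: "i \<in> I"
    have d: "disjoint_family_on (\<lambda>j. ref_cell I A J B (Some i, j)) (opts J)"
      by (rule disjoint_family_on_shrink[OF dI(2)]) (auto simp: ref_cell_def)
    have eq: "A i = (\<Union>j\<in>opts J. ref_cell I A J B (Some i, j))"
      by (rule ref_cell_Some_left) (use i sub in blast)+
    have "\<nu> (\<Union>j\<in>opts J. ref_cell I A J B (Some i, j)) = (\<Sum>Y\<in>(\<lambda>j. ref_cell I A J B (Some i, j)) ` opts J. \<nu> Y)"
    proof (rule \<nu>)
      show "disjoint ((\<lambda>j. ref_cell I A J B (Some i, j)) ` opts J)"
        by (rule disjoint_family_on_disjoint_image[OF d])
      show "(\<exists>i'\<in>I. (\<Union>j\<in>opts J. ref_cell I A J B (Some i, j)) = A i') \<or> (\<exists>j'\<in>J. (\<Union>j\<in>opts J. ref_cell I A J B (Some i, j)) = B j')"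
        using i eq by blast
    qed (use fin in auto)
    then have "\<nu> (A i) = (\<Sum>Y\<in>(\<lambda>j. ref_cell I A J B (Some i, j)) ` opts J. \<nu> Y)"
      unfolding eq[symmetric] .
    then show "\<nu> (A i) = (\<Sum>j\<in>opts J. \<nu> (ref_cell I A J B (Some i, j)))" using img[OF fin(2) d] by simp
  next
    fix j assume j: "j \<in> J"
    have d: "disjoint_family_on (\<lambda>i. ref_cell I A J B (i, Some j)) (opts I)"
      by (rule disjoint_family_on_shrink[OF dI(1)]) (auto simp: ref_cell_def)
    have eq: "B j = (\<Union>i\<in>opts I. ref_cell I A J B (i, Some j))"
      by (rule ref_cell_Some_right) (use j sub in blast)+
    have "\<nu> (\<Union>i\<in>opts I. ref_cell I A J B (i, Some j)) = (\<Sum>Y\<in>(\<lambda>i. ref_cell I A J B (i, Some j)) ` opts I. \<nu> Y)"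
    proof (rule \<nu>)
      show "disjoint ((\<lambda>i. ref_cell I A J B (i, Some j)) ` opts I)"
        by (rule disjoint_family_on_disjoint_image[OF d])
      show "(\<exists>i'\<in>I. (\<Union>i\<in>opts I. ref_cell I A J B (i, Some j)) = A i') \<or> (\<exists>j'\<in>J. (\<Union>i\<in>opts I. ref_cell I A J B (i, Some j)) = B j')"
        using j eq by blast
    qed (use fin in auto)
    then have "\<nu> (B j) = (\<Sum>Y\<in>(\<lambda>i. ref_cell I A J B (i, Some j)) ` opts I. \<nu> Y)"
      unfolding eq[symmetric] .
    then show "\<nu> (B j) = (\<Sum>i\<in>opts I. \<nu> (ref_cell I A J B (i, Some j)))" using img[OF fin(1) d] by simp
  qed
qed

lemma additive_on_indicator:
  assumes "fin_part I A" "fin_part J B"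
  shows "additive_on (\<lambda>X. indicator X x) I A J B"
proof (rule additive_onI[OF assms])
  fix X :: "real set set" assume X: "finite X" "disjoint X"
  have "disjoint_family_on (\<lambda>Y. Y) X" using X(2) by (auto simp: disjoint_family_on_def disjoint_def)
  then show "indicator (\<Union>X) x = (\<Sum>Y\<in>X. indicator Y x :: real)"
    using indicator_UN_disjoint[OF X(1), of "\<lambda>Y. Y" x] by simp
qed simp

lemma additive_on_card:
  assumes "fin_part I A" "fin_part J B"
    and "\<And>i. i \<in> I \<Longrightarrow> finite (T \<inter> A i)" "\<And>j. j \<in> J \<Longrightarrow> finite (T \<inter> B j)"
  shows "additive_on (\<lambda>X. real (card (T \<inter> X))) I A J B"
proof (rule additive_onI[OF assms(1,2)])
  fix X :: "real set set" assume X: "finite X" "disjoint X" and U: "(\<exists>i\<in>I. \<Union>X = A i) \<or> (\<exists>j\<in>J. \<Union>X = B j)"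
  have "finite (T \<inter> \<Union>X)" using U assms(3,4) by auto
  then have f: "finite (T \<inter> Y)" if "Y \<in> X" for Y using that by (rule_tac finite_subset[of _ "T \<inter> \<Union>X"]) auto
  have "card (\<Union>Y\<in>X. T \<inter> Y) = (\<Sum>Y\<in>X. card (T \<inter> Y))"
    using X f by (intro card_UN_disjoint) (auto simp: disjoint_def)
  moreover have "T \<inter> \<Union>X = (\<Union>Y\<in>X. T \<inter> Y)" by auto
  ultimately show "real (card (T \<inter> \<Union>X)) = (\<Sum>Y\<in>X. real (card (T \<inter> Y)))"
    by (simp only: of_nat_sum)
qed simp

section \<open>Existence of the stochastic integrals\<close>

lemma nn_integral_abs_triangle:
  fixes f g h :: "'a \<Rightarrow> real"
  assumes "f \<in> borel_measurable M" "g \<in> borel_measurable M" "h \<in> borel_measurable M"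
  shows "(\<integral>\<^sup>+x. ennreal \<bar>f x - h x\<bar> \<partial>M) \<le> (\<integral>\<^sup>+x. ennreal \<bar>f x - g x\<bar> \<partial>M) + (\<integral>\<^sup>+x. ennreal \<bar>g x - h x\<bar> \<partial>M)"
proof -
  have "(\<integral>\<^sup>+x. ennreal \<bar>f x - h x\<bar> \<partial>M) \<le> (\<integral>\<^sup>+x. ennreal \<bar>f x - g x\<bar> + ennreal \<bar>g x - h x\<bar> \<partial>M)"
    by (intro nn_integral_mono) (auto simp: ennreal_plus[symmetric] intro!: ennreal_leI simp del: ennreal_plus)
  also have "\<dots> = (\<integral>\<^sup>+x. ennreal \<bar>f x - g x\<bar> \<partial>M) + (\<integral>\<^sup>+x. ennreal \<bar>g x - h x\<bar> \<partial>M)"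
    using assms by (intro nn_integral_add) auto
  finally show ?thesis .
qed

text \<open>Riesz-Fischer: an almost surely convergent subsequence gives the limit, and Fatou
  transfers the Cauchy bound to the whole sequence.\<close>

lemma L1_complete:
  fixes J :: "nat \<Rightarrow> 'w \<Rightarrow> real"
  assumes J: "\<And>l. integrable P (J l)"
    and Cauchy: "\<And>e::real. 0 < e \<Longrightarrow> \<exists>N. \<forall>i\<ge>N. \<forall>j\<ge>N. (\<integral>\<^sup>+\<omega>. ennreal \<bar>J i \<omega> - J j \<omega>\<bar> \<partial>P) < ennreal e"
  obtains I where "integrable P I" "(\<lambda>l. \<integral>\<^sup>+\<omega>. ennreal \<bar>J l \<omega> - I \<omega>\<bar> \<partial>P) \<longlonglongrightarrow> 0"
proof -
  have eq: "(\<integral>\<^sup>+\<omega>. ennreal \<bar>J i \<omega> - J j \<omega>\<bar> \<partial>P) = ennreal (LINT \<omega>|P. norm (J i \<omega> - J j \<omega>))" for i j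
    unfolding real_norm_def using J by (intro nn_integral_eq_integral integrable_abs) auto
  have "\<exists>N. \<forall>i\<ge>N. \<forall>j\<ge>N. (LINT \<omega>|P. norm (J i \<omega> - J j \<omega>)) < e" if "0 < e" for e
    using Cauchy[OF that] unfolding eq using that by (simp add: ennreal_less_iff integral_nonneg_AE)
  then obtain r where r: "strict_mono r" "AE \<omega> in P. Cauchy (\<lambda>i. J (r i) \<omega>)"
    using cauchy_L1_AE_cauchy_subseq[of P J] J by blast
  define I where "I = (\<lambda>\<omega>. lim (\<lambda>i. J (r i) \<omega>))"
  have Jm [measurable]: "J l \<in> borel_measurable P" for l using J by auto
  have Im [measurable]: "I \<in> borel_measurable P" unfolding I_def by measurable
  have lim: "AE \<omega> in P. (\<lambda>i. J (r i) \<omega>) \<longlonglongrightarrow> I \<omega>"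
    using r(2) by eventually_elim (simp add: I_def Cauchy_convergent_iff convergent_LIMSEQ_iff)
  have bound: "\<exists>N. \<forall>l\<ge>N. (\<integral>\<^sup>+\<omega>. ennreal \<bar>J l \<omega> - I \<omega>\<bar> \<partial>P) \<le> ennreal e" if e: "0 < e" for e
  proof -
    obtain N where N: "\<forall>i\<ge>N. \<forall>j\<ge>N. (\<integral>\<^sup>+\<omega>. ennreal \<bar>J i \<omega> - J j \<omega>\<bar> \<partial>P) < ennreal e"
      using Cauchy[OF e] by auto
    show ?thesis
    proof (intro exI allI impI)
      fix l assume l: "N \<le> l"
      have "(\<integral>\<^sup>+\<omega>. ennreal \<bar>J l \<omega> - I \<omega>\<bar> \<partial>P) = (\<integral>\<^sup>+\<omega>. liminf (\<lambda>i. ennreal \<bar>J l \<omega> - J (r i) \<omega>\<bar>) \<partial>P)"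
      proof (rule nn_integral_cong_AE)
        show "AE \<omega> in P. ennreal \<bar>J l \<omega> - I \<omega>\<bar> = liminf (\<lambda>i. ennreal \<bar>J l \<omega> - J (r i) \<omega>\<bar>)"
          using lim
        proof eventually_elim
          case (elim \<omega>)
          have "(\<lambda>i. ennreal \<bar>J l \<omega> - J (r i) \<omega>\<bar>) \<longlonglongrightarrow> ennreal \<bar>J l \<omega> - I \<omega>\<bar>"
            by (intro tendsto_ennrealI tendsto_intros elim)
          then show ?case by (intro lim_imp_Liminf[symmetric]) auto
        qed
      qed
      also have "\<dots> \<le> liminf (\<lambda>i. \<integral>\<^sup>+\<omega>. ennreal \<bar>J l \<omega> - J (r i) \<omega>\<bar> \<partial>P)"
        by (rule nn_integral_liminf) measurable
      also have "\<dots> \<le> liminf (\<lambda>i. ennreal e)"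
      proof (rule Liminf_mono)
        show "\<forall>\<^sub>F i in sequentially. (\<integral>\<^sup>+\<omega>. ennreal \<bar>J l \<omega> - J (r i) \<omega>\<bar> \<partial>P) \<le> ennreal e"
          using eventually_ge_at_top[of N]
        proof eventually_elim
          case (elim i)
          then have "N \<le> r i" using seq_suble[OF r(1), of i] by simp
          then show ?case using N l by (auto intro: less_imp_le)
        qed
      qed
      also have "\<dots> = ennreal e" by (simp add: Liminf_const)
      finally show "(\<integral>\<^sup>+\<omega>. ennreal \<bar>J l \<omega> - I \<omega>\<bar> \<partial>P) \<le> ennreal e" .
    qed
  qed
  have "integrable P I"
  proof -
    obtain l where "(\<integral>\<^sup>+\<omega>. ennreal \<bar>J l \<omega> - I \<omega>\<bar> \<partial>P) \<le> ennreal 1" using bound[of 1] by auto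
    then have "(\<integral>\<^sup>+\<omega>. ennreal (norm (J l \<omega> - I \<omega>)) \<partial>P) < \<infinity>" by (simp add: order_le_less_trans)
    then have "integrable P (\<lambda>\<omega>. J l \<omega> - I \<omega>)" by (intro integrableI_bounded) auto
    from Bochner_Integration.integrable_diff[OF J[of l] this] show ?thesis by simp
  qed
  moreover have "(\<lambda>l. \<integral>\<^sup>+\<omega>. ennreal \<bar>J l \<omega> - I \<omega>\<bar> \<partial>P) \<longlonglongrightarrow> 0"
  proof (rule order_tendstoI)
    fix a :: ennreal assume "0 < a"
    then obtain e where e: "0 < e" "ennreal e < a"
      by (metis dense ennreal_cases ennreal_less_zero_iff less_top_ennreal order_less_trans top.not_eq_extremum)
    then show "\<forall>\<^sub>F l in sequentially. (\<integral>\<^sup>+\<omega>. ennreal \<bar>J l \<omega> - I \<omega>\<bar> \<partial>P) < a"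
      using bound[OF e(1)] unfolding eventually_sequentially by (meson order_le_less_trans)
  qed simp
  ultimately show thesis by (rule that)
qed

text \<open>Extension of a contraction from a dense set without linear structure: the estimate is
  required for pairs of elements. One reference sequence \<open>s0\<close> defines the limit, and
  any other approximating sequence is compared with it, which gives independence of the
  sequence.\<close>

lemma L1_extension:
  fixes T :: "'s \<Rightarrow> 'w \<Rightarrow> real" and F :: "'s \<Rightarrow> 'b \<Rightarrow> real" and f :: "'b \<Rightarrow> real"
  assumes T: "\<And>s. s \<in> D \<Longrightarrow> integrable P (T s)"
    and F: "\<And>s. s \<in> D \<Longrightarrow> F s \<in> borel_measurable L" and f: "f \<in> borel_measurable L"
    and contr: "\<And>s s'. s \<in> D \<Longrightarrow> s' \<in> D \<Longrightarrow> (\<integral>\<^sup>+\<omega>. ennreal \<bar>T s \<omega> - T s' \<omega>\<bar> \<partial>P) \<le> (\<integral>\<^sup>+x. ennreal \<bar>F s x - F s' x\<bar> \<partial>L)"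
    and s0: "\<And>l. s0 l \<in> D" "(\<lambda>l. \<integral>\<^sup>+x. ennreal \<bar>F (s0 l) x - f x\<bar> \<partial>L) \<longlonglongrightarrow> 0"
  obtains I where "integrable P I"
    "\<And>s. (\<And>l. s l \<in> D) \<Longrightarrow> (\<lambda>l. \<integral>\<^sup>+x. ennreal \<bar>F (s l) x - f x\<bar> \<partial>L) \<longlonglongrightarrow> 0 \<Longrightarrow>
       (\<lambda>l. \<integral>\<^sup>+\<omega>. ennreal \<bar>T (s l) \<omega> - I \<omega>\<bar> \<partial>P) \<longlonglongrightarrow> 0"
proof -
  have d: "(\<integral>\<^sup>+\<omega>. ennreal \<bar>T s \<omega> - T s' \<omega>\<bar> \<partial>P) \<le> (\<integral>\<^sup>+x. ennreal \<bar>F s x - f x\<bar> \<partial>L) + (\<integral>\<^sup>+x. ennreal \<bar>F s' x - f x\<bar> \<partial>L)"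
    if "s \<in> D" "s' \<in> D" for s s'
    using order_trans[OF contr[OF that] nn_integral_abs_triangle[OF F[OF that(1)] f F[OF that(2)]]]
    by (simp add: abs_minus_commute)
  have "\<exists>N. \<forall>i\<ge>N. \<forall>j\<ge>N. (\<integral>\<^sup>+\<omega>. ennreal \<bar>T (s0 i) \<omega> - T (s0 j) \<omega>\<bar> \<partial>P) < ennreal e" if e: "0 < e" for e
  proof -
    have "\<forall>\<^sub>F l in sequentially. (\<integral>\<^sup>+x. ennreal \<bar>F (s0 l) x - f x\<bar> \<partial>L) < ennreal (e / 2)"
      using e by (intro order_tendstoD(2)[OF s0(2)]) simp
    then obtain N where N: "\<And>l. l \<ge> N \<Longrightarrow> (\<integral>\<^sup>+x. ennreal \<bar>F (s0 l) x - f x\<bar> \<partial>L) < ennreal (e / 2)"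
      unfolding eventually_sequentially by auto
    have "(\<integral>\<^sup>+\<omega>. ennreal \<bar>T (s0 i) \<omega> - T (s0 j) \<omega>\<bar> \<partial>P) < ennreal e" if "i \<ge> N" "j \<ge> N" for i j
    proof -
      have "(\<integral>\<^sup>+\<omega>. ennreal \<bar>T (s0 i) \<omega> - T (s0 j) \<omega>\<bar> \<partial>P) < ennreal (e / 2) + ennreal (e / 2)"
        by (rule order_le_less_trans[OF d[OF s0(1) s0(1)]]) (intro add_strict_mono N that)
      also have "\<dots> = ennreal e" using e by (simp add: ennreal_plus[symmetric] del: ennreal_plus)
      finally show ?thesis .
    qed
    then show ?thesis by blast
  qed
  then obtain I where I: "integrable P I" "(\<lambda>l. \<integral>\<^sup>+\<omega>. ennreal \<bar>T (s0 l) \<omega> - I \<omega>\<bar> \<partial>P) \<longlonglongrightarrow> 0"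
    using L1_complete[of P "\<lambda>l. T (s0 l)"] T s0(1) by blast
  show thesis
  proof (rule that[OF I(1)])
    fix s assume s: "\<And>l. s l \<in> D" "(\<lambda>l. \<integral>\<^sup>+x. ennreal \<bar>F (s l) x - f x\<bar> \<partial>L) \<longlonglongrightarrow> 0"
    have "(\<lambda>l. (\<integral>\<^sup>+x. ennreal \<bar>F (s l) x - f x\<bar> \<partial>L) + (\<integral>\<^sup>+x. ennreal \<bar>F (s0 l) x - f x\<bar> \<partial>L)
       + (\<integral>\<^sup>+\<omega>. ennreal \<bar>T (s0 l) \<omega> - I \<omega>\<bar> \<partial>P)) \<longlonglongrightarrow> 0 + 0 + 0"
      by (intro tendsto_add s(2) s0(2) I(2))
    then have l: "(\<lambda>l. (\<integral>\<^sup>+x. ennreal \<bar>F (s l) x - f x\<bar> \<partial>L) + (\<integral>\<^sup>+x. ennreal \<bar>F (s0 l) x - f x\<bar> \<partial>L)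
       + (\<integral>\<^sup>+\<omega>. ennreal \<bar>T (s0 l) \<omega> - I \<omega>\<bar> \<partial>P)) \<longlonglongrightarrow> 0" by simp
    have le: "(\<integral>\<^sup>+\<omega>. ennreal \<bar>T (s l) \<omega> - I \<omega>\<bar> \<partial>P) \<le> (\<integral>\<^sup>+x. ennreal \<bar>F (s l) x - f x\<bar> \<partial>L) + (\<integral>\<^sup>+x. ennreal \<bar>F (s0 l) x - f x\<bar> \<partial>L)
       + (\<integral>\<^sup>+\<omega>. ennreal \<bar>T (s0 l) \<omega> - I \<omega>\<bar> \<partial>P)" for l
      by (rule order_trans[OF nn_integral_abs_triangle[of _ _ "T (s0 l)"]])
         (use T s s0 I(1) d in \<open>auto intro!: add_right_mono borel_measurable_integrable\<close>)
    show "(\<lambda>l. \<integral>\<^sup>+\<omega>. ennreal \<bar>T (s l) \<omega> - I \<omega>\<bar> \<partial>P) \<longlonglongrightarrow> 0"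
      by (rule tendsto_sandwich[OF _ _ tendsto_const l]) (auto intro!: always_eventually le)
  qed
qed

subsection \<open>The contraction property\<close>

lemma abs_sum_indicator_disjoint:
  assumes "finite K" "disjoint_family_on C K"
  shows "\<bar>\<Sum>k\<in>K. c k * indicator (C k) x\<bar> = (\<Sum>k\<in>K. \<bar>c k\<bar> * indicator (C k) x :: real)"
proof (cases "\<exists>k\<in>K. x \<in> C k")
  case True
  then obtain k where k: "k \<in> K" "x \<in> C k" by auto
  have o: "g l * indicator (C l) x = (if l = k then g k else 0 :: real)" if "l \<in> K" for l g
    using assms(2) k that by (auto simp: disjoint_family_on_def indicator_def)
  have "(\<Sum>l\<in>K. g l * indicator (C l) x) = (g k :: real)" for g
    using o[of _ g] assms(1) k by simp
  then show ?thesis by simp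
next
  case False
  then show ?thesis by (auto simp: indicator_def)
qed

context poisson_proc
begin

abbreviation Nr :: "'w \<Rightarrow> real set \<Rightarrow> real" where "Nr \<omega> X \<equiv> real (N X \<omega>)"

lemma Nr_measurable:
  "A \<in> sets borel \<Longrightarrow> A \<subseteq> {0..} \<Longrightarrow> emeasure lborel A < \<infinity> \<Longrightarrow> (\<lambda>\<omega>. Nr \<omega> A) \<in> borel_measurable P"
  by (rule measurable_compose[OF N_measurable]) auto

lemma fin_partD:
  "fin_part K C \<Longrightarrow> k \<in> K \<Longrightarrow> C k \<in> sets borel" "fin_part K C \<Longrightarrow> k \<in> K \<Longrightarrow> C k \<subseteq> {0..}"
  "fin_part K C \<Longrightarrow> k \<in> K \<Longrightarrow> emeasure lborel (C k) < \<infinity>" "fin_part K C \<Longrightarrow> finite K"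
  "fin_part K C \<Longrightarrow> disjoint_family_on C K"
  by (auto simp: fin_part_def)

text \<open>The mean of a count is the measure of its cell, and for disjoint cells the absolute
  value of an elementary function is the elementary function with absolute coefficients. Hence the
  triangle inequality already ends at the L1 norm.\<close>

lemma nn_integral_lin1:
  assumes K: "fin_part K C"
  shows "(\<integral>\<^sup>+\<omega>. ennreal \<bar>lin1 K C c (Nr \<omega>)\<bar> \<partial>P) \<le> (\<integral>\<^sup>+x. ennreal \<bar>lin1 K C c (\<lambda>X. indicator X x)\<bar> \<partial>lborel)"
proof -
  note KD = fin_partD[OF K]
  have "(\<integral>\<^sup>+\<omega>. ennreal \<bar>lin1 K C c (Nr \<omega>)\<bar> \<partial>P) \<le> (\<integral>\<^sup>+\<omega>. (\<Sum>k\<in>K. ennreal \<bar>c k\<bar> * of_nat (N (C k) \<omega>)) \<partial>P)"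
  proof (intro nn_integral_mono)
    fix \<omega>
    have "\<bar>lin1 K C c (Nr \<omega>)\<bar> \<le> (\<Sum>k\<in>K. \<bar>c k\<bar> * Nr \<omega> (C k))"
      unfolding lin1_def by (rule order_trans[OF sum_abs]) (simp add: abs_mult)
    then have "ennreal \<bar>lin1 K C c (Nr \<omega>)\<bar> \<le> ennreal (\<Sum>k\<in>K. \<bar>c k\<bar> * Nr \<omega> (C k))" by (rule ennreal_leI)
    then show "ennreal \<bar>lin1 K C c (Nr \<omega>)\<bar> \<le> (\<Sum>k\<in>K. ennreal \<bar>c k\<bar> * of_nat (N (C k) \<omega>))"
      by (simp add: sum_ennreal[symmetric] ennreal_mult ennreal_of_nat_eq_real_of_nat)
  qed
  also have "\<dots> = (\<Sum>k\<in>K. \<integral>\<^sup>+\<omega>. ennreal \<bar>c k\<bar> * of_nat (N (C k) \<omega>) \<partial>P)"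
  proof (rule nn_integral_sum)
    fix k assume "k \<in> K"
    then have "N (C k) \<in> measurable P (count_space UNIV)" using KD by (intro N_measurable) auto
    then show "(\<lambda>\<omega>. ennreal \<bar>c k\<bar> * of_nat (N (C k) \<omega>)) \<in> borel_measurable P" by measurable
  qed
  also have "\<dots> = (\<Sum>k\<in>K. ennreal \<bar>c k\<bar> * emeasure lborel (C k))"
  proof (intro sum.cong refl)
    fix k assume k: "k \<in> K"
    then have "N (C k) \<in> measurable P (count_space UNIV)" using KD by (intro N_measurable) auto
    then have "(\<integral>\<^sup>+\<omega>. ennreal \<bar>c k\<bar> * of_nat (N (C k) \<omega>) \<partial>P) = ennreal \<bar>c k\<bar> * (\<integral>\<^sup>+\<omega>. of_nat (N (C k) \<omega>) \<partial>P)"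
      by (intro nn_integral_cmult) measurable
    then show "(\<integral>\<^sup>+\<omega>. ennreal \<bar>c k\<bar> * of_nat (N (C k) \<omega>) \<partial>P) = ennreal \<bar>c k\<bar> * emeasure lborel (C k)"
      using nn_integral_N[of "C k"] KD k by simp
  qed
  also have "\<dots> = (\<Sum>k\<in>K. \<integral>\<^sup>+x. ennreal \<bar>c k\<bar> * indicator (C k) x \<partial>lborel)"
    using KD by (intro sum.cong refl) (simp add: nn_integral_cmult)
  also have "\<dots> = (\<integral>\<^sup>+x. (\<Sum>k\<in>K. ennreal \<bar>c k\<bar> * indicator (C k) x) \<partial>lborel)"
    using KD by (intro nn_integral_sum[symmetric]) auto
  also have "\<dots> = (\<integral>\<^sup>+x. ennreal \<bar>lin1 K C c (\<lambda>X. indicator X x)\<bar> \<partial>lborel)"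
    unfolding lin1_def abs_sum_indicator_disjoint[OF KD(4,5)]
    by (intro nn_integral_cong) (simp add: sum_ennreal[symmetric] ennreal_mult ennreal_indicator)
  finally show ?thesis .
qed

text \<open>Counts of distinct cells are independent, so the mean of their product is the area of
  the rectangle. The second moment of a Poisson count would exceed the area of the diagonal square,
  hence the condition \<open>c k k = 0\<close>.\<close>

lemma nn_integral_lin2:
  assumes K: "fin_part K C" and diag: "\<And>k. k \<in> K \<Longrightarrow> c k k = 0"
  shows "(\<integral>\<^sup>+\<omega>. ennreal \<bar>lin2 K C c (Nr \<omega>) (Nr \<omega>)\<bar> \<partial>P)
     \<le> (\<integral>\<^sup>+z. ennreal \<bar>lin2 K C c (\<lambda>X. indicator X (fst z)) (\<lambda>X. indicator X (snd z))\<bar> \<partial>lborel)"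
proof -
  note KD = fin_partD[OF K]
  let ?C2 = "\<lambda>(k, l). C k \<times> C l"
  have dis2: "disjoint_family_on ?C2 (K \<times> K)"
    using KD(5) unfolding disjoint_family_on_def by (auto 4 4)
  have lin2_eq: "lin2 K C c \<nu> \<nu>' = (\<Sum>(k, l)\<in>K \<times> K. c k l * \<nu> (C k) * \<nu>' (C l))" for \<nu> \<nu>'
    by (simp add: lin2_def sum.cartesian_product)
  have m: "(\<lambda>\<omega>. ennreal \<bar>c k l\<bar> * (of_nat (N (C k) \<omega>) * of_nat (N (C l) \<omega>))) \<in> borel_measurable P"
    if "k \<in> K" "l \<in> K" for k l
  proof -
    have "N (C k) \<in> measurable P (count_space UNIV)" "N (C l) \<in> measurable P (count_space UNIV)"
      using KD that by (auto intro!: N_measurable)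
    then show ?thesis by measurable
  qed
  have "(\<integral>\<^sup>+\<omega>. ennreal \<bar>lin2 K C c (Nr \<omega>) (Nr \<omega>)\<bar> \<partial>P)
     \<le> (\<integral>\<^sup>+\<omega>. (\<Sum>(k, l)\<in>K \<times> K. ennreal \<bar>c k l\<bar> * (of_nat (N (C k) \<omega>) * of_nat (N (C l) \<omega>))) \<partial>P)"
  proof (intro nn_integral_mono)
    fix \<omega>
    have "\<bar>lin2 K C c (Nr \<omega>) (Nr \<omega>)\<bar> \<le> (\<Sum>(k, l)\<in>K \<times> K. \<bar>c k l\<bar> * (Nr \<omega> (C k) * Nr \<omega> (C l)))"
      unfolding lin2_eq by (rule order_trans[OF sum_abs]) (auto intro!: sum_mono simp: abs_mult)
    then have "ennreal \<bar>lin2 K C c (Nr \<omega>) (Nr \<omega>)\<bar> \<le> ennreal (\<Sum>(k, l)\<in>K \<times> K. \<bar>c k l\<bar> * (Nr \<omega> (C k) * Nr \<omega> (C l)))"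
      by (rule ennreal_leI)
    also have "\<dots> = (\<Sum>(k, l)\<in>K \<times> K. ennreal \<bar>c k l\<bar> * (of_nat (N (C k) \<omega>) * of_nat (N (C l) \<omega>)))"
      unfolding case_prod_unfold
      by (subst sum_ennreal[symmetric]) (auto simp: ennreal_mult ennreal_of_nat_eq_real_of_nat)
    finally show "ennreal \<bar>lin2 K C c (Nr \<omega>) (Nr \<omega>)\<bar>
       \<le> (\<Sum>(k, l)\<in>K \<times> K. ennreal \<bar>c k l\<bar> * (of_nat (N (C k) \<omega>) * of_nat (N (C l) \<omega>)))" .
  qed
  also have "\<dots> = (\<Sum>(k, l)\<in>K \<times> K. \<integral>\<^sup>+\<omega>. ennreal \<bar>c k l\<bar> * (of_nat (N (C k) \<omega>) * of_nat (N (C l) \<omega>)) \<partial>P)"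
    unfolding case_prod_unfold using m by (intro nn_integral_sum) auto
  also have "\<dots> = (\<Sum>(k, l)\<in>K \<times> K. ennreal \<bar>c k l\<bar> * (emeasure lborel (C k) * emeasure lborel (C l)))"
  proof (intro sum.cong refl, clarify)
    fix k l assume kl: "k \<in> K" "l \<in> K"
    show "(\<integral>\<^sup>+\<omega>. ennreal \<bar>c k l\<bar> * (of_nat (N (C k) \<omega>) * of_nat (N (C l) \<omega>)) \<partial>P)
       = ennreal \<bar>c k l\<bar> * (emeasure lborel (C k) * emeasure lborel (C l))"
    proof (cases "k = l")
      case False
      then have "C k \<inter> C l = {}" using KD(5) kl by (auto simp: disjoint_family_on_def)
      then have e: "(\<integral>\<^sup>+\<omega>. of_nat (N (C k) \<omega>) * of_nat (N (C l) \<omega>) \<partial>P) = emeasure lborel (C k) * emeasure lborel (C l)"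
        using KD kl by (intro nn_integral_N_mult) auto
      have "(\<lambda>\<omega>. of_nat (N (C k) \<omega>) :: ennreal) \<in> borel_measurable P"
        "(\<lambda>\<omega>. of_nat (N (C l) \<omega>) :: ennreal) \<in> borel_measurable P"
        using KD kl by (auto intro!: measurable_compose[OF N_measurable])
      then have "(\<integral>\<^sup>+\<omega>. ennreal \<bar>c k l\<bar> * (of_nat (N (C k) \<omega>) * of_nat (N (C l) \<omega>)) \<partial>P)
         = ennreal \<bar>c k l\<bar> * (\<integral>\<^sup>+\<omega>. of_nat (N (C k) \<omega>) * of_nat (N (C l) \<omega>) \<partial>P)"
        by (intro nn_integral_cmult borel_measurable_times_ennreal)
      then show ?thesis using e by simp
    qed (use diag kl in simp)
  qed
  also have "\<dots> = (\<Sum>(k, l)\<in>K \<times> K. \<integral>\<^sup>+z. ennreal \<bar>c k l\<bar> * indicator (C k \<times> C l) z \<partial>lborel)"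
  proof (intro sum.cong refl, clarify)
    fix k l assume kl: "k \<in> K" "l \<in> K"
    have "emeasure (lborel :: (real \<times> real) measure) (C k \<times> C l) = emeasure lborel (C k) * emeasure lborel (C l)"
      unfolding lborel_prod[symmetric] using KD kl by (intro lborel.emeasure_pair_measure_Times) auto
    then show "ennreal \<bar>c k l\<bar> * (emeasure lborel (C k) * emeasure lborel (C l))
        = (\<integral>\<^sup>+z. ennreal \<bar>c k l\<bar> * indicator (C k \<times> C l) z \<partial>lborel)"
      using KD kl by (simp add: nn_integral_cmult_indicator borel_Times)
  qed
  also have "\<dots> = (\<integral>\<^sup>+z. (\<Sum>(k, l)\<in>K \<times> K. ennreal \<bar>c k l\<bar> * indicator (C k \<times> C l) z) \<partial>lborel)"
    unfolding case_prod_unfold using KD by (intro nn_integral_sum[symmetric]) (auto intro!: borel_measurable_times_ennreal borel_measurable_indicator borel_Times)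
  also have "\<dots> = (\<integral>\<^sup>+z. ennreal \<bar>lin2 K C c (\<lambda>X. indicator X (fst z)) (\<lambda>X. indicator X (snd z))\<bar> \<partial>lborel)"
  proof (intro nn_integral_cong)
    fix z :: "real \<times> real"
    have "lin2 K C c (\<lambda>X. indicator X (fst z)) (\<lambda>X. indicator X (snd z)) = (\<Sum>q\<in>K \<times> K. (case q of (k, l) \<Rightarrow> c k l) * indicator (?C2 q) z)"
      unfolding lin2_eq by (intro sum.cong refl) (auto simp: indicator_def mem_Times_iff)
    then have "\<bar>lin2 K C c (\<lambda>X. indicator X (fst z)) (\<lambda>X. indicator X (snd z))\<bar>
       = (\<Sum>q\<in>K \<times> K. \<bar>case q of (k, l) \<Rightarrow> c k l\<bar> * indicator (?C2 q) z)"
      using abs_sum_indicator_disjoint[OF _ dis2] KD(4) by simp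
    then show "(\<Sum>(k, l)\<in>K \<times> K. ennreal \<bar>c k l\<bar> * indicator (C k \<times> C l) z)
        = ennreal \<bar>lin2 K C c (\<lambda>X. indicator X (fst z)) (\<lambda>X. indicator X (snd z))\<bar>"
      unfolding case_prod_unfold
      by (simp only:) (subst sum_ennreal[symmetric], auto simp: ennreal_mult ennreal_indicator)
  qed
  finally show ?thesis .
qed

lemma AE_additive_N:
  assumes A: "fin_part I A" and B: "fin_part J B"
  shows "AE \<omega> in P. additive_on (Nr \<omega>) I A J B"
proof -
  have "AE \<omega> in P. \<forall>i\<in>I. finite (S \<omega> \<inter> A i)" "AE \<omega> in P. \<forall>j\<in>J. finite (S \<omega> \<inter> B j)"
    using A B AE_finite by (auto intro!: AE_finite_allI simp: fin_part_def)
  then show ?thesis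
  proof eventually_elim
    case (elim \<omega>)
    then show ?case unfolding num_points_def by (intro additive_on_card A B) auto
  qed
qed

lemma lin1_contract:
  assumes A: "fin_part I A" and B: "fin_part J B"
  shows "(\<integral>\<^sup>+\<omega>. ennreal \<bar>lin1 I A a (Nr \<omega>) - lin1 J B b (Nr \<omega>)\<bar> \<partial>P)
    \<le> (\<integral>\<^sup>+x. ennreal \<bar>lin1 I A a (\<lambda>X. indicator X x) - lin1 J B b (\<lambda>X. indicator X x)\<bar> \<partial>lborel)"
proof -
  note fin = fin_partD(4)[OF A] fin_partD(4)[OF B]
  let ?c = "\<lambda>k. zero_ext a (fst k) - zero_ext b (snd k)"
  have "(\<integral>\<^sup>+\<omega>. ennreal \<bar>lin1 I A a (Nr \<omega>) - lin1 J B b (Nr \<omega>)\<bar> \<partial>P)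
     = (\<integral>\<^sup>+\<omega>. ennreal \<bar>lin1 (ref_index I J) (ref_cell I A J B) ?c (Nr \<omega>)\<bar> \<partial>P)"
    by (rule nn_integral_cong_AE) (use AE_additive_N[OF A B] in eventually_elim, simp add: lin1_refine[OF fin])
  also have "\<dots> \<le> (\<integral>\<^sup>+x. ennreal \<bar>lin1 (ref_index I J) (ref_cell I A J B) ?c (\<lambda>X. indicator X x)\<bar> \<partial>lborel)"
    by (rule nn_integral_lin1[OF fin_part_ref[OF A B]])
  finally show ?thesis unfolding lin1_refine[OF fin additive_on_indicator[OF A B]] .
qed

lemma lin2_contract:
  assumes A: "fin_part I A" and B: "fin_part J B"
    and a: "\<And>i. i \<in> I \<Longrightarrow> a i i = 0" and b: "\<And>j. j \<in> J \<Longrightarrow> b j j = 0"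
  shows "(\<integral>\<^sup>+\<omega>. ennreal \<bar>lin2 I A a (Nr \<omega>) (Nr \<omega>) - lin2 J B b (Nr \<omega>) (Nr \<omega>)\<bar> \<partial>P)
    \<le> (\<integral>\<^sup>+z. ennreal \<bar>lin2 I A a (\<lambda>X. indicator X (fst z)) (\<lambda>X. indicator X (snd z))
          - lin2 J B b (\<lambda>X. indicator X (fst z)) (\<lambda>X. indicator X (snd z))\<bar> \<partial>lborel)"
proof -
  note fin = fin_partD(4)[OF A] fin_partD(4)[OF B]
  let ?c = "\<lambda>k l. zero_ext (\<lambda>i. zero_ext (a i) (fst l)) (fst k) - zero_ext (\<lambda>j. zero_ext (b j) (snd l)) (snd k)"
  have "(\<integral>\<^sup>+\<omega>. ennreal \<bar>lin2 I A a (Nr \<omega>) (Nr \<omega>) - lin2 J B b (Nr \<omega>) (Nr \<omega>)\<bar> \<partial>P)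
     = (\<integral>\<^sup>+\<omega>. ennreal \<bar>lin2 (ref_index I J) (ref_cell I A J B) ?c (Nr \<omega>) (Nr \<omega>)\<bar> \<partial>P)"
    by (rule nn_integral_cong_AE) (use AE_additive_N[OF A B] in eventually_elim, simp add: lin2_refine[OF fin])
  also have "\<dots> \<le> (\<integral>\<^sup>+z. ennreal \<bar>lin2 (ref_index I J) (ref_cell I A J B) ?c (\<lambda>X. indicator X (fst z)) (\<lambda>X. indicator X (snd z))\<bar> \<partial>lborel)"
  proof (rule nn_integral_lin2[OF fin_part_ref[OF A B]])
    fix k assume "k \<in> ref_index I J"
    \<comment> \<open>A refined cell lies in at most one cell of each partition, so both parts of
      its diagonal coefficient come from diagonal coefficients or are 0.\<close>
    then show "?c k k = 0" using a b by (auto simp: ref_index_def opts_def zero_ext_def)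
  qed
  finally show ?thesis unfolding lin2_refine[OF fin additive_on_indicator[OF A B] additive_on_indicator[OF A B]] .
qed

end

section \<open>Elementary functions on the mesh, and cells of infinite measure\<close>

lemma elem_fun1_eq_lin1: "elem_fun1 m A a x = lin1 {..<m} A a (\<lambda>X. indicator X x)"
  by (simp add: elem_fun1_def lin1_def)

lemma elem_fun2_eq_lin2:
  "elem_fun2 m A a x y = lin2 {..<m} A a (\<lambda>X. indicator X x) (\<lambda>X. indicator X y)"
  by (simp add: elem_fun2_def lin2_def indicator_times mult.assoc)

text \<open>Elementary functions index their cells from 0, the mesh from 1; with cell 0 empty,
  \<open>Suc N\<close> matches the two.\<close>

lemma elem_fun1_vcell:
  assumes "0 < p"
  shows "elem_fun1 (Suc N) (vcell p) a x = (\<Sum>u\<in>{1..N}. a u * indicator (vcell p u) x)"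
proof -
  have "{..<Suc N} = insert 0 {1..N}" by auto
  then show ?thesis using assms unfolding elem_fun1_def by (simp only:) (subst sum.insert, auto)
qed

lemma elem_fun2_vcell:
  assumes "0 < p" "\<And>u. a u u = 0"
  shows "elem_fun2 (Suc N) (vcell p) a x y = (\<Sum>i\<in>offdiag N. a (fst i) (snd i) * indicator (vcell2 p i) (x, y))"
proof -
  have "elem_fun2 (Suc N) (vcell p) a x y
     = (\<Sum>i\<in>{..<Suc N} \<times> {..<Suc N}. a (fst i) (snd i) * indicator (vcell2 p i) (x, y))"
    by (simp only: elem_fun2_def sum.cartesian_product case_prod_unfold vcell2_def fst_conv snd_conv)
  also have "\<dots> = (\<Sum>i\<in>offdiag N. a (fst i) (snd i) * indicator (vcell2 p i) (x, y))"
  proof (rule sum.mono_neutral_right)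
    show "\<forall>i\<in>{..<Suc N} \<times> {..<Suc N} - offdiag N. a (fst i) (snd i) * indicator (vcell2 p i) (x, y) = 0"
    proof
      fix i assume i: "i \<in> {..<Suc N} \<times> {..<Suc N} - offdiag N"
      then have "fst i = 0 \<or> snd i = 0 \<or> fst i = snd i" by (cases i) (auto simp: offdiag_def)
      then show "a (fst i) (snd i) * indicator (vcell2 p i) (x, y) = 0"
        using assms by (auto simp: vcell2_def case_prod_unfold)
    qed
  qed (auto simp: offdiag_def)
  finally show ?thesis .
qed

lemma disjoint_borel_sets_vcell: "0 < p \<Longrightarrow> disjoint_borel_sets m (vcell p)"
  using vcell_nonneg disjoint_vcell by (auto simp: disjoint_borel_sets_def)

lemma fin_part_vcell: "0 < p \<Longrightarrow> fin_part {..<m} (vcell p)"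
  using vcell_nonneg disjoint_vcell by (auto simp: fin_part_def emeasure_vcell)

lemma lin1_outside: "fin_part I A \<Longrightarrow> x \<notin> {0..} \<Longrightarrow> lin1 I A a (\<lambda>X. indicator X x) = 0"
  unfolding lin1_def fin_part_def by (intro sum.neutral) (auto simp: indicator_def)

lemma lin2_outside:
  "fin_part I A \<Longrightarrow> z \<notin> {0..} \<times> {0..} \<Longrightarrow> lin2 I A a (\<lambda>X. indicator X (fst z)) (\<lambda>X. indicator X (snd z)) = 0"
  unfolding lin2_def fin_part_def by (intro sum.neutral ballI) (cases z, force simp: indicator_def)

lemma quadrant_borel: "{0..} \<times> {0..} \<in> sets (borel :: (real \<times> real) measure)"
  by (simp add: borel_Times)

text \<open>Cells of infinite measure carry the coefficient \<open>0\<close>, or are multiplied by cells without points.\<close>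

definition fin_cells :: "(nat \<Rightarrow> real set) \<Rightarrow> nat \<Rightarrow> real set" where
  "fin_cells A i = (if emeasure lborel (A i) < \<infinity> then A i else {})"

lemma fin_part_fin_cells: "disjoint_borel_sets m A \<Longrightarrow> fin_part {..<m} (fin_cells A)"
  by (auto simp: disjoint_borel_sets_def fin_part_def fin_cells_def disjoint_family_on_def)

lemma elem1_coeff_finite:
  assumes A: "disjoint_borel_sets m A" and int: "set_integrable lborel {0..} (elem_fun1 m A a)"
    and i: "i < m" "a i \<noteq> 0"
  shows "emeasure lborel (A i) < \<infinity>"
proof -
  have dis: "disjoint_family_on A {..<m}" and Ai: "A i \<in> sets borel" "A i \<subseteq> {0..}"
    using A i by (auto simp: disjoint_borel_sets_def)
  have "(\<integral>\<^sup>+x. ennreal \<bar>a i\<bar> * indicator (A i) x \<partial>lborel) \<le> (\<integral>\<^sup>+x. ennreal (norm (indicator {0..} x *\<^sub>R elem_fun1 m A a x)) \<partial>lborel)"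
  proof (intro nn_integral_mono)
    fix x
    have "\<bar>elem_fun1 m A a x\<bar> = (\<Sum>k<m. \<bar>a k\<bar> * indicator (A k) x)"
      unfolding elem_fun1_def by (rule abs_sum_indicator_disjoint[OF _ dis]) simp
    then have "\<bar>a i\<bar> * indicator (A i) x \<le> \<bar>elem_fun1 m A a x\<bar>"
      using member_le_sum[of i "{..<m}" "\<lambda>k. \<bar>a k\<bar> * indicator (A k) x"] i by simp
    then show "ennreal \<bar>a i\<bar> * indicator (A i) x \<le> ennreal (norm (indicator {0..} x *\<^sub>R elem_fun1 m A a x))"
      using Ai(2) by (auto simp: indicator_def intro!: ennreal_leI)
  qed
  also have "\<dots> < \<infinity>" using int unfolding set_integrable_def integrable_iff_bounded by auto
  finally have "ennreal \<bar>a i\<bar> * emeasure lborel (A i) < \<infinity>" using Ai by (simp add: nn_integral_cmult_indicator)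
  then show ?thesis using i(2) by (auto simp: ennreal_mult_less_top)
qed

text \<open>Only the product of the measures is bounded: a cell of infinite measure may be paired
  with a null cell. Such terms vanish almost everywhere but not identically, which is why
  \<open>reduce2\<close> is an almost sure statement.\<close>

lemma elem2_coeff_finite:
  assumes A: "disjoint_borel_sets m A"
    and int: "set_integrable lborel ({0..} \<times> {0..}) (\<lambda>(x, y). elem_fun2 m A a x y)"
    and ij: "i < m" "j < m" "a i j \<noteq> 0"
  shows "emeasure lborel (A i) * emeasure lborel (A j) < \<infinity>"
proof -
  have dis: "disjoint_family_on A {..<m}" and Am: "\<And>i. i < m \<Longrightarrow> A i \<in> sets borel \<and> A i \<subseteq> {0..}"
    using A by (auto simp: disjoint_borel_sets_def)
  have dis2: "disjoint_family_on (\<lambda>(k, l). A k \<times> A l) ({..<m} \<times> {..<m})"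
    using dis unfolding disjoint_family_on_def by (auto 4 4)
  have "(\<integral>\<^sup>+z. ennreal \<bar>a i j\<bar> * indicator (A i \<times> A j) z \<partial>lborel)
     \<le> (\<integral>\<^sup>+z. ennreal (norm (indicator ({0..} \<times> {0..}) z *\<^sub>R (case z of (x, y) \<Rightarrow> elem_fun2 m A a x y))) \<partial>lborel)"
  proof (intro nn_integral_mono)
    fix z :: "real \<times> real"
    obtain x y where z: "z = (x, y)" by force
    have "elem_fun2 m A a x y = (\<Sum>q\<in>{..<m} \<times> {..<m}. (case q of (k, l) \<Rightarrow> a k l) * indicator (case q of (k, l) \<Rightarrow> A k \<times> A l) (x, y))"
      by (simp only: elem_fun2_def sum.cartesian_product case_prod_unfold)
    then have "\<bar>elem_fun2 m A a x y\<bar> = (\<Sum>q\<in>{..<m} \<times> {..<m}. \<bar>case q of (k, l) \<Rightarrow> a k l\<bar> * indicator (case q of (k, l) \<Rightarrow> A k \<times> A l) (x, y))"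
      using abs_sum_indicator_disjoint[OF _ dis2] by simp
    then have "\<bar>a i j\<bar> * indicator (A i \<times> A j) (x, y) \<le> \<bar>elem_fun2 m A a x y\<bar>"
      using member_le_sum[of "(i, j)" "{..<m} \<times> {..<m}" "\<lambda>q. \<bar>case q of (k, l) \<Rightarrow> a k l\<bar> * indicator (case q of (k, l) \<Rightarrow> A k \<times> A l) (x, y)"] ij
      by auto
    moreover have "A i \<times> A j \<subseteq> {0..} \<times> {0..}" using Am ij by auto
    ultimately show "ennreal \<bar>a i j\<bar> * indicator (A i \<times> A j) z
       \<le> ennreal (norm (indicator ({0..} \<times> {0..}) z *\<^sub>R (case z of (x, y) \<Rightarrow> elem_fun2 m A a x y)))"
      unfolding z by (auto simp: indicator_def intro!: ennreal_leI)
  qed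
  also have "\<dots> < \<infinity>" using int unfolding set_integrable_def integrable_iff_bounded by auto
  finally have "ennreal \<bar>a i j\<bar> * emeasure lborel (A i \<times> A j) < \<infinity>"
    using Am ij by (simp add: nn_integral_cmult_indicator borel_Times)
  moreover have "emeasure (lborel :: (real \<times> real) measure) (A i \<times> A j) = emeasure lborel (A i) * emeasure lborel (A j)"
    unfolding lborel_prod[symmetric] using Am ij by (intro lborel.emeasure_pair_measure_Times) auto
  ultimately show ?thesis using ij(3) by (auto simp: ennreal_mult_less_top[of "ennreal _"])
qed

context poisson_proc
begin

lemma reduce1:
  assumes A: "disjoint_borel_sets m A" and int: "set_integrable lborel {0..} (elem_fun1 m A a)"
  shows "elem_int1 S m A a \<omega> = lin1 {..<m} (fin_cells A) a (Nr \<omega>)"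
    and "elem_fun1 m A a x = lin1 {..<m} (fin_cells A) a (\<lambda>X. indicator X x)"
proof -
  have *: "a i = 0 \<or> fin_cells A i = A i" if "i < m" for i
    using elem1_coeff_finite[OF A int that] by (auto simp: fin_cells_def)
  show "elem_int1 S m A a \<omega> = lin1 {..<m} (fin_cells A) a (Nr \<omega>)"
    unfolding elem_int1_def lin1_def using * by (intro sum.cong refl) fastforce
  show "elem_fun1 m A a x = lin1 {..<m} (fin_cells A) a (\<lambda>X. indicator X x)"
    unfolding elem_fun1_def lin1_def using * by (intro sum.cong refl) fastforce
qed

lemma reduce2:
  assumes A: "disjoint_borel_sets m A"
    and int: "set_integrable lborel ({0..} \<times> {0..}) (\<lambda>(x, y). elem_fun2 m A a x y)"
  shows "AE \<omega> in P. elem_int2 S m A a \<omega> = lin2 {..<m} (fin_cells A) a (Nr \<omega>) (Nr \<omega>)"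
    and "AE z in lborel. elem_fun2 m A a (fst z) (snd z) = lin2 {..<m} (fin_cells A) a (\<lambda>X. indicator X (fst z)) (\<lambda>X. indicator X (snd z))"
proof -
  have Am: "\<And>i. i < m \<Longrightarrow> A i \<in> sets borel \<and> A i \<subseteq> {0..}" using A by (auto simp: disjoint_borel_sets_def)
  \<comment> \<open>Stated for abstract \<nu> and \<nu>', so that one case distinction covers both
    the counts and the indicators, each of which vanishes on null cells outside a null set.\<close>
  have key: "a i j * \<nu> (A i) * \<nu>' (A j) = a i j * \<nu> (fin_cells A i) * \<nu>' (fin_cells A j)"
    if ij: "i < m" "j < m"
      and \<nu>: "\<And>k. k < m \<Longrightarrow> emeasure lborel (A k) = 0 \<Longrightarrow> \<nu> (A k) = 0 \<and> \<nu>' (A k) = 0" and e: "\<nu> {} = 0" "\<nu>' {} = 0"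
    for i j and \<nu> \<nu>' :: "real set \<Rightarrow> real"
  proof (cases "a i j = 0")
    case False
    then have f: "emeasure lborel (A i) * emeasure lborel (A j) < \<infinity>" using elem2_coeff_finite[OF A int ij] by simp
    then consider "emeasure lborel (A i) < \<infinity>" "emeasure lborel (A j) < \<infinity>"
      | "emeasure lborel (A i) = 0" | "emeasure lborel (A j) = 0"
      by (auto simp: ennreal_mult_less_top)
    then show ?thesis
    proof cases
      case 1 then show ?thesis by (simp add: fin_cells_def)
    next
      case 2 then show ?thesis using \<nu>[OF ij(1)] by (simp add: fin_cells_def)
    next
      case 3 then show ?thesis using \<nu>[OF ij(2)] by (simp add: fin_cells_def)
    qed
  qed simp
  have "AE \<omega> in P. \<forall>k\<in>{k\<in>{..<m}. emeasure lborel (A k) = 0}. N (A k) \<omega> = 0"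
    using Am by (intro AE_finite_allI AE_N_null) auto
  then show "AE \<omega> in P. elem_int2 S m A a \<omega> = lin2 {..<m} (fin_cells A) a (Nr \<omega>) (Nr \<omega>)"
  proof eventually_elim
    case (elim \<omega>)
    show ?case unfolding elem_int2_def lin2_def
      by (intro sum.cong refl key) (use elim in \<open>auto simp: num_points_def\<close>)
  qed
  have "AE z in lborel \<Otimes>\<^sub>M lborel. \<forall>k\<in>{k\<in>{..<m}. emeasure lborel (A k) = 0}. fst z \<notin> A k \<and> snd z \<notin> A k"
  proof (intro AE_finite_allI)
    fix k assume "k \<in> {k\<in>{..<m}. emeasure lborel (A k) = 0}"
    then have k: "A k \<in> sets borel" "A k \<in> null_sets lborel" using Am by (auto simp: null_sets_def)
    note [measurable] = k(1)
    show "AE z in lborel \<Otimes>\<^sub>M lborel. fst z \<notin> A k \<and> snd z \<notin> A k"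
    proof (rule lborel_pair.AE_pair_measure)
      show "AE x in lborel. AE y in lborel. fst (x, y) \<notin> A k \<and> snd (x, y) \<notin> A k"
        using AE_not_in[OF k(2)]
      proof eventually_elim
        case (elim x)
        show ?case using AE_not_in[OF k(2)] by eventually_elim (use elim in auto)
      qed
    qed measurable
  qed simp
  then have "AE z in lborel. \<forall>k\<in>{k\<in>{..<m}. emeasure lborel (A k) = 0}. fst z \<notin> A k \<and> snd z \<notin> A k"
    unfolding lborel_prod .
  then show "AE z in lborel. elem_fun2 m A a (fst z) (snd z) = lin2 {..<m} (fin_cells A) a (\<lambda>X. indicator X (fst z)) (\<lambda>X. indicator X (snd z))"
  proof eventually_elim
    case (elim z)
    show ?case unfolding elem_fun2_eq_lin2 unfolding lin2_def
      by (intro sum.cong refl key) (use elim in auto)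
  qed
qed

lemma Nr_integrable:
  assumes "A \<in> sets borel" "A \<subseteq> {0..}" "emeasure lborel A < \<infinity>"
  shows "integrable P (\<lambda>\<omega>. Nr \<omega> A)"
proof (rule integrableI_bounded)
  have "(\<integral>\<^sup>+\<omega>. ennreal (norm (Nr \<omega> A)) \<partial>P) = emeasure lborel A"
    using nn_integral_N[OF assms] by (simp add: ennreal_of_nat_eq_real_of_nat)
  then show "(\<integral>\<^sup>+\<omega>. ennreal (norm (Nr \<omega> A)) \<partial>P) < \<infinity>" using assms(3) by simp
qed (rule Nr_measurable[OF assms])

lemma Nr_mult_integrable:
  assumes A: "A \<in> sets borel" "A \<subseteq> {0..}" "emeasure lborel A < \<infinity>"
    and B: "B \<in> sets borel" "B \<subseteq> {0..}" "emeasure lborel B < \<infinity>" and "A \<inter> B = {}"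
  shows "integrable P (\<lambda>\<omega>. Nr \<omega> A * Nr \<omega> B)"
proof (rule integrableI_bounded)
  have "(\<integral>\<^sup>+\<omega>. ennreal (norm (Nr \<omega> A * Nr \<omega> B)) \<partial>P) = emeasure lborel A * emeasure lborel B"
    using nn_integral_N_mult[OF assms] by (simp add: ennreal_of_nat_eq_real_of_nat ennreal_mult)
  then show "(\<integral>\<^sup>+\<omega>. ennreal (norm (Nr \<omega> A * Nr \<omega> B)) \<partial>P) < \<infinity>" using A(3) B(3) by (simp add: ennreal_mult_less_top)
qed (intro borel_measurable_times Nr_measurable A B)

lemma lin1_integrable: "fin_part K C \<Longrightarrow> integrable P (\<lambda>\<omega>. lin1 K C c (Nr \<omega>))"
  unfolding lin1_def
  by (intro Bochner_Integration.integrable_sum integrable_mult_right Nr_integrable) (auto simp: fin_part_def)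

lemma lin2_integrable:
  assumes K: "fin_part K C" and diag: "\<And>k. k \<in> K \<Longrightarrow> c k k = 0"
  shows "integrable P (\<lambda>\<omega>. lin2 K C c (Nr \<omega>) (Nr \<omega>))"
  unfolding lin2_def
proof (intro Bochner_Integration.integrable_sum)
  fix k l assume kl: "k \<in> K" "l \<in> K"
  show "integrable P (\<lambda>\<omega>. c k l * Nr \<omega> (C k) * Nr \<omega> (C l))"
  proof (cases "k = l")
    case False
    then have "C k \<inter> C l = {}" using K kl by (auto simp: fin_part_def disjoint_family_on_def)
    then have "integrable P (\<lambda>\<omega>. c k l * (Nr \<omega> (C k) * Nr \<omega> (C l)))"
      using K kl by (intro integrable_mult_right Nr_mult_integrable) (auto simp: fin_part_def)
    then show ?thesis by (simp add: mult.assoc)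
  qed (use diag kl in simp)
qed

lemma LINT_tendsto_nn:
  fixes g :: "nat \<Rightarrow> 'b \<Rightarrow> real"
  assumes "\<And>n. integrable M (g n)" "(\<lambda>n. LINT x|M. \<bar>g n x\<bar>) \<longlonglongrightarrow> 0"
  shows "(\<lambda>n. \<integral>\<^sup>+x. ennreal \<bar>g n x\<bar> \<partial>M) \<longlonglongrightarrow> 0"
proof -
  have "(\<integral>\<^sup>+x. ennreal \<bar>g n x\<bar> \<partial>M) = ennreal (LINT x|M. \<bar>g n x\<bar>)" for n
    using assms(1) by (intro nn_integral_eq_integral integrable_abs) auto
  then show ?thesis using tendsto_ennrealI[OF assms(2)] by simp
qed

text \<open>Mesh width 1 / (l + 1) with (l + 1)^2 cells reaches up to l + 1: the mesh refines and
  exhausts the half-line at once.\<close>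

lemma mesh_limits:
  "(\<lambda>l. 1 / real (Suc l)) \<longlonglongrightarrow> 0" "filterlim (\<lambda>l. real ((Suc l)\<^sup>2) * (1 / real (Suc l))) at_top sequentially"
proof -
  show "(\<lambda>l. 1 / real (Suc l)) \<longlonglongrightarrow> 0" by (rule LIMSEQ_Suc[OF lim_1_over_n])
  have "real (k\<^sup>2) * (1 / real k) = real k" if "0 < k" for k
    using that by (simp add: power2_eq_square)
  then have "real ((Suc l)\<^sup>2) * (1 / real (Suc l)) = real (Suc l)" for l by blast
  moreover have "filterlim (\<lambda>l. real (Suc l)) at_top sequentially"
    by (rule filterlim_compose[OF filterlim_real_sequentially filterlim_Suc])
  ultimately show "filterlim (\<lambda>l. real ((Suc l)\<^sup>2) * (1 / real (Suc l))) at_top sequentially" by simp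
qed

text \<open>\<open>stoch_int1\<close> is a choice by \<open>SOME\<close>, so it has the defining
  property only once some limit exists. The contraction \<open>lin1_contract\<close> is extended by
  density, with averages over the mesh as reference sequence; \<open>reduce1\<close> removes the
  infinite cells, so the extension covers every sequence that the definition admits.\<close>

theorem is_stoch_int1_exists:
  assumes f: "set_integrable lborel {0..} f"
  shows "is_stoch_int1 P S f (stoch_int1 P S f)"
proof -
  define g where "g = (\<lambda>x. indicator {0..} x * f x :: real)"
  have g: "integrable lborel g" using f by (simp add: g_def set_integrable_def)
  define D where "D = {(m::nat, A :: nat \<Rightarrow> real set, a :: nat \<Rightarrow> real). fin_part {..<m} A}"
  define T where "T = (\<lambda>(m::nat, A, a) \<omega>. lin1 {..<m} A a (Nr \<omega>))"
  define F where "F = (\<lambda>(m::nat, A, a) x. lin1 {..<m} A a (\<lambda>X. indicator X x :: real))"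
  define p where "p = (\<lambda>l. 1 / real (Suc l))"
  have p: "0 < p l" for l by (simp add: p_def)
  define a0 where "a0 = (\<lambda>l u. (LINT y:vcell (p l) u|lborel. g y) / measure lborel (vcell (p l) u))"
  define s0 where "s0 = (\<lambda>l. (Suc ((Suc l)\<^sup>2), vcell (p l), a0 l))"
  have s0F: "F (s0 l) x = avg {1..(Suc l)\<^sup>2} (vcell (p l)) g x" for l x
    unfolding F_def s0_def case_prod_conv elem_fun1_eq_lin1[symmetric] elem_fun1_vcell[OF p] avg_def a0_def ..
  have Fm: "F s \<in> borel_measurable lborel" if "s \<in> D" for s
  proof -
    obtain m A a where s: "s = (m, A, a)" by (cases s)
    have "A i \<in> sets borel" if "i < m" for i using \<open>s \<in> D\<close> that by (auto simp: D_def s fin_part_def)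
    then show ?thesis
      unfolding s F_def case_prod_conv lin1_def by (intro borel_measurable_sum borel_measurable_times) auto
  qed
  have F0: "F s x = 0" if "s \<in> D" "x \<notin> {0..}" for s x
    using that lin1_outside by (auto simp: D_def F_def)
  obtain I where I: "integrable P I"
    "\<And>s. (\<And>l. s l \<in> D) \<Longrightarrow> (\<lambda>l. \<integral>\<^sup>+x. ennreal \<bar>F (s l) x - g x\<bar> \<partial>lborel) \<longlonglongrightarrow> 0 \<Longrightarrow>
       (\<lambda>l. \<integral>\<^sup>+\<omega>. ennreal \<bar>T (s l) \<omega> - I \<omega>\<bar> \<partial>P) \<longlonglongrightarrow> 0"
  proof (rule L1_extension[of D P T F lborel g s0])
    show "integrable P (T s)" if "s \<in> D" for s
      using that lin1_integrable by (auto simp: D_def T_def)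
    show "(\<integral>\<^sup>+\<omega>. ennreal \<bar>T s \<omega> - T s' \<omega>\<bar> \<partial>P) \<le> (\<integral>\<^sup>+x. ennreal \<bar>F s x - F s' x\<bar> \<partial>lborel)"
      if "s \<in> D" "s' \<in> D" for s s'
      using that lin1_contract by (auto simp: D_def T_def F_def)
    show "s0 l \<in> D" for l using fin_part_vcell[OF p] by (simp add: s0_def D_def)
    have "(\<lambda>l. LINT x|lborel. \<bar>avg {1..(Suc l)\<^sup>2} (vcell (p l)) g x - g x\<bar>) \<longlonglongrightarrow> 0"
      using mesh_limits by (intro avg_vcell_tendsto g) (auto simp: p_def g_def)
    then show "(\<lambda>l. \<integral>\<^sup>+x. ennreal \<bar>F (s0 l) x - g x\<bar> \<partial>lborel) \<longlonglongrightarrow> 0"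
      unfolding s0F by (intro LINT_tendsto_nn Bochner_Integration.integrable_diff g avg_integrable cells_vcell p)
  qed (use Fm g in auto)
  have "is_stoch_int1 P S f I"
    unfolding is_stoch_int1_def
  proof (intro conjI allI impI I(1))
    fix m :: "nat \<Rightarrow> nat" and A a
    assume A: "\<forall>l. disjoint_borel_sets (m l) (A l) \<and> set_integrable lborel {0..} (elem_fun1 (m l) (A l) (a l))"
      and lim: "(\<lambda>l. \<integral>\<^sup>+x\<in>{0..}. ennreal \<bar>elem_fun1 (m l) (A l) (a l) x - f x\<bar> \<partial>lborel) \<longlonglongrightarrow> 0"
    define s where "s = (\<lambda>l. (m l, fin_cells (A l), a l))"
    have sD: "s l \<in> D" for l using A fin_part_fin_cells by (simp add: s_def D_def)
    have "(\<integral>\<^sup>+x. ennreal \<bar>F (s l) x - g x\<bar> \<partial>lborel) = (\<integral>\<^sup>+x\<in>{0..}. ennreal \<bar>elem_fun1 (m l) (A l) (a l) x - f x\<bar> \<partial>lborel)" for l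
    proof (intro nn_integral_cong)
      fix x :: real
      show "ennreal \<bar>F (s l) x - g x\<bar> = ennreal \<bar>elem_fun1 (m l) (A l) (a l) x - f x\<bar> * indicator {0..} x"
      proof (cases "x \<in> {0..}")
        case True
        have "elem_fun1 (m l) (A l) (a l) x = F (s l) x"
          using reduce1(2)[of "m l" "A l" "a l" x] A by (simp add: F_def s_def)
        then show ?thesis using True by (simp add: g_def)
      qed (use F0[OF sD] in \<open>simp add: g_def\<close>)
    qed
    then have "(\<lambda>l. \<integral>\<^sup>+\<omega>. ennreal \<bar>T (s l) \<omega> - I \<omega>\<bar> \<partial>P) \<longlonglongrightarrow> 0"
      using lim by (intro I(2) sD) simp
    moreover have "elem_int1 S (m l) (A l) (a l) \<omega> = T (s l) \<omega>" for l \<omega>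
      using reduce1(1)[of "m l" "A l" "a l" \<omega>] A by (simp add: T_def s_def)
    ultimately show "(\<lambda>l. \<integral>\<^sup>+\<omega>. ennreal \<bar>elem_int1 S (m l) (A l) (a l) \<omega> - I \<omega>\<bar> \<partial>P) \<longlonglongrightarrow> 0" by simp
  qed
  then show ?thesis unfolding stoch_int1_def by (rule someI[of "is_stoch_int1 P S f"])
qed

text \<open>As in one variable, with two changes: the reference coefficients are set to 0 on the
  diagonal, and elementary integrals agree with their reductions only almost surely.\<close>

theorem is_stoch_int2_exists:
  assumes f: "set_integrable lborel ({0..} \<times> {0..}) (\<lambda>z. f (fst z) (snd z))"
  shows "is_stoch_int2 P S f (stoch_int2 P S f)"
proof -
  define g where "g = (\<lambda>z. indicator ({0..} \<times> {0..}) z * f (fst z) (snd z) :: real)"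
  have g: "integrable lborel g" using f by (simp add: g_def set_integrable_def)
  define D where "D = {(m::nat, A :: nat \<Rightarrow> real set, a :: nat \<Rightarrow> nat \<Rightarrow> real). fin_part {..<m} A \<and> (\<forall>i. a i i = 0)}"
  define T where "T = (\<lambda>(m::nat, A, a) \<omega>. lin2 {..<m} A a (Nr \<omega>) (Nr \<omega>))"
  define F where "F = (\<lambda>(m::nat, A, a) z. lin2 {..<m} A a (\<lambda>X. indicator X (fst z) :: real) (\<lambda>X. indicator X (snd z)))"
  define p where "p = (\<lambda>l. 1 / real (Suc l))"
  have p: "0 < p l" for l by (simp add: p_def)
  define a0 where "a0 = (\<lambda>l u v. if u = v then 0 else (LINT y:vcell2 (p l) (u, v)|lborel. g y) / measure lborel (vcell2 (p l) (u, v)))"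
  define s0 where "s0 = (\<lambda>l. (Suc ((Suc l)\<^sup>2), vcell (p l), a0 l))"
  have s0F: "F (s0 l) z = avg (offdiag ((Suc l)\<^sup>2)) (vcell2 (p l)) g z" for l z
  proof -
    have "F (s0 l) z = elem_fun2 (Suc ((Suc l)\<^sup>2)) (vcell (p l)) (a0 l) (fst z) (snd z)"
      by (simp add: F_def s0_def elem_fun2_eq_lin2)
    also have "\<dots> = (\<Sum>i\<in>offdiag ((Suc l)\<^sup>2). a0 l (fst i) (snd i) * indicator (vcell2 (p l) i) (fst z, snd z))"
      by (rule elem_fun2_vcell[OF p]) (simp add: a0_def)
    also have "\<dots> = avg (offdiag ((Suc l)\<^sup>2)) (vcell2 (p l)) g z"
      unfolding avg_def by (intro sum.cong refl) (auto simp: a0_def offdiag_def)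
    finally show ?thesis .
  qed
  have Fm: "F s \<in> borel_measurable lborel" if "s \<in> D" for s
  proof -
    obtain m A a where s: "s = (m, A, a)" by (cases s)
    have "A i \<in> sets borel" if "i < m" for i using \<open>s \<in> D\<close> that by (auto simp: D_def s fin_part_def)
    then have "(\<lambda>z. indicator (A i) (fst z) :: real) \<in> borel_measurable (borel \<Otimes>\<^sub>M borel)"
      "(\<lambda>z. indicator (A i) (snd z) :: real) \<in> borel_measurable (borel \<Otimes>\<^sub>M borel)" if "i < m" for i
      using that by (auto intro!: measurable_compose[OF measurable_fst] measurable_compose[OF measurable_snd] borel_measurable_indicator)
    then have "F s \<in> borel_measurable (borel \<Otimes>\<^sub>M borel)"
      unfolding s F_def case_prod_conv lin2_def by (intro borel_measurable_sum borel_measurable_times) auto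
    then show ?thesis by (simp add: borel_prod)
  qed
  have F0: "F s z = 0" if "s \<in> D" "z \<notin> {0..} \<times> {0..}" for s z
  proof -
    obtain m A a where s: "s = (m, A, a)" by (cases s)
    have "fin_part {..<m} A" using that(1) by (simp add: s D_def)
    then show ?thesis unfolding s F_def case_prod_conv by (rule lin2_outside[OF _ that(2)])
  qed
  obtain I where I: "integrable P I"
    "\<And>s. (\<And>l. s l \<in> D) \<Longrightarrow> (\<lambda>l. \<integral>\<^sup>+x. ennreal \<bar>F (s l) x - g x\<bar> \<partial>lborel) \<longlonglongrightarrow> 0 \<Longrightarrow>
       (\<lambda>l. \<integral>\<^sup>+\<omega>. ennreal \<bar>T (s l) \<omega> - I \<omega>\<bar> \<partial>P) \<longlonglongrightarrow> 0"
  proof (rule L1_extension[of D P T F lborel g s0])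
    show "integrable P (T s)" if "s \<in> D" for s
      using that by (auto simp: D_def T_def intro!: lin2_integrable)
    show "(\<integral>\<^sup>+\<omega>. ennreal \<bar>T s \<omega> - T s' \<omega>\<bar> \<partial>P) \<le> (\<integral>\<^sup>+x. ennreal \<bar>F s x - F s' x\<bar> \<partial>lborel)"
      if "s \<in> D" "s' \<in> D" for s s'
      using that by (auto simp: D_def T_def F_def intro!: lin2_contract)
    show "s0 l \<in> D" for l using fin_part_vcell[OF p] by (simp add: s0_def D_def a0_def)
    have "(\<lambda>l. LINT x|lborel. \<bar>avg (offdiag ((Suc l)\<^sup>2)) (vcell2 (p l)) g x - g x\<bar>) \<longlonglongrightarrow> 0"
      using mesh_limits by (intro avg_vcell2_tendsto g) (auto simp: p_def g_def indicator_def)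
    then show "(\<lambda>l. \<integral>\<^sup>+x. ennreal \<bar>F (s0 l) x - g x\<bar> \<partial>lborel) \<longlonglongrightarrow> 0"
      unfolding s0F by (intro LINT_tendsto_nn Bochner_Integration.integrable_diff g avg_integrable cells_vcell2 p)
  qed (use Fm g in auto)
  have "is_stoch_int2 P S f I"
    unfolding is_stoch_int2_def
  proof (intro conjI allI impI I(1))
    fix m :: "nat \<Rightarrow> nat" and A a
    assume A: "\<forall>l. disjoint_borel_sets (m l) (A l) \<and> (\<forall>i. a l i i = 0) \<and>
        set_integrable lborel ({0..} \<times> {0..}) (\<lambda>(x, y). elem_fun2 (m l) (A l) (a l) x y)"
      and lim: "(\<lambda>l. \<integral>\<^sup>+z\<in>{0..} \<times> {0..}. ennreal \<bar>elem_fun2 (m l) (A l) (a l) (fst z) (snd z) - f (fst z) (snd z)\<bar> \<partial>lborel) \<longlonglongrightarrow> 0"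
    define s where "s = (\<lambda>l. (m l, fin_cells (A l), a l))"
    have sD: "s l \<in> D" for l using A fin_part_fin_cells by (simp add: s_def D_def)
    have "(\<integral>\<^sup>+z. ennreal \<bar>F (s l) z - g z\<bar> \<partial>lborel)
       = (\<integral>\<^sup>+z\<in>{0..} \<times> {0..}. ennreal \<bar>elem_fun2 (m l) (A l) (a l) (fst z) (snd z) - f (fst z) (snd z)\<bar> \<partial>lborel)" for l
    proof (rule nn_integral_cong_AE)
      have "AE z in lborel. elem_fun2 (m l) (A l) (a l) (fst z) (snd z) = F (s l) z"
        using reduce2(2)[of "m l" "A l" "a l"] A by (simp add: F_def s_def)
      then show "AE z in lborel. ennreal \<bar>F (s l) z - g z\<bar>
          = ennreal \<bar>elem_fun2 (m l) (A l) (a l) (fst z) (snd z) - f (fst z) (snd z)\<bar> * indicator ({0..} \<times> {0..}) z"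
      proof eventually_elim
        case (elim z)
        show ?case
        proof (cases "z \<in> {0..} \<times> {0..}")
          case True
          then show ?thesis using elim by (simp add: g_def)
        next
          case False
          then show ?thesis using F0[OF sD] by (simp add: g_def)
        qed
      qed
    qed
    then have l: "(\<lambda>l. \<integral>\<^sup>+\<omega>. ennreal \<bar>T (s l) \<omega> - I \<omega>\<bar> \<partial>P) \<longlonglongrightarrow> 0"
      using lim by (intro I(2) sD) simp
    have "(\<integral>\<^sup>+\<omega>. ennreal \<bar>elem_int2 S (m l) (A l) (a l) \<omega> - I \<omega>\<bar> \<partial>P) = (\<integral>\<^sup>+\<omega>. ennreal \<bar>T (s l) \<omega> - I \<omega>\<bar> \<partial>P)" for l
    proof (rule nn_integral_cong_AE)
      have "AE \<omega> in P. elem_int2 S (m l) (A l) (a l) \<omega> = T (s l) \<omega>"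
        using reduce2(1)[of "m l" "A l" "a l"] A by (simp add: T_def s_def)
      then show "AE \<omega> in P. ennreal \<bar>elem_int2 S (m l) (A l) (a l) \<omega> - I \<omega>\<bar> = ennreal \<bar>T (s l) \<omega> - I \<omega>\<bar>"
        by eventually_elim simp
    qed
    then show "(\<lambda>l. \<integral>\<^sup>+\<omega>. ennreal \<bar>elem_int2 S (m l) (A l) (a l) \<omega> - I \<omega>\<bar> \<partial>P) \<longlonglongrightarrow> 0" using l by simp
  qed
  then show ?thesis unfolding stoch_int2_def by (rule someI[of "is_stoch_int2 P S f"])
qed

end

section \<open>Independent events as random subsets\<close>

lemma sum_pairs_twice:
  fixes f :: "'v set \<Rightarrow> real"
  assumes "finite A"
  shows "(\<Sum>u\<in>A. \<Sum>v\<in>A. if u = v then 0 else f {u, v}) = 2 * (\<Sum>e\<in>pairs A. f e)"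
  using assms
proof (induction A rule: finite_induct)
  case empty
  have "pairs ({} :: 'v set) = {}" by (auto simp: pairs_def)
  then show ?case by simp
next
  case (insert x A)
  have inj: "inj_on (\<lambda>w. {x, w}) A" by (auto simp: inj_on_def doubleton_eq_iff)
  have s1: "(\<Sum>v\<in>A. if x = v then 0 else f {x, v}) = (\<Sum>v\<in>A. f {x, v})"
    using insert by (intro sum.cong) auto
  have s2: "(\<Sum>u\<in>A. (if u = x then 0 else f {u, x}) + (\<Sum>v\<in>A. if u = v then 0 else f {u, v}))
     = (\<Sum>u\<in>A. f {x, u}) + (\<Sum>u\<in>A. \<Sum>v\<in>A. if u = v then 0 else f {u, v})"
    unfolding sum.distrib[symmetric] using insert by (intro sum.cong refl) (auto simp: insert_commute)
  have "(\<Sum>e\<in>pairs (insert x A). f e) = (\<Sum>e\<in>pairs A. f e) + (\<Sum>v\<in>A. f {x, v})"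
    unfolding pairs_insert(1)[OF insert(2,1)] using insert finite_pairs pairs_insert(2)[OF insert(2,1)]
    by (subst sum.union_disjoint) (auto simp: sum.reindex[OF inj])
  then show ?case using insert s1 s2 by simp
qed

text \<open>The events split the probability space into atoms indexed by the subsets T of
  \<open>V\<close>, and independence makes their probabilities the weights of \<open>bern\<close>.
  Both the given Bernoulli variables and the occupied cells of the Poisson process enter through
  this lemma.\<close>

lemma (in prob_space) indep_events_bern:
  fixes G :: "'i set \<Rightarrow> real"
  assumes V: "finite V" and ind: "indep_vars (\<lambda>_. M') X V"
    and B: "\<And>u. u \<in> V \<Longrightarrow> B u \<in> sets M'" and p: "\<And>u. u \<in> V \<Longrightarrow> prob (X u -` B u \<inter> space M) = p"
  shows "expectation (\<lambda>\<omega>. G {u \<in> V. X u \<omega> \<in> B u}) = bern p V G"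
    and "(\<lambda>\<omega>. G {u \<in> V. X u \<omega> \<in> B u}) \<in> borel_measurable M"
proof -
  have X: "X u \<in> measurable M M'" if "u \<in> V" for u using ind that by (auto simp: indep_vars_def)
  define A where "A = (\<lambda>T u. if u \<in> T then B u else space M' - B u)"
  define Ev where "Ev = (\<lambda>T. {\<omega> \<in> space M. {u \<in> V. X u \<omega> \<in> B u} = T})"
  have AS: "A T u \<in> sets M'" if "u \<in> V" for T u using B[OF that] by (auto simp: A_def)
  have Ev_eq: "Ev T = space M \<inter> (\<Inter>u\<in>V. X u -` A T u \<inter> space M)" if "T \<subseteq> V" for T
    using that measurable_space[OF X] by (fastforce simp: Ev_def A_def split: if_splits)
  have Ev_events: "Ev T \<in> events" if "T \<subseteq> V" for T
  proof (cases "V = {}")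
    case False
    then show ?thesis unfolding Ev_eq[OF that] using V AS X
      by (intro sets.Int sets.top sets.finite_INT measurable_sets) auto
  qed (use that in \<open>simp add: Ev_def\<close>)
  have Ev_prob: "prob (Ev T) = p ^ card T * (1 - p) ^ card (V - T)" if T: "T \<subseteq> V" for T
  proof (cases "V = {}")
    case True
    then show ?thesis using T by (simp add: Ev_def prob_space)
  next
    case False
    have "Ev T = (\<Inter>u\<in>V. X u -` A T u \<inter> space M)" using Ev_eq[OF T] False by auto
    then have "prob (Ev T) = (\<Prod>u\<in>V. prob (X u -` A T u \<inter> space M))"
      using indep_varsD_finite[OF ind False V AS] by simp
    also have "\<dots> = (\<Prod>u\<in>V. if u \<in> T then p else 1 - p)"
    proof (intro prod.cong refl)
      fix u assume u: "u \<in> V"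
      have "X u -` (space M' - B u) \<inter> space M = space M - (X u -` B u \<inter> space M)"
        using measurable_space[OF X[OF u]] by auto
      then have "prob (X u -` (space M' - B u) \<inter> space M) = 1 - p"
        using prob_compl[OF measurable_sets[OF X[OF u] B[OF u]]] p[OF u] by simp
      then show "prob (X u -` A T u \<inter> space M) = (if u \<in> T then p else 1 - p)"
        using p[OF u] by (simp add: A_def)
    qed
    also have "\<dots> = p ^ card T * (1 - p) ^ card (V - T)"
    proof -
      have "{x \<in> V. x \<in> T} = T" "{x \<in> V. x \<notin> T} = V - T" using T by auto
      then show ?thesis using V by (simp add: prod.If_cases Int_def)
    qed
    finally show ?thesis .
  qed
  have rep: "G {u \<in> V. X u \<omega> \<in> B u} = (\<Sum>T\<in>Pow V. G T * indicator (Ev T) \<omega>)" if "\<omega> \<in> space M" for \<omega>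
  proof -
    have "(\<Sum>T\<in>Pow V. G T * indicator (Ev T) \<omega>)
       = (\<Sum>T\<in>Pow V. if T = {u \<in> V. X u \<omega> \<in> B u} then G T else 0)"
      using that by (intro sum.cong refl) (auto simp: Ev_def indicator_def)
    also have "\<dots> = G {u \<in> V. X u \<omega> \<in> B u}"
      using V by (subst sum.delta) auto
    finally show ?thesis by simp
  qed
  have m: "(\<lambda>\<omega>. \<Sum>T\<in>Pow V. G T * indicator (Ev T) \<omega>) \<in> borel_measurable M"
    using Ev_events by (intro borel_measurable_sum borel_measurable_times borel_measurable_indicator) auto
  then show "(\<lambda>\<omega>. G {u \<in> V. X u \<omega> \<in> B u}) \<in> borel_measurable M"
    by (subst measurable_cong[OF rep]) auto
  have "expectation (\<lambda>\<omega>. G {u \<in> V. X u \<omega> \<in> B u}) = expectation (\<lambda>\<omega>. \<Sum>T\<in>Pow V. G T * indicator (Ev T) \<omega>)"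
    by (rule Bochner_Integration.integral_cong[OF refl rep])
  also have "\<dots> = (\<Sum>T\<in>Pow V. expectation (\<lambda>\<omega>. G T * indicator (Ev T) \<omega>))"
    using Ev_events by (intro Bochner_Integration.integral_sum integrable_mult_right integrable_real_indicator)
      (auto simp: emeasure_eq_measure)
  also have "\<dots> = (\<Sum>T\<in>Pow V. G T * prob (Ev T))"
    using Ev_events sets.sets_into_space by (intro sum.cong refl) (simp add: Int_absorb2)
  also have "\<dots> = bern p V G" unfolding bern_def using Ev_prob by (intro sum.cong refl) (simp add: mult_ac)
  finally show "expectation (\<lambda>\<omega>. G {u \<in> V. X u \<omega> \<in> B u}) = bern p V G" .
qed

lemma edge_count_eq_card:
  assumes E: "simple_graph n E" and X: "\<And>v. v \<in> {1..n} \<Longrightarrow> X v \<omega> = 0 \<or> X v \<omega> = 1"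
  shows "edge_count_stat n E X \<omega> = real (card {e \<in> E. e \<subseteq> {u \<in> {1..n}. X u \<omega> = 1}})"
proof -
  define A where "A = {u \<in> {1..n}. X u \<omega> = 1}"
  have finA: "finite A" by (simp add: A_def)
  have "(\<Sum>u=1..n. \<Sum>v=1..n. adj E u v * X u \<omega> * X v \<omega>) = (\<Sum>u\<in>A. \<Sum>v\<in>A. adj E u v)"
  proof -
    have "X v \<omega> = of_bool (v \<in> A)" if "v \<in> {1..n}" for v using X[OF that] that by (auto simp: A_def)
    then have "(\<Sum>u=1..n. \<Sum>v=1..n. adj E u v * X u \<omega> * X v \<omega>)
       = (\<Sum>u=1..n. \<Sum>v=1..n. adj E u v * of_bool (u \<in> A) * of_bool (v \<in> A))"
      by (intro sum.cong refl) simp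
    also have "\<dots> = (\<Sum>u=1..n. \<Sum>v\<in>A. adj E u v * of_bool (u \<in> A))"
      by (intro sum.cong refl sum.mono_neutral_cong_right) (auto simp: A_def)
    also have "\<dots> = (\<Sum>u\<in>A. \<Sum>v\<in>A. adj E u v)"
      by (intro sum.mono_neutral_cong_right) (auto simp: A_def)
    finally show ?thesis .
  qed
  also have "\<dots> = (\<Sum>u\<in>A. \<Sum>v\<in>A. if u = v then 0 else of_bool ({u, v} \<in> E))"
  proof (intro sum.cong refl)
    fix u v
    have "{u} \<notin> E" using E by (auto simp: simple_graph_def)
    then show "adj E u v = (if u = v then 0 else of_bool ({u, v} \<in> E))" by (auto simp: adj_def)
  qed
  also have "\<dots> = 2 * (\<Sum>e\<in>pairs A. of_bool (e \<in> E))" by (rule sum_pairs_twice[OF finA])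
  also have "(\<Sum>e\<in>pairs A. of_bool (e \<in> E) :: real) = (\<Sum>e\<in>{e \<in> E. e \<subseteq> A}. 1)"
    using E finite_pairs[OF finA] by (intro sum.mono_neutral_cong_right) (auto simp: simple_graph_def pairs_def)
  finally show ?thesis by (simp add: edge_count_stat_def A_def)
qed

lemma (in prob_space) edge_count_bern:
  assumes ind: "indep_vars (\<lambda>_. borel) X {1..n}" and p: "0 \<le> p" "p \<le> 1"
    and Ber: "\<And>v. v \<in> {1..n} \<Longrightarrow> distr M borel (X v) = distr (measure_pmf (bernoulli_pmf p)) borel of_bool"
    and E: "simple_graph n E" and f: "f \<in> borel_measurable borel"
  shows "expectation (\<lambda>\<omega>. f (edge_count_stat n E X \<omega>)) = bern p {1..n} (\<lambda>A. f (real (card {e \<in> E. e \<subseteq> A})) :: real)"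
    and "edge_count_stat n E X \<in> borel_measurable M"
proof -
  have X: "X v \<in> borel_measurable M" if "v \<in> {1..n}" for v using ind that by (auto simp: indep_vars_def)
  have prob: "prob (X v -` B \<inter> space M) = measure_pmf.prob (bernoulli_pmf p) {b. of_bool b \<in> B}"
    if "v \<in> {1..n}" "B \<in> sets borel" for v B
  proof -
    have "prob (X v -` B \<inter> space M) = measure (distr M borel (X v)) B"
      using X[OF that(1)] that(2) by (simp add: measure_distr)
    also have "\<dots> = measure_pmf.prob (bernoulli_pmf p) {b. of_bool b \<in> B}"
      unfolding Ber[OF that(1)] using that(2) by (subst measure_distr) (auto simp: vimage_def)
    finally show ?thesis .
  qed
  have p1: "prob (X v -` {1} \<inter> space M) = p" if "v \<in> {1..n}" for v
  proof -
    have "{b. of_bool b \<in> {1::real}} = {True}" by auto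
    then show ?thesis using prob[OF that, of "{1}"] p by (simp add: measure_pmf_single)
  qed
  \<comment> \<open>Only the law of \<open>X v\<close> is given, so the values are 0 or 1 merely
    almost surely, and the statistic is an edge count almost surely.\<close>
  have ae: "AE \<omega> in M. X v \<omega> = 0 \<or> X v \<omega> = 1" if "v \<in> {1..n}" for v
  proof -
    have "{b. of_bool b \<in> {0::real, 1}} = UNIV" by auto
    then have "prob (X v -` {0, 1} \<inter> space M) = 1" using prob[OF that, of "{0, 1}"] by simp
    then have "AE \<omega> in M. \<omega> \<in> X v -` {0, 1} \<inter> space M"
      using X[OF that] by (subst (asm) prob_eq_1) auto
    then show ?thesis by eventually_elim auto
  qed
  have all: "AE \<omega> in M. \<forall>v\<in>{1..n}. X v \<omega> = 0 \<or> X v \<omega> = 1" using ae by (intro AE_finite_allI) auto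
  show m: "edge_count_stat n E X \<in> borel_measurable M"
    unfolding edge_count_stat_def using X by (intro borel_measurable_times borel_measurable_sum) auto
  define G where "G = (\<lambda>A. f (real (card {e \<in> E. e \<subseteq> A})))"
  note b = indep_events_bern[OF _ ind, of "\<lambda>_. {1}" p G]
  have "expectation (\<lambda>\<omega>. f (edge_count_stat n E X \<omega>)) = expectation (\<lambda>\<omega>. G {u \<in> {1..n}. X u \<omega> \<in> {1}})"
  proof (rule integral_cong_AE)
    show "(\<lambda>\<omega>. f (edge_count_stat n E X \<omega>)) \<in> borel_measurable M" using m f by simp
    show "(\<lambda>\<omega>. G {u \<in> {1..n}. X u \<omega> \<in> {1}}) \<in> borel_measurable M" using p1 by (intro b(2)) auto
    show "AE \<omega> in M. f (edge_count_stat n E X \<omega>) = G {u \<in> {1..n}. X u \<omega> \<in> {1}}"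
      using all
    proof eventually_elim
      case (elim \<omega>)
      then have "edge_count_stat n E X \<omega> = real (card {e \<in> E. e \<subseteq> {u \<in> {1..n}. X u \<omega> = 1}})"
        by (intro edge_count_eq_card[OF E]) auto
      then show ?case by (simp add: G_def)
    qed
  qed
  also have "\<dots> = bern p {1..n} G" using p1 by (intro b(1)) auto
  finally show "expectation (\<lambda>\<omega>. f (edge_count_stat n E X \<omega>)) = bern p {1..n} (\<lambda>A. f (real (card {e \<in> E. e \<subseteq> A})))"
    unfolding G_def .
qed

section \<open>Poisson counts on a mesh\<close>

context poisson_proc
begin

lemma prob_N:
  assumes "A \<in> sets borel" "A \<subseteq> {0..}" "emeasure lborel A < \<infinity>"
  shows "prob (N A -` B \<inter> space P) = measure_pmf.prob (pois (measure lborel A)) B"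
proof -
  have "prob (N A -` B \<inter> space P) = measure (distr P (count_space UNIV) (N A)) B"
    using N_measurable[OF assms] by (simp add: measure_distr)
  then show ?thesis unfolding N_distr[OF assms] .
qed

lemma prob_vcell:
  assumes p: "0 < p" "p \<le> 1" and u: "1 \<le> u"
  shows "prob (N (vcell p u) -` {1..} \<inter> space P) = 1 - exp (- p)"
    and "prob (N (vcell p u) -` {2..} \<inter> space P) \<le> p\<^sup>2"
proof -
  have v: "vcell p u \<in> sets borel" "vcell p u \<subseteq> {0..}" "emeasure lborel (vcell p u) < \<infinity>"
    using p vcell_nonneg by (auto simp: emeasure_vcell)
  have pr: "prob (N (vcell p u) -` B \<inter> space P) = measure_pmf.prob (poisson_pmf p) B" for B
    using prob_N[OF v, of B] p u by (simp add: measure_vcell pois_def)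
  have "measure_pmf.prob (poisson_pmf p) (UNIV - {0}) = 1 - exp (- p)"
    using p measure_pmf.prob_compl[of "{0}" "poisson_pmf p"] by (simp add: measure_pmf_single)
  moreover have "UNIV - {0} = {1::nat..}" by auto
  ultimately show "prob (N (vcell p u) -` {1..} \<inter> space P) = 1 - exp (- p)" unfolding pr by simp
  have "measure_pmf.prob (poisson_pmf p) (UNIV - {0, 1}) = 1 - (exp (- p) + p * exp (- p))"
    using p measure_pmf.prob_compl[of "{0, 1}" "poisson_pmf p"] by (simp add: measure_measure_pmf_finite)
  moreover have "UNIV - {0, 1} = {2::nat..}" by auto
  moreover have "1 - (exp (- p) + p * exp (- p)) \<le> p\<^sup>2"
  proof -
    \<comment> \<open>The left side is 1 - p^2.\<close>
    have "(1 + p) * (1 - p) \<le> (1 + p) * exp (- p)"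
      using p exp_ge_add_one_self[of "- p"] by (intro mult_left_mono) auto
    then show ?thesis by (simp add: algebra_simps power2_eq_square)
  qed
  ultimately show "prob (N (vcell p u) -` {2..} \<inter> space P) \<le> p\<^sup>2" unfolding pr by simp
qed

text \<open>Outside the event \<open>Bad\<close> that some cell holds two points, counts are
  indicators of occupied cells, and the exponential of the elementary integrals is the weight in
  \<open>gibbs\<close>. One error m p^2 bounds the probability of \<open>Bad\<close>; the other
  comes from the occupation probability 1 - exp (- p) in place of p. The bound c < 1 keeps the
  arguments of the logarithms positive.\<close>

lemma poisson_gibbs:
  fixes K :: "nat set \<Rightarrow> real" and \<beta> :: "nat \<Rightarrow> real"
  assumes p: "0 < p" "p \<le> 1" and c: "0 \<le> c" "c < 1"
    and K: "\<And>e. e \<in> pairs {1..m} \<Longrightarrow> 0 \<le> K e \<and> K e \<le> 1"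
    and \<beta>: "\<And>u. u \<in> {1..m} \<Longrightarrow> 0 \<le> \<beta> u"
  defines "a \<equiv> \<lambda>u v. if u = v then 0 else ln (1 - c * K {u, v})"
  shows "\<bar>expectation (\<lambda>\<omega>. exp (1/2 * elem_int2 S (Suc m) (vcell p) a \<omega> - elem_int1 S (Suc m) (vcell p) \<beta> \<omega>))
       - gibbs p {1..m} c K (\<lambda>u. exp (- \<beta> u))\<bar> \<le> 2 * (real m * p\<^sup>2)"
proof -
  define V where "V = {1..m}"
  have V: "finite V" "0 \<notin> V" and sV: "{..<Suc m} = insert 0 V" by (auto simp: V_def)
  have vc: "vcell p u \<in> sets borel" "vcell p u \<subseteq> {0..}" "emeasure lborel (vcell p u) < \<infinity>" for u
    using p vcell_nonneg by (auto simp: emeasure_vcell)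
  define Y where "Y = (\<lambda>\<omega>. 1/2 * elem_int2 S (Suc m) (vcell p) a \<omega> - elem_int1 S (Suc m) (vcell p) \<beta> \<omega>)"
  define G where "G = (\<lambda>B. (\<Prod>e\<in>pairs B. 1 - c * K e) * (\<Prod>u\<in>B. exp (- \<beta> u)))"
  define A where "A = (\<lambda>\<omega>. {u \<in> V. N (vcell p u) \<omega> \<in> {1..}})"
  define Bad where "Bad = (\<Union>u\<in>V. N (vcell p u) -` {2..} \<inter> space P)"
  have N0: "N (vcell p 0) \<omega> = 0" for \<omega> using p by (simp add: num_points_def)
  have cK: "0 \<le> c * K e \<and> c * K e \<le> c" if "e \<in> pairs V" for e
    using K[of e] that c by (auto simp: V_def intro: mult_left_le)
  have a_le: "a u v \<le> 0" if "u \<in> V" "v \<in> V" for u v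
  proof (cases "u = v")
    case False
    then have "{u, v} \<in> pairs V" using that by (auto simp: pairs_def)
    then show ?thesis using cK[of "{u, v}"] c False by (auto simp: a_def)
  qed (simp add: a_def)
  have Y_eq: "Y \<omega> = 1/2 * (\<Sum>u\<in>V. \<Sum>v\<in>V. a u v * Nr \<omega> (vcell p u) * Nr \<omega> (vcell p v)) - (\<Sum>u\<in>V. \<beta> u * Nr \<omega> (vcell p u))" for \<omega>
    unfolding Y_def elem_int2_def elem_int1_def sV using V N0 by simp
  \<comment> \<open>A nonpositive exponent keeps the exponential in [0,1]; together with
    \<open>G01\<close> this bounds the error on \<open>Bad\<close> by 1.\<close>
  have Y_le: "Y \<omega> \<le> 0" for \<omega>
  proof -
    have "(\<Sum>u\<in>V. \<Sum>v\<in>V. a u v * Nr \<omega> (vcell p u) * Nr \<omega> (vcell p v)) \<le> 0"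
      using a_le by (intro sum_nonpos mult_nonpos_nonneg) auto
    moreover have "0 \<le> (\<Sum>u\<in>V. \<beta> u * Nr \<omega> (vcell p u))"
      using \<beta> by (intro sum_nonneg mult_nonneg_nonneg) (auto simp: V_def)
    ultimately show ?thesis unfolding Y_eq by linarith
  qed
  have Ym: "Y \<in> borel_measurable P"
    unfolding Y_eq by (intro borel_measurable_diff borel_measurable_times borel_measurable_sum Nr_measurable vc) auto
  have G01: "0 \<le> G B \<and> G B \<le> 1" if "B \<subseteq> V" for B
  proof -
    have "0 \<le> 1 - c * K e \<and> 1 - c * K e \<le> 1" if "e \<in> pairs B" for e
    proof -
      have "e \<in> pairs V" using that \<open>B \<subseteq> V\<close> by (auto simp: pairs_def)
      then show ?thesis using cK[of e] c by linarith
    qed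
    then have "0 \<le> (\<Prod>e\<in>pairs B. 1 - c * K e) \<and> (\<Prod>e\<in>pairs B. 1 - c * K e) \<le> 1"
      by (auto intro!: prod_nonneg prod_le_1)
    moreover have "0 \<le> (\<Prod>u\<in>B. exp (- \<beta> u)) \<and> (\<Prod>u\<in>B. exp (- \<beta> u)) \<le> 1"
      using that \<beta> by (auto intro!: prod_nonneg prod_le_1 simp: V_def)
    ultimately show ?thesis unfolding G_def by (auto intro: mult_le_one)
  qed
  have good: "exp (Y \<omega>) = G (A \<omega>)" if "\<omega> \<in> space P - Bad" for \<omega>
  proof -
    have "Nr \<omega> (vcell p u) = of_bool (u \<in> A \<omega>)" if "u \<in> V" for u
    proof -
      have "\<not> 2 \<le> N (vcell p u) \<omega>" using \<open>\<omega> \<in> space P - Bad\<close> that by (auto simp: Bad_def)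
      then have "N (vcell p u) \<omega> = 0 \<or> N (vcell p u) \<omega> = 1" by linarith
      then show ?thesis using that by (auto simp: A_def)
    qed
    then have Y1: "Y \<omega> = 1/2 * (\<Sum>u\<in>V. \<Sum>v\<in>V. a u v * of_bool (u \<in> A \<omega>) * of_bool (v \<in> A \<omega>)) - (\<Sum>u\<in>V. \<beta> u * of_bool (u \<in> A \<omega>))"
      unfolding Y_eq by (simp cong: sum.cong)
    have AV: "A \<omega> \<subseteq> V" and fA: "finite (A \<omega>)" using V by (auto simp: A_def)
    have "(\<Sum>u\<in>V. \<Sum>v\<in>V. a u v * of_bool (u \<in> A \<omega>) * of_bool (v \<in> A \<omega>)) = (\<Sum>u\<in>V. \<Sum>v\<in>A \<omega>. a u v * of_bool (u \<in> A \<omega>))"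
      using V AV fA by (intro sum.cong refl sum.mono_neutral_cong_right) auto
    also have "\<dots> = (\<Sum>u\<in>A \<omega>. \<Sum>v\<in>A \<omega>. a u v)"
      using V AV fA by (intro sum.mono_neutral_cong_right) auto
    also have "\<dots> = 2 * (\<Sum>e\<in>pairs (A \<omega>). ln (1 - c * K e))"
      unfolding a_def by (rule sum_pairs_twice[OF fA])
    finally have s2: "(\<Sum>u\<in>V. \<Sum>v\<in>V. a u v * of_bool (u \<in> A \<omega>) * of_bool (v \<in> A \<omega>)) = 2 * (\<Sum>e\<in>pairs (A \<omega>). ln (1 - c * K e))" .
    have s1: "(\<Sum>u\<in>V. \<beta> u * of_bool (u \<in> A \<omega>)) = (\<Sum>u\<in>A \<omega>. \<beta> u)"
      using V AV fA by (intro sum.mono_neutral_cong_right) auto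
    have "Y \<omega> = (\<Sum>e\<in>pairs (A \<omega>). ln (1 - c * K e)) + (\<Sum>u\<in>A \<omega>. - \<beta> u)"
      unfolding Y1 s2 s1 by (simp add: sum_negf)
    then have "exp (Y \<omega>) = (\<Prod>e\<in>pairs (A \<omega>). exp (ln (1 - c * K e))) * (\<Prod>u\<in>A \<omega>. exp (- \<beta> u))"
      using fA finite_pairs[OF fA] by (simp add: exp_add exp_sum)
    also have "(\<Prod>e\<in>pairs (A \<omega>). exp (ln (1 - c * K e))) = (\<Prod>e\<in>pairs (A \<omega>). 1 - c * K e)"
    proof (intro prod.cong refl)
      fix e assume "e \<in> pairs (A \<omega>)"
      then have "e \<in> pairs V" using AV by (auto simp: pairs_def)
      then have "0 < 1 - c * K e" using cK[of e] c by linarith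
      then show "exp (ln (1 - c * K e)) = 1 - c * K e" by simp
    qed
    finally show ?thesis by (simp add: G_def)
  qed
  have BadE: "Bad \<in> events"
    unfolding Bad_def using V measurable_sets[OF N_measurable[OF vc]] by (intro sets.finite_UN) auto
  have "prob Bad \<le> (\<Sum>u\<in>V. prob (N (vcell p u) -` {2..} \<inter> space P))"
    unfolding Bad_def using V measurable_sets[OF N_measurable[OF vc]]
    by (intro finite_measure_subadditive_finite) auto
  also have "\<dots> \<le> (\<Sum>u\<in>V. p\<^sup>2)" using prob_vcell(2)[OF p] by (intro sum_mono) (auto simp: V_def)
  finally have Bad: "prob Bad \<le> real m * p\<^sup>2" by (simp add: V_def)
  have "indep_vars (\<lambda>_. count_space UNIV) (\<lambda>i. N (vcell p i)) {..<Suc m}"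
    using vc disjoint_vcell[OF p(1)] by (intro N_indep) auto
  then have ind: "indep_vars (\<lambda>_. count_space UNIV) (\<lambda>i. N (vcell p i)) V"
    by (rule indep_vars_subset) (auto simp: V_def)
  have EG: "expectation (\<lambda>\<omega>. G (A \<omega>)) = bern (1 - exp (- p)) V G"
    unfolding A_def by (rule indep_events_bern(1)[OF V(1) ind]) (use prob_vcell(1)[OF p] in \<open>auto simp: V_def\<close>)
  have Gm: "(\<lambda>\<omega>. G (A \<omega>)) \<in> borel_measurable P"
    unfolding A_def by (rule indep_events_bern(2)[OF V(1) ind]) (use prob_vcell(1)[OF p] in \<open>auto simp: V_def\<close>)
  have AV: "A \<omega> \<subseteq> V" for \<omega> by (auto simp: A_def)
  have iY: "integrable P (\<lambda>\<omega>. exp (Y \<omega>))"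
    using Ym Y_le by (intro integrable_const_bound[where B = 1]) auto
  have iG: "integrable P (\<lambda>\<omega>. G (A \<omega>))"
    using Gm G01[OF AV] by (intro integrable_const_bound[where B = 1]) auto
  have "\<bar>expectation (\<lambda>\<omega>. exp (Y \<omega>)) - expectation (\<lambda>\<omega>. G (A \<omega>))\<bar> = \<bar>expectation (\<lambda>\<omega>. exp (Y \<omega>) - G (A \<omega>))\<bar>"
    using iY iG by simp
  also have "\<dots> \<le> expectation (\<lambda>\<omega>. \<bar>exp (Y \<omega>) - G (A \<omega>)\<bar>)" by (rule integral_abs_bound)
  also have "\<dots> \<le> expectation (\<lambda>\<omega>. indicator Bad \<omega>)"
  proof (rule integral_mono)
    show "integrable P (\<lambda>\<omega>. \<bar>exp (Y \<omega>) - G (A \<omega>)\<bar>)" using iY iG by simp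
    show "integrable P (indicator Bad :: _ \<Rightarrow> real)" using BadE by (simp add: emeasure_eq_measure)
    fix \<omega> assume \<omega>: "\<omega> \<in> space P"
    show "\<bar>exp (Y \<omega>) - G (A \<omega>)\<bar> \<le> indicator Bad \<omega>"
    proof (cases "\<omega> \<in> Bad")
      case True
      have "exp (Y \<omega>) \<le> 1" using Y_le by simp
      then have "\<bar>exp (Y \<omega>) - G (A \<omega>)\<bar> \<le> 1" using G01[OF AV, of \<omega>] exp_gt_zero[of "Y \<omega>"] by linarith
      then show ?thesis using True by simp
    qed (use good \<omega> in simp)
  qed
  also have "\<dots> = prob Bad" using BadE sets.sets_into_space by (simp add: Int_absorb2)
  finally have d1: "\<bar>expectation (\<lambda>\<omega>. exp (Y \<omega>)) - bern (1 - exp (- p)) V G\<bar> \<le> real m * p\<^sup>2"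
    using Bad unfolding EG by simp
  have ep: "0 \<le> 1 - exp (- p)" "1 - exp (- p) \<le> 1" using p by auto
  have "\<bar>bern (1 - exp (- p)) V G - bern p V G\<bar> \<le> real (card V) * \<bar>1 - exp (- p) - p\<bar>"
    using p V G01 ep by (intro bern_param_diff) auto
  also have "\<dots> \<le> real m * p\<^sup>2"
  proof -
    have "1 - p \<le> exp (- p)" using exp_ge_add_one_self[of "- p"] by simp
    \<comment> \<open>The one-factor case of \<open>prod_one_minus_exp\<close>.\<close>
    moreover have "exp (- p) \<le> 1 - p + p\<^sup>2"
      using prod_one_minus_exp[of "{()}" "\<lambda>_. p"] p by simp
    ultimately show ?thesis by (intro mult_mono) (auto simp: V_def)
  qed
  finally show ?thesis using d1 unfolding Y_def gibbs_def G_def V_def by linarith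
qed

end

section \<open>The graphon of a graph\<close>

text \<open>A non-integrable g has integral 0 by convention, so a pointwise bound is enough. It
  makes the set in \<open>cut_dist\<close> bounded above, without which a real supremum says nothing
  about its members.\<close>

lemma LINT_bounded_on_square:
  fixes g :: "real \<times> real \<Rightarrow> real"
  assumes K: "0 \<le> K" and g: "\<And>z. z \<in> {0..K} \<times> {0..K} \<Longrightarrow> \<bar>g z\<bar> \<le> 1"
  shows "\<bar>LINT z:{0..K} \<times> {0..K}|lborel. g z\<bar> \<le> K\<^sup>2"
proof -
  have box: "{0..K} \<times> {0..K} \<in> sets (lborel :: (real \<times> real) measure)" by (simp add: borel_Times)
  have em: "emeasure (lborel :: (real \<times> real) measure) ({0..K} \<times> {0..K}) = ennreal (K\<^sup>2)"
    unfolding lborel_prod[symmetric] using K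
    by (subst lborel.emeasure_pair_measure_Times) (auto simp: ennreal_mult[symmetric] power2_eq_square)
  then have ms: "measure (lborel :: (real \<times> real) measure) ({0..K} \<times> {0..K}) = K\<^sup>2" by (simp add: measure_def)
  have i: "integrable lborel (indicator ({0..K} \<times> {0..K}) :: real \<times> real \<Rightarrow> real)"
    using em box by (intro integrable_real_indicator) auto
  show ?thesis
  proof (cases "set_integrable lborel ({0..K} \<times> {0..K}) g")
    case True
    have "\<bar>LINT z:{0..K} \<times> {0..K}|lborel. g z\<bar> \<le> (LINT z|lborel. indicator ({0..K} \<times> {0..K}) z)"
      unfolding set_lebesgue_integral_def
    proof (rule order_trans[OF integral_abs_bound], rule integral_mono)
      show "integrable lborel (\<lambda>z. \<bar>indicator ({0..K} \<times> {0..K}) z *\<^sub>R g z\<bar>)"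
        using True by (simp add: set_integrable_def)
      show "\<bar>indicator ({0..K} \<times> {0..K}) z *\<^sub>R g z\<bar> \<le> indicator ({0..K} \<times> {0..K}) z" for z
        using g[of z] by (simp add: indicator_def)
    qed (rule i)
    then show ?thesis using ms by simp
  next
    case False
    then show ?thesis using not_integrable_integral_eq[of lborel "\<lambda>z. indicator ({0..K} \<times> {0..K}) z *\<^sub>R g z"]
      by (simp add: set_lebesgue_integral_def set_integrable_def)
  qed
qed

lemma abs_LINT_le_cut_dist:
  assumes K: "0 \<le> K"
    and W1: "\<And>x y. 0 \<le> x \<Longrightarrow> 0 \<le> y \<Longrightarrow> 0 \<le> W1 x y \<and> W1 x y \<le> 1"
    and W2: "\<And>x y. 0 \<le> x \<Longrightarrow> 0 \<le> y \<Longrightarrow> 0 \<le> W2 x y \<and> W2 x y \<le> 1"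
    and f: "f \<in> borel_measurable borel" "\<And>x. \<bar>f x\<bar> \<le> 1" and g: "g \<in> borel_measurable borel" "\<And>x. \<bar>g x\<bar> \<le> 1"
  shows "\<bar>LINT z:{0..K} \<times> {0..K}|lborel. (W1 (fst z) (snd z) - W2 (fst z) (snd z)) * f (fst z) * g (snd z)\<bar> \<le> cut_dist K W1 W2"
proof -
  have "(\<lambda>(f, g). \<bar>LINT z:{0..K} \<times> {0..K}|lborel. (W1 (fst z) (snd z) - W2 (fst z) (snd z)) * f (fst z) * g (snd z)\<bar>) (f, g)
     \<le> cut_dist K W1 W2"
    unfolding cut_dist_def
  proof (rule cSUP_upper)
    show "(f, g) \<in> cut_test_functions K \<times> cut_test_functions K"
      using f g by (auto simp: cut_test_functions_def abs_le_iff measurable_restrict_space1 minus_le_iff)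
    show "bdd_above ((\<lambda>(f, g). \<bar>LINT z:{0..K} \<times> {0..K}|lborel. (W1 (fst z) (snd z) - W2 (fst z) (snd z)) * f (fst z) * g (snd z)\<bar>)
       ` (cut_test_functions K \<times> cut_test_functions K))"
    proof (rule bdd_aboveI2[where M = "K\<^sup>2"])
      fix q assume q: "q \<in> cut_test_functions K \<times> cut_test_functions K"
      obtain f g where fg: "q = (f, g)" by force
      have b: "\<bar>f x\<bar> \<le> 1" "\<bar>g x\<bar> \<le> 1" if "x \<in> {0..K}" for x
        using q that unfolding fg cut_test_functions_def by (auto simp: abs_le_iff image_subset_iff)
      have "\<bar>(W1 (fst z) (snd z) - W2 (fst z) (snd z)) * f (fst z) * g (snd z)\<bar> \<le> 1" if "z \<in> {0..K} \<times> {0..K}" for z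
      proof -
        have z: "fst z \<in> {0..K}" "snd z \<in> {0..K}" using that by auto
        then have "\<bar>W1 (fst z) (snd z) - W2 (fst z) (snd z)\<bar> \<le> 1"
          using W1[of "fst z" "snd z"] W2[of "fst z" "snd z"] by auto
        then have "\<bar>W1 (fst z) (snd z) - W2 (fst z) (snd z)\<bar> * \<bar>f (fst z)\<bar> * \<bar>g (snd z)\<bar> \<le> 1 * 1 * 1"
          using b(1)[OF z(1)] b(2)[OF z(2)] by (intro mult_mono) auto
        then show ?thesis by (simp add: abs_mult)
      qed
      then show "(case q of (f, g) \<Rightarrow> \<bar>LINT z:{0..K} \<times> {0..K}|lborel. (W1 (fst z) (snd z) - W2 (fst z) (snd z)) * f (fst z) * g (snd z)\<bar>) \<le> K\<^sup>2"
        unfolding fg using LINT_bounded_on_square[OF K] by simp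
    qed
  qed
  then show ?thesis by simp
qed

lemma LINT_lborel2_swap:
  fixes f :: "real \<times> real \<Rightarrow> real"
  assumes "f \<in> borel_measurable borel"
  shows "(LINT z|lborel. f (snd z, fst z)) = (LINT z|lborel. f z)"
proof -
  have "f \<in> borel_measurable (lborel \<Otimes>\<^sub>M lborel)" using assms unfolding lborel_prod by simp
  from lborel_pair.integral_product_swap[OF this] show ?thesis
    by (simp add: case_prod_unfold lborel_prod)
qed

text \<open>Extension by 0 to the plane: a graphon is constrained only on the quadrant, whereas
  Fubini and averaging need a function that is measurable everywhere.\<close>

definition W0 :: "(real \<Rightarrow> real \<Rightarrow> real) \<Rightarrow> real \<times> real \<Rightarrow> real" where
  "W0 W z = indicator ({0..} \<times> {0..}) z * W (fst z) (snd z)"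

lemma W0_measurable [measurable]: "W \<in> graphons \<Longrightarrow> W0 W \<in> borel_measurable borel"
proof -
  assume "W \<in> graphons"
  then have "(\<lambda>z. W (fst z) (snd z)) \<in> borel_measurable (restrict_space borel ({0..} \<times> {0..}))"
    by (simp add: graphons_def case_prod_unfold)
  then have "(\<lambda>z. indicator ({0..} \<times> {0..}) z *\<^sub>R W (fst z) (snd z)) \<in> borel_measurable borel"
    using quadrant_borel by (subst (asm) borel_measurable_restrict_space_iff) auto
  then show ?thesis by (simp add: W0_def[abs_def])
qed

lemma W0_bounds: "W \<in> graphons \<Longrightarrow> 0 \<le> W0 W z \<and> W0 W z \<le> 1"
  by (cases z) (auto simp: W0_def graphons_def indicator_def)

lemma W0_sym: "W \<in> graphons \<Longrightarrow> W0 W (y, x) = W0 W (x, y)"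
  by (auto simp: W0_def graphons_def indicator_def)

definition mean_cell :: "real \<Rightarrow> (real \<times> real \<Rightarrow> real) \<Rightarrow> nat \<Rightarrow> nat \<Rightarrow> real" where
  "mean_cell p w u v = (LINT z:vcell2 p (u, v)|lborel. w z) / p\<^sup>2"

text \<open>\<open>gibbs\<close> takes a kernel on unordered pairs; \<open>Min\<close> and
  \<open>Max\<close> pick an order, and symmetry of w makes the choice immaterial
  (\<open>mean_kernel_pair\<close>).\<close>

definition mean_kernel :: "real \<Rightarrow> (real \<times> real \<Rightarrow> real) \<Rightarrow> nat set \<Rightarrow> real" where
  "mean_kernel p w e = mean_cell p w (Min e) (Max e)"

lemma mean_cell_sym:
  assumes "w \<in> borel_measurable borel" "\<And>x y. w (y, x) = w (x, y)"
  shows "mean_cell p w u v = mean_cell p w v u"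
proof -
  have "(LINT z:vcell2 p (u, v)|lborel. w z) = (LINT z|lborel. indicator (vcell2 p (u, v)) (snd z, fst z) *\<^sub>R w (snd z, fst z))"
    unfolding set_lebesgue_integral_def
    by (rule LINT_lborel2_swap[symmetric]) (use assms(1) in measurable)
  also have "\<dots> = (LINT z:vcell2 p (v, u)|lborel. w z)"
    unfolding set_lebesgue_integral_def using assms(2)
    by (intro Bochner_Integration.integral_cong refl) (auto simp: vcell2_def indicator_def)
  finally show ?thesis by (simp add: mean_cell_def)
qed

lemma mean_kernel_pair:
  assumes "w \<in> borel_measurable borel" "\<And>x y. w (y, x) = w (x, y)" "u \<noteq> v"
  shows "mean_kernel p w {u, v} = mean_cell p w u v"
  using mean_cell_sym[OF assms(1,2)] assms(3) by (cases "u < v") (auto simp: mean_kernel_def min_def max_def)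

lemma emeasure_vcell2: "0 < p \<Longrightarrow> emeasure lborel (vcell2 p (u, v)) \<le> ennreal (p\<^sup>2)"
proof -
  assume p: "0 < p"
  have "emeasure (lborel :: (real \<times> real) measure) (vcell p u \<times> vcell p v) = emeasure lborel (vcell p u) * emeasure lborel (vcell p v)"
    unfolding lborel_prod[symmetric] by (rule lborel.emeasure_pair_measure_Times) auto
  then show ?thesis using p by (auto simp: vcell2_def emeasure_vcell ennreal_mult[symmetric] power2_eq_square)
qed

lemma set_integrable_vcell2:
  fixes w :: "real \<times> real \<Rightarrow> real"
  assumes "0 < p" "w \<in> borel_measurable borel" "\<And>z. \<bar>w z\<bar> \<le> 1"
  shows "set_integrable lborel (vcell2 p (u, v)) w"
  unfolding set_integrable_def
proof (rule Bochner_Integration.integrable_bound)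
  show "integrable lborel (indicator (vcell2 p (u, v)) :: real \<times> real \<Rightarrow> real)"
    using emeasure_vcell2[OF assms(1), of u v] by (intro integrable_real_indicator) (auto simp: order_le_less_trans)
qed (use assms in \<open>auto simp: indicator_def\<close>)

lemma LINT_vcell2_bound:
  fixes w :: "real \<times> real \<Rightarrow> real"
  assumes "0 < p" "w \<in> borel_measurable borel" "\<And>z. \<bar>w z\<bar> \<le> 1"
  shows "\<bar>LINT z:vcell2 p (u, v)|lborel. w z\<bar> \<le> p\<^sup>2"
proof -
  have "\<bar>LINT z:vcell2 p (u, v)|lborel. w z\<bar> \<le> (LINT z|lborel. indicator (vcell2 p (u, v)) z)"
    unfolding set_lebesgue_integral_def
  proof (rule order_trans[OF integral_abs_bound], rule integral_mono)
    show "integrable lborel (\<lambda>z. \<bar>indicator (vcell2 p (u, v)) z *\<^sub>R w z\<bar>)"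
      using set_integrable_vcell2[OF assms] by (simp add: set_integrable_def)
    show "integrable lborel (indicator (vcell2 p (u, v)) :: real \<times> real \<Rightarrow> real)"
      using emeasure_vcell2[OF assms(1), of u v] by (intro integrable_real_indicator) (auto simp: order_le_less_trans)
  qed (use assms(3) in \<open>auto simp: indicator_def\<close>)
  also have "\<dots> = measure lborel (vcell2 p (u, v))" by simp
  also have "\<dots> \<le> p\<^sup>2" unfolding measure_def
    using emeasure_vcell2[OF assms(1), of u v] by (intro enn2real_leI) auto
  finally show ?thesis .
qed

lemma mean_cell_bounds:
  assumes "0 < p" "w \<in> borel_measurable borel" "\<And>z. 0 \<le> w z \<and> w z \<le> 1"
  shows "0 \<le> mean_cell p w u v \<and> mean_cell p w u v \<le> 1"
proof -
  have "0 \<le> (LINT z:vcell2 p (u, v)|lborel. w z)"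
    unfolding set_lebesgue_integral_def using assms(3) by (intro integral_nonneg_AE) auto
  moreover have "(LINT z:vcell2 p (u, v)|lborel. w z) \<le> p\<^sup>2"
    using LINT_vcell2_bound[OF assms(1,2), of u v] assms(3) by (auto simp: abs_le_iff)
  ultimately show ?thesis using assms(1) by (simp add: mean_cell_def divide_le_eq)
qed

section \<open>The step graphon of one fixed graph on the mesh of side p\<close>

locale graph_mesh =
  fixes p :: real and m :: nat and E :: "nat set set"
  assumes p: "0 < p" and graph: "simple_graph m E"
begin

abbreviation Wg :: "real \<Rightarrow> real \<Rightarrow> real" where "Wg \<equiv> graph_graphon m (1 / p) E"

lemma edgeD: "e \<in> E \<Longrightarrow> e \<subseteq> {1..m} \<and> card e = 2"
  using graph by (simp add: simple_graph_def)

lemma edge_pair: "{u, v} \<in> E \<Longrightarrow> u \<in> {1..m} \<and> v \<in> {1..m} \<and> u \<noteq> v"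
  using edgeD[of "{u, v}"] by auto

lemma finite_E: "finite E"
  by (rule finite_subset[of _ "Pow {1..m}"]) (use edgeD in auto)

lemma Wg_eq: "Wg x y = of_bool ({nat \<lceil>x / p\<rceil>, nat \<lceil>y / p\<rceil>} \<in> E)"
proof -
  have in_range: "x \<in> {0..real m / (1 / p)}" if "nat \<lceil>x / p\<rceil> \<in> {1..m}" for x
  proof -
    have "x \<in> vcell p (nat \<lceil>x / p\<rceil>)"
    proof -
      have "1 \<le> nat \<lceil>x / p\<rceil>" using that unfolding atLeastAtMost_iff by (rule conjunct1)
      then have "0 < nat \<lceil>x / p\<rceil>" by (rule order_less_le_trans[OF zero_less_one])
      then have "0 < x / p" by (simp only: zero_less_nat_eq zero_less_ceiling)
      then show ?thesis using p by (simp add: vcell_iff zero_less_divide_iff)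
    qed
    then have "x \<in> (\<Union>u\<in>{1..m}. vcell p u)" using that by blast
    then show ?thesis unfolding UN_vcell[OF p] by simp
  qed
  show ?thesis
  proof (cases "{nat \<lceil>x / p\<rceil>, nat \<lceil>y / p\<rceil>} \<in> E")
    case True
    then show ?thesis using edge_pair[OF True] in_range[of x] in_range[of y] by (simp add: graph_graphon_def)
  next
    case False
    then show ?thesis by (simp add: graph_graphon_def)
  qed
qed

lemma Wg_bounds: "0 \<le> Wg x y \<and> Wg x y \<le> 1" by (simp add: Wg_eq)

lemma Wg_sym: "Wg x y = Wg y x" by (simp add: Wg_eq insert_commute)

lemma Wg_row: "Wg x y = (\<Sum>v\<in>{1..m}. of_bool ({nat \<lceil>x / p\<rceil>, v} \<in> E) * indicator (vcell p v) y)"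
proof -
  have "(\<Sum>v\<in>{1..m}. of_bool ({nat \<lceil>x / p\<rceil>, v} \<in> E) * indicator (vcell p v) y :: real)
     = (\<Sum>v\<in>{1..m}. if v = nat \<lceil>y / p\<rceil> then of_bool ({nat \<lceil>x / p\<rceil>, nat \<lceil>y / p\<rceil>} \<in> E) else 0)"
  proof (intro sum.cong refl)
    fix v assume v: "v \<in> {1..m}"
    have "0 < y" if "v = nat \<lceil>y / p\<rceil>"
    proof -
      have "1 \<le> nat \<lceil>y / p\<rceil>" using v unfolding that atLeastAtMost_iff by (rule conjunct1)
      then have "0 < nat \<lceil>y / p\<rceil>" by (rule order_less_le_trans[OF zero_less_one])
      then have "0 < y / p" by (simp only: zero_less_nat_eq zero_less_ceiling)
      then show ?thesis using p by (simp add: zero_less_divide_iff)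
    qed
    then show "of_bool ({nat \<lceil>x / p\<rceil>, v} \<in> E) * indicator (vcell p v) y
       = (if v = nat \<lceil>y / p\<rceil> then of_bool ({nat \<lceil>x / p\<rceil>, nat \<lceil>y / p\<rceil>} \<in> E) else 0 :: real)"
      by (auto simp: indicator_def vcell_iff[OF p])
  qed
  also have "\<dots> = Wg x y" using edge_pair[of "nat \<lceil>x / p\<rceil>" "nat \<lceil>y / p\<rceil>"] by (auto simp: Wg_eq)
  finally show ?thesis by simp
qed

lemma Wg_measurable: "(\<lambda>z. Wg (fst z) (snd z)) \<in> borel_measurable borel"
proof -
  have "Wg x y = (\<Sum>u\<in>{1..m}. \<Sum>v\<in>{1..m}. of_bool ({u, v} \<in> E) * (indicator (vcell p u) x * indicator (vcell p v) y))" for x y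
  proof -
    have "Wg x y = (\<Sum>v\<in>{1..m}. Wg x (real v * p) * indicator (vcell p v) y)"
    proof -
      have "nat \<lceil>real v * p / p\<rceil> = v" for v using p by simp
      then show ?thesis by (subst Wg_row) (simp add: Wg_eq)
    qed
    also have "\<dots> = (\<Sum>v\<in>{1..m}. (\<Sum>u\<in>{1..m}. of_bool ({u, v} \<in> E) * indicator (vcell p u) x) * indicator (vcell p v) y)"
    proof (intro sum.cong refl arg_cong2[of _ _ _ _ "(*)"])
      fix v
      have "nat \<lceil>real v * p / p\<rceil> = v" using p by simp
      then show "Wg x (real v * p) = (\<Sum>u\<in>{1..m}. of_bool ({u, v} \<in> E) * indicator (vcell p u) x)"
        by (subst Wg_sym, subst Wg_row) (simp add: insert_commute)
    qed
    also have "\<dots> = (\<Sum>v\<in>{1..m}. \<Sum>u\<in>{1..m}. of_bool ({u, v} \<in> E) * (indicator (vcell p u) x * indicator (vcell p v) y))"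
      by (simp add: sum_distrib_right mult.assoc)
    finally show ?thesis by (subst (asm) sum.swap)
  qed
  then have "(\<lambda>z. Wg (fst z) (snd z)) = (\<lambda>z. \<Sum>u\<in>{1..m}. \<Sum>v\<in>{1..m}. of_bool ({u, v} \<in> E) * (indicator (vcell p u) (fst z) * indicator (vcell p v) (snd z)))"
    by (intro ext)
  moreover have "(\<lambda>z. \<Sum>u\<in>{1..m}. \<Sum>v\<in>{1..m}. of_bool ({u, v} \<in> E) * (indicator (vcell p u) (fst z) * indicator (vcell p v) (snd z)) :: real)
     \<in> borel_measurable (borel \<Otimes>\<^sub>M (borel :: real measure))"
    by (intro borel_measurable_sum borel_measurable_times borel_measurable_const
        measurable_compose[OF measurable_fst] measurable_compose[OF measurable_snd] borel_measurable_indicator) auto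
  ultimately show ?thesis by (simp only: borel_prod)
qed

lemma LINT_row:
  assumes "B \<in> sets borel"
  shows "(LINT y:B|lborel. Wg x y) = (\<Sum>v\<in>{1..m}. of_bool ({nat \<lceil>x / p\<rceil>, v} \<in> E) * measure lborel (vcell p v \<inter> B))"
    and "set_integrable lborel B (Wg x)"
proof -
  have em: "emeasure lborel (vcell p v \<inter> B) < \<infinity>" for v
    using emeasure_mono[of "vcell p v \<inter> B" "vcell p v" lborel] emeasure_vcell[OF p, of v] assms
    by (auto simp: order_le_less_trans)
  have i: "integrable lborel (indicator (vcell p v \<inter> B) :: _ \<Rightarrow> real)" for v
    using em assms by (intro integrable_real_indicator) auto
  have eq: "indicator B y *\<^sub>R Wg x y = (\<Sum>v\<in>{1..m}. of_bool ({nat \<lceil>x / p\<rceil>, v} \<in> E) * indicator (vcell p v \<inter> B) y)" for y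
    by (subst Wg_row) (simp only: real_scaleR_def sum_distrib_left indicator_inter_arith mult_ac)
  show "set_integrable lborel B (Wg x)"
    unfolding set_integrable_def eq by (intro Bochner_Integration.integrable_sum integrable_mult_right i)
  show "(LINT y:B|lborel. Wg x y) = (\<Sum>v\<in>{1..m}. of_bool ({nat \<lceil>x / p\<rceil>, v} \<in> E) * measure lborel (vcell p v \<inter> B))"
    unfolding set_lebesgue_integral_def eq using i
    by (subst Bochner_Integration.integral_sum) (auto intro: integrable_mult_right)
qed

lemma sum_adj_eq_card:
  "(\<Sum>v\<in>V. of_bool ({u, v} \<in> E) :: real) = real (card {e \<in> E. u \<in> e \<and> e - {u} \<subseteq> V})" if "finite V"
proof -
  have "(\<Sum>v\<in>V. of_bool ({u, v} \<in> E) :: real) = real (card {v \<in> V. {u, v} \<in> E})"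
    using that by (simp add: of_bool_def sum.If_cases Int_def)
  also have "card {v \<in> V. {u, v} \<in> E} = card {e \<in> E. u \<in> e \<and> e - {u} \<subseteq> V}"
  proof (rule bij_betw_same_card[of "\<lambda>v. {u, v}"])
    show "bij_betw (\<lambda>v. {u, v}) {v \<in> V. {u, v} \<in> E} {e \<in> E. u \<in> e \<and> e - {u} \<subseteq> V}"
      unfolding bij_betw_def
    proof (intro conjI set_eqI iffI)
      show "inj_on (\<lambda>v. {u, v}) {v \<in> V. {u, v} \<in> E}" by (auto simp: inj_on_def doubleton_eq_iff)
    next
      fix e assume "e \<in> (\<lambda>v. {u, v}) ` {v \<in> V. {u, v} \<in> E}"
      then show "e \<in> {e \<in> E. u \<in> e \<and> e - {u} \<subseteq> V}" by auto
    next
      fix e assume e: "e \<in> {e \<in> E. u \<in> e \<and> e - {u} \<subseteq> V}"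
      then have "card e = 2" using edgeD by auto
      then obtain x y where xy: "e = {x, y}" "x \<noteq> y" by (auto simp: card_2_iff)
      then obtain v where "e = {u, v}" "v \<noteq> u" using e by auto
      then show "e \<in> (\<lambda>v. {u, v}) ` {v \<in> V. {u, v} \<in> E}" using e by auto
    qed
  qed
  finally show ?thesis .
qed

lemma degree_eq: "graphon_degree Wg x = p * real (vertex_degree E (nat \<lceil>x / p\<rceil>))"
proof -
  have "vcell p v \<inter> {0..} = vcell p v" for v using vcell_nonneg by auto
  then have "graphon_degree Wg x = (\<Sum>v\<in>{1..m}. of_bool ({nat \<lceil>x / p\<rceil>, v} \<in> E) * p)"
    unfolding graphon_degree_def by (subst LINT_row) (auto simp: measure_vcell p intro!: sum.cong)
  also have "\<dots> = p * (\<Sum>v\<in>{1..m}. of_bool ({nat \<lceil>x / p\<rceil>, v} \<in> E))" by (simp add: sum_distrib_left mult.commute)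
  also have "(\<Sum>v\<in>{1..m}. of_bool ({nat \<lceil>x / p\<rceil>, v} \<in> E) :: real) = real (vertex_degree E (nat \<lceil>x / p\<rceil>))"
    unfolding sum_adj_eq_card[OF finite_atLeastAtMost] vertex_degree_def
    using edgeD by (intro arg_cong[of _ _ real] arg_cong[of _ _ card]) auto
  finally show ?thesis .
qed

lemma sum_degrees: "(\<Sum>v\<in>{1..m}. vertex_degree E v) = 2 * card E"
proof -
  have "(\<Sum>v\<in>{1..m}. vertex_degree E v) = (\<Sum>v\<in>{1..m}. \<Sum>e\<in>E. of_bool (v \<in> e))"
    unfolding vertex_degree_def using finite_E by (simp add: of_bool_def sum.If_cases Int_def)
  also have "\<dots> = (\<Sum>e\<in>E. \<Sum>v\<in>{1..m}. of_bool (v \<in> e))" by (rule sum.swap)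
  also have "\<dots> = (\<Sum>e\<in>E. 2)"
  proof (intro sum.cong refl)
    fix e assume "e \<in> E"
    then have "{1..m} \<inter> {v. v \<in> e} = e" "card e = 2" using edgeD by auto
    then show "(\<Sum>v\<in>{1..m}. of_bool (v \<in> e)) = (2::nat)" by (simp add: of_bool_def sum.If_cases)
  qed
  finally show ?thesis by simp
qed

text \<open>The first v vertices all have at least the degree of v, and all degrees sum to twice the
  number of edges. The labelling by degree enters here.\<close>

lemma sorted_degree_bound:
  assumes sorted: "\<And>u v. 1 \<le> u \<Longrightarrow> u \<le> v \<Longrightarrow> v \<le> m \<Longrightarrow> vertex_degree E v \<le> vertex_degree E u"
    and v: "1 \<le> v"
  shows "v * vertex_degree E v \<le> 2 * card E"
proof (cases "v \<le> m")
  case True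
  have "v * vertex_degree E v = (\<Sum>u\<in>{1..v}. vertex_degree E v)" by simp
  also have "\<dots> \<le> (\<Sum>u\<in>{1..v}. vertex_degree E u)" using sorted True by (intro sum_mono) auto
  also have "\<dots> \<le> (\<Sum>u\<in>{1..m}. vertex_degree E u)" using True by (intro sum_mono2) auto
  finally show ?thesis unfolding sum_degrees .
next
  case False
  then have "{e \<in> E. v \<in> e} = {}" using edgeD by fastforce
  then show ?thesis unfolding vertex_degree_def by (simp only:) simp
qed

text \<open>Step functions as test functions turn the form in the cut norm into a finite bilinear
  sum over cells, diagonal cells included.\<close>

lemma LINT_square_cells:
  fixes D :: "real \<times> real \<Rightarrow> real"
  assumes D: "D \<in> borel_measurable borel" "\<And>z. \<bar>D z\<bar> \<le> 1" and K: "real N * p \<le> K"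
  shows "(LINT z:{0..K} \<times> {0..K}|lborel. D z * (\<Sum>u\<in>{1..N}. a u * indicator (vcell p u) (fst z)) * (\<Sum>v\<in>{1..N}. a v * indicator (vcell p v) (snd z)))
     = (\<Sum>u\<in>{1..N}. \<Sum>v\<in>{1..N}. a u * a v * (LINT z:vcell2 p (u, v)|lborel. D z))"
proof -
  have sub: "vcell p u \<subseteq> {0..K}" if "u \<in> {1..N}" for u
  proof -
    have "vcell p u \<subseteq> (\<Union>u\<in>{1..N}. vcell p u)" using that by blast
    then show ?thesis unfolding UN_vcell[OF p] using K by auto
  qed
  have eq: "indicator ({0..K} \<times> {0..K}) z *\<^sub>R (D z * (\<Sum>u\<in>{1..N}. a u * indicator (vcell p u) (fst z)) * (\<Sum>v\<in>{1..N}. a v * indicator (vcell p v) (snd z)))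
     = (\<Sum>u\<in>{1..N}. \<Sum>v\<in>{1..N}. a u * a v * (indicator (vcell2 p (u, v)) z *\<^sub>R D z))" for z :: "real \<times> real"
  proof -
    have "(\<Sum>u\<in>{1..N}. \<Sum>v\<in>{1..N}. a u * a v * (indicator (vcell2 p (u, v)) z *\<^sub>R D z))
       = (\<Sum>u\<in>{1..N}. \<Sum>v\<in>{1..N}. (a u * indicator (vcell p u) (fst z)) * (a v * indicator (vcell p v) (snd z))) * D z"
      unfolding sum_distrib_right
      by (intro sum.cong refl) (cases z, simp add: vcell2_def indicator_times mult_ac)
    also have "\<dots> = (\<Sum>u\<in>{1..N}. a u * indicator (vcell p u) (fst z)) * (\<Sum>v\<in>{1..N}. a v * indicator (vcell p v) (snd z)) * D z"
      by (simp only: sum_product)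
    also have "\<dots> = indicator ({0..K} \<times> {0..K}) z *\<^sub>R (D z * (\<Sum>u\<in>{1..N}. a u * indicator (vcell p u) (fst z)) * (\<Sum>v\<in>{1..N}. a v * indicator (vcell p v) (snd z)))"
    proof (cases "z \<in> {0..K} \<times> {0..K}")
      case True
      then show ?thesis by (simp only: indicator_simps scaleR_one) (simp only: mult_ac)
    next
      case False
      then have "fst z \<notin> {0..K} \<or> snd z \<notin> {0..K}" by (cases z) auto
      then have "(\<Sum>u\<in>{1..N}. a u * indicator (vcell p u) (fst z)) = 0 \<or> (\<Sum>v\<in>{1..N}. a v * indicator (vcell p v) (snd z)) = 0"
      proof
        assume "fst z \<notin> {0..K}"
        then have "fst z \<notin> vcell p u" if "u \<in> {1..N}" for u using sub[OF that] by blast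
        then show ?thesis by (intro disjI1 sum.neutral) simp
      next
        assume "snd z \<notin> {0..K}"
        then have "snd z \<notin> vcell p u" if "u \<in> {1..N}" for u using sub[OF that] by blast
        then show ?thesis by (intro disjI2 sum.neutral) simp
      qed
      moreover have "indicator ({0..K} \<times> {0..K}) z = (0 :: real)" using False by simp
      ultimately show ?thesis by (elim disjE) (simp_all only: mult_zero_left mult_zero_right scaleR_zero_left)
    qed
    finally show ?thesis by simp
  qed
  have i: "integrable lborel (\<lambda>z. a u * a v * (indicator (vcell2 p (u, v)) z *\<^sub>R D z))" for u v
    using set_integrable_vcell2[OF p D, of u v] by (intro integrable_mult_right) (simp add: set_integrable_def)
  show ?thesis
  proof -
    have "(LINT z|lborel. (\<Sum>u\<in>{1..N}. \<Sum>v\<in>{1..N}. a u * a v * (indicator (vcell2 p (u, v)) z *\<^sub>R D z)))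
       = (\<Sum>u\<in>{1..N}. LINT z|lborel. (\<Sum>v\<in>{1..N}. a u * a v * (indicator (vcell2 p (u, v)) z *\<^sub>R D z)))"
      by (intro Bochner_Integration.integral_sum Bochner_Integration.integrable_sum i)
    also have "\<dots> = (\<Sum>u\<in>{1..N}. \<Sum>v\<in>{1..N}. LINT z|lborel. a u * a v * (indicator (vcell2 p (u, v)) z *\<^sub>R D z))"
      by (intro sum.cong refl Bochner_Integration.integral_sum i)
    finally show ?thesis unfolding set_lebesgue_integral_def eq by simp
  qed
qed

text \<open>\<open>gibbs_kernel_diff\<close> asks for a quadratic form in a function a on the
  vertices. With a spread over the cells this is the form in the cut norm, up to two discrepancies:
  the latter counts every pair twice, and it contains the N diagonal cells, which contribute at most
  N p^2.\<close>

lemma gibbs_graph_vs_graphon: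
  assumes p1: "p \<le> 1" and W: "W \<in> graphons" and K: "real N * p \<le> K" and c: "0 \<le> c" "c \<le> 1"
    and h: "\<And>u. u \<in> {1..N} \<Longrightarrow> 0 \<le> h u \<and> h u \<le> 1"
  shows "(1 - p)\<^sup>2 * \<bar>gibbs p {1..N} c (\<lambda>e. of_bool (e \<in> E)) h - gibbs p {1..N} c (mean_kernel p (W0 W)) h\<bar>
     \<le> cut_dist K Wg W + real N * p\<^sup>2"
proof (rule gibbs_kernel_diff)
  note Wm = W0_measurable[OF W] and Ws = W0_sym[OF W] and Wb = W0_bounds[OF W]
  have K0: "0 \<le> K" using K p by (meson mult_nonneg_nonneg of_nat_0_le_iff order_less_imp_le order_trans)
  fix a :: "nat \<Rightarrow> real" assume a: "\<And>u. 0 \<le> a u \<and> a u \<le> 1"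
  define D where "D = (\<lambda>z. Wg (fst z) (snd z) - W0 W z)"
  have Dm: "D \<in> borel_measurable borel" unfolding D_def using Wg_measurable Wm by (rule borel_measurable_diff)
  have Db: "\<bar>D z\<bar> \<le> 1" for z using Wg_bounds[of "fst z" "snd z"] Wb[of z] by (simp add: D_def abs_le_iff)
  define \<alpha> where "\<alpha> = (\<lambda>x. \<Sum>u\<in>{1..N}. a u * indicator (vcell p u) x)"
  have \<alpha>m: "\<alpha> \<in> borel_measurable borel" unfolding \<alpha>_def by measurable
  have \<alpha>b: "\<bar>\<alpha> x\<bar> \<le> 1" for x
  proof -
    have "\<bar>\<alpha> x\<bar> = (\<Sum>u\<in>{1..N}. \<bar>a u\<bar> * indicator (vcell p u) x)"
      unfolding \<alpha>_def by (rule abs_sum_indicator_disjoint[OF _ disjoint_vcell[OF p]]) simp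
    also have "\<dots> \<le> (\<Sum>u\<in>{1..N}. indicator (vcell p u) x)"
      using a by (intro sum_mono) (auto simp: indicator_def)
    also have "\<dots> = indicator (\<Union>u\<in>{1..N}. vcell p u) x"
      using disjoint_vcell[OF p] by (simp add: indicator_UN_disjoint)
    also have "\<dots> \<le> 1" by (simp add: indicator_def)
    finally show ?thesis .
  qed
  define f where "f = (\<lambda>e. p\<^sup>2 * (of_bool (e \<in> E) - mean_kernel p (W0 W) e) * (\<Prod>u\<in>e. a u))"
  have cell: "a u * a v * (LINT z:vcell2 p (u, v)|lborel. D z) = f {u, v}" if uv: "u \<in> {1..N}" "v \<in> {1..N}" "u \<noteq> v" for u v
  proof -
    have "(LINT z:vcell2 p (u, v)|lborel. Wg (fst z) (snd z)) = (LINT z:vcell2 p (u, v)|lborel. of_bool ({u, v} \<in> E))"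
    proof (rule set_lebesgue_integral_cong)
      show "\<forall>z. z \<in> vcell2 p (u, v) \<longrightarrow> Wg (fst z) (snd z) = of_bool ({u, v} \<in> E)"
        by (auto simp: Wg_eq vcell2_def vcell_iff[OF p])
    qed simp
    also have "\<dots> = p\<^sup>2 * of_bool ({u, v} \<in> E)"
      using measure_vcell2(1)[OF p, of "(u, v)" N] uv by (simp add: set_lebesgue_integral_def offdiag_def)
    finally have 1: "(LINT z:vcell2 p (u, v)|lborel. Wg (fst z) (snd z)) = p\<^sup>2 * of_bool ({u, v} \<in> E)" .
    have 2: "(LINT z:vcell2 p (u, v)|lborel. W0 W z) = p\<^sup>2 * mean_kernel p (W0 W) {u, v}"
      unfolding mean_kernel_pair[OF Wm Ws uv(3)] using p by (simp add: mean_cell_def)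
    have "(LINT z:vcell2 p (u, v)|lborel. D z) = (LINT z:vcell2 p (u, v)|lborel. Wg (fst z) (snd z)) - (LINT z:vcell2 p (u, v)|lborel. W0 W z)"
      unfolding D_def using Wg_bounds Wb
      by (intro set_integral_diff(2) set_integrable_vcell2 p Wg_measurable Wm) (auto simp: abs_le_iff order_trans[of _ 0])
    then have L: "(LINT z:vcell2 p (u, v)|lborel. D z) = p\<^sup>2 * (of_bool ({u, v} \<in> E) - mean_kernel p (W0 W) {u, v})"
      unfolding 1 2 by (simp only: right_diff_distrib)
    have P: "(\<Prod>u\<in>{u, v}. a u) = a u * a v" using uv by simp
    show ?thesis unfolding f_def L P by (simp only: mult_ac)
  qed
  have "2 * (\<Sum>e\<in>pairs {1..N}. f e) = (\<Sum>u\<in>{1..N}. \<Sum>v\<in>{1..N}. if u = v then 0 else f {u, v})"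
    by (rule sum_pairs_twice[symmetric]) simp
  also have "\<dots> = (\<Sum>u\<in>{1..N}. \<Sum>v\<in>{1..N}. a u * a v * (LINT z:vcell2 p (u, v)|lborel. D z)
       - (if u = v then a u * a v * (LINT z:vcell2 p (u, v)|lborel. D z) else 0))"
    using cell by (intro sum.cong refl) auto
  also have "\<dots> = (\<Sum>u\<in>{1..N}. \<Sum>v\<in>{1..N}. a u * a v * (LINT z:vcell2 p (u, v)|lborel. D z))
       - (\<Sum>u\<in>{1..N}. a u * a u * (LINT z:vcell2 p (u, u)|lborel. D z))"
    by (simp add: sum_subtractf)
  finally have eq: "2 * (\<Sum>e\<in>pairs {1..N}. f e) = \<dots>" .
  have "\<bar>\<Sum>u\<in>{1..N}. \<Sum>v\<in>{1..N}. a u * a v * (LINT z:vcell2 p (u, v)|lborel. D z)\<bar> \<le> cut_dist K Wg W"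
  proof -
    have "(\<Sum>u\<in>{1..N}. \<Sum>v\<in>{1..N}. a u * a v * (LINT z:vcell2 p (u, v)|lborel. D z))
       = (LINT z:{0..K} \<times> {0..K}|lborel. D z * \<alpha> (fst z) * \<alpha> (snd z))"
      unfolding \<alpha>_def by (rule LINT_square_cells[OF Dm Db K, symmetric])
    also have "\<dots> = (LINT z:{0..K} \<times> {0..K}|lborel. (Wg (fst z) (snd z) - W (fst z) (snd z)) * \<alpha> (fst z) * \<alpha> (snd z))"
      by (intro set_lebesgue_integral_cong) (auto simp: D_def W0_def borel_Times)
    finally show ?thesis
      using abs_LINT_le_cut_dist[OF K0, of Wg W \<alpha> \<alpha>] Wg_bounds W \<alpha>m \<alpha>b by (auto simp: graphons_def)
  qed
  moreover have "\<bar>\<Sum>u\<in>{1..N}. a u * a u * (LINT z:vcell2 p (u, u)|lborel. D z)\<bar> \<le> real N * p\<^sup>2"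
  proof -
    have "\<bar>\<Sum>u\<in>{1..N}. a u * a u * (LINT z:vcell2 p (u, u)|lborel. D z)\<bar> \<le> (\<Sum>u\<in>{1..N}. p\<^sup>2)"
    proof (rule order_trans[OF sum_abs], intro sum_mono)
      fix u
      show "\<bar>a u * a u * (LINT z:vcell2 p (u, u)|lborel. D z)\<bar> \<le> p\<^sup>2"
        using a[of u] LINT_vcell2_bound[OF p Dm Db] by (intro abs_mult_le_of_le_one) (auto intro: mult_le_one)
    qed
    then show ?thesis by simp
  qed
  ultimately have "\<bar>2 * (\<Sum>e\<in>pairs {1..N}. f e)\<bar> \<le> cut_dist K Wg W + real N * p\<^sup>2"
    unfolding eq by linarith
  then have "\<bar>\<Sum>e\<in>pairs {1..N}. f e\<bar> \<le> cut_dist K Wg W + real N * p\<^sup>2" by linarith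
  then show "\<bar>\<Sum>e\<in>pairs {1..N}. p\<^sup>2 * (of_bool (e \<in> E) - mean_kernel p (W0 W) e) * (\<Prod>u\<in>e. a u)\<bar> \<le> cut_dist K Wg W + real N * p\<^sup>2"
    by (simp add: f_def)
qed (use p p1 c h mean_cell_bounds[OF p W0_measurable[OF W] W0_bounds[OF W]] in \<open>auto simp: mean_kernel_def\<close>)

end

section \<open>Convergence of the Poisson functionals\<close>

lemma abs_exp_diff_le:
  fixes x y :: real
  assumes "x \<le> 0" "y \<le> 0"
  shows "\<bar>exp x - exp y\<bar> \<le> \<bar>x - y\<bar>"
proof -
  have *: "exp b - exp a \<le> b - a" if "a \<le> b" "b \<le> 0" for a b :: real
  proof -
    have "exp b - exp a = exp b * (1 - exp (a - b))" by (simp add: right_diff_distrib exp_add[symmetric])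
    also have "\<dots> \<le> 1 * (b - a)"
    proof (rule mult_mono)
      show "1 - exp (a - b) \<le> b - a" using exp_ge_add_one_self[of "a - b"] by linarith
    qed (use that in auto)
    finally show ?thesis by simp
  qed
  show ?thesis using *[of x y] *[of y x] assms by (cases "x \<le> y") auto
qed

text \<open>For c = 1 - exp (- t) the Lipschitz constant 1 / (1 - c) is exp t, finite for every
  t.\<close>

lemma abs_ln_diff_le:
  fixes c x y :: real
  assumes c: "0 \<le> c" "c < 1" and x: "0 \<le> x" "x \<le> 1" and y: "0 \<le> y" "y \<le> 1"
  shows "\<bar>ln (1 - c * x) - ln (1 - c * y)\<bar> \<le> 1 / (1 - c) * \<bar>x - y\<bar>"
proof -
  have *: "0 \<le> ln (1 - c * a) - ln (1 - c * b) \<and> ln (1 - c * a) - ln (1 - c * b) \<le> 1 / (1 - c) * (b - a)"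
    if "0 \<le> a" "a \<le> b" "b \<le> 1" for a b
  proof -
    have cb: "c * b \<le> c" "c * a \<le> c" using that c by (auto intro: mult_left_le)
    then have pos: "0 < 1 - c * b" "0 < 1 - c * a" using c by auto
    have "ln (1 - c * a) - ln (1 - c * b) \<le> ((1 - c * a) - (1 - c * b)) / (1 - c * b)"
      by (rule ln_diff_le[OF pos(2,1)])
    also have "\<dots> = c * (b - a) / (1 - c * b)" by (simp add: algebra_simps)
    also have "\<dots> \<le> (b - a) / (1 - c)"
    proof (rule frac_le)
      show "c * (b - a) \<le> b - a" using mult_right_mono[of c 1 "b - a"] c that by simp
    qed (use c that cb in auto)
    finally have "ln (1 - c * a) - ln (1 - c * b) \<le> 1 / (1 - c) * (b - a)" by simp
    moreover have "ln (1 - c * b) \<le> ln (1 - c * a)"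
      using pos mult_left_mono[of a b c] that c by (subst ln_le_cancel_iff) auto
    ultimately show ?thesis by simp
  qed
  show ?thesis
  proof (cases "x \<le> y")
    case True
    then show ?thesis using *[of x y] x y by (simp add: abs_of_nonneg)
  next
    case False
    then show ?thesis using *[of y x] x y by (simp add: abs_minus_commute[of "ln (1 - c * x)"] abs_of_nonneg)
  qed
qed

lemma phi_eq: "phi W t x y = ln (1 - (1 - exp (- t)) * W x y)"
  by (simp add: phi_def algebra_simps)

text \<open>A stochastic integral is known only as an L1 limit; its sign is inherited from the
  approximating elementary integrals.\<close>

lemma L1_limit_nonneg:
  fixes J :: "nat \<Rightarrow> 'w \<Rightarrow> real"
  assumes I: "integrable P I" and J: "\<And>n \<omega>. 0 \<le> J n \<omega>"
    and lim: "(\<lambda>n. \<integral>\<^sup>+\<omega>. ennreal \<bar>J n \<omega> - I \<omega>\<bar> \<partial>P) \<longlonglongrightarrow> 0"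
  shows "AE \<omega> in P. 0 \<le> I \<omega>"
proof -
  have "(\<integral>\<^sup>+\<omega>. ennreal (- I \<omega>) \<partial>P) \<le> (\<integral>\<^sup>+\<omega>. ennreal \<bar>J n \<omega> - I \<omega>\<bar> \<partial>P)" for n
  proof (intro nn_integral_mono ennreal_leI)
    show "- I \<omega> \<le> \<bar>J n \<omega> - I \<omega>\<bar>" for \<omega> using J[of n \<omega>] by linarith
  qed
  then have "(\<integral>\<^sup>+\<omega>. ennreal (- I \<omega>) \<partial>P) \<le> 0"
    using lim by (intro LIMSEQ_le_const) auto
  then have "(\<integral>\<^sup>+\<omega>. ennreal (- I \<omega>) \<partial>P) = 0" by simp
  then have "AE \<omega> in P. ennreal (- I \<omega>) = 0" using I by (subst (asm) nn_integral_0_iff_AE) auto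
  then show ?thesis by eventually_elim (auto simp: ennreal_eq_0_iff)
qed

lemma LINT_abs_eq_nn:
  fixes f :: "'a \<Rightarrow> real"
  assumes "integrable M f"
  shows "(\<integral>\<^sup>+x. ennreal \<bar>f x\<bar> \<partial>M) = ennreal (LINT x|M. \<bar>f x\<bar>)"
  using assms by (intro nn_integral_eq_integral integrable_abs) auto

lemma nn_tendsto_LINT:
  fixes g :: "nat \<Rightarrow> 'b \<Rightarrow> real"
  assumes "\<And>n. integrable M (g n)" "(\<lambda>n. \<integral>\<^sup>+x. ennreal \<bar>g n x\<bar> \<partial>M) \<longlonglongrightarrow> 0"
  shows "(\<lambda>n. LINT x|M. \<bar>g n x\<bar>) \<longlonglongrightarrow> 0"
proof -
  have "(\<integral>\<^sup>+x. ennreal \<bar>g n x\<bar> \<partial>M) = ennreal (LINT x|M. \<bar>g n x\<bar>)" for n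
    using assms(1) by (intro LINT_abs_eq_nn)
  then have "(\<lambda>n. ennreal (LINT x|M. \<bar>g n x\<bar>)) \<longlonglongrightarrow> ennreal 0" using assms(2) by simp
  then show ?thesis by (subst (asm) tendsto_ennreal_iff) (auto intro!: always_eventually integral_nonneg_AE)
qed

text \<open>On the nonpositive half-line the exponential is 1-Lipschitz, so L1 convergence of the
  exponents is enough; the sign conditions pass to the limits by
  \<open>L1_limit_nonneg\<close>.\<close>

lemma expectation_exp_tendsto:
  assumes P: "prob_space P"
    and J2: "\<And>n. integrable P (J2 n)" "\<And>n \<omega>. J2 n \<omega> \<le> 0" and J1: "\<And>n. integrable P (J1 n)" "\<And>n \<omega>. 0 \<le> J1 n \<omega>"
    and I2: "integrable P I2" "(\<lambda>n. \<integral>\<^sup>+\<omega>. ennreal \<bar>J2 n \<omega> - I2 \<omega>\<bar> \<partial>P) \<longlonglongrightarrow> 0"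
    and I1: "integrable P I1" "(\<lambda>n. \<integral>\<^sup>+\<omega>. ennreal \<bar>J1 n \<omega> - I1 \<omega>\<bar> \<partial>P) \<longlonglongrightarrow> 0"
    and c: "0 \<le> c"
  shows "integrable P (\<lambda>\<omega>. exp (1/2 * I2 \<omega> - c * I1 \<omega>))"
    and "(\<lambda>n. LINT \<omega>|P. exp (1/2 * J2 n \<omega> - c * J1 n \<omega>)) \<longlonglongrightarrow> (LINT \<omega>|P. exp (1/2 * I2 \<omega> - c * I1 \<omega>))"
proof -
  interpret prob_space P by (rule P)
  have AE1: "AE \<omega> in P. 0 \<le> I1 \<omega>" by (rule L1_limit_nonneg[OF I1(1) J1(2) I1(2)])
  have AE2: "AE \<omega> in P. 0 \<le> - I2 \<omega>"
  proof (rule L1_limit_nonneg[of P _ "\<lambda>n \<omega>. - J2 n \<omega>"])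
    have "\<bar>- J2 n \<omega> - - I2 \<omega>\<bar> = \<bar>J2 n \<omega> - I2 \<omega>\<bar>" for n \<omega> by simp
    then show "(\<lambda>n. \<integral>\<^sup>+\<omega>. ennreal \<bar>- J2 n \<omega> - - I2 \<omega>\<bar> \<partial>P) \<longlonglongrightarrow> 0" using I2(2) by simp
  qed (use I2 J2 in auto)
  have AE: "AE \<omega> in P. 1/2 * I2 \<omega> - c * I1 \<omega> \<le> 0"
    using AE1 AE2 by eventually_elim (use c in \<open>simp add: order_trans[of _ 0]\<close>)
  have Im: "(\<lambda>\<omega>. exp (1/2 * I2 \<omega> - c * I1 \<omega>)) \<in> borel_measurable P" using I1(1) I2(1) by measurable
  have Jm: "(\<lambda>\<omega>. exp (1/2 * J2 n \<omega> - c * J1 n \<omega>)) \<in> borel_measurable P" for n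
    using J1(1)[of n] J2(1)[of n] by measurable
  have Jle: "1/2 * J2 n \<omega> - c * J1 n \<omega> \<le> 0" for n \<omega>
    using J2(2)[of n \<omega>] J1(2)[of n \<omega>] c by (simp add: order_trans[of _ 0])
  show iI: "integrable P (\<lambda>\<omega>. exp (1/2 * I2 \<omega> - c * I1 \<omega>))"
    by (rule integrable_const_bound[where B = 1, OF _ Im]) (use AE in eventually_elim, simp)
  have iJ: "integrable P (\<lambda>\<omega>. exp (1/2 * J2 n \<omega> - c * J1 n \<omega>))" for n
    by (rule integrable_const_bound[where B = 1, OF _ Jm]) (use Jle[of n] in simp)
  have d2: "(\<lambda>n. LINT \<omega>|P. \<bar>J2 n \<omega> - I2 \<omega>\<bar>) \<longlonglongrightarrow> 0"
    using J2(1) I2 by (intro nn_tendsto_LINT) auto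
  have d1: "(\<lambda>n. LINT \<omega>|P. \<bar>J1 n \<omega> - I1 \<omega>\<bar>) \<longlonglongrightarrow> 0"
    using J1(1) I1 by (intro nn_tendsto_LINT) auto
  have le: "\<bar>(LINT \<omega>|P. exp (1/2 * J2 n \<omega> - c * J1 n \<omega>)) - (LINT \<omega>|P. exp (1/2 * I2 \<omega> - c * I1 \<omega>))\<bar>
     \<le> 1/2 * (LINT \<omega>|P. \<bar>J2 n \<omega> - I2 \<omega>\<bar>) + c * (LINT \<omega>|P. \<bar>J1 n \<omega> - I1 \<omega>\<bar>)" for n
  proof -
    have "\<bar>(LINT \<omega>|P. exp (1/2 * J2 n \<omega> - c * J1 n \<omega>)) - (LINT \<omega>|P. exp (1/2 * I2 \<omega> - c * I1 \<omega>))\<bar>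
       = \<bar>LINT \<omega>|P. exp (1/2 * J2 n \<omega> - c * J1 n \<omega>) - exp (1/2 * I2 \<omega> - c * I1 \<omega>)\<bar>"
      using iI iJ by simp
    also have "\<dots> \<le> (LINT \<omega>|P. \<bar>exp (1/2 * J2 n \<omega> - c * J1 n \<omega>) - exp (1/2 * I2 \<omega> - c * I1 \<omega>)\<bar>)"
      by (rule integral_abs_bound)
    also have "\<dots> \<le> (LINT \<omega>|P. 1/2 * \<bar>J2 n \<omega> - I2 \<omega>\<bar> + c * \<bar>J1 n \<omega> - I1 \<omega>\<bar>)"
    proof (rule integral_mono_AE)
      show "integrable P (\<lambda>\<omega>. \<bar>exp (1/2 * J2 n \<omega> - c * J1 n \<omega>) - exp (1/2 * I2 \<omega> - c * I1 \<omega>)\<bar>)" using iI iJ by simp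
      show "integrable P (\<lambda>\<omega>. 1/2 * \<bar>J2 n \<omega> - I2 \<omega>\<bar> + c * \<bar>J1 n \<omega> - I1 \<omega>\<bar>)" using I1(1) I2(1) J1(1) J2(1) by simp
      show "AE \<omega> in P. \<bar>exp (1/2 * J2 n \<omega> - c * J1 n \<omega>) - exp (1/2 * I2 \<omega> - c * I1 \<omega>)\<bar> \<le> 1/2 * \<bar>J2 n \<omega> - I2 \<omega>\<bar> + c * \<bar>J1 n \<omega> - I1 \<omega>\<bar>"
        using AE
      proof eventually_elim
        case (elim \<omega>)
        have "\<bar>exp (1/2 * J2 n \<omega> - c * J1 n \<omega>) - exp (1/2 * I2 \<omega> - c * I1 \<omega>)\<bar> \<le> \<bar>(1/2 * J2 n \<omega> - c * J1 n \<omega>) - (1/2 * I2 \<omega> - c * I1 \<omega>)\<bar>"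
          by (rule abs_exp_diff_le[OF Jle elim])
        also have "\<dots> = \<bar>1/2 * (J2 n \<omega> - I2 \<omega>) - c * (J1 n \<omega> - I1 \<omega>)\<bar>" by (simp add: algebra_simps)
        also have "\<dots> \<le> \<bar>1/2 * (J2 n \<omega> - I2 \<omega>)\<bar> + \<bar>c * (J1 n \<omega> - I1 \<omega>)\<bar>" by (rule abs_triangle_ineq4)
        also have "\<dots> = 1/2 * \<bar>J2 n \<omega> - I2 \<omega>\<bar> + c * \<bar>J1 n \<omega> - I1 \<omega>\<bar>" using c by (simp add: abs_mult)
        finally show ?case .
      qed
    qed
    also have "\<dots> = 1/2 * (LINT \<omega>|P. \<bar>J2 n \<omega> - I2 \<omega>\<bar>) + c * (LINT \<omega>|P. \<bar>J1 n \<omega> - I1 \<omega>\<bar>)"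
      using I1(1) I2(1) J1(1) J2(1) by simp
    finally show ?thesis .
  qed
  have "(\<lambda>n. 1/2 * (LINT \<omega>|P. \<bar>J2 n \<omega> - I2 \<omega>\<bar>) + c * (LINT \<omega>|P. \<bar>J1 n \<omega> - I1 \<omega>\<bar>)) \<longlonglongrightarrow> 1/2 * 0 + c * 0"
    by (intro tendsto_intros d1 d2)
  then have lim: "(\<lambda>n. 1/2 * (LINT \<omega>|P. \<bar>J2 n \<omega> - I2 \<omega>\<bar>) + c * (LINT \<omega>|P. \<bar>J1 n \<omega> - I1 \<omega>\<bar>)) \<longlonglongrightarrow> 0" by simp
  have "(\<lambda>n. (LINT \<omega>|P. exp (1/2 * J2 n \<omega> - c * J1 n \<omega>)) - (LINT \<omega>|P. exp (1/2 * I2 \<omega> - c * I1 \<omega>))) \<longlonglongrightarrow> 0"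
    by (rule Lim_null_comparison[OF always_eventually[OF allI] lim]) (use le in \<open>simp only: real_norm_def\<close>)
  then show "(\<lambda>n. LINT \<omega>|P. exp (1/2 * J2 n \<omega> - c * J1 n \<omega>)) \<longlonglongrightarrow> (LINT \<omega>|P. exp (1/2 * I2 \<omega> - c * I1 \<omega>))"
    by (rule LIM_zero_cancel)
qed

text \<open>The averaged function is constant on each of the disjoint cells, so \<psi> may be
  applied to the coefficients or to the values. The condition on \<psi> at 0 accounts for the points
  in no off-diagonal cell.\<close>

lemma elem_fun2_mean_kernel:
  assumes p: "0 < p" and w: "w \<in> borel_measurable borel" "\<And>x y. w (y, x) = w (x, y)"
    and \<psi>: "\<psi> 0 = (0::real)"
  shows "elem_fun2 (Suc N) (vcell p) (\<lambda>u v. if u = v then 0 else \<psi> (mean_kernel p w {u, v})) (fst z) (snd z)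
     = \<psi> (avg (offdiag N) (vcell2 p) w z)"
proof -
  have e: "elem_fun2 (Suc N) (vcell p) (\<lambda>u v. if u = v then 0 else \<psi> (mean_kernel p w {u, v})) (fst z) (snd z)
     = (\<Sum>i\<in>offdiag N. \<psi> (mean_cell p w (fst i) (snd i)) * indicator (vcell2 p i) z)"
    by (subst elem_fun2_vcell[OF p], simp, intro sum.cong refl) (auto simp: offdiag_def mean_kernel_pair[OF w])
  show ?thesis
  proof (cases "\<exists>i\<in>offdiag N. z \<in> vcell2 p i")
    case True
    then obtain i where i: "i \<in> offdiag N" "z \<in> vcell2 p i" by auto
    have "(\<Sum>j\<in>offdiag N. \<psi> (mean_cell p w (fst j) (snd j)) * indicator (vcell2 p j) z)
       = (\<Sum>j\<in>offdiag N. if j = i then \<psi> (mean_cell p w (fst i) (snd i)) else 0)"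
    proof (intro sum.cong refl)
      fix j assume j: "j \<in> offdiag N"
      have "j \<noteq> i \<Longrightarrow> z \<notin> vcell2 p j"
        using cells_vcell2[OF p, of N] i j by (auto simp: cells_def disjoint_family_on_def)
      then show "\<psi> (mean_cell p w (fst j) (snd j)) * indicator (vcell2 p j) z = (if j = i then \<psi> (mean_cell p w (fst i) (snd i)) else 0)"
        using i by auto
    qed
    moreover have "avg (offdiag N) (vcell2 p) w z = mean_cell p w (fst i) (snd i)"
      unfolding avg_eq[OF cells_vcell2[OF p] i] mean_cell_def using measure_vcell2(1)[OF p i(1)] by simp
    ultimately show ?thesis using i unfolding e by simp
  next
    case False
    then have "avg (offdiag N) (vcell2 p) w z = 0" by (intro avg_eq_0) auto
    then show ?thesis using False \<psi> unfolding e by (auto intro!: sum.neutral)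
  qed
qed

lemma avg_mean_bounds:
  assumes "0 < p" "w \<in> borel_measurable borel" "\<And>z. 0 \<le> w z \<and> w z \<le> 1"
  shows "0 \<le> avg (offdiag N) (vcell2 p) w z \<and> avg (offdiag N) (vcell2 p) w z \<le> 1"
proof (cases "\<exists>i\<in>offdiag N. z \<in> vcell2 p i")
  case True
  then obtain i where i: "i \<in> offdiag N" "z \<in> vcell2 p i" by auto
  have "avg (offdiag N) (vcell2 p) w z = mean_cell p w (fst i) (snd i)"
    unfolding avg_eq[OF cells_vcell2[OF assms(1)] i] mean_cell_def using measure_vcell2(1)[OF assms(1) i(1)] by simp
  then show ?thesis using mean_cell_bounds[OF assms] by simp
next
  case False
  then have "avg (offdiag N) (vcell2 p) w z = 0" by (intro avg_eq_0) auto
  then show ?thesis by simp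
qed

section \<open>Limits of elementary integrals on a shrinking mesh\<close>

context poisson_proc
begin

lemma elem_int2_vcell_integrable:
  "0 < p \<Longrightarrow> (\<And>u. a u u = 0) \<Longrightarrow> integrable P (elem_int2 S m (vcell p) a)"
  unfolding elem_int2_def[abs_def] using lin2_integrable[OF fin_part_vcell] unfolding lin2_def by blast

lemma elem_int1_vcell_integrable: "0 < p \<Longrightarrow> integrable P (elem_int1 S m (vcell p) b)"
  unfolding elem_int1_def[abs_def] using lin1_integrable[OF fin_part_vcell] unfolding lin1_def by blast

text \<open>The coefficients contain the logarithm of a cell mean, not the cell mean of a logarithm.
  Since the logarithm is Lipschitz on the relevant range, L1 convergence of the averages of W
  carries over to \<open>phi W t\<close>. In \<open>b\<close> the positive part is taken because f
  is nonnegative only almost everywhere, while the elementary integrals must have a fixed sign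
  everywhere.\<close>

theorem stoch_limit:
  fixes p :: "nat \<Rightarrow> real" and N :: "nat \<Rightarrow> nat"
  assumes p: "\<And>n. 0 < p n" "p \<longlonglongrightarrow> 0" and N: "filterlim (\<lambda>n. real (N n) * p n) at_top sequentially"
    and W: "W \<in> graphons" and iW: "integrable lborel (W0 W)"
    and f: "set_integrable lborel {0..} f" and f0: "AE x in lborel. 0 \<le> x \<longrightarrow> 0 \<le> f x"
    and t: "0 \<le> t" and c: "0 \<le> c"
  defines "a \<equiv> \<lambda>n u v. if u = v then 0 else ln (1 - (1 - exp (- t)) * mean_kernel (p n) (W0 W) {u, v})"
    and "b \<equiv> \<lambda>n u. (LINT x:vcell (p n) u|lborel. max 0 (indicator {0..} x * f x)) / p n"
  shows "integrable P (\<lambda>\<omega>. exp (1/2 * stoch_int2 P S (phi W t) \<omega> - c * stoch_int1 P S f \<omega>))"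
    and "(\<lambda>n. expectation (\<lambda>\<omega>. exp (1/2 * elem_int2 S (Suc (N n)) (vcell (p n)) (a n) \<omega>
             - elem_int1 S (Suc (N n)) (vcell (p n)) (\<lambda>u. c * b n u) \<omega>)))
         \<longlonglongrightarrow> expectation (\<lambda>\<omega>. exp (1/2 * stoch_int2 P S (phi W t) \<omega> - c * stoch_int1 P S f \<omega>))"
proof -
  define c1 where "c1 = 1 - exp (- t)"
  have c1: "0 \<le> c1" "c1 < 1" using t by (auto simp: c1_def)
  define \<psi> where "\<psi> = (\<lambda>x::real. ln (1 - c1 * x))"
  note Wm = W0_measurable[OF W] and Wb = W0_bounds[OF W] and Ws = W0_sym[OF W]
  define g where "g = (\<lambda>x. max 0 (indicator {0..} x * f x) :: real)"
  have gi: "integrable lborel g"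
    unfolding g_def using f by (intro integrable_max) (auto simp: set_integrable_def)
  have \<psi>0: "\<psi> 0 = 0" by (simp add: \<psi>_def)
  have a_eq: "a n = (\<lambda>u v. if u = v then 0 else \<psi> (mean_kernel (p n) (W0 W) {u, v}))" for n
    unfolding a_def \<psi>_def c1_def by (rule refl)
  have F2: "elem_fun2 (Suc (N n)) (vcell (p n)) (a n) (fst z) (snd z) = \<psi> (avg (offdiag (N n)) (vcell2 (p n)) (W0 W) z)" for n z
    unfolding a_eq by (rule elem_fun2_mean_kernel[where \<psi> = \<psi>, OF p(1) Wm Ws \<psi>0])
  have F1: "elem_fun1 (Suc (N n)) (vcell (p n)) (b n) x = avg {1..N n} (vcell (p n)) g x" for n x
    unfolding elem_fun1_vcell[OF p(1)] avg_def b_def g_def using measure_vcell[OF p(1)]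
    by (intro sum.cong refl) auto
  have ab: "0 \<le> avg (offdiag (N n)) (vcell2 (p n)) (W0 W) z \<and> avg (offdiag (N n)) (vcell2 (p n)) (W0 W) z \<le> 1" for n z
    by (rule avg_mean_bounds[OF p(1) Wm Wb])
  have \<psi>m: "(\<lambda>z. \<psi> (h z)) \<in> borel_measurable lborel" if "h \<in> borel_measurable lborel" for h :: "real \<times> real \<Rightarrow> real"
    unfolding \<psi>_def using that by measurable
  have \<psi>L: "\<bar>\<psi> x - \<psi> y\<bar> \<le> 1 / (1 - c1) * \<bar>x - y\<bar>" if "0 \<le> x" "x \<le> 1" "0 \<le> y" "y \<le> 1" for x y
    unfolding \<psi>_def by (rule abs_ln_diff_le[OF c1 that])
  have \<psi>i: "integrable lborel (\<lambda>z. \<psi> (h z))" if h: "integrable lborel h" "\<And>z. 0 \<le> h z \<and> h z \<le> 1" for h :: "real \<times> real \<Rightarrow> real"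
  proof (rule Bochner_Integration.integrable_bound)
    show "integrable lborel (\<lambda>z. 1 / (1 - c1) * h z)" using h(1) by simp
    show "(\<lambda>z. \<psi> (h z)) \<in> borel_measurable lborel" using h(1) by (intro \<psi>m) auto
    show "AE z in lborel. norm (\<psi> (h z)) \<le> norm (1 / (1 - c1) * h z)"
      using \<psi>L[of "h _" 0] h(2) \<psi>0 c1 by (intro AE_I2) (simp add: abs_mult)
  qed
  have phi_W: "indicator ({0..} \<times> {0..}) z * phi W t (fst z) (snd z) = \<psi> (W0 W z)" for z
    using \<psi>0 by (cases "z \<in> {0..} \<times> {0..}") (simp_all add: phi_eq \<psi>_def W0_def c1_def)
  have "set_integrable lborel ({0..} \<times> {0..}) (\<lambda>z. phi W t (fst z) (snd z))"
    unfolding set_integrable_def real_scaleR_def phi_W by (rule \<psi>i[OF iW Wb])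
  then have s2: "is_stoch_int2 P S (phi W t) (stoch_int2 P S (phi W t))" by (rule is_stoch_int2_exists)
  have s1: "is_stoch_int1 P S f (stoch_int1 P S f)" by (rule is_stoch_int1_exists[OF f])
  have lim2: "(\<lambda>n. \<integral>\<^sup>+\<omega>. ennreal \<bar>elem_int2 S (Suc (N n)) (vcell (p n)) (a n) \<omega> - stoch_int2 P S (phi W t) \<omega>\<bar> \<partial>P) \<longlonglongrightarrow> 0"
  proof (rule s2[unfolded is_stoch_int2_def, THEN conjunct2, rule_format])
    fix n
    have "set_integrable lborel ({0..} \<times> {0..}) (\<lambda>z. elem_fun2 (Suc (N n)) (vcell (p n)) (a n) (fst z) (snd z))"
      unfolding F2 using \<psi>i[OF avg_integrable[OF cells_vcell2[OF p(1)]] ab] quadrant_borel by (intro set_integrable_lborel) auto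
    then show "disjoint_borel_sets (Suc (N n)) (vcell (p n)) \<and> (\<forall>i. a n i i = 0) \<and>
        set_integrable lborel ({0..} \<times> {0..}) (\<lambda>(x, y). elem_fun2 (Suc (N n)) (vcell (p n)) (a n) x y)"
      using disjoint_borel_sets_vcell[OF p(1)] by (simp add: a_def case_prod_unfold)
  next
    have A: "(\<lambda>n. LINT z|lborel. \<bar>avg (offdiag (N n)) (vcell2 (p n)) (W0 W) z - W0 W z\<bar>) \<longlonglongrightarrow> 0"
      by (rule avg_vcell2_tendsto[OF p N iW]) (simp add: W0_def indicator_def)
    have "(\<lambda>n. 1 / (1 - c1) * (LINT z|lborel. \<bar>avg (offdiag (N n)) (vcell2 (p n)) (W0 W) z - W0 W z\<bar>)) \<longlonglongrightarrow> 1 / (1 - c1) * 0"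
      by (intro tendsto_intros A)
    then have B: "(\<lambda>n. 1 / (1 - c1) * (LINT z|lborel. \<bar>avg (offdiag (N n)) (vcell2 (p n)) (W0 W) z - W0 W z\<bar>)) \<longlonglongrightarrow> 0" by simp
    have C: "(\<lambda>n. ennreal (1 / (1 - c1) * (LINT z|lborel. \<bar>avg (offdiag (N n)) (vcell2 (p n)) (W0 W) z - W0 W z\<bar>))) \<longlonglongrightarrow> 0"
      using tendsto_ennrealI[OF B] by simp
    have le: "(\<integral>\<^sup>+z\<in>{0..} \<times> {0..}. ennreal \<bar>elem_fun2 (Suc (N n)) (vcell (p n)) (a n) (fst z) (snd z) - phi W t (fst z) (snd z)\<bar> \<partial>lborel)
       \<le> ennreal (1 / (1 - c1) * (LINT z|lborel. \<bar>avg (offdiag (N n)) (vcell2 (p n)) (W0 W) z - W0 W z\<bar>))" for n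
    proof -
      have i: "integrable lborel (\<lambda>z. 1 / (1 - c1) * (avg (offdiag (N n)) (vcell2 (p n)) (W0 W) z - W0 W z))"
        using avg_integrable[OF cells_vcell2[OF p(1)]] iW by (intro integrable_mult_right Bochner_Integration.integrable_diff) auto
      have "(\<integral>\<^sup>+z\<in>{0..} \<times> {0..}. ennreal \<bar>elem_fun2 (Suc (N n)) (vcell (p n)) (a n) (fst z) (snd z) - phi W t (fst z) (snd z)\<bar> \<partial>lborel)
         \<le> (\<integral>\<^sup>+z. ennreal \<bar>1 / (1 - c1) * (avg (offdiag (N n)) (vcell2 (p n)) (W0 W) z - W0 W z)\<bar> \<partial>lborel)"
      proof (rule nn_integral_mono)
        fix z :: "real \<times> real"
        show "ennreal \<bar>elem_fun2 (Suc (N n)) (vcell (p n)) (a n) (fst z) (snd z) - phi W t (fst z) (snd z)\<bar> * indicator ({0..} \<times> {0..}) z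
           \<le> ennreal \<bar>1 / (1 - c1) * (avg (offdiag (N n)) (vcell2 (p n)) (W0 W) z - W0 W z)\<bar>"
        proof (cases "z \<in> {0..} \<times> {0..}")
          case True
          then have "phi W t (fst z) (snd z) = \<psi> (W0 W z)" using phi_W[of z] by simp
          then show ?thesis using True \<psi>L ab Wb c1 unfolding F2 by (auto intro!: ennreal_leI simp: abs_mult)
        next
          case False
          then have "indicator ({0..} \<times> {0..}) z = (0::ennreal)" by (rule indicator_simps(2))
          then show ?thesis by (simp only: mult_zero_right zero_le)
        qed
      qed
      also have "\<dots> = ennreal (LINT z|lborel. \<bar>1 / (1 - c1) * (avg (offdiag (N n)) (vcell2 (p n)) (W0 W) z - W0 W z)\<bar>)"
        by (rule LINT_abs_eq_nn[OF i])
      also have "\<dots> = ennreal (1 / (1 - c1) * (LINT z|lborel. \<bar>avg (offdiag (N n)) (vcell2 (p n)) (W0 W) z - W0 W z\<bar>))"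
        using c1 by (simp add: abs_mult)
      finally show ?thesis .
    qed
    show "(\<lambda>n. \<integral>\<^sup>+z\<in>{0..} \<times> {0..}. ennreal \<bar>elem_fun2 (Suc (N n)) (vcell (p n)) (a n) (fst z) (snd z) - phi W t (fst z) (snd z)\<bar> \<partial>lborel) \<longlonglongrightarrow> 0"
      by (rule tendsto_sandwich[OF always_eventually[OF allI] always_eventually[OF allI[OF le]] tendsto_const C]) simp
  qed
  have lim1: "(\<lambda>n. \<integral>\<^sup>+\<omega>. ennreal \<bar>elem_int1 S (Suc (N n)) (vcell (p n)) (b n) \<omega> - stoch_int1 P S f \<omega>\<bar> \<partial>P) \<longlonglongrightarrow> 0"
  proof (rule s1[unfolded is_stoch_int1_def, THEN conjunct2, rule_format])
    fix n
    have "set_integrable lborel {0..} (elem_fun1 (Suc (N n)) (vcell (p n)) (b n))"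
      unfolding F1[abs_def] using avg_integrable[OF cells_vcell[OF p(1)]] by (intro set_integrable_lborel) auto
    then show "disjoint_borel_sets (Suc (N n)) (vcell (p n)) \<and> set_integrable lborel {0..} (elem_fun1 (Suc (N n)) (vcell (p n)) (b n))"
      using disjoint_borel_sets_vcell[OF p(1)] by simp
  next
    have "(\<lambda>n. LINT x|lborel. \<bar>avg {1..N n} (vcell (p n)) g x - g x\<bar>) \<longlonglongrightarrow> 0"
      by (rule avg_vcell_tendsto[OF p N gi]) (simp add: g_def)
    then have "(\<lambda>n. \<integral>\<^sup>+x. ennreal \<bar>avg {1..N n} (vcell (p n)) g x - g x\<bar> \<partial>lborel) \<longlonglongrightarrow> 0"
      by (intro LINT_tendsto_nn Bochner_Integration.integrable_diff gi avg_integrable cells_vcell p)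
    moreover have le: "(\<integral>\<^sup>+x\<in>{0..}. ennreal \<bar>elem_fun1 (Suc (N n)) (vcell (p n)) (b n) x - f x\<bar> \<partial>lborel)
       \<le> (\<integral>\<^sup>+x. ennreal \<bar>avg {1..N n} (vcell (p n)) g x - g x\<bar> \<partial>lborel)" for n
    proof (rule nn_integral_mono_AE)
      show "AE x in lborel. ennreal \<bar>elem_fun1 (Suc (N n)) (vcell (p n)) (b n) x - f x\<bar> * indicator {0..} x
         \<le> ennreal \<bar>avg {1..N n} (vcell (p n)) g x - g x\<bar>"
        using f0
      proof eventually_elim
        case (elim x)
        show ?case
        proof (cases "0 \<le> x")
          case True
          then have "g x = f x" using elim by (simp add: g_def)
          then show ?thesis using True by (simp add: F1)
        qed simp
      qed
    qed
    ultimately show "(\<lambda>n. \<integral>\<^sup>+x\<in>{0..}. ennreal \<bar>elem_fun1 (Suc (N n)) (vcell (p n)) (b n) x - f x\<bar> \<partial>lborel) \<longlonglongrightarrow> 0"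
      by (intro tendsto_sandwich[OF always_eventually[OF allI] always_eventually[OF allI[OF le]] tendsto_const]) simp_all
  qed
  have i2: "integrable P (elem_int2 S (Suc (N n)) (vcell (p n)) (a n))" for n
    using p(1) by (intro elem_int2_vcell_integrable) (auto simp: a_def)
  have i1: "integrable P (elem_int1 S (Suc (N n)) (vcell (p n)) (b n))" for n
    using p(1) by (intro elem_int1_vcell_integrable)
  have n2: "elem_int2 S (Suc (N n)) (vcell (p n)) (a n) \<omega> \<le> 0" for n \<omega>
  proof -
    have "a n u v \<le> 0" for u v
    proof -
      have "0 \<le> mean_kernel (p n) (W0 W) {u, v} \<and> mean_kernel (p n) (W0 W) {u, v} \<le> 1"
        unfolding mean_kernel_def by (rule mean_cell_bounds[OF p(1) Wm Wb])
      then have "0 \<le> c1 * mean_kernel (p n) (W0 W) {u, v}" "c1 * mean_kernel (p n) (W0 W) {u, v} \<le> c1"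
        using c1 by (auto intro: mult_left_le)
      then show ?thesis using c1 by (simp add: a_eq \<psi>_def)
    qed
    then show ?thesis unfolding elem_int2_def by (intro sum_nonpos mult_nonpos_nonneg) auto
  qed
  have n1: "0 \<le> elem_int1 S (Suc (N n)) (vcell (p n)) (b n) \<omega>" for n \<omega>
  proof -
    have "0 \<le> b n u" for u
      unfolding b_def set_lebesgue_integral_def using p(1)[of n] by (intro divide_nonneg_pos integral_nonneg_AE) auto
    then show ?thesis unfolding elem_int1_def by (intro sum_nonneg mult_nonneg_nonneg) auto
  qed
  have I2: "integrable P (stoch_int2 P S (phi W t))" and I1: "integrable P (stoch_int1 P S f)"
    using s1 s2 by (auto simp: is_stoch_int1_def is_stoch_int2_def)
  note E = expectation_exp_tendsto[OF prob_space_axioms i2 n2 i1 n1 I2 lim2 I1 lim1 c]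
  show "integrable P (\<lambda>\<omega>. exp (1/2 * stoch_int2 P S (phi W t) \<omega> - c * stoch_int1 P S f \<omega>))" by (rule E(1))
  have "elem_int1 S (Suc (N n)) (vcell (p n)) (\<lambda>u. c * b n u) \<omega> = c * elem_int1 S (Suc (N n)) (vcell (p n)) (b n) \<omega>" for n \<omega>
    by (simp only: elem_int1_def sum_distrib_left mult.assoc)
  then show "(\<lambda>n. expectation (\<lambda>\<omega>. exp (1/2 * elem_int2 S (Suc (N n)) (vcell (p n)) (a n) \<omega>
             - elem_int1 S (Suc (N n)) (vcell (p n)) (\<lambda>u. c * b n u) \<omega>)))
         \<longlonglongrightarrow> expectation (\<lambda>\<omega>. exp (1/2 * stoch_int2 P S (phi W t) \<omega> - c * stoch_int1 P S f \<omega>))"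
    using E(2) by simp
qed

end

section \<open>Edges, degrees and row sums of the step graphon relative to the cut-off\<close>

context graph_mesh
begin

text \<open>The cut-off K lies inside cell N + 1 or at its left border, so this is the only cell
  that the tail can meet partially.\<close>

lemma tail_cell_measure:
  assumes K: "0 < K" "real N * p \<le> K" "K < real N * p + p"
  defines "\<mu> \<equiv> \<lambda>v. measure lborel (vcell p v \<inter> {K..})"
  shows "v \<le> N \<Longrightarrow> \<mu> v = 0" "N + 2 \<le> v \<Longrightarrow> \<mu> v = p" "0 \<le> \<mu> v" "\<mu> v \<le> p"
proof -
  show "\<mu> v = 0" if "v \<le> N"
  proof -
    have "real v * p \<le> real N * p" using that p by (intro mult_right_mono) auto
    moreover have "x \<le> real v * p" if "x \<in> vcell p v" for x using that by (simp add: vcell_def)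
    ultimately have "x = K" if "x \<in> vcell p v" "K \<le> x" for x using that K(2) by (meson antisym order_trans)
    then have "vcell p v \<inter> {K..} \<subseteq> {K}" by auto
    then have "vcell p v \<inter> {K..} = {} \<or> vcell p v \<inter> {K..} = {K}" by blast
    then show ?thesis unfolding \<mu>_def by (elim disjE) simp_all
  qed
  show "\<mu> v = p" if "N + 2 \<le> v"
  proof -
    have "real (N + 2) * p \<le> real v * p" using that p by (intro mult_right_mono) auto
    then have "real N * p + p \<le> real v * p - p" by (simp add: algebra_simps)
    then have "vcell p v \<inter> {K..} = vcell p v" using K by (auto simp: vcell_def)
    then show ?thesis unfolding \<mu>_def using measure_vcell[OF p] that by simp
  qed
  show "0 \<le> \<mu> v" by (simp add: \<mu>_def)
  have "emeasure lborel (vcell p v \<inter> {K..}) \<le> emeasure lborel (vcell p v)" by (intro emeasure_mono) auto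
  also have "\<dots> \<le> ennreal p" using p by (auto simp: emeasure_vcell)
  finally show "\<mu> v \<le> p" unfolding \<mu>_def measure_def using p by (intro enn2real_leI) auto
qed

lemma LINT_tail_square:
  assumes "0 < K"
  shows "(LINT x:{K..}|lborel. (LINT y:{K..}|lborel. Wg x y))
     = (\<Sum>u\<in>{1..m}. \<Sum>v\<in>{1..m}. of_bool ({u, v} \<in> E) * (measure lborel (vcell p u \<inter> {K..}) * measure lborel (vcell p v \<inter> {K..})))"
proof -
  define \<mu> where "\<mu> = (\<lambda>v. measure lborel (vcell p v \<inter> {K..}))"
  define s where "s = (\<lambda>u. \<Sum>v\<in>{1..m}. of_bool ({u, v} \<in> E) * \<mu> v)"
  have inner: "(LINT y:{K..}|lborel. Wg x y) = s (nat \<lceil>x / p\<rceil>)" for x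
    unfolding s_def \<mu>_def by (rule LINT_row(1)) simp
  have eq: "indicator {K..} x *\<^sub>R s (nat \<lceil>x / p\<rceil>) = (\<Sum>u\<in>{1..m}. s u * indicator (vcell p u \<inter> {K..}) x)" for x
  proof (cases "x \<in> {K..}")
    case True
    then have x: "0 < x" using assms by simp
    have "(\<Sum>u\<in>{1..m}. s u * indicator (vcell p u \<inter> {K..}) x) = (\<Sum>u\<in>{1..m}. if u = nat \<lceil>x / p\<rceil> then s (nat \<lceil>x / p\<rceil>) else 0)"
      using True x by (intro sum.cong refl) (auto simp: indicator_def vcell_iff[OF p])
    also have "\<dots> = s (nat \<lceil>x / p\<rceil>)"
    proof (cases "nat \<lceil>x / p\<rceil> \<in> {1..m}")
      case False
      then have "of_bool ({nat \<lceil>x / p\<rceil>, v} \<in> E) * \<mu> v = 0" for v using edge_pair[of "nat \<lceil>x / p\<rceil>" v] by auto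
      then have "s (nat \<lceil>x / p\<rceil>) = 0" unfolding s_def by (intro sum.neutral) blast
      then show ?thesis by simp
    qed simp
    finally show ?thesis using True by simp
  next
    case False
    have "(\<Sum>u\<in>{1..m}. s u * indicator (vcell p u \<inter> {K..}) x) = 0" using False by (intro sum.neutral) auto
    then show ?thesis using False by simp
  qed
  have em: "emeasure lborel (vcell p u \<inter> {K..}) < \<infinity>" for u
    using emeasure_mono[of "vcell p u \<inter> {K..}" "vcell p u" lborel] emeasure_vcell[OF p, of u]
    by (auto simp: order_le_less_trans)
  have i: "integrable lborel (\<lambda>x. s u * indicator (vcell p u \<inter> {K..}) x :: real)" for u
    using em by (intro integrable_mult_right integrable_real_indicator) auto
  have "(LINT x:{K..}|lborel. (LINT y:{K..}|lborel. Wg x y)) = (LINT x|lborel. (\<Sum>u\<in>{1..m}. s u * indicator (vcell p u \<inter> {K..}) x))"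
    unfolding inner unfolding set_lebesgue_integral_def eq ..
  also have "\<dots> = (\<Sum>u\<in>{1..m}. LINT x|lborel. s u * indicator (vcell p u \<inter> {K..}) x)"
    by (intro Bochner_Integration.integral_sum i)
  also have "\<dots> = (\<Sum>u\<in>{1..m}. s u * \<mu> u)" by (simp add: \<mu>_def)
  finally show ?thesis unfolding s_def sum_distrib_right by (simp add: \<mu>_def mult_ac)
qed

text \<open>An edge with both ends beyond N + 1 has weight p^2 in the integral as well. Only edges
  at vertex N + 1, whose cell may be cut by K, can weigh less, and their number is at most the
  degree of this vertex.\<close>

lemma small_edges_bound:
  assumes K: "0 < K" "real N * p \<le> K" "K < real N * p + p"
  shows "\<bar>p\<^sup>2 * real (card {e \<in> E. e \<subseteq> {N+1..m}}) - 1/2 * (LINT x:{K..}|lborel. (LINT y:{K..}|lborel. Wg x y))\<bar>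
     \<le> p\<^sup>2 * real (vertex_degree E (N + 1))"
proof -
  define \<mu> where "\<mu> = (\<lambda>v. measure lborel (vcell p v \<inter> {K..}))"
  have \<mu>: "\<And>v. v \<le> N \<Longrightarrow> \<mu> v = 0" "\<And>v. N + 2 \<le> v \<Longrightarrow> \<mu> v = p" "\<And>v. 0 \<le> \<mu> v" "\<And>v. \<mu> v \<le> p"
    unfolding \<mu>_def by (fact tail_cell_measure[OF K])+
  have loop: "{u} \<notin> E" for u using edgeD[of "{u}"] by auto
  define ad where "ad = (\<lambda>u v. of_bool ({u, v} \<in> E) :: real)"
  have "2 * real (card {e \<in> E. e \<subseteq> {N+1..m}}) = 2 * (\<Sum>e\<in>pairs {N+1..m}. of_bool (e \<in> E))"
  proof -
    have "(\<Sum>e\<in>pairs {N+1..m}. of_bool (e \<in> E) :: real) = (\<Sum>e\<in>{e \<in> E. e \<subseteq> {N+1..m}}. 1)"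
      using edgeD finite_pairs by (intro sum.mono_neutral_cong_right) (auto simp: pairs_def)
    then show ?thesis by simp
  qed
  also have "\<dots> = (\<Sum>u\<in>{N+1..m}. \<Sum>v\<in>{N+1..m}. if u = v then 0 else of_bool ({u, v} \<in> E))"
    by (rule sum_pairs_twice[symmetric]) simp
  also have "\<dots> = (\<Sum>u\<in>{N+1..m}. \<Sum>v\<in>{N+1..m}. ad u v)"
  proof (intro sum.cong refl)
    fix u v :: nat
    have "{u} \<notin> E" using edgeD[of "{u}"] by auto
    then show "(if u = v then 0 else of_bool ({u, v} \<in> E)) = ad u v" by (auto simp: ad_def)
  qed
  finally have c2: "2 * real (card {e \<in> E. e \<subseteq> {N+1..m}}) = (\<Sum>u\<in>{N+1..m}. \<Sum>v\<in>{N+1..m}. ad u v)" .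
  have J: "(LINT x:{K..}|lborel. (LINT y:{K..}|lborel. Wg x y)) = (\<Sum>u\<in>{N+1..m}. \<Sum>v\<in>{N+1..m}. ad u v * (\<mu> u * \<mu> v))"
  proof -
    have "(LINT x:{K..}|lborel. (LINT y:{K..}|lborel. Wg x y)) = (\<Sum>u\<in>{1..m}. \<Sum>v\<in>{1..m}. ad u v * (\<mu> u * \<mu> v))"
      using LINT_tail_square[OF K(1)] by (simp only: ad_def \<mu>_def)
    also have "\<dots> = (\<Sum>u\<in>{1..m}. \<Sum>v\<in>{N+1..m}. ad u v * (\<mu> u * \<mu> v))"
      using \<mu>(1) by (intro sum.cong refl sum.mono_neutral_right) auto
    also have "\<dots> = (\<Sum>u\<in>{N+1..m}. \<Sum>v\<in>{N+1..m}. ad u v * (\<mu> u * \<mu> v))"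
      using \<mu>(1) by (intro sum.mono_neutral_right) auto
    finally show ?thesis .
  qed
  have deg: "(\<Sum>v\<in>{N+1..m}. ad u v) \<le> real (vertex_degree E u)" for u
  proof -
    have "(\<Sum>v\<in>{N+1..m}. ad u v) = real (card {e \<in> E. u \<in> e \<and> e - {u} \<subseteq> {N+1..m}})"
      unfolding ad_def by (rule sum_adj_eq_card) simp
    also have "\<dots> \<le> real (vertex_degree E u)"
      unfolding vertex_degree_def using finite_E by (intro of_nat_mono card_mono) auto
    finally show ?thesis .
  qed
  have ad_sym: "ad u v = ad v u" for u v by (simp add: ad_def insert_commute)
  have "2 * (p\<^sup>2 * real (card {e \<in> E. e \<subseteq> {N+1..m}}) - 1/2 * (LINT x:{K..}|lborel. (LINT y:{K..}|lborel. Wg x y)))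
     = p\<^sup>2 * (2 * real (card {e \<in> E. e \<subseteq> {N+1..m}})) - (LINT x:{K..}|lborel. (LINT y:{K..}|lborel. Wg x y))"
    by (simp add: algebra_simps)
  also have "\<dots> = (\<Sum>u\<in>{N+1..m}. \<Sum>v\<in>{N+1..m}. ad u v * (p\<^sup>2 - \<mu> u * \<mu> v))"
    unfolding c2 J by (simp add: sum_distrib_left sum_subtractf[symmetric] algebra_simps)
  finally have eq: "2 * (p\<^sup>2 * real (card {e \<in> E. e \<subseteq> {N+1..m}}) - 1/2 * (LINT x:{K..}|lborel. (LINT y:{K..}|lborel. Wg x y))) = \<dots>" .
  have t: "0 \<le> ad u v * (p\<^sup>2 - \<mu> u * \<mu> v) \<and> ad u v * (p\<^sup>2 - \<mu> u * \<mu> v)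
       \<le> (if u = N + 1 then p\<^sup>2 * ad (N+1) v else 0) + (if v = N + 1 then p\<^sup>2 * ad (N+1) u else 0)"
    if "u \<in> {N+1..m}" "v \<in> {N+1..m}" for u v
  proof -
    have "\<mu> u * \<mu> v \<le> p * p" using \<mu>(3,4)[of u] \<mu>(3,4)[of v] p by (intro mult_mono) auto
    then have "0 \<le> p\<^sup>2 - \<mu> u * \<mu> v" by (simp add: power2_eq_square)
    moreover have "p\<^sup>2 - \<mu> u * \<mu> v \<le> p\<^sup>2" using \<mu>(3)[of u] \<mu>(3)[of v] by simp
    moreover have "p\<^sup>2 - \<mu> u * \<mu> v = 0" if "u \<noteq> N + 1" "v \<noteq> N + 1"
      using \<mu>(2)[of u] \<mu>(2)[of v] that \<open>u \<in> {N+1..m}\<close> \<open>v \<in> {N+1..m}\<close> by (simp add: power2_eq_square)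
    ultimately show ?thesis using p ad_sym[of u v] loop by (auto simp: ad_def of_bool_def)
  qed
  have "(\<Sum>u\<in>{N+1..m}. \<Sum>v\<in>{N+1..m}. ad u v * (p\<^sup>2 - \<mu> u * \<mu> v))
     \<le> (\<Sum>u\<in>{N+1..m}. \<Sum>v\<in>{N+1..m}. (if u = N + 1 then p\<^sup>2 * ad (N+1) v else 0) + (if v = N + 1 then p\<^sup>2 * ad (N+1) u else 0))"
    using t by (intro sum_mono) auto
  also have "\<dots> \<le> p\<^sup>2 * (\<Sum>v\<in>{N+1..m}. ad (N+1) v) + p\<^sup>2 * (\<Sum>u\<in>{N+1..m}. ad (N+1) u)"
  proof -
    have ad0: "0 \<le> (\<Sum>v\<in>{N+1..m}. ad (N+1) v)" by (intro sum_nonneg) (simp add: ad_def)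
    have "(\<Sum>u\<in>{N+1..m}. \<Sum>v\<in>{N+1..m}. if u = N + 1 then p\<^sup>2 * ad (N+1) v else 0)
        = (\<Sum>u\<in>{N+1..m}. if u = N + 1 then p\<^sup>2 * (\<Sum>v\<in>{N+1..m}. ad (N+1) v) else 0)"
      by (intro sum.cong refl) (auto simp: sum_distrib_left)
    also have "\<dots> \<le> p\<^sup>2 * (\<Sum>v\<in>{N+1..m}. ad (N+1) v)" using ad0 by simp
    finally have A: "(\<Sum>u\<in>{N+1..m}. \<Sum>v\<in>{N+1..m}. if u = N + 1 then p\<^sup>2 * ad (N+1) v else 0) \<le> p\<^sup>2 * (\<Sum>v\<in>{N+1..m}. ad (N+1) v)" .
    have "(\<Sum>u\<in>{N+1..m}. \<Sum>v\<in>{N+1..m}. if v = N + 1 then p\<^sup>2 * ad (N+1) u else 0)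
        \<le> (\<Sum>u\<in>{N+1..m}. p\<^sup>2 * ad (N+1) u)"
      by (intro sum_mono) (simp add: ad_def)
    then have B: "(\<Sum>u\<in>{N+1..m}. \<Sum>v\<in>{N+1..m}. if v = N + 1 then p\<^sup>2 * ad (N+1) u else 0)
        \<le> p\<^sup>2 * (\<Sum>u\<in>{N+1..m}. ad (N+1) u)" by (simp add: sum_distrib_left)
    show ?thesis unfolding sum.distrib using A B by linarith
  qed
  also have "\<dots> \<le> p\<^sup>2 * real (vertex_degree E (N + 1)) + p\<^sup>2 * real (vertex_degree E (N + 1))"
    using deg[of "N + 1"] p by (intro add_mono mult_left_mono) auto
  finally have up: "(\<Sum>u\<in>{N+1..m}. \<Sum>v\<in>{N+1..m}. ad u v * (p\<^sup>2 - \<mu> u * \<mu> v)) \<le> 2 * (p\<^sup>2 * real (vertex_degree E (N + 1)))" by (simp only: mult_2)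
  have lo: "0 \<le> (\<Sum>u\<in>{N+1..m}. \<Sum>v\<in>{N+1..m}. ad u v * (p\<^sup>2 - \<mu> u * \<mu> v))"
    using t by (intro sum_nonneg) auto
  have half: "\<bar>x\<bar> \<le> y" if "2 * x \<le> 2 * y" "0 \<le> 2 * x" for x y :: real using that by linarith
  show ?thesis by (rule half) (use up lo in \<open>simp_all only: eq\<close>)
qed

lemma sum_cells_eq_LINT:
  shows "(\<Sum>u\<in>{1..N}. p * F u) = (LINT x:{0<..real N * p}|lborel. F (nat \<lceil>x / p\<rceil>))"
    and "set_integrable lborel {0<..real N * p} (\<lambda>x. F (nat \<lceil>x / p\<rceil>) :: real)"
proof -
  have eq: "indicator {0<..real N * p} x *\<^sub>R F (nat \<lceil>x / p\<rceil>) = (\<Sum>u\<in>{1..N}. F u * indicator (vcell p u) x)" for x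
  proof -
    have "(\<Sum>u\<in>{1..N}. F u * indicator (vcell p u) x) = F (nat \<lceil>x / p\<rceil>) * (\<Sum>u\<in>{1..N}. indicator (vcell p u) x)"
      unfolding sum_distrib_left by (intro sum.cong refl) (auto simp: indicator_def vcell_iff[OF p])
    also have "(\<Sum>u\<in>{1..N}. indicator (vcell p u) x :: real) = indicator (\<Union>u\<in>{1..N}. vcell p u) x"
      using disjoint_vcell[OF p] by (simp add: indicator_UN_disjoint)
    finally show ?thesis unfolding UN_vcell[OF p] by simp
  qed
  have i: "integrable lborel (\<lambda>x. F u * indicator (vcell p u) x :: real)" for u
    using p by (intro integrable_mult_right integrable_real_indicator) (auto simp: emeasure_vcell)
  show "set_integrable lborel {0<..real N * p} (\<lambda>x. F (nat \<lceil>x / p\<rceil>) :: real)"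
    unfolding set_integrable_def eq by (intro Bochner_Integration.integrable_sum i)
  have "(LINT x:{0<..real N * p}|lborel. F (nat \<lceil>x / p\<rceil>)) = (\<Sum>u\<in>{1..N}. LINT x|lborel. F u * indicator (vcell p u) x)"
    unfolding set_lebesgue_integral_def eq by (intro Bochner_Integration.integral_sum i)
  also have "\<dots> = (\<Sum>u\<in>{1..N}. p * F u)"
    using measure_vcell[OF p] by (intro sum.cong refl) simp
  finally show "(\<Sum>u\<in>{1..N}. p * F u) = (LINT x:{0<..real N * p}|lborel. F (nat \<lceil>x / p\<rceil>))" by simp
qed

text \<open>For a big vertex u, the conditional mean number of present edges from u to small
  vertices, given that u is selected.\<close>

definition bs_degree :: "nat \<Rightarrow> nat \<Rightarrow> real" where
  "bs_degree N u = p * real (card {e \<in> E. u \<in> e \<and> e \<inter> {N+1..m} \<noteq> {}})"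

text \<open>The discrete counterpart of \<open>Delta\<close>. It subtracts the row over the big
  interval only, whereas \<open>Delta\<close> subtracts the whole row; the difference later appears
  as a tail of \<open>W\<close>.\<close>

lemma bs_degree_eq:
  assumes x: "x \<in> {0<..real N * p}"
  shows "bs_degree N (nat \<lceil>x / p\<rceil>) = graphon_degree Wg x - (LINT y:{0<..real N * p}|lborel. Wg x y)"
proof -
  define u where "u = nat \<lceil>x / p\<rceil>"
  have "x \<in> (\<Union>u\<in>{1..N}. vcell p u)" unfolding UN_vcell[OF p] by (rule x)
  then have u: "u \<in> {1..N}" by (auto simp: vcell_iff[OF p] u_def)
  have "{e \<in> E. u \<in> e \<and> e \<inter> {N+1..m} \<noteq> {}} = {e \<in> E. u \<in> e \<and> e - {u} \<subseteq> {N+1..m}}"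
  proof (intro set_eqI iffI)
    fix e assume e: "e \<in> {e \<in> E. u \<in> e \<and> e \<inter> {N+1..m} \<noteq> {}}"
    then have "e \<inter> {N+1..m} \<noteq> {}" by simp
    then obtain w where w: "w \<in> e" "w \<in> {N+1..m}" by blast
    then have "w \<noteq> u" using u by auto
    moreover have "card e = 2" using edgeD e by auto
    ultimately have "e = {u, w}" using e w by (auto simp: card_2_iff)
    then show "e \<in> {e \<in> E. u \<in> e \<and> e - {u} \<subseteq> {N+1..m}}" using e w by auto
  next
    fix e assume e: "e \<in> {e \<in> E. u \<in> e \<and> e - {u} \<subseteq> {N+1..m}}"
    then have "card e = 2" using edgeD by auto
    then have "e - {u} \<noteq> {}" using e by (auto simp: card_2_iff)
    then show "e \<in> {e \<in> E. u \<in> e \<and> e \<inter> {N+1..m} \<noteq> {}}" using e by auto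
  qed
  then have 1: "bs_degree N u = p * (\<Sum>v\<in>{N+1..m}. of_bool ({u, v} \<in> E))"
    unfolding bs_degree_def sum_adj_eq_card[OF finite_atLeastAtMost] by (simp only:)
  have 2: "graphon_degree Wg x = p * (\<Sum>v\<in>{1..m}. of_bool ({u, v} \<in> E))"
    unfolding degree_eq u_def[symmetric] vertex_degree_def sum_adj_eq_card[OF finite_atLeastAtMost]
    using edgeD by (intro arg_cong[of _ _ "\<lambda>x. p * real x"] arg_cong[of _ _ card]) auto
  have meas: "measure lborel (vcell p v \<inter> {0<..real N * p}) = (if v \<le> N then p else 0)" if "v \<in> {1..m}" for v
  proof (cases "v \<le> N")
    case True
    then have "vcell p v \<subseteq> (\<Union>u\<in>{1..N}. vcell p u)" using that by auto
    then have "vcell p v \<inter> {0<..real N * p} = vcell p v" unfolding UN_vcell[OF p] by auto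
    then show ?thesis using True measure_vcell[OF p, of v] that by simp
  next
    case False
    have "vcell p v \<inter> (\<Union>u\<in>{1..N}. vcell p u) = {}" using False by (auto simp: vcell_iff[OF p])
    then have "vcell p v \<inter> {0<..real N * p} = {}" unfolding UN_vcell[OF p] .
    then show ?thesis using False by simp
  qed
  have "(LINT y:{0<..real N * p}|lborel. Wg x y) = (\<Sum>v\<in>{1..m}. of_bool ({u, v} \<in> E) * measure lborel (vcell p v \<inter> {0<..real N * p}))"
    unfolding u_def by (rule LINT_row(1)) simp
  also have "\<dots> = (\<Sum>v\<in>{1..m}. of_bool ({u, v} \<in> E) * (if v \<le> N then p else 0))"
    using meas by (intro sum.cong refl) simp
  finally have 3: "(LINT y:{0<..real N * p}|lborel. Wg x y) = \<dots>" .
  have "(\<Sum>v\<in>{N+1..m}. of_bool ({u, v} \<in> E)) = (\<Sum>v\<in>{1..m}. of_bool ({u, v} \<in> E) * (if v \<le> N then 0 else 1 :: real))"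
    by (intro sum.mono_neutral_cong_left) auto
  then have "bs_degree N u = (\<Sum>v\<in>{1..m}. of_bool ({u, v} \<in> E) * (if v \<le> N then 0 else p))"
    unfolding 1 by (auto simp: sum_distrib_left intro!: sum.cong)
  moreover have "graphon_degree Wg x = (\<Sum>v\<in>{1..m}. of_bool ({u, v} \<in> E) * p)"
    unfolding 2 by (simp add: sum_distrib_left mult.commute)
  ultimately show ?thesis
    unfolding u_def[symmetric] 3 by (simp only: sum_subtractf[symmetric]) (intro sum.cong refl, auto)
qed

lemma LINT_degree_le: "(LINT x:{0<..real N * p}|lborel. graphon_degree Wg x) \<le> 2 * (real (card E) * p\<^sup>2)"
proof -
  have "(LINT x:{0<..real N * p}|lborel. graphon_degree Wg x) = (\<Sum>u\<in>{1..N}. p * (p * real (vertex_degree E u)))"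
    unfolding degree_eq by (rule sum_cells_eq_LINT(1)[symmetric])
  also have "\<dots> = p\<^sup>2 * real (\<Sum>u\<in>{1..N}. vertex_degree E u)"
    by (simp add: sum_distrib_left power2_eq_square mult.assoc)
  also have "(\<Sum>u\<in>{1..N}. vertex_degree E u) \<le> 2 * card E"
  proof -
    \<comment> \<open>N may exceed the number m of vertices; indices beyond m have degree 0.\<close>
    have "(\<Sum>u\<in>{1..N}. vertex_degree E u) = (\<Sum>u\<in>{1..N} \<inter> {1..m}. vertex_degree E u)"
    proof (rule sum.mono_neutral_right)
      show "\<forall>u\<in>{1..N} - {1..N} \<inter> {1..m}. vertex_degree E u = 0"
      proof
        fix u assume "u \<in> {1..N} - {1..N} \<inter> {1..m}"
        then have "{e \<in> E. u \<in> e} = {}" using edgeD by fastforce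
        then show "vertex_degree E u = 0" unfolding vertex_degree_def by (simp only:) simp
      qed
    qed auto
    also have "\<dots> \<le> (\<Sum>u\<in>{1..m}. vertex_degree E u)" by (intro sum_mono2) auto
    finally show ?thesis unfolding sum_degrees .
  qed
  then have "p\<^sup>2 * real (\<Sum>u\<in>{1..N}. vertex_degree E u) \<le> p\<^sup>2 * real (2 * card E)"
    by (intro mult_left_mono of_nat_mono) auto
  finally show ?thesis by (simp add: mult_ac)
qed

text \<open>Testing with the sign of the row integral in x and the indicator of B in y turns the cut
  norm into the L1 norm of the row integrals. Testing with constants on B bounds the mass of
  \<open>W0 W\<close> on the square by that of the graph, at most 2 |E| p^2, plus the cut
  distance.\<close>

lemma cut_row_L1:
  assumes W: "W \<in> graphons" and K: "real N * p \<le> K"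
  defines "B \<equiv> {0<..real N * p}"
  defines "F \<equiv> \<lambda>z. indicator (B \<times> B) z * (Wg (fst z) (snd z) - W0 W z)"
  shows "integrable lborel F" "integrable lborel (\<lambda>x. LINT y|lborel. F (x, y))"
    and "(LINT x|lborel. \<bar>LINT y|lborel. F (x, y)\<bar>) \<le> cut_dist K Wg W"
    and "(LINT z|lborel. indicator (B \<times> B) z * W0 W z) \<le> 2 * (real (card E) * p\<^sup>2) + cut_dist K Wg W"
    and "integrable lborel (\<lambda>z. indicator (B \<times> B) z * W0 W z)"
proof -
  note Wm = W0_measurable[OF W] and Wb = W0_bounds[OF W]
  have K0: "0 \<le> K" using K p by (meson mult_nonneg_nonneg of_nat_0_le_iff order_less_imp_le order_trans)
  have Bm: "B \<times> B \<in> sets (borel :: (real \<times> real) measure)" unfolding B_def by (simp add: borel_Times)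
  have BK: "B \<subseteq> {0..K}" using K by (auto simp: B_def)
  have em: "emeasure (lborel :: (real \<times> real) measure) (B \<times> B) < \<infinity>"
    unfolding lborel_prod[symmetric] B_def using p
    by (subst lborel.emeasure_pair_measure_Times) (auto simp: ennreal_mult_less_top)
  have iB: "integrable lborel (indicator (B \<times> B) :: real \<times> real \<Rightarrow> real)"
    using em Bm by (intro integrable_real_indicator) auto
  have Fm: "F \<in> borel_measurable borel"
    unfolding F_def using Wg_measurable Wm Bm by (intro borel_measurable_times borel_measurable_diff borel_measurable_indicator)
  have bounded: "integrable lborel (\<lambda>z. f z * F z)" if "f \<in> borel_measurable borel" "\<And>z. \<bar>f z\<bar> \<le> 1" for f :: "real \<times> real \<Rightarrow> real"
  proof (rule Bochner_Integration.integrable_bound[OF iB])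
    show "(\<lambda>z. f z * F z) \<in> borel_measurable lborel" using that Fm by simp
    show "AE z in lborel. norm (f z * F z) \<le> norm (indicator (B \<times> B) z :: real)"
    proof (rule AE_I2)
      fix z :: "real \<times> real"
      have "\<bar>Wg (fst z) (snd z) - W0 W z\<bar> \<le> 1" using Wg_bounds[of "fst z" "snd z"] Wb[of z] by (simp add: abs_le_iff)
      then have "\<bar>f z\<bar> * \<bar>Wg (fst z) (snd z) - W0 W z\<bar> \<le> 1 * 1" using that(2) by (intro mult_mono) auto
      then show "norm (f z * F z) \<le> norm (indicator (B \<times> B) z :: real)" by (auto simp: F_def indicator_def abs_mult)
    qed
  qed
  show Fi: "integrable lborel F" using bounded[of "\<lambda>_. 1"] by simp
  then have Fi2: "integrable (lborel \<Otimes>\<^sub>M lborel) F" unfolding lborel_prod .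
  define D where "D = (\<lambda>x. LINT y|lborel. F (x, y))"
  have Di: "integrable lborel D" unfolding D_def by (rule lborel_pair.integrable_fst'[OF Fi2])
  then show "integrable lborel (\<lambda>x. LINT y|lborel. F (x, y))" unfolding D_def .
  have sm: "(\<lambda>x. sgn (D x)) \<in> borel_measurable borel" using Di by simp
  have sm2: "(\<lambda>z :: real \<times> real. sgn (D (fst z))) \<in> borel_measurable borel"
    using measurable_compose[OF measurable_fst sm, of "borel :: real measure"] by (simp add: borel_prod)
  have sb: "\<bar>sgn (D x)\<bar> \<le> 1" for x by (simp add: sgn_real_def)
  have i3: "integrable (lborel \<Otimes>\<^sub>M lborel) (\<lambda>z. sgn (D (fst z)) * F z)"
    unfolding lborel_prod using sm2 sb by (intro bounded) auto
  have cut: "\<bar>LINT z|lborel. sgn' (fst z) * F z\<bar> \<le> cut_dist K Wg W"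
    if s: "sgn' \<in> borel_measurable borel" "\<And>x. \<bar>sgn' x\<bar> \<le> 1" for sgn' :: "real \<Rightarrow> real"
  proof -
    have "(LINT z|lborel. sgn' (fst z) * F z)
       = (LINT z:{0..K} \<times> {0..K}|lborel. (Wg (fst z) (snd z) - W (fst z) (snd z)) * (sgn' (fst z) * indicator B (fst z)) * indicator B (snd z))"
      unfolding set_lebesgue_integral_def
    proof (intro Bochner_Integration.integral_cong refl)
      fix z :: "real \<times> real"
      show "sgn' (fst z) * F z = indicator ({0..K} \<times> {0..K}) z *\<^sub>R ((Wg (fst z) (snd z) - W (fst z) (snd z)) * (sgn' (fst z) * indicator B (fst z)) * indicator B (snd z))"
      proof (cases "z \<in> B \<times> B")
        case True
        then have "z \<in> {0..K} \<times> {0..K}" "z \<in> {0..} \<times> {0..}" "fst z \<in> B" "snd z \<in> B" using BK by auto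
        then show ?thesis using True by (simp add: F_def W0_def)
      next
        case False
        then have "fst z \<notin> B \<or> snd z \<notin> B" by (cases z) auto
        then show ?thesis using False by (auto simp: F_def)
      qed
    qed
    also have "\<bar>\<dots>\<bar> \<le> cut_dist K Wg W"
    proof (rule abs_LINT_le_cut_dist[OF K0])
      show "(\<lambda>x. sgn' x * indicator B x) \<in> borel_measurable borel" using s(1) by (simp add: B_def)
      show "\<bar>sgn' x * indicator B x\<bar> \<le> 1" for x using s(2)[of x] by (simp add: indicator_def)
    qed (use Wg_bounds W in \<open>auto simp: graphons_def B_def indicator_def\<close>)
    finally show ?thesis .
  qed
  have "(LINT x|lborel. \<bar>D x\<bar>) = (LINT x|lborel. (LINT y|lborel. sgn (D (fst (x, y))) * F (x, y)))"
  proof (intro Bochner_Integration.integral_cong refl)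
    fix x
    have "(LINT y|lborel. sgn (D (fst (x, y))) * F (x, y)) = sgn (D x) * D x"
      unfolding D_def by simp
    then show "\<bar>D x\<bar> = (LINT y|lborel. sgn (D (fst (x, y))) * F (x, y))"
      by (simp only: abs_sgn mult.commute)
  qed
  also have "\<dots> = (LINT z|lborel. sgn (D (fst z)) * F z)"
    using lborel_pair.integral_fst'[OF i3] by (simp add: lborel_prod)
  also have "\<dots> \<le> cut_dist K Wg W" using cut[OF sm sb] by linarith
  finally show "(LINT x|lborel. \<bar>LINT y|lborel. F (x, y)\<bar>) \<le> cut_dist K Wg W" unfolding D_def .
  have iW: "integrable lborel (\<lambda>z. indicator (B \<times> B) z * h z)"
    if "h \<in> borel_measurable borel" "\<And>z. \<bar>h z\<bar> \<le> 1" for h :: "real \<times> real \<Rightarrow> real"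
    by (rule Bochner_Integration.integrable_bound[OF iB]) (use that Bm in \<open>auto simp: indicator_def\<close>)
  show i1: "integrable lborel (\<lambda>z. indicator (B \<times> B) z * W0 W z)" using Wm Wb by (intro iW) (auto simp: abs_le_iff order_trans[of _ 0])
  have i2: "integrable lborel (\<lambda>z. indicator (B \<times> B) z * Wg (fst z) (snd z))"
    using Wg_measurable Wg_bounds by (intro iW) (auto simp: abs_le_iff order_trans[of _ 0])
  have "(LINT z|lborel. indicator (B \<times> B) z * W0 W z) = (LINT z|lborel. indicator (B \<times> B) z * Wg (fst z) (snd z)) - (LINT z|lborel. F z)"
    using i1 i2 by (subst Bochner_Integration.integral_diff[symmetric]) (auto simp: F_def algebra_simps Fi[unfolded F_def])
  also have "\<dots> \<le> 2 * (real (card E) * p\<^sup>2) + cut_dist K Wg W"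
  proof -
    have i2': "integrable (lborel \<Otimes>\<^sub>M lborel) (\<lambda>z. indicator (B \<times> B) z * Wg (fst z) (snd z))" using i2 unfolding lborel_prod .
    have "(LINT z|lborel. indicator (B \<times> B) z * Wg (fst z) (snd z)) = (LINT x|lborel. (LINT y|lborel. indicator (B \<times> B) (x, y) * Wg x y))"
      using lborel_pair.integral_fst'[OF i2'] by (simp add: lborel_prod)
    also have "\<dots> \<le> (LINT x:B|lborel. graphon_degree Wg x)"
      unfolding set_lebesgue_integral_def
    proof (rule integral_mono)
      show "integrable lborel (\<lambda>x. LINT y|lborel. indicator (B \<times> B) (x, y) * Wg x y)"
        using lborel_pair.integrable_fst'[OF i2'] by simp
      show "integrable lborel (\<lambda>x. indicator B x *\<^sub>R graphon_degree Wg x)"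
        using sum_cells_eq_LINT(2)[of N "\<lambda>u. p * real (vertex_degree E u)"] unfolding degree_eq B_def set_integrable_def .
      fix x
      have "(LINT y|lborel. indicator (B \<times> B) (x, y) * Wg x y) = indicator B x * (LINT y:B|lborel. Wg x y)"
        by (simp add: set_lebesgue_integral_def indicator_times mult.assoc)
      also have "\<dots> \<le> indicator B x * graphon_degree Wg x"
      proof (rule mult_left_mono)
        show "(LINT y:B|lborel. Wg x y) \<le> graphon_degree Wg x"
          unfolding graphon_degree_def set_lebesgue_integral_def
        proof (rule integral_mono)
          show "integrable lborel (\<lambda>y. indicator B y *\<^sub>R Wg x y)" "integrable lborel (\<lambda>y. indicator {0..} y *\<^sub>R Wg x y)"
            using LINT_row(2)[of B x] LINT_row(2)[of "{0..}" x] by (simp_all add: B_def set_integrable_def)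
        qed (use Wg_bounds in \<open>auto simp: B_def indicator_def\<close>)
      qed simp
      finally show "(LINT y|lborel. indicator (B \<times> B) (x, y) * Wg x y) \<le> indicator B x *\<^sub>R graphon_degree Wg x" by simp
    qed
    also have "\<dots> \<le> 2 * (real (card E) * p\<^sup>2)" unfolding B_def by (rule LINT_degree_le)
    finally have "(LINT z|lborel. indicator (B \<times> B) z * Wg (fst z) (snd z)) \<le> 2 * (real (card E) * p\<^sup>2)" .
    moreover have "\<bar>LINT z|lborel. F z\<bar> \<le> cut_dist K Wg W" using cut[of "\<lambda>_. 1"] by simp
    ultimately show ?thesis by linarith
  qed
  finally show "(LINT z|lborel. indicator (B \<times> B) z * W0 W z) \<le> 2 * (real (card E) * p\<^sup>2) + cut_dist K Wg W" .
qed

end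

section \<open>Sequences of graphs\<close>

lemma (in graph_mesh) vertex_degree_outside: "u \<notin> {1..m} \<Longrightarrow> vertex_degree E u = 0"
proof -
  assume "u \<notin> {1..m}"
  then have "{e \<in> E. u \<in> e} = {}" using edgeD by fastforce
  then show ?thesis unfolding vertex_degree_def by (simp only:) simp
qed

lemma (in graph_mesh) degree_integrable: "integrable lborel (graphon_degree Wg)"
proof -
  have "indicator {0<..real m * p} x *\<^sub>R (p * real (vertex_degree E (nat \<lceil>x / p\<rceil>))) = graphon_degree Wg x" for x
  proof (cases "x \<in> {0<..real m * p}")
    case False
    have "nat \<lceil>x / p\<rceil> \<notin> {1..m}"
    proof
      assume "nat \<lceil>x / p\<rceil> \<in> {1..m}"
      moreover from this have "0 < nat \<lceil>x / p\<rceil>" unfolding atLeastAtMost_iff by (rule order_less_le_trans[OF zero_less_one conjunct1])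
      then have "0 < x / p" by (simp only: zero_less_nat_eq zero_less_ceiling)
      then have "0 < x" using p by (simp add: zero_less_divide_iff)
      ultimately have "x \<in> (\<Union>u\<in>{1..m}. vcell p u)" by (auto simp: vcell_iff[OF p])
      then show False using False unfolding UN_vcell[OF p] by simp
    qed
    then show ?thesis using False vertex_degree_outside by (simp add: degree_eq)
  qed (simp add: degree_eq)
  then show ?thesis
    using sum_cells_eq_LINT(2)[of m "\<lambda>u. p * real (vertex_degree E u)"] by (simp add: set_integrable_def)
qed

text \<open>The double limit and the limits at fixed K and fixed truncation level appear as limits
  along one sequence \<kappa>, which is both cut-off and truncation level. The number m n of
  vertices is separate from n because the locale is used with m n = Suc n.\<close>

locale graph_seq =
  fixes p :: "nat \<Rightarrow> real" and m :: "nat \<Rightarrow> nat" and E :: "nat \<Rightarrow> nat set set"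
    and W :: "real \<Rightarrow> real \<Rightarrow> real" and d :: "real \<Rightarrow> real" and \<kappa> :: "nat \<Rightarrow> real" and lam C :: real
  assumes p: "\<And>n. 0 < p n" "\<And>n. p n < 1" "p \<longlonglongrightarrow> 0"
    and graph: "\<And>n. simple_graph (m n) (E n)"
    and edges: "\<And>n. real (card (E n)) * (p n)\<^sup>2 \<le> C"
    and sorted: "\<And>n u v. 1 \<le> u \<Longrightarrow> u \<le> v \<Longrightarrow> v \<le> m n \<Longrightarrow> vertex_degree (E n) v \<le> vertex_degree (E n) u"
    and \<kappa>: "\<And>n. 1 \<le> \<kappa> n" "filterlim \<kappa> at_top sequentially" "(\<lambda>n. \<kappa> n * p n) \<longlonglongrightarrow> 0"
    and cut: "(\<lambda>n. cut_dist (\<kappa> n) (graph_graphon (m n) (1 / p n) (E n)) W) \<longlonglongrightarrow> 0"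
    and trunc: "(\<lambda>n. LINT x:{0..\<kappa> n}|lborel.
             \<bar>graphon_degree (graph_graphon (m n) (1 / p n) (E n)) x
                * of_bool (graphon_degree (graph_graphon (m n) (1 / p n) (E n)) x \<le> \<kappa> n)
              - d x * of_bool (d x \<le> \<kappa> n)\<bar>) \<longlonglongrightarrow> 0"
    and small: "(\<lambda>n. 1/2 * (LINT x:{\<kappa> n..}|lborel. (LINT y:{\<kappa> n..}|lborel.
             graph_graphon (m n) (1 / p n) (E n) x y))) \<longlonglongrightarrow> lam"
    and W: "W \<in> graphons" and d_nonneg: "\<And>x. 0 \<le> x \<Longrightarrow> 0 \<le> d x" and d_int: "set_integrable lborel {0..} d"
begin

abbreviation Wn :: "nat \<Rightarrow> real \<Rightarrow> real \<Rightarrow> real" where "Wn n \<equiv> graph_graphon (m n) (1 / p n) (E n)"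

text \<open>Rounding down gives \<open>Nn n * p n \<le> \<kappa> n < Nn n * p n + p n\<close>, the
  situation of \<open>tail_cell_measure\<close>.\<close>

definition Nn :: "nat \<Rightarrow> nat" where "Nn n = nat \<lfloor>\<kappa> n / p n\<rfloor>"

definition Bn :: "nat \<Rightarrow> real set" where "Bn n = {0<..real (Nn n) * p n}"

lemma mesh: "graph_mesh (p n) (m n) (E n)"
  using p graph by (simp add: graph_mesh_def)

lemma Nn_bounds: "real (Nn n) * p n \<le> \<kappa> n" "\<kappa> n < real (Nn n) * p n + p n"
proof -
  have q: "0 \<le> \<kappa> n / p n" using p(1)[of n] \<kappa>(1)[of n] by simp
  then have N: "real (Nn n) = of_int \<lfloor>\<kappa> n / p n\<rfloor>" by (simp add: Nn_def)
  have "real (Nn n) \<le> \<kappa> n / p n" "\<kappa> n / p n < real (Nn n) + 1" unfolding N by linarith+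
  then show "real (Nn n) * p n \<le> \<kappa> n" "\<kappa> n < real (Nn n) * p n + p n"
    using p(1)[of n] by (simp_all add: pos_le_divide_eq pos_divide_less_eq distrib_right)
qed

lemma Nn_lim: "filterlim (\<lambda>n. real (Nn n) * p n) at_top sequentially"
proof (rule filterlim_at_top_mono)
  show "filterlim (\<lambda>n. - 1 + \<kappa> n) at_top sequentially"
    by (rule filterlim_tendsto_add_at_top[OF tendsto_const \<kappa>(2)])
  have "- 1 + \<kappa> n \<le> real (Nn n) * p n" for n using Nn_bounds(2)[of n] p(2)[of n] by linarith
  then show "\<forall>\<^sub>F n in sequentially. - 1 + \<kappa> n \<le> real (Nn n) * p n" by simp
qed

lemma Npp_lim: "(\<lambda>n. real (Nn n) * (p n)\<^sup>2) \<longlonglongrightarrow> 0"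
proof (rule tendsto_sandwich[OF _ _ tendsto_const \<kappa>(3)])
  have "real (Nn n) * (p n)\<^sup>2 \<le> \<kappa> n * p n" for n
    using mult_right_mono[OF Nn_bounds(1)[of n], of "p n"] p(1)[of n] by (simp add: power2_eq_square mult.assoc)
  then show "\<forall>\<^sub>F n in sequentially. real (Nn n) * (p n)\<^sup>2 \<le> \<kappa> n * p n" by simp
qed simp

lemma C_nonneg: "0 \<le> C"
  using edges[of 0] by (meson mult_nonneg_nonneg of_nat_0_le_iff order_trans zero_le_power2)

lemma inv_\<kappa>: "(\<lambda>n. a / \<kappa> n) \<longlonglongrightarrow> 0"
  using tendsto_mult[OF tendsto_const tendsto_inverse_0_at_top[OF \<kappa>(2)], of a] by (simp add: divide_inverse)

text \<open>By \<open>sorted_degree_bound\<close>, p times the degree is at most 2 |E| p^2 divided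
  by v p, and v p is at least \<kappa> beyond the cut-off.\<close>

lemma small_degree:
  assumes "Nn n < v"
  shows "p n * real (vertex_degree (E n) v) \<le> 2 * C / \<kappa> n"
proof -
  interpret G: graph_mesh "p n" "m n" "E n" by (rule mesh)
  have "v * vertex_degree (E n) v \<le> 2 * card (E n)"
    using assms sorted by (intro G.sorted_degree_bound) auto
  then have "real v * real (vertex_degree (E n) v) \<le> 2 * real (card (E n))"
    by (metis of_nat_le_iff of_nat_mult of_nat_numeral)
  then have "(p n)\<^sup>2 * (real v * real (vertex_degree (E n) v)) \<le> (p n)\<^sup>2 * (2 * real (card (E n)))"
    by (intro mult_left_mono) auto
  also have "\<dots> \<le> 2 * C" using edges[of n] by (simp add: mult.commute)
  finally have b: "(real v * p n) * (p n * real (vertex_degree (E n) v)) \<le> 2 * C"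
    by (simp add: power2_eq_square mult_ac)
  have "real (Nn n + 1) * p n \<le> real v * p n" using assms p(1)[of n] by (intro mult_right_mono) auto
  then have "\<kappa> n \<le> real v * p n" using Nn_bounds(2)[of n] by (simp add: distrib_right)
  then have "\<kappa> n * (p n * real (vertex_degree (E n) v)) \<le> (real v * p n) * (p n * real (vertex_degree (E n) v))"
    using p(1)[of n] by (intro mult_right_mono) auto
  then have "\<kappa> n * (p n * real (vertex_degree (E n) v)) \<le> 2 * C" using b by linarith
  then show ?thesis using \<kappa>(1)[of n] by (subst pos_le_divide_eq) (auto simp: mult_ac)
qed

text \<open>In p^3 times the sum of squared degrees, one factor p times degree is at most 2 C /
  \<kappa> by \<open>small_degree\<close>, and p^2 times the remaining sum of degrees is at most 2
  C. The factor 2 in front gives 8 C^2 / \<kappa>.\<close>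

lemma dependency_error:
  "(\<lambda>n. 2 * p n ^ 3 * (\<Sum>v\<in>{Nn n + 1..m n}. (real (card {e \<in> E n. v \<in> e}))\<^sup>2) + p n ^ 3 * real (card (E n))) \<longlonglongrightarrow> 0"
proof -
  have le: "2 * p n ^ 3 * (\<Sum>v\<in>{Nn n + 1..m n}. (real (card {e \<in> E n. v \<in> e}))\<^sup>2) + p n ^ 3 * real (card (E n))
     \<le> 8 * C\<^sup>2 / \<kappa> n + C * p n" for n
  proof -
    interpret G: graph_mesh "p n" "m n" "E n" by (rule mesh)
    define dg where "dg = (\<lambda>v. real (vertex_degree (E n) v))"
    have dg: "0 \<le> dg v" for v by (simp add: dg_def)
    have "p n ^ 3 * (\<Sum>v\<in>{Nn n + 1..m n}. (dg v)\<^sup>2) = (\<Sum>v\<in>{Nn n + 1..m n}. (p n * dg v) * ((p n)\<^sup>2 * dg v))"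
      by (simp add: sum_distrib_left power2_eq_square power3_eq_cube mult_ac)
    also have "\<dots> \<le> (\<Sum>v\<in>{Nn n + 1..m n}. (2 * C / \<kappa> n) * ((p n)\<^sup>2 * dg v))"
      using small_degree[of n] dg by (intro sum_mono mult_right_mono) (auto simp: dg_def)
    also have "\<dots> = (2 * C / \<kappa> n) * ((p n)\<^sup>2 * (\<Sum>v\<in>{Nn n + 1..m n}. dg v))"
      by (simp only: sum_distrib_left)
    also have "\<dots> \<le> (2 * C / \<kappa> n) * (2 * C)"
    proof (rule mult_left_mono)
      have "(\<Sum>v\<in>{Nn n + 1..m n}. dg v) \<le> (\<Sum>v\<in>{1..m n}. dg v)" using dg by (intro sum_mono2) auto
      also have "\<dots> = 2 * real (card (E n))"
        unfolding dg_def of_nat_sum[symmetric] G.sum_degrees by simp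
      finally have "(p n)\<^sup>2 * (\<Sum>v\<in>{Nn n + 1..m n}. dg v) \<le> (p n)\<^sup>2 * (2 * real (card (E n)))" by (intro mult_left_mono) auto
      also have "\<dots> \<le> 2 * C" using edges[of n] by (simp add: mult.commute)
      finally show "(p n)\<^sup>2 * (\<Sum>v\<in>{Nn n + 1..m n}. dg v) \<le> 2 * C" .
      show "0 \<le> 2 * C / \<kappa> n" using C_nonneg \<kappa>(1)[of n] by simp
    qed
    finally have 1: "p n ^ 3 * (\<Sum>v\<in>{Nn n + 1..m n}. (dg v)\<^sup>2) \<le> 4 * C\<^sup>2 / \<kappa> n" by (simp add: power2_eq_square)
    have "p n ^ 3 * real (card (E n)) = (real (card (E n)) * (p n)\<^sup>2) * p n"
      by (simp add: power2_eq_square power3_eq_cube mult_ac)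
    also have "\<dots> \<le> C * p n" using edges[of n] p(1)[of n] by (intro mult_right_mono) auto
    finally have 2: "p n ^ 3 * real (card (E n)) \<le> C * p n" .
    have "2 * p n ^ 3 * (\<Sum>v\<in>{Nn n + 1..m n}. (real (card {e \<in> E n. v \<in> e}))\<^sup>2) = 2 * (p n ^ 3 * (\<Sum>v\<in>{Nn n + 1..m n}. (dg v)\<^sup>2))"
    proof -
      have "real (card {e \<in> E n. v \<in> e}) = dg v" for v by (simp add: dg_def vertex_degree_def)
      then show ?thesis by (simp only: mult.assoc)
    qed
    moreover have "8 * C\<^sup>2 / \<kappa> n = 2 * (4 * C\<^sup>2 / \<kappa> n)" by simp
    ultimately show ?thesis using 1 2 by linarith
  qed
  have "(\<lambda>n. 8 * C\<^sup>2 / \<kappa> n + C * p n) \<longlonglongrightarrow> 0 + C * 0" by (intro tendsto_add inv_\<kappa> tendsto_mult tendsto_const p(3))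
  then have lim: "(\<lambda>n. 8 * C\<^sup>2 / \<kappa> n + C * p n) \<longlonglongrightarrow> 0" by simp
  have nn: "0 \<le> 2 * p n ^ 3 * (\<Sum>v\<in>{Nn n + 1..m n}. (real (card {e \<in> E n. v \<in> e}))\<^sup>2) + p n ^ 3 * real (card (E n))" for n
    using p(1)[of n] by (intro add_nonneg_nonneg mult_nonneg_nonneg sum_nonneg) auto
  show ?thesis
    by (rule tendsto_sandwich[OF always_eventually[OF allI[OF nn]] always_eventually[OF allI[OF le]] tendsto_const lim])
qed

lemma small_edges_lim: "(\<lambda>n. (p n)\<^sup>2 * real (card {e \<in> E n. e \<subseteq> {Nn n + 1..m n}})) \<longlonglongrightarrow> lam"
proof -
  have le: "norm ((p n)\<^sup>2 * real (card {e \<in> E n. e \<subseteq> {Nn n + 1..m n}})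
       - 1/2 * (LINT x:{\<kappa> n..}|lborel. (LINT y:{\<kappa> n..}|lborel. Wn n x y))) \<le> 2 * C / \<kappa> n" for n
  proof -
    interpret G: graph_mesh "p n" "m n" "E n" by (rule mesh)
    have "norm ((p n)\<^sup>2 * real (card {e \<in> E n. e \<subseteq> {Nn n + 1..m n}})
       - 1/2 * (LINT x:{\<kappa> n..}|lborel. (LINT y:{\<kappa> n..}|lborel. Wn n x y))) \<le> (p n)\<^sup>2 * real (vertex_degree (E n) (Nn n + 1))"
      unfolding real_norm_def using \<kappa>(1)[of n] Nn_bounds[of n] by (intro G.small_edges_bound) auto
    also have "\<dots> = p n * (p n * real (vertex_degree (E n) (Nn n + 1)))" by (simp add: power2_eq_square)
    also have "\<dots> \<le> 1 * (2 * C / \<kappa> n)"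
      using small_degree[of n "Nn n + 1"] p(1,2)[of n] by (intro mult_mono) auto
    finally show ?thesis by simp
  qed
  have "(\<lambda>n. (p n)\<^sup>2 * real (card {e \<in> E n. e \<subseteq> {Nn n + 1..m n}})
       - 1/2 * (LINT x:{\<kappa> n..}|lborel. (LINT y:{\<kappa> n..}|lborel. Wn n x y))) \<longlonglongrightarrow> 0"
    by (rule Lim_null_comparison[OF always_eventually[OF allI[OF le]] inv_\<kappa>])
  from tendsto_add[OF this small] show ?thesis by simp
qed

subsection \<open>Integrability of the limit graphon\<close>

lemma eventually_in_Bn: "0 < x \<Longrightarrow> \<forall>\<^sub>F n in sequentially. x \<in> Bn n"
  using Nn_lim unfolding filterlim_at_top Bn_def by (auto elim: allE[of _ x])

text \<open>Fatou along the squares \<open>Bn n \<times> Bn n\<close>, which eventually contain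
  almost every point of the quadrant: \<open>cut_row_L1\<close> bounds each mass by 2 C plus a cut
  distance that tends to 0.\<close>

theorem W0_integrable: "integrable lborel (W0 W)"
proof (rule integrableI_nonneg)
  note Wb = W0_bounds[OF W]
  show "W0 W \<in> borel_measurable lborel" using W0_measurable[OF W] by simp
  show "AE z in lborel. 0 \<le> W0 W z" using Wb by auto
  have "(\<integral>\<^sup>+z. ennreal (W0 W z) \<partial>lborel) = (\<integral>\<^sup>+z. liminf (\<lambda>n. ennreal (indicator (Bn n \<times> Bn n) z * W0 W z)) \<partial>lborel)"
  proof (rule nn_integral_cong_AE)
    show "AE z in lborel. ennreal (W0 W z) = liminf (\<lambda>n. ennreal (indicator (Bn n \<times> Bn n) z * W0 W z))"
      using AE_lborel_offdiag
    proof eventually_elim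
      case (elim z)
      have "(\<lambda>n. ennreal (indicator (Bn n \<times> Bn n) z * W0 W z)) \<longlonglongrightarrow> ennreal (W0 W z)"
      proof (cases "z \<in> {0..} \<times> {0..}")
        case True
        then have "0 < fst z" "0 < snd z" using elim by auto
        then have "\<forall>\<^sub>F n in sequentially. fst z \<in> Bn n \<and> snd z \<in> Bn n"
          using eventually_in_Bn by (intro eventually_conj) auto
        then show ?thesis
          by (intro tendsto_eventually) (auto elim!: eventually_mono simp: mem_Times_iff)
      qed (simp add: W0_def)
      then show ?case by (intro lim_imp_Liminf[symmetric]) auto
    qed
  qed
  also have "\<dots> \<le> liminf (\<lambda>n. \<integral>\<^sup>+z. ennreal (indicator (Bn n \<times> Bn n) z * W0 W z) \<partial>lborel)"
  proof (rule nn_integral_liminf)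
    have "Bn n \<times> Bn n \<in> sets borel" for n by (simp add: Bn_def borel_Times)
    then show "(\<lambda>z. ennreal (indicator (Bn n \<times> Bn n) z * W0 W z)) \<in> borel_measurable lborel" for n
      using W0_measurable[OF W] by simp
  qed
  also have "\<dots> \<le> liminf (\<lambda>n. ennreal (2 * C + cut_dist (\<kappa> n) (Wn n) W))"
  proof (rule Liminf_mono, rule always_eventually, rule allI)
    fix n
    interpret G: graph_mesh "p n" "m n" "E n" by (rule mesh)
    note cr = G.cut_row_L1[OF W Nn_bounds(1), folded Bn_def]
    have "(\<integral>\<^sup>+z. ennreal (indicator (Bn n \<times> Bn n) z * W0 W z) \<partial>lborel) = ennreal (LINT z|lborel. indicator (Bn n \<times> Bn n) z * W0 W z)"
      using Wb by (intro nn_integral_eq_integral cr(5)) auto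
    also have "\<dots> \<le> ennreal (2 * C + cut_dist (\<kappa> n) (Wn n) W)"
      using cr(4) edges[of n] by (intro ennreal_leI) linarith
    finally show "(\<integral>\<^sup>+z. ennreal (indicator (Bn n \<times> Bn n) z * W0 W z) \<partial>lborel) \<le> \<dots>" .
  qed
  also have "\<dots> = ennreal (2 * C)"
    using tendsto_ennrealI[OF tendsto_add[OF tendsto_const cut]] by (intro lim_imp_Liminf) auto
  finally show "(\<integral>\<^sup>+z. ennreal (W0 W z) \<partial>lborel) < \<infinity>" by (simp add: order_le_less_trans)
qed

subsection \<open>Edges between vertices of large and of small degree\<close>

definition d0 :: "real \<Rightarrow> real" where "d0 x = indicator {0..} x * d x"

definition DW :: "real \<Rightarrow> real" where "DW x = (LINT y|lborel. W0 W (x, y))"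

definition \<Delta>0 :: "real \<Rightarrow> real" where "\<Delta>0 x = indicator {0..} x * Delta W d x"

lemma d0_integrable: "integrable lborel d0" and d0_nonneg: "0 \<le> d0 x"
  using d_int d_nonneg by (auto simp: d0_def[abs_def] set_integrable_def indicator_def)

lemma W0_integrable': "integrable (lborel \<Otimes>\<^sub>M lborel) (W0 W)"
  unfolding lborel_prod by (rule W0_integrable)

lemma DW_integrable: "integrable lborel DW"
  unfolding DW_def[abs_def] by (rule lborel_pair.integrable_fst'[OF W0_integrable'])

lemma DW_eq: "0 \<le> x \<Longrightarrow> graphon_degree W x = DW x"
  unfolding graphon_degree_def DW_def set_lebesgue_integral_def
  by (intro Bochner_Integration.integral_cong refl) (simp add: W0_def indicator_times)

lemma \<Delta>0_eq: "\<Delta>0 x = d0 x - DW x"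
proof (cases "0 \<le> x")
  case True
  then show ?thesis using DW_eq[OF True] by (simp add: \<Delta>0_def d0_def Delta_def)
next
  case False
  then have "DW x = 0" by (simp add: DW_def W0_def)
  then show ?thesis using False by (simp add: \<Delta>0_def d0_def)
qed

lemma \<Delta>0_integrable: "integrable lborel \<Delta>0"
  unfolding \<Delta>0_eq[abs_def] using d0_integrable DW_integrable by (rule Bochner_Integration.integrable_diff)

definition bsn :: "nat \<Rightarrow> nat \<Rightarrow> real" where
  "bsn n u = p n * real (card {e \<in> E n. u \<in> e \<and> e \<inter> {Nn n + 1..m n} \<noteq> {}})"

text \<open>The cap at 1 is essential: only truncated degrees converge, so a small set of very large
  degrees may carry mass that an L1 distance would see. The capped distance still controls
  exponentials of the degrees.\<close>

definition row_err :: "nat \<Rightarrow> real" where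
  "row_err n = (LINT x:Bn n|lborel. min 1 \<bar>bsn n (nat \<lceil>x / p n\<rceil>) - \<Delta>0 x\<bar>)"

lemma bsn_nonneg: "0 \<le> bsn n u"
  using p(1)[of n] by (simp add: bsn_def)

lemma bsn_set_integrable: "set_integrable lborel (Bn n) (\<lambda>x. bsn n (nat \<lceil>x / p n\<rceil>))"
  unfolding Bn_def by (rule graph_mesh.sum_cells_eq_LINT(2)[OF mesh])

lemma Bn_borel [measurable]: "Bn n \<in> sets borel"
  by (simp add: Bn_def)

lemma Bn_finite: "emeasure lborel (Bn n) < \<infinity>"
  using p(1)[of n] by (simp add: Bn_def)

lemma row_err_integrable: "set_integrable lborel (Bn n) (\<lambda>x. min 1 \<bar>bsn n (nat \<lceil>x / p n\<rceil>) - \<Delta>0 x\<bar>)"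
  unfolding set_integrable_def
proof (rule Bochner_Integration.integrable_bound)
  have b: "(\<lambda>x. indicator (Bn n) x *\<^sub>R bsn n (nat \<lceil>x / p n\<rceil>)) \<in> borel_measurable lborel"
    using bsn_set_integrable[of n] by (simp add: set_integrable_def)
  have D: "\<Delta>0 \<in> borel_measurable lborel" using \<Delta>0_integrable by simp
  have "(\<lambda>x. indicator (Bn n) x *\<^sub>R min 1 \<bar>indicator (Bn n) x *\<^sub>R bsn n (nat \<lceil>x / p n\<rceil>) - \<Delta>0 x\<bar>) \<in> borel_measurable lborel"
    using b D by measurable
  moreover have "indicator (Bn n) x *\<^sub>R min 1 \<bar>indicator (Bn n) x *\<^sub>R bsn n (nat \<lceil>x / p n\<rceil>) - \<Delta>0 x\<bar>
     = indicator (Bn n) x *\<^sub>R min 1 \<bar>bsn n (nat \<lceil>x / p n\<rceil>) - \<Delta>0 x\<bar>" for x by (simp add: indicator_def)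
  ultimately show "(\<lambda>x. indicator (Bn n) x *\<^sub>R min 1 \<bar>bsn n (nat \<lceil>x / p n\<rceil>) - \<Delta>0 x\<bar>) \<in> borel_measurable lborel"
    by (simp only:)
  show "integrable lborel (indicator (Bn n) :: real \<Rightarrow> real)" using Bn_finite by (intro integrable_real_indicator) auto
qed (auto simp: indicator_def)

text \<open>The majorant is \<open>W0 W\<close> itself, so the tail is negligible by
  \<open>W0_integrable\<close>.\<close>

lemma tail_lim: "(\<lambda>n. LINT z|lborel. indicator (- Bn n) (snd z) * W0 W z) \<longlonglongrightarrow> 0"
proof -
  have "(\<lambda>n. LINT z|lborel. indicator (- Bn n) (snd z) * W0 W z) \<longlonglongrightarrow> (LINT z::real \<times> real|lborel. 0)"
  proof (rule integral_dominated_convergence[where w = "W0 W"])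
    show "(\<lambda>z. indicator (- Bn n) (snd z) * W0 W z) \<in> borel_measurable lborel" for n
    proof -
      have i: "(\<lambda>x. indicator (- Bn n) x :: real) \<in> borel_measurable borel" by simp
      have "(\<lambda>z :: real \<times> real. indicator (- Bn n) (snd z) :: real) \<in> borel_measurable borel"
        using measurable_compose[OF measurable_snd i, of "borel :: real measure"] by (simp add: borel_prod)
      then show ?thesis using W0_measurable[OF W] by simp
    qed
    show "AE z in lborel. (\<lambda>n. indicator (- Bn n) (snd z) * W0 W z) \<longlonglongrightarrow> 0"
      using AE_lborel_offdiag
    proof eventually_elim
      case (elim z)
      show ?case
      proof (cases "z \<in> {0..} \<times> {0..}")
        case True
        then have "0 < snd z" using elim by auto
        from eventually_in_Bn[OF this] have "\<forall>\<^sub>F n in sequentially. indicator (- Bn n) (snd z) * W0 W z = 0"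
          by (rule eventually_mono) (simp add: indicator_def)
        then show ?thesis by (rule tendsto_eventually)
      qed (simp add: W0_def)
    qed
    show "AE z in lborel. norm (indicator (- Bn n) (snd z) * W0 W z) \<le> W0 W z" for n
      using W0_bounds[OF W] by (intro AE_I2) (simp add: indicator_def)
  qed (use W0_integrable in auto)
  then show ?thesis by simp
qed

text \<open>The error splits into \<open>dn - d0\<close>, the row integral D of the kernel
  difference over the big square, and the row of W outside it. For the first, a degree above
  \<kappa> has quotient at least 1 by \<kappa> and absorbs the cap, which gives the two terms
  divided by \<kappa>; otherwise the truncated distance applies. D is bounded by the cut
  distance.\<close>

lemma row_err_bound:
  "row_err n \<le> 2 * C / \<kappa> n + (LINT x|lborel. d0 x) / \<kappa> n
     + (LINT x:{0..\<kappa> n}|lborel. \<bar>graphon_degree (Wn n) x * of_bool (graphon_degree (Wn n) x \<le> \<kappa> n) - d x * of_bool (d x \<le> \<kappa> n)\<bar>)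
     + cut_dist (\<kappa> n) (Wn n) W + (LINT z|lborel. indicator (- Bn n) (snd z) * W0 W z)"
proof -
  interpret G: graph_mesh "p n" "m n" "E n" by (rule mesh)
  define dn where "dn = graphon_degree (Wn n)"
  have dn_int: "integrable lborel dn" unfolding dn_def by (rule G.degree_integrable)
  have dn_nn: "0 \<le> dn x" for x unfolding dn_def G.degree_eq using p(1)[of n] by simp
  have \<kappa>0: "0 < \<kappa> n" using \<kappa>(1)[of n] by simp
  define F where "F = (\<lambda>z. indicator (Bn n \<times> Bn n) z * (Wn n (fst z) (snd z) - W0 W z))"
  define D where "D = (\<lambda>x. LINT y|lborel. F (x, y))"
  have cr: "integrable lborel F" "integrable lborel D" "(LINT x|lborel. \<bar>D x\<bar>) \<le> cut_dist (\<kappa> n) (Wn n) W"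
    using G.cut_row_L1(1,2,3)[OF W Nn_bounds(1)] unfolding D_def F_def Bn_def by auto
  define T where "T = (\<lambda>z. indicator (- Bn n) (snd z) * W0 W z)"
  have Ti: "integrable lborel T"
  proof (rule Bochner_Integration.integrable_bound[OF W0_integrable])
    have i: "(\<lambda>x. indicator (- Bn n) x :: real) \<in> borel_measurable borel" by simp
    have "(\<lambda>z :: real \<times> real. indicator (- Bn n) (snd z) :: real) \<in> borel_measurable borel"
      using measurable_compose[OF measurable_snd i, of "borel :: real measure"] by (simp add: borel_prod)
    then show "T \<in> borel_measurable lborel" unfolding T_def using W0_measurable[OF W] by simp
  qed (auto simp: T_def indicator_def)
  then have Ti': "integrable (lborel \<Otimes>\<^sub>M lborel) T" unfolding lborel_prod .
  define tl where "tl = (\<lambda>x. LINT y|lborel. T (x, y))"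
  have tli: "integrable lborel tl" unfolding tl_def by (rule lborel_pair.integrable_fst'[OF Ti'])
  have tl_nn: "0 \<le> tl x" for x
    unfolding tl_def T_def using W0_bounds[OF W] by (intro integral_nonneg_AE) auto
  have tl_int: "(LINT x|lborel. tl x) = (LINT z|lborel. T z)"
    unfolding tl_def lborel_pair.integral_fst'[OF Ti'] lborel_prod ..
  define tr where "tr = (\<lambda>x. indicator {0..\<kappa> n} x * \<bar>dn x * of_bool (dn x \<le> \<kappa> n) - d x * of_bool (d x \<le> \<kappa> n)\<bar>)"
  have tri: "integrable lborel tr"
  proof (rule Bochner_Integration.integrable_bound)
    show "integrable lborel (\<lambda>x. dn x + d0 x)" using dn_int d0_integrable by simp
    have eq: "tr = (\<lambda>x. indicator {0..\<kappa> n} x * \<bar>dn x * indicator {..\<kappa> n} (dn x) - d0 x * indicator {..\<kappa> n} (d0 x)\<bar>)"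
      by (auto simp: tr_def d0_def indicator_def of_bool_def)
    have m: "dn \<in> borel_measurable lborel" "d0 \<in> borel_measurable lborel" using dn_int d0_integrable by auto
    show "tr \<in> borel_measurable lborel" unfolding eq using m by measurable
    show "AE x in lborel. norm (tr x) \<le> norm (dn x + d0 x)"
      using dn_nn d0_nonneg by (intro AE_I2) (auto simp: tr_def d0_def indicator_def of_bool_def d_nonneg abs_le_iff add_nonneg_nonneg add_increasing add_increasing2)
  qed
  have AE_int: "AE x in lborel. integrable lborel (\<lambda>y. W0 W (x, y))"
    by (rule lborel_pair.AE_integrable_fst'[OF W0_integrable'])
  have ri: "integrable lborel (\<lambda>x. dn x * indicator (Bn n) x / \<kappa> n + d0 x / \<kappa> n + tr x + \<bar>D x\<bar> + tl x)"
  proof -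
    have "integrable lborel (\<lambda>x. dn x * indicator (Bn n) x)"
      using integrable_mult_indicator[of "Bn n" lborel dn] dn_int by (simp add: mult.commute)
    then show ?thesis using d0_integrable tri cr(2) tli by simp
  qed
  have "row_err n \<le> (LINT x|lborel. dn x * indicator (Bn n) x / \<kappa> n + d0 x / \<kappa> n + tr x + \<bar>D x\<bar> + tl x)"
    unfolding row_err_def set_lebesgue_integral_def
  proof (rule integral_mono_AE)
    show "integrable lborel (\<lambda>x. indicator (Bn n) x *\<^sub>R min 1 \<bar>bsn n (nat \<lceil>x / p n\<rceil>) - \<Delta>0 x\<bar>)"
      using row_err_integrable by (simp add: set_integrable_def)
    show "AE x in lborel. indicator (Bn n) x *\<^sub>R min 1 \<bar>bsn n (nat \<lceil>x / p n\<rceil>) - \<Delta>0 x\<bar>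
       \<le> dn x * indicator (Bn n) x / \<kappa> n + d0 x / \<kappa> n + tr x + \<bar>D x\<bar> + tl x"
      using AE_int
    proof eventually_elim
      case (elim x)
      have rest: "0 \<le> d0 x / \<kappa> n" "0 \<le> tr x" "0 \<le> dn x / \<kappa> n"
        using d0_nonneg[of x] dn_nn[of x] \<kappa>0 by (auto simp: tr_def)
      show ?case
      proof (cases "x \<in> Bn n")
        case True
        then have x: "x \<in> {0<..real (Nn n) * p n}" "0 < x" "x \<in> {0..\<kappa> n}" using Nn_bounds(1)[of n] by (auto simp: Bn_def)
        have "bsn n (nat \<lceil>x / p n\<rceil>) = dn x - (LINT y:Bn n|lborel. Wn n x y)"
          using G.bs_degree_eq[OF x(1)] by (simp add: bsn_def G.bs_degree_def dn_def Bn_def)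
        moreover have "D x = (LINT y:Bn n|lborel. Wn n x y) - (LINT y:Bn n|lborel. W0 W (x, y))"
        proof -
          have "set_integrable lborel (Bn n) (\<lambda>y. W0 W (x, y))" using elim by (intro set_integrable_lborel) auto
          then show ?thesis
            using G.LINT_row(2)[of "Bn n" x] True
            by (simp add: D_def F_def set_lebesgue_integral_def set_integrable_def indicator_times right_diff_distrib)
        qed
        moreover have "DW x = (LINT y:Bn n|lborel. W0 W (x, y)) + tl x"
        proof -
          have i: "set_integrable lborel (Bn n) (\<lambda>y. W0 W (x, y))" "set_integrable lborel (- Bn n) (\<lambda>y. W0 W (x, y))"
            using elim by (auto intro!: set_integrable_lborel)
          have "DW x = (LINT y|lborel. indicator (Bn n) y * W0 W (x, y) + indicator (- Bn n) y * W0 W (x, y))"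
            unfolding DW_def by (intro Bochner_Integration.integral_cong refl) (simp add: indicator_def)
          also have "\<dots> = (LINT y:Bn n|lborel. W0 W (x, y)) + tl x"
            using i by (simp add: set_lebesgue_integral_def set_integrable_def tl_def T_def)
          finally show ?thesis .
        qed
        ultimately have "bsn n (nat \<lceil>x / p n\<rceil>) - \<Delta>0 x = (dn x - d0 x) - D x + tl x"
          by (simp add: \<Delta>0_eq)
        then have 1: "\<bar>bsn n (nat \<lceil>x / p n\<rceil>) - \<Delta>0 x\<bar> \<le> \<bar>dn x - d0 x\<bar> + \<bar>D x\<bar> + tl x"
          using tl_nn[of x] by linarith
        have 2: "min 1 \<bar>dn x - d0 x\<bar> \<le> dn x / \<kappa> n + d0 x / \<kappa> n + tr x"
        proof (cases "dn x \<le> \<kappa> n \<and> d0 x \<le> \<kappa> n")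
          case True
          then have "tr x = \<bar>dn x - d0 x\<bar>" using x by (simp add: tr_def d0_def)
          then show ?thesis using rest by linarith
        next
          case False
          then have "1 \<le> dn x / \<kappa> n \<or> 1 \<le> d0 x / \<kappa> n" using \<kappa>0 by (auto simp: pos_le_divide_eq)
          then show ?thesis using rest by linarith
        qed
        have "min 1 \<bar>bsn n (nat \<lceil>x / p n\<rceil>) - \<Delta>0 x\<bar> \<le> dn x / \<kappa> n + d0 x / \<kappa> n + tr x + \<bar>D x\<bar> + tl x"
          using 1 2 tl_nn[of x] by linarith
        then show ?thesis using True by simp
      next
        case False
        then show ?thesis using rest tl_nn[of x] by simp
      qed
    qed
  qed (rule ri)
  also have "\<dots> = (LINT x:Bn n|lborel. dn x) / \<kappa> n + (LINT x|lborel. d0 x) / \<kappa> n + (LINT x|lborel. tr x) + (LINT x|lborel. \<bar>D x\<bar>) + (LINT x|lborel. tl x)"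
  proof -
    have "integrable lborel (\<lambda>x. dn x * indicator (Bn n) x)"
      using integrable_mult_indicator[of "Bn n" lborel dn] dn_int by (simp add: mult.commute)
    then show ?thesis using d0_integrable tri cr(2) tli by (simp add: set_lebesgue_integral_def mult.commute)
  qed
  also have "\<dots> \<le> 2 * C / \<kappa> n + (LINT x|lborel. d0 x) / \<kappa> n + (LINT x|lborel. tr x) + cut_dist (\<kappa> n) (Wn n) W + (LINT z|lborel. T z)"
  proof -
    have "(LINT x:Bn n|lborel. dn x) \<le> 2 * C"
      using G.LINT_degree_le[of "Nn n"] edges[of n] unfolding Bn_def dn_def by linarith
    then have "(LINT x:Bn n|lborel. dn x) / \<kappa> n \<le> 2 * C / \<kappa> n" using \<kappa>0 by (intro divide_right_mono) auto
    then show ?thesis using cr(3) tl_int by linarith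
  qed
  finally show ?thesis unfolding tr_def T_def dn_def set_lebesgue_integral_def by simp
qed

lemma row_err_lim: "row_err \<longlonglongrightarrow> 0"
proof -
  have "(\<lambda>n. 2 * C / \<kappa> n + (LINT x|lborel. d0 x) / \<kappa> n
     + (LINT x:{0..\<kappa> n}|lborel. \<bar>graphon_degree (Wn n) x * of_bool (graphon_degree (Wn n) x \<le> \<kappa> n) - d x * of_bool (d x \<le> \<kappa> n)\<bar>)
     + cut_dist (\<kappa> n) (Wn n) W + (LINT z|lborel. indicator (- Bn n) (snd z) * W0 W z)) \<longlonglongrightarrow> 0 + 0 + 0 + 0 + 0"
    by (intro tendsto_add inv_\<kappa> trunc cut tail_lim)
  then have l: "(\<lambda>n. 2 * C / \<kappa> n + (LINT x|lborel. d0 x) / \<kappa> n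
     + (LINT x:{0..\<kappa> n}|lborel. \<bar>graphon_degree (Wn n) x * of_bool (graphon_degree (Wn n) x \<le> \<kappa> n) - d x * of_bool (d x \<le> \<kappa> n)\<bar>)
     + cut_dist (\<kappa> n) (Wn n) W + (LINT z|lborel. indicator (- Bn n) (snd z) * W0 W z)) \<longlonglongrightarrow> 0" by simp
  have nn: "0 \<le> row_err n" for n
    unfolding row_err_def set_lebesgue_integral_def by (intro integral_nonneg_AE) auto
  show ?thesis
    by (rule tendsto_sandwich[OF always_eventually[OF allI[OF nn]] always_eventually[OF allI[OF row_err_bound]] tendsto_const l])
qed

text \<open>That d dominates the degree of W is not assumed but follows, because \<Delta>0 is the
  limit of the nonnegative \<open>bsn\<close> in the capped distance: on a fixed interval (0, K] the
  capped negative part of \<Delta>0 lies below the integrand of \<open>row_err\<close>.\<close>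

lemma \<Delta>0_nonneg: "AE x in lborel. 0 \<le> \<Delta>0 x"
proof -
  define h where "h = (\<lambda>x. min 1 (max 0 (- \<Delta>0 x)))"
  have hm: "h \<in> borel_measurable lborel" unfolding h_def using \<Delta>0_integrable by measurable
  have h01: "0 \<le> h x" "h x \<le> 1" for x by (auto simp: h_def)
  have hi: "integrable lborel (\<lambda>x. indicator {0<..K} x * h x)" for K :: real
  proof (rule Bochner_Integration.integrable_bound)
    show "integrable lborel (indicator {0<..K} :: real \<Rightarrow> real)"
      by (cases "0 \<le> K") (auto intro!: integrable_real_indicator)
    show "(\<lambda>x. indicator {0<..K} x * h x) \<in> borel_measurable lborel" using hm by simp
  qed (use h01 in \<open>auto simp: indicator_def\<close>)
  have ae: "AE x in lborel. indicator {0<..real K} x * h x = 0" for K :: nat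
  proof -
    have "\<forall>\<^sub>F n in sequentially. (LINT x|lborel. indicator {0<..real K} x * h x) \<le> row_err n"
    proof -
      have "\<forall>\<^sub>F n in sequentially. real K \<le> real (Nn n) * p n" using Nn_lim by (simp add: filterlim_at_top)
      then show ?thesis
      proof eventually_elim
        case (elim n)
        then have sub: "{0<..real K} \<subseteq> Bn n" by (auto simp: Bn_def)
        show ?case
          unfolding row_err_def set_lebesgue_integral_def
        proof (rule integral_mono[OF hi])
          show "integrable lborel (\<lambda>x. indicator (Bn n) x *\<^sub>R min 1 \<bar>bsn n (nat \<lceil>x / p n\<rceil>) - \<Delta>0 x\<bar>)"
            using row_err_integrable by (simp add: set_integrable_def)
          fix x
          have "h x \<le> min 1 \<bar>bsn n (nat \<lceil>x / p n\<rceil>) - \<Delta>0 x\<bar>" using bsn_nonneg[of n "nat \<lceil>x / p n\<rceil>"] by (auto simp: h_def)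
          then show "indicator {0<..real K} x * h x \<le> indicator (Bn n) x *\<^sub>R min 1 \<bar>bsn n (nat \<lceil>x / p n\<rceil>) - \<Delta>0 x\<bar>"
            using sub h01[of x] by (auto simp: indicator_def)
        qed
      qed
    qed
    then have "(LINT x|lborel. indicator {0<..real K} x * h x) \<le> 0"
      by (intro tendsto_lowerbound[OF row_err_lim]) auto
    moreover have "0 \<le> (LINT x|lborel. indicator {0<..real K} x * h x)" using h01 by (intro integral_nonneg_AE) auto
    ultimately have "(LINT x|lborel. indicator {0<..real K} x * h x) = 0" by simp
    then show ?thesis using h01 by (subst (asm) integral_nonneg_eq_0_iff_AE[OF hi]) auto
  qed
  then have "AE x in lborel. \<forall>K::nat. indicator {0<..real K} x * h x = 0"
    unfolding AE_all_countable by blast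
  then show ?thesis
    using AE_lborel_singleton[of 0]
  proof eventually_elim
    case (elim x)
    show ?case
    proof (cases "0 < x")
      case True
      obtain K :: nat where "x \<le> real K" using real_arch_simple by blast
      then have "h x = 0" using elim(1)[rule_format, of K] True by simp
      then show ?thesis by (auto simp: h_def min_def max_def split: if_splits)
    next
      case False
      then show ?thesis using elim(2) by (simp add: \<Delta>0_def)
    qed
  qed
qed

text \<open>The positive part makes the mean nonnegative for every cell; by
  \<open>\<Delta>0_nonneg\<close> it changes the integrand on a null set only.\<close>

definition mean_\<Delta> :: "nat \<Rightarrow> nat \<Rightarrow> real" where
  "mean_\<Delta> n u = (LINT x:vcell (p n) u|lborel. max 0 (indicator {0..} x * Delta W d x)) / p n"

text \<open>For nonnegative arguments and c in [0,1], exp (- c a) and exp (- c b) differ by at most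
  the minimum of 1 and |a - b|. The Riemann sum is an integral over \<open>Bn n\<close>, and
  inserting \<Delta>0 x splits it into \<open>row_err\<close> and the error of averaging.\<close>

lemma field_error:
  assumes c: "0 \<le> c" "c \<le> 1"
  shows "(\<lambda>n. \<Sum>u\<in>{1..Nn n}. p n * \<bar>exp (- c * bsn n u) - exp (- (c * mean_\<Delta> n u))\<bar>) \<longlonglongrightarrow> 0"
proof -
  define g where "g = (\<lambda>x. max 0 (\<Delta>0 x))"
  have gi: "integrable lborel g" unfolding g_def using \<Delta>0_integrable by (intro integrable_max) auto
  have A: "(\<lambda>n. LINT x|lborel. \<bar>avg {1..Nn n} (vcell (p n)) g x - g x\<bar>) \<longlonglongrightarrow> 0"
    by (rule avg_vcell_tendsto[OF p(1,3) Nn_lim gi]) (simp add: g_def \<Delta>0_def)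
  have mean_nn: "0 \<le> mean_\<Delta> n u" for n u
    unfolding mean_\<Delta>_def set_lebesgue_integral_def using p(1)[of n] by (intro divide_nonneg_pos integral_nonneg_AE) auto
  have le: "(\<Sum>u\<in>{1..Nn n}. p n * \<bar>exp (- c * bsn n u) - exp (- (c * mean_\<Delta> n u))\<bar>)
     \<le> row_err n + (LINT x|lborel. \<bar>avg {1..Nn n} (vcell (p n)) g x - g x\<bar>)" for n
  proof -
    interpret G: graph_mesh "p n" "m n" "E n" by (rule mesh)
    have ai: "integrable lborel (\<lambda>x. \<bar>avg {1..Nn n} (vcell (p n)) g x - g x\<bar>)"
      by (intro integrable_abs Bochner_Integration.integrable_diff gi avg_integrable cells_vcell p)
    have ri: "integrable lborel (\<lambda>x. indicator (Bn n) x *\<^sub>R min 1 \<bar>bsn n (nat \<lceil>x / p n\<rceil>) - \<Delta>0 x\<bar>)"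
      using row_err_integrable by (simp add: set_integrable_def)
    have "(\<Sum>u\<in>{1..Nn n}. p n * \<bar>exp (- c * bsn n u) - exp (- (c * mean_\<Delta> n u))\<bar>)
       = (LINT x|lborel. indicator (Bn n) x *\<^sub>R \<bar>exp (- c * bsn n (nat \<lceil>x / p n\<rceil>)) - exp (- (c * mean_\<Delta> n (nat \<lceil>x / p n\<rceil>)))\<bar>)"
      unfolding G.sum_cells_eq_LINT(1) Bn_def set_lebesgue_integral_def ..
    also have "\<dots> \<le> (LINT x|lborel. indicator (Bn n) x *\<^sub>R min 1 \<bar>bsn n (nat \<lceil>x / p n\<rceil>) - \<Delta>0 x\<bar> + \<bar>avg {1..Nn n} (vcell (p n)) g x - g x\<bar>)"
    proof (rule integral_mono_AE)
      show "integrable lborel (\<lambda>x. indicator (Bn n) x *\<^sub>R \<bar>exp (- c * bsn n (nat \<lceil>x / p n\<rceil>)) - exp (- (c * mean_\<Delta> n (nat \<lceil>x / p n\<rceil>)))\<bar>)"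
        using G.sum_cells_eq_LINT(2)[of "Nn n" "\<lambda>u. \<bar>exp (- c * bsn n u) - exp (- (c * mean_\<Delta> n u))\<bar>"]
        by (simp only: set_integrable_def Bn_def)
      show "integrable lborel (\<lambda>x. indicator (Bn n) x *\<^sub>R min 1 \<bar>bsn n (nat \<lceil>x / p n\<rceil>) - \<Delta>0 x\<bar> + \<bar>avg {1..Nn n} (vcell (p n)) g x - g x\<bar>)"
        by (rule Bochner_Integration.integrable_add[OF ri ai])
      show "AE x in lborel. indicator (Bn n) x *\<^sub>R \<bar>exp (- c * bsn n (nat \<lceil>x / p n\<rceil>)) - exp (- (c * mean_\<Delta> n (nat \<lceil>x / p n\<rceil>)))\<bar>
         \<le> indicator (Bn n) x *\<^sub>R min 1 \<bar>bsn n (nat \<lceil>x / p n\<rceil>) - \<Delta>0 x\<bar> + \<bar>avg {1..Nn n} (vcell (p n)) g x - g x\<bar>"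
        using \<Delta>0_nonneg
      proof eventually_elim
        case (elim x)
        show ?case
        proof (cases "x \<in> Bn n")
          case True
          define u where "u = nat \<lceil>x / p n\<rceil>"
          have "x \<in> (\<Union>u\<in>{1..Nn n}. vcell (p n) u)" unfolding UN_vcell[OF p(1)] using True by (simp add: Bn_def)
          then have u: "u \<in> {1..Nn n}" "x \<in> vcell (p n) u" by (auto simp: vcell_iff[OF p(1)] u_def)
          have av: "avg {1..Nn n} (vcell (p n)) g x = mean_\<Delta> n u"
            unfolding avg_eq[OF cells_vcell[OF p(1)] u] mean_\<Delta>_def g_def \<Delta>0_def
            using measure_vcell[OF p(1)] u(1) by simp
          have gx: "g x = \<Delta>0 x" using elim by (simp add: g_def)
          have s: "\<bar>exp (- (c * a)) - exp (- (c * b))\<bar> \<le> min 1 \<bar>a - b\<bar>" if "0 \<le> a" "0 \<le> b" for a b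
          proof -
            have "\<bar>exp (- (c * a)) - exp (- (c * b))\<bar> \<le> \<bar>- (c * a) - - (c * b)\<bar>" using that c by (intro abs_exp_diff_le) auto
            also have "\<dots> = \<bar>c * (b - a)\<bar>" by (simp add: algebra_simps)
            also have "\<dots> = c * \<bar>a - b\<bar>" using c by (simp add: abs_mult abs_minus_commute)
            also have "\<dots> \<le> \<bar>a - b\<bar>" using c by (simp add: mult_left_le_one_le)
            finally have 1: "\<bar>exp (- (c * a)) - exp (- (c * b))\<bar> \<le> \<bar>a - b\<bar>" .
            have "0 < exp (- (c * a)) \<and> exp (- (c * a)) \<le> 1" "0 < exp (- (c * b)) \<and> exp (- (c * b)) \<le> 1"
              using that c by auto
            then show ?thesis using 1 by linarith
          qed
          have 1: "\<bar>exp (- (c * bsn n u)) - exp (- (c * \<Delta>0 x))\<bar> \<le> min 1 \<bar>bsn n u - \<Delta>0 x\<bar>"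
            using bsn_nonneg elim by (rule s)
          have 2: "\<bar>exp (- (c * \<Delta>0 x)) - exp (- (c * mean_\<Delta> n u))\<bar> \<le> min 1 \<bar>\<Delta>0 x - mean_\<Delta> n u\<bar>"
            using elim mean_nn by (rule s)
          have "\<bar>exp (- (c * bsn n u)) - exp (- (c * mean_\<Delta> n u))\<bar> \<le> min 1 \<bar>bsn n u - \<Delta>0 x\<bar> + \<bar>mean_\<Delta> n u - \<Delta>0 x\<bar>"
            using 1 2 by linarith
          then show ?thesis using True unfolding av gx u_def[symmetric] by simp
        qed simp
      qed
    qed
    also have "\<dots> = row_err n + (LINT x|lborel. \<bar>avg {1..Nn n} (vcell (p n)) g x - g x\<bar>)"
      unfolding row_err_def set_lebesgue_integral_def by (rule Bochner_Integration.integral_add[OF ri ai])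
    finally show ?thesis .
  qed
  have "(\<lambda>n. row_err n + (LINT x|lborel. \<bar>avg {1..Nn n} (vcell (p n)) g x - g x\<bar>)) \<longlonglongrightarrow> 0 + 0"
    by (intro tendsto_add row_err_lim A)
  then have l: "(\<lambda>n. row_err n + (LINT x|lborel. \<bar>avg {1..Nn n} (vcell (p n)) g x - g x\<bar>)) \<longlonglongrightarrow> 0" by simp
  have nn: "0 \<le> (\<Sum>u\<in>{1..Nn n}. p n * \<bar>exp (- c * bsn n u) - exp (- (c * mean_\<Delta> n u))\<bar>)" for n
    using p(1)[of n] by (intro sum_nonneg mult_nonneg_nonneg) auto
  show ?thesis
    by (rule tendsto_sandwich[OF always_eventually[OF allI[OF nn]] always_eventually[OF allI[OF le]] tendsto_const l])
qed

end

section \<open>Generating functions of integer valued laws\<close>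

text \<open>Strong induction on k: subtract the terms below k and divide by s^k; the k-th
  coefficient is what remains, up to a tail of at most s / (1 - s). The filter is arbitrary so that
  the lemma serves both convergence, through pairs of indices, and uniqueness.\<close>

lemma coeff_tendsto_zero:
  fixes x :: "'b \<Rightarrow> nat \<Rightarrow> real"
  assumes b: "\<And>y k. \<bar>x y k\<bar> \<le> 1"
    and lim: "\<And>s. 0 < s \<Longrightarrow> s < 1 \<Longrightarrow> ((\<lambda>y. \<Sum>k. x y k * s ^ k) \<longlongrightarrow> 0) F"
  shows "((\<lambda>y. x y k) \<longlongrightarrow> 0) F"
proof (induction k rule: less_induct)
  case (less k)
  show ?case
  proof (rule tendstoI)
    fix e :: real assume e: "0 < e"
    \<comment> \<open>Chosen so that s / (1 - s) = e / 2.\<close>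
    define s where "s = e / (2 + e)"
    have s: "0 < s" "s < 1" using e by (auto simp: s_def)
    have se: "s / (1 - s) = e / 2" using e by (simp add: s_def field_simps)
    have summ: "summable (\<lambda>k. x y k * s ^ k)" for y
    proof (rule summable_comparison_test')
      show "summable (\<lambda>k. s ^ k)" using s by (intro summable_geometric) auto
      show "norm (x y k * s ^ k) \<le> s ^ k" if "0 \<le> k" for k
        using b[of y k] s by (simp add: abs_mult mult_left_le_one_le)
    qed
    define R where "R = (\<lambda>y. ((\<Sum>k. x y k * s ^ k) - (\<Sum>i<k. x y i * s ^ i)) / s ^ k)"
    have R: "(R \<longlongrightarrow> (0 - (\<Sum>i<k. 0 * s ^ i)) / s ^ k) F"
      unfolding R_def using s less by (intro tendsto_intros lim) auto
    then have "\<forall>\<^sub>F y in F. \<bar>R y\<bar> < e / 2"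
      using tendstoD[OF R, of "e / 2"] e by (simp add: dist_real_def)
    then show "\<forall>\<^sub>F y in F. dist (x y k) 0 < e"
    proof eventually_elim
      case (elim y)
      have sh: "(\<lambda>i. x y (i + k) * s ^ (i + k)) sums ((\<Sum>k. x y k * s ^ k) - (\<Sum>i<k. x y i * s ^ i))"
        using summable_sums[OF summ] by (subst sums_iff_shift) simp
      have "(\<lambda>i. x y (i + k) * s ^ (i + k) / s ^ k) sums R y" unfolding R_def by (rule sums_divide[OF sh])
      then have "(\<lambda>i. x y (i + k) * s ^ i) sums R y" using s by (simp add: power_add)
      then have "(\<lambda>i. x y (Suc i + k) * s ^ Suc i) sums (R y - x y k)" by (subst sums_Suc_iff) simp
      then have "\<bar>R y - x y k\<bar> \<le> (\<Sum>i. s ^ Suc i)"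
      proof -
        assume su: "(\<lambda>i. x y (Suc i + k) * s ^ Suc i) sums (R y - x y k)"
        have g: "summable (\<lambda>i. s ^ Suc i)" using s by (subst summable_Suc_iff) (intro summable_geometric, auto)
        have "norm (\<Sum>i. x y (Suc i + k) * s ^ Suc i) \<le> (\<Sum>i. s ^ Suc i)"
        proof (rule norm_suminf_le[OF _ g])
          fix i
          have "\<bar>x y (Suc i + k)\<bar> * s ^ Suc i \<le> 1 * s ^ Suc i"
            using b[of y "Suc i + k"] s by (intro mult_right_mono) auto
          then show "norm (x y (Suc i + k) * s ^ Suc i) \<le> s ^ Suc i" using s by (simp add: abs_mult)
        qed
        then show ?thesis using sums_unique[OF su] by simp
      qed
      also have "(\<Sum>i. s ^ Suc i) = s / (1 - s)"
        using s by (simp add: suminf_mult suminf_geometric summable_geometric)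
      finally have "\<bar>R y - x y k\<bar> \<le> e / 2" unfolding se .
      then show ?case using elim unfolding dist_real_def diff_0_right by linarith
    qed
  qed
qed

lemma Cauchy_of_prod_filter:
  fixes X :: "nat \<Rightarrow> real"
  assumes "((\<lambda>(n, n'). X n - X n') \<longlongrightarrow> 0) (sequentially \<times>\<^sub>F sequentially)"
  shows "convergent X"
proof -
  have "Cauchy X"
  proof (rule metric_CauchyI)
    fix e :: real assume "0 < e"
    then have "\<forall>\<^sub>F (n, n') in sequentially \<times>\<^sub>F sequentially. dist (X n - X n') 0 < e"
      using tendstoD[OF assms, of e] by (simp add: case_prod_unfold)
    then obtain P Q where PQ: "eventually P sequentially" "eventually Q sequentially" "\<And>n n'. P n \<Longrightarrow> Q n' \<Longrightarrow> dist (X n - X n') 0 < e"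
      unfolding eventually_prod_filter by auto
    obtain M1 M2 where "\<And>n. n \<ge> M1 \<Longrightarrow> P n" "\<And>n. n \<ge> M2 \<Longrightarrow> Q n"
      using PQ(1,2) unfolding eventually_sequentially by auto
    then have "\<forall>m\<ge>max M1 M2. \<forall>n\<ge>max M1 M2. dist (X m) (X n) < e"
      using PQ(3) by (auto simp: dist_real_def)
    then show "\<exists>M. \<forall>m\<ge>M. \<forall>n\<ge>M. dist (X m) (X n) < e" by blast
  qed
  then show ?thesis by (simp add: Cauchy_convergent_iff)
qed

lemma tendsto_prod_filter_diff:
  fixes X :: "nat \<Rightarrow> real"
  assumes "convergent X"
  shows "((\<lambda>(n, n'). X n - X n') \<longlongrightarrow> 0) (sequentially \<times>\<^sub>F sequentially)"
proof -
  obtain L where L: "X \<longlonglongrightarrow> L" using assms by (auto simp: convergent_def)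
  have "((\<lambda>y. X (fst y) - X (snd y)) \<longlongrightarrow> L - L) (sequentially \<times>\<^sub>F sequentially)"
    by (intro tendsto_diff filterlim_compose[OF L] filterlim_fst filterlim_snd)
  then show ?thesis by (simp add: case_prod_unfold)
qed

text \<open>The limits of the coefficients are not known in advance, so the Cauchy property is
  proved: \<open>coeff_tendsto_zero\<close> is applied to the differences over pairs (n,
  n').\<close>

lemma convergent_coeff:
  fixes a :: "nat \<Rightarrow> nat \<Rightarrow> real"
  assumes a: "\<And>n k. 0 \<le> a n k \<and> a n k \<le> 1"
    and conv: "\<And>s. 0 < s \<Longrightarrow> s < 1 \<Longrightarrow> convergent (\<lambda>n. \<Sum>k. a n k * s ^ k)"
  shows "convergent (\<lambda>n. a n k)"
proof -
  have summ: "summable (\<lambda>k. a n k * s ^ k)" if "0 < s" "s < 1" for n and s :: real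
  proof (rule summable_comparison_test')
    show "summable (\<lambda>k. s ^ k)" using that by (intro summable_geometric) auto
    show "norm (a n k * s ^ k) \<le> s ^ k" if "0 \<le> k" for k
      using a[of n k] \<open>0 < s\<close> by (simp add: abs_mult mult_left_le_one_le)
  qed
  have "((\<lambda>y. (\<lambda>(n, n') k. a n k - a n' k) y k) \<longlongrightarrow> 0) (sequentially \<times>\<^sub>F sequentially)"
  proof (rule coeff_tendsto_zero)
    show "\<bar>(\<lambda>(n, n') k. a n k - a n' k) y k\<bar> \<le> 1" for y k
      using a[of "fst y" k] a[of "snd y" k] by (auto simp: case_prod_unfold abs_le_iff)
    fix s :: real assume s: "0 < s" "s < 1"
    have "(\<Sum>k. (\<lambda>(n, n') k. a n k - a n' k) y k * s ^ k) = (\<lambda>(n, n'). (\<Sum>k. a n k * s ^ k) - (\<Sum>k. a n' k * s ^ k)) y" for y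
      using suminf_diff[OF summ[OF s, of "fst y"] summ[OF s, of "snd y"]]
      by (simp add: case_prod_unfold left_diff_distrib)
    then show "((\<lambda>y. \<Sum>k. (\<lambda>(n, n') k. a n k - a n' k) y k * s ^ k) \<longlongrightarrow> 0) (sequentially \<times>\<^sub>F sequentially)"
      using tendsto_prod_filter_diff[OF conv[OF s]] by simp
  qed
  then show ?thesis by (intro Cauchy_of_prod_filter) (simp add: case_prod_unfold)
qed

section \<open>Limits and transforms of laws on the natural numbers\<close>

lemma expectation_nat_pmf:
  fixes q :: "nat pmf" and f :: "nat \<Rightarrow> real"
  assumes "\<And>k. 0 \<le> f k \<and> f k \<le> 1"
  shows "(\<lambda>k. pmf q k * f k) sums measure_pmf.expectation q f"
proof -
  have b: "integrable (measure_pmf q) f"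
    using assms by (intro measure_pmf.integrable_const_bound[where B = 1]) auto
  have "integrable (count_space UNIV) (\<lambda>k. pmf q k *\<^sub>R f k)"
    using b unfolding measure_pmf_eq_density by (subst (asm) integrable_density) auto
  note sums_integral_count_space_nat[OF this]
  moreover have "measure_pmf.expectation q f = (LINT k|count_space UNIV. pmf q k *\<^sub>R f k)"
    unfolding measure_pmf_eq_density by (subst integral_density) auto
  ultimately show ?thesis by simp
qed

lemma nat_pmf_eqI_pgf:
  fixes q q' :: "nat pmf"
  assumes "\<And>s::real. 0 < s \<Longrightarrow> s < 1 \<Longrightarrow> measure_pmf.expectation q (\<lambda>k. s ^ k) = measure_pmf.expectation q' (\<lambda>k. s ^ k)"
  shows "q = q'"
proof (rule pmf_eqI)
  fix k
  have "((\<lambda>y::nat. (\<lambda>y k. pmf q k - pmf q' k) y k) \<longlongrightarrow> 0) sequentially"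
  proof (rule coeff_tendsto_zero)
    show "\<bar>pmf q k - pmf q' k\<bar> \<le> 1" for y :: nat and k
      using pmf_le_1[of q k] pmf_le_1[of q' k] pmf_nonneg[of q k] pmf_nonneg[of q' k] by linarith
    fix s :: real assume s: "0 < s" "s < 1"
    have b: "0 \<le> s ^ k \<and> s ^ k \<le> 1" for k using s by (simp add: power_le_one)
    have "(\<lambda>k. pmf q k * s ^ k - pmf q' k * s ^ k) sums (measure_pmf.expectation q (\<lambda>k. s ^ k) - measure_pmf.expectation q' (\<lambda>k. s ^ k))"
      by (intro sums_diff expectation_nat_pmf b)
    then have "(\<Sum>k. (pmf q k - pmf q' k) * s ^ k) = 0"
      using assms[OF s] by (simp add: sums_iff left_diff_distrib)
    then show "((\<lambda>y::nat. \<Sum>k. (pmf q k - pmf q' k) * s ^ k) \<longlongrightarrow> 0) sequentially" by simp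
  qed
  then have "pmf q k - pmf q' k = 0" by (simp add: LIMSEQ_const_iff)
  then show "pmf q k = pmf q' k" by simp
qed

text \<open>Tightness keeps mass from escaping, so the limits of the coefficients sum to 1. The
  conclusion concerns any v squeezed between a truncated sum and that sum plus the missing mass; in
  this form the approximating laws never have to be built as values of type
  \<open>pmf\<close>.\<close>

lemma tight_pmf_limit:
  fixes r :: "nat \<Rightarrow> nat \<Rightarrow> real"
  assumes r0: "\<And>n k. 0 \<le> r n k" and r1: "\<And>n K. (\<Sum>k<K. r n k) \<le> 1"
    and tight: "\<And>e::real. 0 < e \<Longrightarrow> \<exists>K. \<forall>n. 1 - e \<le> (\<Sum>k<K. r n k)"
    and conv: "\<And>k. convergent (\<lambda>n. r n k)"
  shows "\<exists>q :: nat pmf. \<forall>f v. (\<forall>k. 0 \<le> f k \<and> f k \<le> 1) \<longrightarrow>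
       (\<forall>n K. (\<Sum>k<K. r n k * f k) \<le> v n \<and> v n \<le> (\<Sum>k<K. r n k * f k) + (1 - (\<Sum>k<K. r n k))) \<longrightarrow>
       v \<longlonglongrightarrow> measure_pmf.expectation q f"
proof -
  define R where "R = (\<lambda>k. lim (\<lambda>n. r n k))"
  have R: "(\<lambda>n. r n k) \<longlonglongrightarrow> R k" for k using conv[of k] by (simp add: R_def convergent_LIMSEQ_iff)
  have R0: "0 \<le> R k" for k using r0 by (intro LIMSEQ_le_const[OF R]) auto
  have R1: "(\<Sum>k<K. R k) \<le> 1" for K
    using r1 by (intro LIMSEQ_le_const2[OF tendsto_sum[OF R]]) auto
  have summ: "summable R"
    by (rule summableI_nonneg_bounded[of _ 1]) (use R0 R1 in auto)
  have "suminf R = 1"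
  proof (rule antisym)
    show "suminf R \<le> 1" using R1 by (intro suminf_le_const[OF summ]) auto
    show "1 \<le> suminf R"
    proof (rule field_le_epsilon)
      fix e :: real assume "0 < e"
      then obtain K where K: "\<forall>n. 1 - e \<le> (\<Sum>k<K. r n k)" using tight by blast
      have "1 - e \<le> (\<Sum>k<K. R k)" using K by (intro LIMSEQ_le_const[OF tendsto_sum[OF R]]) auto
      also have "\<dots> \<le> suminf R" using R0 by (intro sum_le_suminf[OF summ]) auto
      finally show "1 \<le> suminf R + e" by simp
    qed
  qed
  then have Rs: "R sums 1" using summ by (simp add: sums_iff)
  have nn: "(\<integral>\<^sup>+k. ennreal (R k) \<partial>count_space UNIV) = 1"
    unfolding nn_integral_count_space_nat using suminf_ennreal_eq[OF R0 Rs] by simp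
  define q where "q = embed_pmf R"
  have q: "pmf q k = R k" for k unfolding q_def by (rule pmf_embed_pmf[OF R0 nn])
  show ?thesis
  proof (intro exI allI impI)
    fix f v assume "\<forall>k. 0 \<le> f k \<and> f k \<le> (1::real)"
      and "\<forall>n K. (\<Sum>k<K. r n k * f k) \<le> v n \<and> v n \<le> (\<Sum>k<K. r n k * f k) + (1 - (\<Sum>k<K. r n k))"
    then have f: "\<And>k. 0 \<le> f k \<and> f k \<le> 1"
      and v: "\<And>n K. (\<Sum>k<K. r n k * f k) \<le> v n \<and> v n \<le> (\<Sum>k<K. r n k * f k) + (1 - (\<Sum>k<K. r n k))" by blast+
    have sE: "(\<lambda>k. R k * f k) sums measure_pmf.expectation q f" using expectation_nat_pmf[OF f, of q] unfolding q .
    have E: "(\<Sum>k<K. R k * f k) \<le> measure_pmf.expectation q f \<and> measure_pmf.expectation q f \<le> (\<Sum>k<K. R k * f k) + (1 - (\<Sum>k<K. R k))" for K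
    proof
      have nonneg: "0 \<le> R k * f k" "0 \<le> R k * (1 - f k)" for k using R0[of k] f[of k] by auto
      show "(\<Sum>k<K. R k * f k) \<le> measure_pmf.expectation q f"
        unfolding sums_unique[OF sE] using nonneg by (intro sum_le_suminf sums_summable[OF sE]) auto
      have s2: "(\<lambda>k. R k * (1 - f k)) sums (1 - measure_pmf.expectation q f)"
        using sums_diff[OF Rs sE] by (simp add: right_diff_distrib)
      have "(\<Sum>k<K. R k * (1 - f k)) \<le> 1 - measure_pmf.expectation q f"
        unfolding sums_unique[OF s2] using nonneg by (intro sum_le_suminf sums_summable[OF s2]) auto
      then show "measure_pmf.expectation q f \<le> (\<Sum>k<K. R k * f k) + (1 - (\<Sum>k<K. R k))"
        by (simp add: right_diff_distrib sum_subtractf)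
    qed
    show "v \<longlonglongrightarrow> measure_pmf.expectation q f"
    proof (rule LIMSEQ_I)
      fix e :: real assume e: "0 < e"
      then obtain K where K: "\<forall>n. 1 - e / 3 \<le> (\<Sum>k<K. r n k)" using tight[of "e / 3"] by auto
      then have KR: "1 - e / 3 \<le> (\<Sum>k<K. R k)" by (intro LIMSEQ_le_const[OF tendsto_sum[OF R]]) auto
      have "(\<lambda>n. \<Sum>k<K. r n k * f k) \<longlonglongrightarrow> (\<Sum>k<K. R k * f k)" by (intro tendsto_sum tendsto_mult R tendsto_const)
      from LIMSEQ_D[OF this, of "e / 3"] e
      obtain no where no: "\<And>n. n \<ge> no \<Longrightarrow> \<bar>(\<Sum>k<K. r n k * f k) - (\<Sum>k<K. R k * f k)\<bar> < e / 3" by auto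
      show "\<exists>no. \<forall>n\<ge>no. norm (v n - measure_pmf.expectation q f) < e"
      proof (intro exI allI impI)
        fix n assume "no \<le> n"
        from no[OF this] show "norm (v n - measure_pmf.expectation q f) < e"
          using v[of n K] E[of K] K[rule_format, of n] KR unfolding real_norm_def by linarith
      qed
    qed
  qed
qed

lemma expectation_pair_pmf_mult:
  fixes f :: "'a \<Rightarrow> real" and g :: "'b \<Rightarrow> real"
  assumes f: "\<And>x. 0 \<le> f x \<and> f x \<le> 1" and g: "\<And>y. 0 \<le> g y \<and> g y \<le> 1"
  shows "measure_pmf.expectation (pair_pmf A B) (\<lambda>z. f (fst z) * g (snd z)) = measure_pmf.expectation A f * measure_pmf.expectation B g"
proof -
  have fi: "integrable (measure_pmf A) f" using f by (intro measure_pmf.integrable_const_bound[where B = 1]) auto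
  have gi: "integrable (measure_pmf B) g" using g by (intro measure_pmf.integrable_const_bound[where B = 1]) auto
  have fgi: "integrable (measure_pmf (pair_pmf A B)) (\<lambda>z. f (fst z) * g (snd z))"
    using f g by (intro measure_pmf.integrable_const_bound[where B = 1]) (auto simp: abs_mult intro!: mult_le_one)
  have "ennreal (measure_pmf.expectation (pair_pmf A B) (\<lambda>z. f (fst z) * g (snd z))) = (\<integral>\<^sup>+z. ennreal (f (fst z) * g (snd z)) \<partial>pair_pmf A B)"
    using fgi f g by (intro nn_integral_eq_integral[symmetric]) auto
  also have "\<dots> = (\<integral>\<^sup>+a. \<integral>\<^sup>+b. ennreal (f a) * ennreal (g b) \<partial>B \<partial>A)"
    using f g by (simp add: nn_integral_pair_pmf' ennreal_mult)
  also have "\<dots> = (\<integral>\<^sup>+a. ennreal (f a) \<partial>A) * (\<integral>\<^sup>+b. ennreal (g b) \<partial>B)"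
    by (simp add: nn_integral_cmult nn_integral_multc)
  also have "\<dots> = ennreal (measure_pmf.expectation A f) * ennreal (measure_pmf.expectation B g)"
    using fi gi f g by (simp add: nn_integral_eq_integral)
  also have "\<dots> = ennreal (measure_pmf.expectation A f * measure_pmf.expectation B g)"
    using f g by (intro ennreal_mult[symmetric] integral_nonneg_AE) auto
  finally show ?thesis
    using f g by (subst (asm) ennreal_inj) (auto intro!: integral_nonneg_AE mult_nonneg_nonneg)
qed

lemma pgf_pois:
  assumes "0 \<le> \<mu>" "0 \<le> s" "s \<le> 1"
  shows "measure_pmf.expectation (pois \<mu>) (\<lambda>k. s ^ k) = exp (- (1 - s) * \<mu>)"
proof (cases "\<mu> = 0")
  case False
  then have \<mu>: "0 < \<mu>" using assms by simp
  have "(\<lambda>k. (\<mu> * s) ^ k /\<^sub>R fact k * exp (- \<mu>)) sums (exp (\<mu> * s) * exp (- \<mu>))"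
    by (intro sums_mult2 exp_converges)
  then have "(\<lambda>k. pmf (pois \<mu>) k * s ^ k) sums (exp (\<mu> * s) * exp (- \<mu>))"
    using \<mu> by (simp add: pois_def power_mult_distrib field_simps)
  moreover have "(\<lambda>k. pmf (pois \<mu>) k * s ^ k) sums measure_pmf.expectation (pois \<mu>) (\<lambda>k. s ^ k)"
    using assms by (intro expectation_nat_pmf) (simp add: power_le_one)
  ultimately have "measure_pmf.expectation (pois \<mu>) (\<lambda>k. s ^ k) = exp (\<mu> * s) * exp (- \<mu>)" by (rule sums_unique2[rotated])
  then show ?thesis by (simp add: exp_add[symmetric] algebra_simps)
qed (simp add: pois_def)

text \<open>k n is the largest j \<le> n whose threshold M j has been passed. Inserting 0 keeps the
  maximum defined, and from n = M 0 on the value 0 is legitimate too.\<close>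

lemma diagonal_choice:
  fixes P :: "nat \<Rightarrow> nat \<Rightarrow> bool"
  assumes "\<And>j. eventually (P j) sequentially"
  obtains k where "filterlim k at_top sequentially" "eventually (\<lambda>n. P (k n) n) sequentially"
proof -
  have "\<exists>M. \<forall>n\<ge>M. P j n" for j using assms[of j] by (simp add: eventually_sequentially)
  then obtain M where M: "\<And>j n. n \<ge> M j \<Longrightarrow> P j n" by metis
  define k where "k = (\<lambda>n. Max (insert 0 {j. j \<le> n \<and> M j \<le> n}))"
  have fin: "finite (insert 0 {j. j \<le> n \<and> M j \<le> n})" for n by simp
  have "filterlim k at_top sequentially"
    unfolding filterlim_at_top eventually_sequentially
  proof
    fix j
    have "j \<le> k n" if "n \<ge> max j (M j)" for n
      unfolding k_def using that by (intro Max_ge[OF fin]) auto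
    then show "\<exists>N. \<forall>n\<ge>N. j \<le> k n" by blast
  qed
  moreover have "eventually (\<lambda>n. P (k n) n) sequentially"
    unfolding eventually_sequentially
  proof (intro exI allI impI)
    fix n assume n: "M 0 \<le> n"
    have "k n \<in> insert 0 {j. j \<le> n \<and> M j \<le> n}" unfolding k_def by (rule Max_in[OF fin]) simp
    then show "P (k n) n" using M n by auto
  qed
  ultimately show thesis by (rule that)
qed

section \<open>Convergence of the joint Laplace transforms\<close>

locale graph_poisson = graph_seq p m E W d \<kappa> lam C + poisson_proc P S
  for p m E W d \<kappa> lam C and P :: "'w measure" and S
begin

text \<open>May contain numbers above m n when the cut-off exceeds the size of the graph. They are
  isolated; \<open>law\<close> includes them, and \<open>bern_restrict\<close> removes them in
  \<open>joint_limit\<close>.\<close>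

definition big :: "nat \<Rightarrow> nat set" where "big n = {1..Nn n}"

definition tiny :: "nat \<Rightarrow> nat set" where "tiny n = {Nn n + 1..m n}"

definition T1 :: "nat \<Rightarrow> nat set \<Rightarrow> nat" where "T1 n A = card {e \<in> E n. e \<subseteq> A \<and> e \<subseteq> big n}"

definition T2 :: "nat \<Rightarrow> nat set \<Rightarrow> nat" where
  "T2 n A = card {e \<in> E n. e \<subseteq> A \<and> e \<inter> big n \<noteq> {} \<and> e \<inter> tiny n \<noteq> {}}"

definition T3 :: "nat \<Rightarrow> nat set \<Rightarrow> nat" where "T3 n A = card {e \<in> E n. e \<subseteq> A \<and> e \<subseteq> tiny n}"

definition law :: "nat \<Rightarrow> (nat set \<Rightarrow> real) \<Rightarrow> real" where "law n = bern (p n) (big n \<union> tiny n)"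

definition F :: "real \<Rightarrow> real \<Rightarrow> real" where
  "F t1 t2 = expectation (\<lambda>\<omega>. exp (1/2 * stoch_int2 P S (phi W t1) \<omega> - (1 - exp (- t2)) * stoch_int1 P S (Delta W d) \<omega>))"

lemma edgeD: "e \<in> E n \<Longrightarrow> e \<subseteq> big n \<union> tiny n \<and> card e = 2"
  using graph[of n] by (fastforce simp: simple_graph_def big_def tiny_def)

lemma finite_E: "finite (E n)"
  by (rule finite_subset[of _ "Pow (big n \<union> tiny n)"]) (use edgeD in \<open>auto simp: big_def tiny_def\<close>)

lemma T_sum: "T1 n A + T2 n A + T3 n A = card {e \<in> E n. e \<subseteq> A}"
proof -
  have disj: "big n \<inter> tiny n = {}" by (auto simp: big_def tiny_def)
  have ne: "e \<noteq> {}" if "e \<in> E n" for e using edgeD[OF that] by auto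
  have "{e \<in> E n. e \<subseteq> A} = ({e \<in> E n. e \<subseteq> A \<and> e \<subseteq> big n} \<union> {e \<in> E n. e \<subseteq> A \<and> e \<inter> big n \<noteq> {} \<and> e \<inter> tiny n \<noteq> {}})
      \<union> {e \<in> E n. e \<subseteq> A \<and> e \<subseteq> tiny n}"
    using edgeD by blast
  moreover have "{e \<in> E n. e \<subseteq> A \<and> e \<subseteq> big n} \<inter> {e \<in> E n. e \<subseteq> A \<and> e \<inter> big n \<noteq> {} \<and> e \<inter> tiny n \<noteq> {}} = {}"
    using disj by blast
  moreover have "({e \<in> E n. e \<subseteq> A \<and> e \<subseteq> big n} \<union> {e \<in> E n. e \<subseteq> A \<and> e \<inter> big n \<noteq> {} \<and> e \<inter> tiny n \<noteq> {}})
      \<inter> {e \<in> E n. e \<subseteq> A \<and> e \<subseteq> tiny n} = {}"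
    using disj ne by blast
  ultimately show ?thesis
    unfolding T1_def T2_def T3_def using finite_E[of n] by (simp add: card_Un_disjoint)
qed

text \<open>\<open>stoch_limit\<close> gives the limit of the elementary integrals on the mesh with
  \<open>Nn n\<close> cells, and \<open>poisson_gibbs\<close> replaces these by \<open>gibbs\<close>
  at the cost of twice Nn p^2, which vanishes by \<open>Npp_lim\<close>.\<close>

lemma Laplace_integrable:
  assumes "0 \<le> t1" "0 \<le> t2"
  shows "integrable P (\<lambda>\<omega>. exp (1/2 * stoch_int2 P S (phi W t1) \<omega> - (1 - exp (- t2)) * stoch_int1 P S (Delta W d) \<omega>))"
  and graphon_gibbs_lim: "(\<lambda>n. gibbs (p n) (big n) (1 - exp (- t1)) (mean_kernel (p n) (W0 W)) (\<lambda>u. exp (- ((1 - exp (- t2)) * mean_\<Delta> n u))))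
      \<longlonglongrightarrow> F t1 t2"
proof -
  have DI: "set_integrable lborel {0..} (Delta W d)"
    using \<Delta>0_integrable by (simp add: set_integrable_def \<Delta>0_def[abs_def])
  have D0: "AE x in lborel. 0 \<le> x \<longrightarrow> 0 \<le> Delta W d x"
    using \<Delta>0_nonneg by eventually_elim (auto simp: \<Delta>0_def)
  have c: "0 \<le> 1 - exp (- t1)" "1 - exp (- t1) < 1" "0 \<le> 1 - exp (- t2)" using assms by auto
  note L = stoch_limit[OF p(1,3) Nn_lim W W0_integrable DI D0 assms(1) c(3)]
  show "integrable P (\<lambda>\<omega>. exp (1/2 * stoch_int2 P S (phi W t1) \<omega> - (1 - exp (- t2)) * stoch_int1 P S (Delta W d) \<omega>))"
    by (rule L(1))
  define X where "X = (\<lambda>n. expectation (\<lambda>\<omega>. exp (1/2 * elem_int2 S (Suc (Nn n)) (vcell (p n))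
       (\<lambda>u v. if u = v then 0 else ln (1 - (1 - exp (- t1)) * mean_kernel (p n) (W0 W) {u, v})) \<omega>
             - elem_int1 S (Suc (Nn n)) (vcell (p n)) (\<lambda>u. (1 - exp (- t2)) * mean_\<Delta> n u) \<omega>)))"
  define Y where "Y = (\<lambda>n. gibbs (p n) (big n) (1 - exp (- t1)) (mean_kernel (p n) (W0 W)) (\<lambda>u. exp (- ((1 - exp (- t2)) * mean_\<Delta> n u))))"
  have X: "X \<longlonglongrightarrow> F t1 t2" unfolding X_def F_def mean_\<Delta>_def by (rule L(2))
  have XY: "\<bar>X n - Y n\<bar> \<le> 2 * (real (Nn n) * (p n)\<^sup>2)" for n
    unfolding X_def Y_def big_def
  proof (rule poisson_gibbs[OF p(1) less_imp_le[OF p(2)] c(1,2)])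
    show "0 \<le> mean_kernel (p n) (W0 W) e \<and> mean_kernel (p n) (W0 W) e \<le> 1" for e
      unfolding mean_kernel_def by (rule mean_cell_bounds[OF p(1) W0_measurable[OF W]]) (use W0_bounds[OF W] in auto)
    show "0 \<le> (1 - exp (- t2)) * mean_\<Delta> n u" for u
      using p(1)[of n] c(3) unfolding mean_\<Delta>_def set_lebesgue_integral_def
      by (intro mult_nonneg_nonneg divide_nonneg_pos integral_nonneg_AE) auto
  qed
  have "(\<lambda>n. 2 * (real (Nn n) * (p n)\<^sup>2)) \<longlonglongrightarrow> 0" using tendsto_mult[OF tendsto_const Npp_lim, of 2] by simp
  then have "(\<lambda>n. X n - Y n) \<longlonglongrightarrow> 0"
    by (rule Lim_null_comparison[rotated]) (use XY in \<open>auto intro!: always_eventually\<close>)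
  then have "(\<lambda>n. X n - (X n - Y n)) \<longlonglongrightarrow> F t1 t2 - 0" by (intro tendsto_diff X)
  then show "Y \<longlonglongrightarrow> F t1 t2" by simp
qed

text \<open>Two exchanges, from \<open>X\<close> over \<open>Y\<close> to \<open>Z\<close>: the
  kernel first, then the field. The kernel estimate carries a factor (1 - p)^2, whence the division
  in \<open>XY\<close>; it is harmless since p tends to 0.\<close>

lemma graph_gibbs_lim:
  assumes "0 \<le> t1" "0 \<le> t2"
  shows "(\<lambda>n. gibbs (p n) (big n) (1 - exp (- t1)) (\<lambda>e. of_bool (e \<in> E n)) (\<lambda>u. exp (- (1 - exp (- t2)) * bsn n u)))
      \<longlonglongrightarrow> F t1 t2"
proof -
  define c1 c2 where "c1 = 1 - exp (- t1)" and "c2 = 1 - exp (- t2)"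
  have c: "0 \<le> c1" "c1 \<le> 1" "0 \<le> c2" "c2 \<le> 1" using assms by (auto simp: c1_def c2_def)
  define X where "X = (\<lambda>n. gibbs (p n) (big n) c1 (\<lambda>e. of_bool (e \<in> E n)) (\<lambda>u. exp (- c2 * bsn n u)))"
  define Y where "Y = (\<lambda>n. gibbs (p n) (big n) c1 (mean_kernel (p n) (W0 W)) (\<lambda>u. exp (- c2 * bsn n u)))"
  define Z where "Z = (\<lambda>n. gibbs (p n) (big n) c1 (mean_kernel (p n) (W0 W)) (\<lambda>u. exp (- (c2 * mean_\<Delta> n u))))"
  have Z: "Z \<longlonglongrightarrow> F t1 t2" unfolding Z_def c1_def c2_def by (rule graphon_gibbs_lim[OF assms])
  have b: "0 \<le> exp (- c2 * bsn n u) \<and> exp (- c2 * bsn n u) \<le> 1" for n u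
    using c(3) bsn_nonneg[of n u] by (auto intro!: mult_nonneg_nonneg)
  have bm: "0 \<le> exp (- (c2 * mean_\<Delta> n u)) \<and> exp (- (c2 * mean_\<Delta> n u)) \<le> 1" for n u
  proof -
    have "0 \<le> mean_\<Delta> n u"
      using p(1)[of n] unfolding mean_\<Delta>_def set_lebesgue_integral_def
      by (intro divide_nonneg_pos integral_nonneg_AE) auto
    then show ?thesis using c(3) by simp
  qed
  have YZ: "\<bar>Y n - Z n\<bar> \<le> (\<Sum>u\<in>big n. p n * \<bar>exp (- c2 * bsn n u) - exp (- (c2 * mean_\<Delta> n u))\<bar>)" for n
    unfolding Y_def Z_def
  proof (rule gibbs_field_diff)
    show "0 \<le> mean_kernel (p n) (W0 W) e \<and> mean_kernel (p n) (W0 W) e \<le> 1" for e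
      unfolding mean_kernel_def by (rule mean_cell_bounds[OF p(1) W0_measurable[OF W]]) (use W0_bounds[OF W] in auto)
  qed (use c b bm p(1)[of n] p(2)[of n] in \<open>auto simp: big_def\<close>)
  have YZ0: "(\<lambda>n. Y n - Z n) \<longlonglongrightarrow> 0"
    using YZ by (intro Lim_null_comparison[OF _ field_error[OF c(3,4)]]) (auto simp: big_def)
  have XY: "\<bar>X n - Y n\<bar> \<le> (cut_dist (\<kappa> n) (Wn n) W + real (Nn n) * (p n)\<^sup>2) / (1 - p n)\<^sup>2" for n
  proof -
    have "(1 - p n)\<^sup>2 * \<bar>X n - Y n\<bar> \<le> cut_dist (\<kappa> n) (Wn n) W + real (Nn n) * (p n)\<^sup>2"
      unfolding X_def Y_def big_def
      by (rule graph_mesh.gibbs_graph_vs_graphon[OF mesh less_imp_le[OF p(2)] W Nn_bounds(1) c(1,2) b])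
    then show ?thesis using p(2)[of n] by (subst pos_le_divide_eq) (auto simp: mult.commute)
  qed
  have "(\<lambda>n. (cut_dist (\<kappa> n) (Wn n) W + real (Nn n) * (p n)\<^sup>2) / (1 - p n)\<^sup>2) \<longlonglongrightarrow> (0 + 0) / (1 - 0)\<^sup>2"
    by (intro tendsto_intros cut Npp_lim p(3)) auto
  then have XY0: "(\<lambda>n. X n - Y n) \<longlonglongrightarrow> 0" using XY by (intro Lim_null_comparison[of "\<lambda>n. X n - Y n"]) auto
  have "(\<lambda>n. (X n - Y n) + (Y n - Z n) + Z n) \<longlonglongrightarrow> 0 + 0 + F t1 t2" by (intro tendsto_add XY0 YZ0 Z)
  then have "X \<longlonglongrightarrow> F t1 t2" by simp
  then show ?thesis unfolding X_def c1_def c2_def .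
qed

lemma Laplace_lim:
  assumes t: "0 \<le> t1" "0 \<le> t2" "0 \<le> t3"
  shows "(\<lambda>n. law n (\<lambda>A. exp (- t1 * real (T1 n A) - t2 * real (T2 n A) - t3 * real (T3 n A))))
     \<longlonglongrightarrow> F t1 t2 * exp (- (1 - exp (- t3)) * lam)"
proof -
  define X where "X = (\<lambda>n. law n (\<lambda>A. exp (- t1 * real (T1 n A) - t2 * real (T2 n A) - t3 * real (T3 n A))))"
  define Y where "Y = (\<lambda>n. gibbs (p n) (big n) (1 - exp (- t1)) (\<lambda>e. of_bool (e \<in> E n)) (\<lambda>u. exp (- (1 - exp (- t2)) * bsn n u))
      * exp (- (1 - exp (- t3)) * ((p n)\<^sup>2 * real (card {e \<in> E n. e \<subseteq> tiny n}))))"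
  have "\<bar>X n - Y n\<bar> \<le> 2 * p n ^ 3 * (\<Sum>v\<in>tiny n. (real (card {e \<in> E n. v \<in> e}))\<^sup>2) + p n ^ 3 * real (card (E n))" for n
    unfolding X_def Y_def law_def T1_def T2_def T3_def bsn_def tiny_def[symmetric]
    using p(1)[of n] p(2)[of n] edgeD t by (intro bern_small_part) (auto simp: big_def tiny_def)
  then have XY: "(\<lambda>n. X n - Y n) \<longlonglongrightarrow> 0"
    by (intro Lim_null_comparison[OF _ dependency_error]) (auto simp: tiny_def)
  have Y: "Y \<longlonglongrightarrow> F t1 t2 * exp (- (1 - exp (- t3)) * lam)"
    unfolding Y_def tiny_def by (intro tendsto_intros graph_gibbs_lim t small_edges_lim)
  have "(\<lambda>n. (X n - Y n) + Y n) \<longlonglongrightarrow> 0 + F t1 t2 * exp (- (1 - exp (- t3)) * lam)" by (intro tendsto_add XY Y)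
  then show ?thesis unfolding X_def by simp
qed

end

section \<open>Convergence of the laws\<close>

lemma bern_pgf:
  fixes Z :: "'v set \<Rightarrow> nat" and s :: real
  shows "(\<lambda>k. bern p V (\<lambda>A. g A * of_bool (Z A = k)) * s ^ k) sums bern p V (\<lambda>A. g A * s ^ Z A)"
proof -
  have "(\<lambda>k. \<Sum>A\<in>Pow V. p ^ card A * (1 - p) ^ card (V - A) * g A * (if k = Z A then s ^ k else 0))
      sums (\<Sum>A\<in>Pow V. p ^ card A * (1 - p) ^ card (V - A) * g A * s ^ Z A)"
    by (intro sums_sum sums_mult sums_single)
  moreover have "(\<Sum>A\<in>Pow V. p ^ card A * (1 - p) ^ card (V - A) * g A * (if k = Z A then s ^ k else 0))
     = bern p V (\<lambda>A. g A * of_bool (Z A = k)) * s ^ k" for k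
    unfolding bern_def sum_distrib_right by (intro sum.cong refl) auto
  ultimately show ?thesis unfolding bern_def by (simp add: mult.assoc)
qed

lemma pmf_sum_split:
  fixes K :: nat and f :: "nat \<Rightarrow> real"
  shows "(\<Sum>k<K. of_bool (z = k) * f k) = of_bool (z < K) * f z"
proof -
  have "(\<Sum>k<K. of_bool (z = k) * f k) = (\<Sum>k<K. if z = k then f k else 0)"
    by (intro sum.cong refl) auto
  then show ?thesis by simp
qed

context graph_poisson
begin

lemma finite_vertices: "finite (big n \<union> tiny n)"
  by (simp add: big_def tiny_def)

lemma law_mono: "(\<And>A. f A \<le> g A) \<Longrightarrow> law n f \<le> law n g"
  unfolding law_def using p(1)[of n] p(2)[of n] by (intro bern_mono) auto

lemma law_bounds: "(\<And>A. 0 \<le> f A \<and> f A \<le> 1) \<Longrightarrow> 0 \<le> law n f \<and> law n f \<le> 1"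
  unfolding law_def using p(1)[of n] p(2)[of n] finite_vertices by (auto intro!: bern_nonneg bern_le)

text \<open>Each edge is present with probability p^2, so the mean is |E| p^2. All tightness below
  rests on this first moment.\<close>

lemma law_card: "law n (\<lambda>A. real (card {e \<in> E n. e \<subseteq> A})) \<le> C"
proof -
  have "real (card {e \<in> E n. e \<subseteq> A}) = (\<Sum>e\<in>E n. of_bool (e \<subseteq> A))" for A
  proof -
    have "(\<Sum>e\<in>E n. of_bool (e \<subseteq> A)) = (\<Sum>e\<in>{e \<in> E n. e \<subseteq> A}. 1 :: real)"
      by (rule sum.mono_neutral_cong_right[OF finite_E]) auto
    then show ?thesis by simp
  qed
  then have "law n (\<lambda>A. real (card {e \<in> E n. e \<subseteq> A})) = (\<Sum>e\<in>E n. bern (p n) (big n \<union> tiny n) (\<lambda>A. of_bool (e \<subseteq> A)))"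
    unfolding law_def by (simp add: bern_sum)
  also have "\<dots> = (\<Sum>e\<in>E n. (p n)\<^sup>2)"
    using edgeD by (intro sum.cong refl) (simp add: bern_prob_all_in[OF finite_vertices])
  also have "\<dots> \<le> C" using edges[of n] by simp
  finally show ?thesis .
qed

text \<open>By Markov's inequality, at most L edges are present with probability at least 1 - C / L.
  The hypothesis \<open>bound\<close> keeps Z below a constant on this event, so tightness holds for
  every statistic controlled by the number of present edges.\<close>

lemma stat_limit:
  fixes Z :: "nat \<Rightarrow> nat set \<Rightarrow> nat"
  assumes bound: "\<And>L. \<exists>K. \<forall>n A. card {e \<in> E n. e \<subseteq> A} \<le> L \<longrightarrow> Z n A < K"
    and conv: "\<And>k. convergent (\<lambda>n. law n (\<lambda>A. of_bool (Z n A = k)))"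
  shows "\<exists>q :: nat pmf. \<forall>f. (\<forall>k. 0 \<le> f k \<and> f k \<le> 1) \<longrightarrow>
    (\<lambda>n. law n (\<lambda>A. f (Z n A))) \<longlonglongrightarrow> measure_pmf.expectation q f"
proof -
  define r where "r = (\<lambda>n k. law n (\<lambda>A. of_bool (Z n A = k)))"
  have rf: "(\<Sum>k<K. r n k * f k) = law n (\<lambda>A. of_bool (Z n A < K) * f (Z n A))" for n K f
    unfolding r_def law_def bern_cmult_right[symmetric] bern_sum[symmetric] pmf_sum_split ..
  have r1: "(\<Sum>k<K. r n k) = law n (\<lambda>A. of_bool (Z n A < K))" for n K
    using rf[of n "\<lambda>_. 1" K] by simp
  have lc: "law n (\<lambda>_. c) = c" for n c unfolding law_def by (rule bern_const[OF finite_vertices])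
  have r_nn: "0 \<le> r n k" for n k unfolding r_def using law_bounds[of "\<lambda>A. of_bool (Z n A = k)" n] by simp
  have r_le: "(\<Sum>k<K. r n k) \<le> 1" for n K unfolding r1 using law_bounds[of "\<lambda>A. of_bool (Z n A < K)" n] by simp
  have r_conv: "convergent (\<lambda>n. r n k)" for k unfolding r_def by (rule conv)
  have r_tight: "\<exists>K. \<forall>n. 1 - e \<le> (\<Sum>k<K. r n k)" if e: "0 < e" for e :: real
  proof -
    obtain L :: nat where L: "C / e < real L" using reals_Archimedean2 by blast
    then have L0: "0 < real L" using C_nonneg e by (meson divide_nonneg_pos le_less_trans)
    obtain K where K: "\<And>n A. card {e \<in> E n. e \<subseteq> A} \<le> L \<Longrightarrow> Z n A < K" using bound[of L] by blast
    have "1 - e \<le> (\<Sum>k<K. r n k)" for n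
    proof -
      have "1 - real (card {e \<in> E n. e \<subseteq> A}) * (1 / real L) \<le> of_bool (Z n A < K)" for A
      proof (cases "card {e \<in> E n. e \<subseteq> A} \<le> L")
        case False
        then have "1 \<le> real (card {e \<in> E n. e \<subseteq> A}) * (1 / real L)" using L0 by simp
        then have "1 - real (card {e \<in> E n. e \<subseteq> A}) * (1 / real L) \<le> 0" by linarith
        also have "0 \<le> (of_bool (Z n A < K) :: real)" by simp
        finally show ?thesis .
      qed (use K in simp)
      then have "law n (\<lambda>A. 1 - real (card {e \<in> E n. e \<subseteq> A}) * (1 / real L)) \<le> (\<Sum>k<K. r n k)"
        unfolding r1 by (rule law_mono)
      moreover have "law n (\<lambda>A. 1 - real (card {e \<in> E n. e \<subseteq> A}) * (1 / real L))
         = 1 - law n (\<lambda>A. real (card {e \<in> E n. e \<subseteq> A})) * (1 / real L)"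
        using lc[of n 1] unfolding law_def bern_diff bern_cmult_right by simp
      moreover have "law n (\<lambda>A. real (card {e \<in> E n. e \<subseteq> A})) * (1 / real L) \<le> C * (1 / real L)"
        by (rule mult_right_mono[OF law_card]) simp
      moreover have "C * (1 / real L) \<le> e" using L L0 e by (simp add: field_simps)
      ultimately show ?thesis by linarith
    qed
    then show ?thesis by blast
  qed
  obtain q :: "nat pmf" where q0: "\<forall>f v. (\<forall>k. 0 \<le> f k \<and> f k \<le> 1) \<longrightarrow>
       (\<forall>n K. (\<Sum>k<K. r n k * f k) \<le> v n \<and> v n \<le> (\<Sum>k<K. r n k * f k) + (1 - (\<Sum>k<K. r n k))) \<longrightarrow>
       v \<longlonglongrightarrow> measure_pmf.expectation q f"
    using tight_pmf_limit[OF r_nn r_le r_tight r_conv] by blast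
  show ?thesis
  proof (intro exI allI impI)
    fix f :: "nat \<Rightarrow> real" assume f: "\<forall>k. 0 \<le> f k \<and> f k \<le> 1"
    show "(\<lambda>n. law n (\<lambda>A. f (Z n A))) \<longlonglongrightarrow> measure_pmf.expectation q f"
    proof (rule q0[rule_format], use f in blast, intro conjI)
      fix n K
      have 1: "of_bool (Z n A < K) * f (Z n A) \<le> f (Z n A)" for A using f by simp
      have 2: "f (Z n A) \<le> of_bool (Z n A < K) * f (Z n A) + (1 - of_bool (Z n A < K))" for A using f by simp
      show "(\<Sum>k<K. r n k * f k) \<le> law n (\<lambda>A. f (Z n A))" unfolding rf using 1 by (rule law_mono)
      have "law n (\<lambda>A. f (Z n A)) \<le> law n (\<lambda>A. of_bool (Z n A < K) * f (Z n A) + (1 - of_bool (Z n A < K)))"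
        using 2 by (rule law_mono)
      also have "\<dots> = law n (\<lambda>A. of_bool (Z n A < K) * f (Z n A)) + (law n (\<lambda>_. 1) - law n (\<lambda>A. of_bool (Z n A < K)))"
        unfolding law_def bern_add bern_diff ..
      finally show "law n (\<lambda>A. f (Z n A)) \<le> (\<Sum>k<K. r n k * f k) + (1 - (\<Sum>k<K. r n k))"
        unfolding rf r1 lc .
    qed
  qed
qed

text \<open>The weight g lets the extraction be iterated: with g a power of s2 it isolates a value
  of \<open>T1\<close>, and with g the indicator of that value it isolates a value of
  \<open>T2\<close>.\<close>

lemma law_coeff_convergent:
  assumes g: "\<And>n A. 0 \<le> g n A \<and> g n A \<le> 1"
    and conv: "\<And>s. 0 < s \<Longrightarrow> s < 1 \<Longrightarrow> convergent (\<lambda>n. law n (\<lambda>A. g n A * s ^ Z n A))"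
  shows "convergent (\<lambda>n. law n (\<lambda>A. g n A * of_bool (Z n A = k)))"
proof (rule convergent_coeff)
  show "0 \<le> law n (\<lambda>A. g n A * of_bool (Z n A = k)) \<and> law n (\<lambda>A. g n A * of_bool (Z n A = k)) \<le> 1" for n k
    by (rule law_bounds) (use g in auto)
  fix s :: real assume "0 < s" "s < 1"
  from conv[OF this] show "convergent (\<lambda>n. \<Sum>k. law n (\<lambda>A. g n A * of_bool (Z n A = k)) * s ^ k)"
    unfolding law_def sums_unique[OF bern_pgf] .
qed

lemma exp_ln_power: "0 < s \<Longrightarrow> exp (ln s * real k) = s ^ k"
  by (metis exp_ln exp_of_nat2_mult)

lemma pgf_lim:
  assumes "0 < s1" "s1 \<le> 1" "0 < s2" "s2 \<le> 1" "0 < s3" "s3 \<le> 1"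
  shows "(\<lambda>n. law n (\<lambda>A. s1 ^ T1 n A * s2 ^ T2 n A * s3 ^ T3 n A)) \<longlonglongrightarrow> F (- ln s1) (- ln s2) * exp (- (1 - s3) * lam)"
proof -
  have "0 \<le> - ln s1" "0 \<le> - ln s2" "0 \<le> - ln s3" using assms by auto
  from Laplace_lim[OF this] show ?thesis using assms by (simp add: exp_add exp_ln_power)
qed

lemma lam_nonneg: "0 \<le> lam"
  by (rule LIMSEQ_le_const[OF small_edges_lim]) auto

text \<open>The pair (T1, T2) is coded as one natural number by \<open>prod_encode\<close>, so the
  one-dimensional limit theorem applies to it. The limit law of the total count is taken separately;
  it has the generating function of the limit of T1 + T2 plus an independent Poisson variable, and
  \<open>nat_pmf_eqI_pgf\<close> identifies the two.\<close>

theorem joint_limit: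
  obtains q :: "nat pmf" where
    "\<And>t1 t2. 0 \<le> t1 \<Longrightarrow> 0 \<le> t2 \<Longrightarrow>
       measure_pmf.expectation q (\<lambda>k. exp (- t1 * real (fst (prod_decode k)) - t2 * real (snd (prod_decode k)))) = F t1 t2"
    "\<And>f. (\<And>k. 0 \<le> f k \<and> f k \<le> 1) \<Longrightarrow>
       (\<lambda>n. bern (p n) {1..m n} (\<lambda>A. f (card {e \<in> E n. e \<subseteq> A})))
         \<longlonglongrightarrow> measure_pmf.expectation (pair_pmf q (pois lam)) (\<lambda>z. f (fst (prod_decode (fst z)) + snd (prod_decode (fst z)) + snd z))"
proof -
  have one: "convergent (\<lambda>n. law n (\<lambda>A. s2 ^ T2 n A * of_bool (T1 n A = i)))" if s2: "0 < s2" "s2 < 1" for s2 i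
  proof (rule law_coeff_convergent)
    show "0 \<le> s2 ^ T2 n A \<and> s2 ^ T2 n A \<le> 1" for n A using s2 by (simp add: power_le_one)
    fix s :: real assume "0 < s" "s < 1"
    then show "convergent (\<lambda>n. law n (\<lambda>A. s2 ^ T2 n A * s ^ T1 n A))"
      using pgf_lim[of s s2 1] s2 by (auto simp: convergent_def mult.commute)
  qed
  have two: "convergent (\<lambda>n. law n (\<lambda>A. of_bool (T1 n A = i) * of_bool (T2 n A = j)))" for i j
    by (rule law_coeff_convergent) (use one in \<open>auto simp: mult.commute\<close>)
  have bound: "\<exists>K. \<forall>n A. card {e \<in> E n. e \<subseteq> A} \<le> L \<longrightarrow> prod_encode (T1 n A, T2 n A) < K" for L
  proof -
    \<comment> \<open>Both counts are at most the total, so the code stays in the image of a finite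
      square.\<close>
    define B where "B = prod_encode ` ({..L} \<times> {..L})"
    have "prod_encode (T1 n A, T2 n A) < Suc (Max B)" if "card {e \<in> E n. e \<subseteq> A} \<le> L" for n A
    proof -
      have "T1 n A \<le> L" "T2 n A \<le> L" using that T_sum[of n A] by linarith+
      then have "prod_encode (T1 n A, T2 n A) \<in> B" by (auto simp: B_def)
      moreover have "finite B" by (simp add: B_def)
      ultimately show ?thesis by (simp add: le_imp_less_Suc)
    qed
    then show ?thesis by blast
  qed
  have conv: "convergent (\<lambda>n. law n (\<lambda>A. of_bool (prod_encode (T1 n A, T2 n A) = k)))" for k
  proof -
    have "(prod_encode (T1 n A, T2 n A) = k) \<longleftrightarrow> T1 n A = fst (prod_decode k) \<and> T2 n A = snd (prod_decode k)" for n A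
      by (metis fst_conv prod.collapse prod_decode_inverse prod_encode_inverse snd_conv)
    then show ?thesis
      using two[of "fst (prod_decode k)" "snd (prod_decode k)"] by (simp add: of_bool_conj)
  qed
  obtain q :: "nat pmf" where q: "\<forall>f. (\<forall>k. 0 \<le> f k \<and> f k \<le> 1) \<longrightarrow>
      (\<lambda>n. law n (\<lambda>A. f (prod_encode (T1 n A, T2 n A)))) \<longlonglongrightarrow> measure_pmf.expectation q f"
    using stat_limit[of "\<lambda>n A. prod_encode (T1 n A, T2 n A)", OF bound conv] by blast
  have qF: "measure_pmf.expectation q (\<lambda>k. exp (- t1 * real (fst (prod_decode k)) - t2 * real (snd (prod_decode k)))) = F t1 t2"
    if t: "0 \<le> t1" "0 \<le> t2" for t1 t2
  proof (rule LIMSEQ_unique)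
    have b: "- t1 * real i - t2 * real j \<le> 0" for i j
    proof -
      have "0 \<le> t1 * real i" "0 \<le> t2 * real j" using t by simp_all
      then show ?thesis unfolding mult_minus_left by linarith
    qed
    show "(\<lambda>n. law n (\<lambda>A. exp (- t1 * real (T1 n A) - t2 * real (T2 n A))))
      \<longlonglongrightarrow> measure_pmf.expectation q (\<lambda>k. exp (- t1 * real (fst (prod_decode k)) - t2 * real (snd (prod_decode k))))"
      using q[rule_format, of "\<lambda>k. exp (- t1 * real (fst (prod_decode k)) - t2 * real (snd (prod_decode k)))"] b
      by (simp only: exp_ge_zero exp_le_one_iff prod_encode_inverse fst_conv snd_conv simp_thms)
    show "(\<lambda>n. law n (\<lambda>A. exp (- t1 * real (T1 n A) - t2 * real (T2 n A)))) \<longlonglongrightarrow> F t1 t2"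
      using Laplace_lim[OF t, of 0] by simp
  qed
  define T where "T = (\<lambda>n A. card {e \<in> E n. e \<subseteq> A})"
  have pgfT: "(\<lambda>n. law n (\<lambda>A. s ^ T n A)) \<longlonglongrightarrow> F (- ln s) (- ln s) * exp (- (1 - s) * lam)" if "0 < s" "s < 1" for s
    using pgf_lim[of s s s] that unfolding T_def T_sum[symmetric] by (simp add: power_add)
  have boundT: "\<exists>K. \<forall>n A. card {e \<in> E n. e \<subseteq> A} \<le> L \<longrightarrow> T n A < K" for L
    by (intro exI[of _ "Suc L"]) (simp add: T_def)
  have convT: "convergent (\<lambda>n. law n (\<lambda>A. of_bool (T n A = k)))" for k
    using law_coeff_convergent[of "\<lambda>_ _. 1" T k] pgfT by (auto simp: convergent_def)
  obtain qT :: "nat pmf" where qT: "\<forall>f. (\<forall>k. 0 \<le> f k \<and> f k \<le> 1) \<longrightarrow>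
      (\<lambda>n. law n (\<lambda>A. f (T n A))) \<longlonglongrightarrow> measure_pmf.expectation qT f"
    using stat_limit[OF boundT convT] by blast
  define \<sigma> where "\<sigma> = (\<lambda>z :: nat \<times> nat. fst (prod_decode (fst z)) + snd (prod_decode (fst z)) + snd z)"
  have "qT = map_pmf \<sigma> (pair_pmf q (pois lam))"
  proof (rule nat_pmf_eqI_pgf)
    fix s :: real assume s: "0 < s" "s < 1"
    have b: "0 \<le> s ^ k \<and> s ^ k \<le> 1" for k using s by (simp add: power_le_one)
    define g where "g = (\<lambda>k. s ^ (fst (prod_decode k) + snd (prod_decode k)))"
    have "measure_pmf.expectation qT (\<lambda>k. s ^ k) = F (- ln s) (- ln s) * exp (- (1 - s) * lam)"
      by (rule LIMSEQ_unique[OF qT[rule_format, of "\<lambda>k. s ^ k", OF b] pgfT[OF s]])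
    also have "F (- ln s) (- ln s) = measure_pmf.expectation q g"
      using qF[of "- ln s" "- ln s"] s unfolding g_def by (simp add: exp_add exp_ln_power power_add)
    also have "exp (- (1 - s) * lam) = measure_pmf.expectation (pois lam) (\<lambda>k. s ^ k)"
      using s by (intro pgf_pois[OF lam_nonneg, symmetric]) auto
    also have "measure_pmf.expectation q g * measure_pmf.expectation (pois lam) (\<lambda>k. s ^ k)
       = measure_pmf.expectation (pair_pmf q (pois lam)) (\<lambda>z. g (fst z) * s ^ snd z)"
      by (rule expectation_pair_pmf_mult[symmetric]) (use b in \<open>auto simp: g_def\<close>)
    also have "\<dots> = measure_pmf.expectation (map_pmf \<sigma> (pair_pmf q (pois lam))) (\<lambda>k. s ^ k)"
      by (simp add: \<sigma>_def g_def power_add)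
    finally show "measure_pmf.expectation qT (\<lambda>k. s ^ k) = measure_pmf.expectation (map_pmf \<sigma> (pair_pmf q (pois lam))) (\<lambda>k. s ^ k)" .
  qed
  then have eT: "measure_pmf.expectation qT f = measure_pmf.expectation (pair_pmf q (pois lam)) (\<lambda>z. f (\<sigma> z))" for f :: "nat \<Rightarrow> real"
    by simp
  have restrict: "law n (\<lambda>A. f (T n A)) = bern (p n) {1..m n} (\<lambda>A. f (T n A))" for n and f :: "nat \<Rightarrow> real"
    unfolding law_def
  proof (rule bern_restrict[OF finite_vertices])
    show "{1..m n} \<subseteq> big n \<union> tiny n" by (auto simp: big_def tiny_def)
    fix A B assume "A \<subseteq> {1..m n}" "B \<subseteq> big n \<union> tiny n - {1..m n}"
    then have "{e \<in> E n. e \<subseteq> A \<union> B} = {e \<in> E n. e \<subseteq> A}" using graph[of n] unfolding simple_graph_def by blast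
    then show "f (T n (A \<union> B)) = f (T n A)" unfolding T_def by (simp only:)
  qed
  show thesis
  proof (rule that)
    fix f :: "nat \<Rightarrow> real" assume f: "\<And>k. 0 \<le> f k \<and> f k \<le> 1"
    show "(\<lambda>n. bern (p n) {1..m n} (\<lambda>A. f (card {e \<in> E n. e \<subseteq> A})))
         \<longlonglongrightarrow> measure_pmf.expectation (pair_pmf q (pois lam)) (\<lambda>z. f (fst (prod_decode (fst z)) + snd (prod_decode (fst z)) + snd z))"
      using qT[rule_format, of f, OF f] unfolding restrict eT unfolding \<sigma>_def T_def .
  qed (rule qF)
qed

end

section \<open>The limiting law and the choice of the cut-off\<close>

lemma distr_map_pmf: "distr (measure_pmf (map_pmf h A)) borel g = distr (measure_pmf A) borel (g \<circ> h)"
  by (simp add: map_pmf_rep_eq distr_distr)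

lemma cdf_distr_eq:
  assumes "g \<in> borel_measurable M"
  shows "cdf (distr M borel g) x = (LINT \<omega>|M. indicator {..x} (g \<omega>))"
proof -
  have "cdf (distr M borel g) x = (LINT y|distr M borel g. indicator {..x} y)" by (simp add: cdf_def)
  also have "\<dots> = (LINT \<omega>|M. indicator {..x} (g \<omega>))" using assms by (intro integral_distr) auto
  finally show ?thesis .
qed

text \<open>The three variables are the coordinates of a discrete law on triples: every function is
  measurable for it, and the product form of \<open>pair_pmf\<close> gives the independence.\<close>

lemma limit_law:
  fixes q :: "nat pmf" and \<mu> :: real
  defines "Q \<equiv> measure_pmf (map_pmf (\<lambda>z. (real (fst (prod_decode (fst z))), real (snd (prod_decode (fst z))), real (snd z)))
       (pair_pmf q (pois \<mu>)))"
  shows "distr Q borel (\<lambda>x. snd (snd x)) = distr (measure_pmf (pois \<mu>)) borel real"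
    and "prob_space.indep_set Q
         (sets (vimage_algebra (space Q) (\<lambda>x. (fst x, fst (snd x))) (borel \<Otimes>\<^sub>M borel)))
         (sets (vimage_algebra (space Q) (\<lambda>x. snd (snd x)) borel))"
    and "0 \<le> t1 \<Longrightarrow> 0 \<le> t2 \<Longrightarrow> integrable Q (\<lambda>x. exp (- t1 * fst x - t2 * fst (snd x)))"
    and "(LINT x|Q. exp (- t1 * fst x - t2 * fst (snd x)))
       = measure_pmf.expectation q (\<lambda>k. exp (- t1 * real (fst (prod_decode k)) - t2 * real (snd (prod_decode k))))"
    and "cdf (distr Q borel (\<lambda>x. fst x + fst (snd x) + snd (snd x))) y
       = measure_pmf.expectation (pair_pmf q (pois \<mu>))
           (\<lambda>z. indicator {..y} (real (fst (prod_decode (fst z)) + snd (prod_decode (fst z)) + snd z)))"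
proof -
  define \<phi> where "\<phi> = (\<lambda>z. (real (fst (prod_decode (fst z))), real (snd (prod_decode (fst z))), real (snd z)))"
  have Q: "Q = measure_pmf (map_pmf \<phi> (pair_pmf q (pois \<mu>)))" by (simp add: Q_def \<phi>_def)
  have "distr Q borel (\<lambda>x. snd (snd x)) = distr (measure_pmf (pair_pmf q (pois \<mu>))) borel (real \<circ> snd)"
    unfolding Q distr_map_pmf by (simp add: \<phi>_def comp_def)
  also have "\<dots> = distr (measure_pmf (map_pmf snd (pair_pmf q (pois \<mu>)))) borel real"
    unfolding distr_map_pmf ..
  finally show "distr Q borel (\<lambda>x. snd (snd x)) = distr (measure_pmf (pois \<mu>)) borel real"
    by (simp add: map_snd_pair_pmf)
  show "prob_space.indep_set Q
         (sets (vimage_algebra (space Q) (\<lambda>x. (fst x, fst (snd x))) (borel \<Otimes>\<^sub>M borel)))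
         (sets (vimage_algebra (space Q) (\<lambda>x. snd (snd x)) borel))"
    unfolding Q
  proof (rule prob_space.indep_setI[OF measure_pmf.prob_space_axioms])
    let ?R = "map_pmf \<phi> (pair_pmf q (pois \<mu>))"
    fix a b
    assume "a \<in> sets (vimage_algebra (space (measure_pmf ?R)) (\<lambda>x. (fst x, fst (snd x))) (borel \<Otimes>\<^sub>M borel))"
      and "b \<in> sets (vimage_algebra (space (measure_pmf ?R)) (\<lambda>x. snd (snd x)) borel)"
    then obtain A B where ab: "a = (\<lambda>x. (fst x, fst (snd x))) -` A" "b = (\<lambda>x. snd (snd x)) -` B"
      by (auto simp: sets_vimage_algebra2 space_pair_measure)
    define u where "u = (\<lambda>k. indicator A (real (fst (prod_decode k)), real (snd (prod_decode k))) :: real)"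
    define v where "v = (\<lambda>k. indicator B (real k) :: real)"
    have uv: "0 \<le> u k \<and> u k \<le> 1" "0 \<le> v k \<and> v k \<le> 1" for k by (auto simp: u_def v_def indicator_def)
    have pr: "measure_pmf.prob ?R c = measure_pmf.expectation (pair_pmf q (pois \<mu>)) (\<lambda>z. indicator c (\<phi> z))" for c
      using integral_map_pmf[of \<phi> "pair_pmf q (pois \<mu>)" "indicator c :: _ \<Rightarrow> real"] by simp
    have "measure_pmf.prob ?R (a \<inter> b) = measure_pmf.expectation (pair_pmf q (pois \<mu>)) (\<lambda>z. u (fst z) * v (snd z))"
      unfolding pr ab by (intro Bochner_Integration.integral_cong) (auto simp: u_def v_def \<phi>_def indicator_def)
    also have "\<dots> = measure_pmf.expectation q u * measure_pmf.expectation (pois \<mu>) v"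
      by (rule expectation_pair_pmf_mult[OF uv])
    also have "measure_pmf.expectation q u = measure_pmf.prob ?R a"
    proof -
      have "measure_pmf.prob ?R a = measure_pmf.expectation (pair_pmf q (pois \<mu>)) (\<lambda>z. u (fst z) * 1)"
        unfolding pr ab by (intro Bochner_Integration.integral_cong) (auto simp: u_def \<phi>_def indicator_def)
      also have "\<dots> = measure_pmf.expectation q u" by (subst expectation_pair_pmf_mult) (use uv in auto)
      finally show ?thesis ..
    qed
    also have "measure_pmf.expectation (pois \<mu>) v = measure_pmf.prob ?R b"
    proof -
      have "measure_pmf.prob ?R b = measure_pmf.expectation (pair_pmf q (pois \<mu>)) (\<lambda>z. 1 * v (snd z))"
        unfolding pr ab by (intro Bochner_Integration.integral_cong) (auto simp: v_def \<phi>_def indicator_def)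
      also have "\<dots> = measure_pmf.expectation (pois \<mu>) v" by (subst expectation_pair_pmf_mult) (use uv in auto)
      finally show ?thesis ..
    qed
    finally show "measure_pmf.prob ?R (a \<inter> b) = measure_pmf.prob ?R a * measure_pmf.prob ?R b" .
  qed auto
  show "integrable Q (\<lambda>x. exp (- t1 * fst x - t2 * fst (snd x)))" if t: "0 \<le> t1" "0 \<le> t2"
    unfolding Q
  proof (rule measure_pmf.integrable_const_bound[where B = 1])
    show "AE x in measure_pmf (map_pmf \<phi> (pair_pmf q (pois \<mu>))). norm (exp (- t1 * fst x - t2 * fst (snd x))) \<le> 1"
      unfolding AE_measure_pmf_iff
    proof
      fix x assume "x \<in> set_pmf (map_pmf \<phi> (pair_pmf q (pois \<mu>)))"
      then have "0 \<le> fst x" "0 \<le> fst (snd x)" by (auto simp: \<phi>_def)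
      then have "0 \<le> t1 * fst x" "0 \<le> t2 * fst (snd x)" using t by simp_all
      then have "- t1 * fst x - t2 * fst (snd x) \<le> 0" unfolding mult_minus_left by linarith
      then show "norm (exp (- t1 * fst x - t2 * fst (snd x))) \<le> 1"
        by (simp only: real_norm_def abs_exp_cancel exp_le_one_iff)
    qed
  qed simp
  have "(LINT x|Q. exp (- t1 * fst x - t2 * fst (snd x)))
     = measure_pmf.expectation (pair_pmf q (pois \<mu>)) (\<lambda>z. exp (- t1 * real (fst (prod_decode (fst z))) - t2 * real (snd (prod_decode (fst z)))))"
    unfolding Q by (simp add: \<phi>_def)
  also have "\<dots> = measure_pmf.expectation (map_pmf fst (pair_pmf q (pois \<mu>))) (\<lambda>k. exp (- t1 * real (fst (prod_decode k)) - t2 * real (snd (prod_decode k))))"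
    unfolding integral_map_pmf ..
  finally show "(LINT x|Q. exp (- t1 * fst x - t2 * fst (snd x)))
       = measure_pmf.expectation q (\<lambda>k. exp (- t1 * real (fst (prod_decode k)) - t2 * real (snd (prod_decode k))))"
    unfolding map_fst_pair_pmf .
  show "cdf (distr Q borel (\<lambda>x. fst x + fst (snd x) + snd (snd x))) y
       = measure_pmf.expectation (pair_pmf q (pois \<mu>))
           (\<lambda>z. indicator {..y} (real (fst (prod_decode (fst z)) + snd (prod_decode (fst z)) + snd z)))"
    unfolding Q by (subst cdf_distr_eq) (simp_all add: \<phi>_def)
qed

section \<open>The cut-off along a diagonal\<close>

lemma double_limit_eventually:
  assumes "double_limit a l" "0 < e"
  shows "\<forall>\<^sub>F K in at_top. \<forall>\<^sub>F n in sequentially. \<bar>a K n - l\<bar> < e"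
proof -
  have "Limsup at_top (\<lambda>K. limsup (\<lambda>n. ereal (a K n))) < ereal (l + e)"
    "ereal (l - e) < Liminf at_top (\<lambda>K. liminf (\<lambda>n. ereal (a K n)))"
    using assms by (auto simp: double_limit_def)
  from Limsup_lessD[OF this(1)] less_LiminfD[OF this(2)]
  show ?thesis
  proof eventually_elim
    case (elim K)
    from Limsup_lessD[OF elim(1)] less_LiminfD[OF elim(2)] show ?case
      by eventually_elim auto
  qed
qed

lemma null_sequence_of_inverse_bound:
  fixes x :: "nat \<Rightarrow> real"
  assumes "filterlim k at_top sequentially" "\<forall>\<^sub>F n in sequentially. \<bar>x n\<bar> \<le> 1 / real (Suc (k n))"
  shows "x \<longlonglongrightarrow> 0"
proof (rule Lim_null_comparison)
  show "\<forall>\<^sub>F n in sequentially. norm (x n) \<le> 1 / real (Suc (k n))" using assms(2) by simp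
  have "(\<lambda>j. 1 / real (Suc j)) \<longlonglongrightarrow> 0" using LIMSEQ_inverse_real_of_nat by (simp add: inverse_eq_divide)
  from filterlim_compose[OF this assms(1)] show "(\<lambda>n. 1 / real (Suc (k n))) \<longlonglongrightarrow> 0" .
qed

text \<open>For each j a level K j \<ge> j + 1 is fixed at which all quantities are eventually
  within 1 / (j + 1) of their limits; \<open>diagonal_choice\<close> lets j grow with n slowly
  enough. The product of K j and p n is one of these quantities, so \<kappa> p tends to 0.\<close>

lemma cutoff_choice:
  fixes a b c :: "real \<Rightarrow> nat \<Rightarrow> real" and p :: "nat \<Rightarrow> real"
  assumes p: "p \<longlonglongrightarrow> 0"
    and a: "\<And>e. 0 < e \<Longrightarrow> \<forall>\<^sub>F K in at_top. \<forall>\<^sub>F n in sequentially. \<bar>a K n - l\<bar> < e"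
    and b: "\<forall>\<^sub>F K in at_top. b K \<longlonglongrightarrow> 0" and c: "\<forall>\<^sub>F K in at_top. c K \<longlonglongrightarrow> 0"
  obtains \<kappa> :: "nat \<Rightarrow> real" where "\<forall>n. 1 \<le> \<kappa> n" "filterlim \<kappa> at_top sequentially" "(\<lambda>n. \<kappa> n * p n) \<longlonglongrightarrow> 0"
    "(\<lambda>n. a (\<kappa> n) n) \<longlonglongrightarrow> l" "(\<lambda>n. b (\<kappa> n) n) \<longlonglongrightarrow> 0" "(\<lambda>n. c (\<kappa> n) n) \<longlonglongrightarrow> 0"
proof -
  define e where "e = (\<lambda>j. 1 / real (Suc j))"
  have e: "0 < e j" for j by (simp add: e_def)
  have "\<exists>K. real (Suc j) \<le> K \<and> (\<forall>\<^sub>F n in sequentially. \<bar>a K n - l\<bar> < e j) \<and> b K \<longlonglongrightarrow> 0 \<and> c K \<longlonglongrightarrow> 0" for j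
    by (rule eventually_happens'[OF trivial_limit_at_top_linorder])
      (intro eventually_conj eventually_ge_at_top a e b c)
  then obtain K where K: "\<And>j. real (Suc j) \<le> K j" "\<And>j. \<forall>\<^sub>F n in sequentially. \<bar>a (K j) n - l\<bar> < e j"
    "\<And>j. b (K j) \<longlonglongrightarrow> 0" "\<And>j. c (K j) \<longlonglongrightarrow> 0"
    by metis
  have near: "\<forall>\<^sub>F n in sequentially. \<bar>x n\<bar> \<le> e j" if "x \<longlonglongrightarrow> 0" for x :: "nat \<Rightarrow> real" and j
    using tendstoD[OF that e[of j]] by eventually_elim simp
  have Kp: "(\<lambda>n. K j * p n) \<longlonglongrightarrow> 0" for j using tendsto_mult[OF tendsto_const p, of "K j"] by simp
  have "\<forall>\<^sub>F n in sequentially. \<bar>K j * p n\<bar> \<le> e j \<and> \<bar>a (K j) n - l\<bar> \<le> e j \<and> \<bar>b (K j) n\<bar> \<le> e j \<and> \<bar>c (K j) n\<bar> \<le> e j" for j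
    using near[OF Kp, of j j] K(2)[of j] near[OF K(3), of j j] near[OF K(4), of j j] by eventually_elim auto
  then obtain k where k: "filterlim k at_top sequentially"
    and ev: "\<forall>\<^sub>F n in sequentially. \<bar>K (k n) * p n\<bar> \<le> e (k n) \<and> \<bar>a (K (k n)) n - l\<bar> \<le> e (k n)
      \<and> \<bar>b (K (k n)) n\<bar> \<le> e (k n) \<and> \<bar>c (K (k n)) n\<bar> \<le> e (k n)"
    by (rule diagonal_choice)
  note null = null_sequence_of_inverse_bound[OF k, folded e_def]
  show thesis
  proof (rule that[of "\<lambda>n. K (k n)"])
    show "\<forall>n. 1 \<le> K (k n)"
    proof
      show "1 \<le> K (k n)" for n using K(1)[of "k n"] by simp
    qed
    show "filterlim (\<lambda>n. K (k n)) at_top sequentially"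
    proof (rule filterlim_at_top_mono)
      show "filterlim (\<lambda>n. real (k n)) at_top sequentially" by (rule filterlim_compose[OF filterlim_real_sequentially k])
      have "real (k n) \<le> K (k n)" for n using K(1)[of "k n"] by simp
      then show "\<forall>\<^sub>F n in sequentially. real (k n) \<le> K (k n)" by simp
    qed
    show "(\<lambda>n. K (k n) * p n) \<longlonglongrightarrow> 0" "(\<lambda>n. b (K (k n)) n) \<longlonglongrightarrow> 0" "(\<lambda>n. c (K (k n)) n) \<longlonglongrightarrow> 0"
      by (rule null, rule eventually_mono[OF ev], simp add: e_def)+
    have "(\<lambda>n. a (K (k n)) n - l) \<longlonglongrightarrow> 0" by (rule null, rule eventually_mono[OF ev], simp add: e_def)
    then show "(\<lambda>n. a (K (k n)) n) \<longlonglongrightarrow> l" by (simp add: LIM_zero_iff)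
  qed
qed

theorem mainTheorem1:
  fixes p :: "nat \<Rightarrow> real"
    and M :: "nat \<Rightarrow> 'a measure"
    and X :: "nat \<Rightarrow> nat \<Rightarrow> 'a \<Rightarrow> real"
    and G :: "nat \<Rightarrow> nat set set"
    and W :: "real \<Rightarrow> real \<Rightarrow> real"
    and d :: "real \<Rightarrow> real"
    and lam0 :: real
    and P :: "'w measure"
    and S :: "'w \<Rightarrow> real set"
  assumes p_range: "\<And>n. n \<ge> 1 \<Longrightarrow> 0 < p n \<and> p n < 1"
    and p_lim: "p \<longlonglongrightarrow> 0"
    and prob: "\<And>n. n \<ge> 1 \<Longrightarrow> prob_space (M n)"
    and X_indep: "\<And>n. n \<ge> 1 \<Longrightarrow> prob_space.indep_vars (M n) (\<lambda>_. borel) (X n) {1..n}"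
    and X_Ber: "\<And>n v. n \<ge> 1 \<Longrightarrow> v \<in> {1..n} \<Longrightarrow>
          distr (M n) borel (X n v) = distr (measure_pmf (bernoulli_pmf (p n))) borel of_bool"
    and graph: "\<And>n. n \<ge> 1 \<Longrightarrow> simple_graph n (G n)"
    and mean: "(\<lambda>n. real (card (G n)) * (p n)\<^sup>2) \<in> \<Theta>(\<lambda>_. 1)"
    and labelling: "\<And>n u v. n \<ge> 1 \<Longrightarrow> 1 \<le> u \<Longrightarrow> u \<le> v \<Longrightarrow> v \<le> n \<Longrightarrow>
          vertex_degree (G n) v \<le> vertex_degree (G n) u"
    and cond_a: "double_limit
          (\<lambda>K n. 1/2 * (LINT x:{K..}|lborel. (LINT y:{K..}|lborel. graph_graphon n (1 / p n) (G n) x y))) lam0"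
    and W: "W \<in> graphons"
    and cond_b: "\<exists>K\<^sub>0>0. \<forall>K\<ge>K\<^sub>0. (\<lambda>n. cut_dist K (graph_graphon n (1 / p n) (G n)) W) \<longlonglongrightarrow> 0"
    and d_nonneg: "\<And>x. x \<ge> 0 \<Longrightarrow> d x \<ge> 0"
    and d_L1: "set_integrable lborel {0..} d"
    and cond_c: "\<exists>K\<^sub>0>0. \<exists>M\<^sub>0>0. \<forall>K\<ge>K\<^sub>0. \<forall>L\<ge>M\<^sub>0.
          (\<lambda>n. LINT x:{0..K}|lborel.
             \<bar>graphon_degree (graph_graphon n (1 / p n) (G n)) x * of_bool (graphon_degree (graph_graphon n (1 / p n) (G n)) x \<le> L)
                - d x * of_bool (d x \<le> L)\<bar>) \<longlonglongrightarrow> 0"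
    and process: "poisson_process P S"
  shows "(\<integral>\<^sup>+z\<in>{0..} \<times> {0..}. ennreal (W (fst z) (snd z)) \<partial>lborel) < \<infinity> \<and>
    (\<exists>(Q :: (real \<times> real \<times> real) measure) Q\<^sub>1 Q\<^sub>2 Q\<^sub>3.
       prob_space Q \<and>
       Q\<^sub>1 \<in> borel_measurable Q \<and> Q\<^sub>2 \<in> borel_measurable Q \<and> Q\<^sub>3 \<in> borel_measurable Q \<and>
       distr Q borel Q\<^sub>3 = distr (measure_pmf (pois lam0)) borel real \<and>
       prob_space.indep_set Q
         (sets (vimage_algebra (space Q) (\<lambda>\<omega>. (Q\<^sub>1 \<omega>, Q\<^sub>2 \<omega>)) (borel \<Otimes>\<^sub>M borel)))
         (sets (vimage_algebra (space Q) Q\<^sub>3 borel)) \<and>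
       weak_conv_m (\<lambda>n. distr (M n) borel (edge_count_stat n (G n) (X n)))
                   (distr Q borel (\<lambda>\<omega>. Q\<^sub>1 \<omega> + Q\<^sub>2 \<omega> + Q\<^sub>3 \<omega>)) \<and>
       (\<forall>t\<^sub>1\<ge>0. \<forall>t\<^sub>2\<ge>0.
          integrable Q (\<lambda>\<omega>. exp (- t\<^sub>1 * Q\<^sub>1 \<omega> - t\<^sub>2 * Q\<^sub>2 \<omega>)) \<and>
          integrable P (\<lambda>\<omega>. exp (1/2 * stoch_int2 P S (phi W t\<^sub>1) \<omega>
                                 - (1 - exp (- t\<^sub>2)) * stoch_int1 P S (Delta W d) \<omega>)) \<and>
          prob_space.expectation Q (\<lambda>\<omega>. exp (- t\<^sub>1 * Q\<^sub>1 \<omega> - t\<^sub>2 * Q\<^sub>2 \<omega>)) =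
          prob_space.expectation P (\<lambda>\<omega>. exp (1/2 * stoch_int2 P S (phi W t\<^sub>1) \<omega>
                                 - (1 - exp (- t\<^sub>2)) * stoch_int1 P S (Delta W d) \<omega>))))"
proof -
  interpret PP: poisson_proc P S
    using process by (simp add: poisson_proc_def poisson_proc_axioms_def poisson_process_def)
  \<comment> \<open>All sequences are shifted by one: the hypotheses hold for n \<ge> 1, while the
    locale asks for every n.\<close>
  define p' where "p' = (\<lambda>n. p (Suc n))"
  define E where "E = (\<lambda>n. G (Suc n))"
  define Wn where "Wn = (\<lambda>n. graph_graphon (Suc n) (1 / p' n) (E n))"
  have p': "0 < p' n" "p' n < 1" for n using p_range[of "Suc n"] by (auto simp: p'_def)
  have p'0: "p' \<longlonglongrightarrow> 0" unfolding p'_def by (rule LIMSEQ_Suc[OF p_lim])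
  have "(\<lambda>n. real (card (G n)) * (p n)\<^sup>2) \<in> O(\<lambda>_. 1)" using mean by (rule bigthetaD1)
  then obtain c0 where "\<forall>\<^sub>F n in sequentially. norm (real (card (G n)) * (p n)\<^sup>2) \<le> c0 * norm (1::real)"
    by (rule landau_o.bigE)
  then obtain n0 where n0: "\<And>n. n \<ge> n0 \<Longrightarrow> real (card (G n)) * (p n)\<^sup>2 \<le> c0"
    unfolding eventually_sequentially by auto
  \<comment> \<open>The bound from \<Theta> holds for large n only; the finitely many earlier terms
    are added, and the absolute value keeps the total an upper bound for each of them.\<close>
  define C where "C = \<bar>c0\<bar> + (\<Sum>n<n0. real (card (G n)) * (p n)\<^sup>2)"
  have C: "real (card (G n)) * (p n)\<^sup>2 \<le> C" for n
  proof (cases "n < n0")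
    case True
    then have "real (card (G n)) * (p n)\<^sup>2 \<le> (\<Sum>n<n0. real (card (G n)) * (p n)\<^sup>2)"
      by (intro member_le_sum) auto
    then show ?thesis unfolding C_def by linarith
  next
    case False
    then have "real (card (G n)) * (p n)\<^sup>2 \<le> c0" using n0 by simp
    moreover have "0 \<le> (\<Sum>n<n0. real (card (G n)) * (p n)\<^sup>2)" by (intro sum_nonneg) auto
    ultimately show ?thesis unfolding C_def by linarith
  qed
  have near: "\<forall>\<^sub>F K in at_top. \<forall>\<^sub>F n in sequentially.
      \<bar>1/2 * (LINT x:{K..}|lborel. (LINT y:{K..}|lborel. Wn n x y)) - lam0\<bar> < e" if "0 < e" for e
    using double_limit_eventually[OF cond_a that]
  proof eventually_elim
    case (elim K)
    then show ?case by (subst (asm) eventually_sequentially_Suc[symmetric]) (simp add: Wn_def p'_def E_def)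
  qed
  obtain K0 where K0: "\<And>K. K \<ge> K0 \<Longrightarrow> (\<lambda>n. cut_dist K (graph_graphon n (1 / p n) (G n)) W) \<longlonglongrightarrow> 0"
    using cond_b by blast
  have "(\<lambda>n. cut_dist K (Wn n) W) \<longlonglongrightarrow> 0" if "K \<ge> K0" for K
    using LIMSEQ_Suc[OF K0[OF that]] by (simp add: Wn_def p'_def E_def)
  then have cut0: "\<forall>\<^sub>F K in at_top. (\<lambda>n. cut_dist K (Wn n) W) \<longlonglongrightarrow> 0" by (auto simp: eventually_at_top_linorder)
  obtain K1 M1 where K1: "\<And>K L. K \<ge> K1 \<Longrightarrow> L \<ge> M1 \<Longrightarrow>
        (\<lambda>n. LINT x:{0..K}|lborel.
           \<bar>graphon_degree (graph_graphon n (1 / p n) (G n)) x * of_bool (graphon_degree (graph_graphon n (1 / p n) (G n)) x \<le> L)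
              - d x * of_bool (d x \<le> L)\<bar>) \<longlonglongrightarrow> 0"
    using cond_c by blast
  \<comment> \<open>The truncation level is tied to the cut-off, L = K, which is allowed once K
    passes both thresholds.\<close>
  have "(\<lambda>n. LINT x:{0..K}|lborel. \<bar>graphon_degree (Wn n) x * of_bool (graphon_degree (Wn n) x \<le> K)
              - d x * of_bool (d x \<le> K)\<bar>) \<longlonglongrightarrow> 0" if "K \<ge> max K1 M1" for K
    using LIMSEQ_Suc[OF K1[of K K]] that unfolding Wn_def p'_def E_def by simp
  then have trunc0: "\<forall>\<^sub>F K in at_top. (\<lambda>n. LINT x:{0..K}|lborel. \<bar>graphon_degree (Wn n) x * of_bool (graphon_degree (Wn n) x \<le> K)
              - d x * of_bool (d x \<le> K)\<bar>) \<longlonglongrightarrow> 0"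
    unfolding eventually_at_top_linorder by blast
  obtain \<kappa> :: "nat \<Rightarrow> real" where \<kappa>: "\<forall>n. 1 \<le> \<kappa> n" "filterlim \<kappa> at_top sequentially" "(\<lambda>n. \<kappa> n * p' n) \<longlonglongrightarrow> 0"
    and a: "(\<lambda>n. 1/2 * (LINT x:{\<kappa> n..}|lborel. (LINT y:{\<kappa> n..}|lborel. Wn n x y))) \<longlonglongrightarrow> lam0"
    and b: "(\<lambda>n. cut_dist (\<kappa> n) (Wn n) W) \<longlonglongrightarrow> 0"
    and c: "(\<lambda>n. LINT x:{0..\<kappa> n}|lborel. \<bar>graphon_degree (Wn n) x * of_bool (graphon_degree (Wn n) x \<le> \<kappa> n)
                - d x * of_bool (d x \<le> \<kappa> n)\<bar>) \<longlonglongrightarrow> 0"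
    by (rule cutoff_choice[OF p'0 near cut0 trunc0])
  \<comment> \<open>Kept under a second name, since the interpretation that follows brings in a fact
    \<open>graph\<close> of its own.\<close>
  note G_simple = graph
  interpret graph_poisson p' Suc E W d \<kappa> lam0 C P S
  proof unfold_locales
    show "simple_graph (Suc n) (E n)" for n unfolding E_def by (rule graph) simp
    show "real (card (E n)) * (p' n)\<^sup>2 \<le> C" for n unfolding E_def p'_def by (rule C)
    show "vertex_degree (E n) v \<le> vertex_degree (E n) u" if "1 \<le> u" "u \<le> v" "v \<le> Suc n" for n u v
      unfolding E_def using that by (intro labelling) auto
  qed (use p' p'0 \<kappa> W d_nonneg d_L1 a b c in \<open>simp_all add: Wn_def\<close>)
  have "(\<integral>\<^sup>+z\<in>{0..} \<times> {0..}. ennreal (W (fst z) (snd z)) \<partial>lborel) = (\<integral>\<^sup>+z. ennreal (norm (W0 W z)) \<partial>lborel)"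
    using W0_bounds[OF W] by (intro nn_integral_cong) (auto simp: W0_def indicator_def abs_of_nonneg split: if_splits)
  also have "\<dots> < \<infinity>" using W0_integrable by (simp add: integrable_iff_bounded)
  finally have fin: "(\<integral>\<^sup>+z\<in>{0..} \<times> {0..}. ennreal (W (fst z) (snd z)) \<partial>lborel) < \<infinity>" .
  obtain q :: "nat pmf" where
    qF: "\<And>t1 t2. 0 \<le> t1 \<Longrightarrow> 0 \<le> t2 \<Longrightarrow>
       measure_pmf.expectation q (\<lambda>k. exp (- t1 * real (fst (prod_decode k)) - t2 * real (snd (prod_decode k)))) = F t1 t2"
    and qT: "\<And>f. (\<And>k. 0 \<le> f k \<and> f k \<le> 1) \<Longrightarrow>
       (\<lambda>n. bern (p' n) {1..Suc n} (\<lambda>A. f (card {e \<in> E n. e \<subseteq> A})))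
         \<longlonglongrightarrow> measure_pmf.expectation (pair_pmf q (pois lam0)) (\<lambda>z. f (fst (prod_decode (fst z)) + snd (prod_decode (fst z)) + snd z))"
    by (fact joint_limit)
  define Q where "Q = measure_pmf (map_pmf (\<lambda>z. (real (fst (prod_decode (fst z))), real (snd (prod_decode (fst z))), real (snd z)))
       (pair_pmf q (pois lam0)))"
  note law = limit_law[where q = q and \<mu> = lam0, folded Q_def]
  \<comment> \<open>Both distribution functions are expectations of the indicator of {..y} at an
    integer count, a function with values in [0,1], so \<open>joint_limit\<close> gives convergence
    at every y.\<close>
  have conv: "weak_conv_m (\<lambda>n. distr (M n) borel (edge_count_stat n (G n) (X n)))
      (distr Q borel (\<lambda>x. fst x + fst (snd x) + snd (snd x)))"
    unfolding weak_conv_m_def weak_conv_def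
  proof (intro allI impI)
    fix y
    define f where "f = (\<lambda>x::real. indicator {..y} x :: real)"
    have f: "f \<in> borel_measurable borel" unfolding f_def by simp
    have cdf: "cdf (distr (M (Suc n)) borel (edge_count_stat (Suc n) (G (Suc n)) (X (Suc n)))) y
       = bern (p' n) {1..Suc n} (\<lambda>A. f (real (card {e \<in> E n. e \<subseteq> A})))" for n
    proof -
      interpret M: prob_space "M (Suc n)" by (rule prob) simp
      have le: "1 \<le> Suc n" by simp
      note eb = M.edge_count_bern[where p = "p (Suc n)", OF X_indep[OF le] _ _ _ G_simple[OF le] f]
      have "edge_count_stat (Suc n) (G (Suc n)) (X (Suc n)) \<in> borel_measurable (M (Suc n))"
        by (rule eb(2)) (use p_range[OF le] X_Ber[OF le] in auto)
      then have "cdf (distr (M (Suc n)) borel (edge_count_stat (Suc n) (G (Suc n)) (X (Suc n)))) y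
         = M.expectation (\<lambda>\<omega>. f (edge_count_stat (Suc n) (G (Suc n)) (X (Suc n)) \<omega>))"
        unfolding f_def by (rule cdf_distr_eq)
      also have "\<dots> = bern (p' n) {1..Suc n} (\<lambda>A. f (real (card {e \<in> E n. e \<subseteq> A})))"
        unfolding p'_def E_def by (rule eb(1)) (use p_range[OF le] X_Ber[OF le] in auto)
      finally show ?thesis .
    qed
    have "(\<lambda>n. bern (p' n) {1..Suc n} (\<lambda>A. f (real (card {e \<in> E n. e \<subseteq> A}))))
       \<longlonglongrightarrow> cdf (distr Q borel (\<lambda>x. fst x + fst (snd x) + snd (snd x))) y"
      unfolding law(5) using qT[of "\<lambda>k. f (real k)"] by (simp add: f_def)
    then show "(\<lambda>n. cdf (distr (M n) borel (edge_count_stat n (G n) (X n))) y)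
       \<longlonglongrightarrow> cdf (distr Q borel (\<lambda>x. fst x + fst (snd x) + snd (snd x))) y"
      unfolding cdf[symmetric] by (rule LIMSEQ_imp_Suc)
  qed
  have transform: "\<forall>t\<^sub>1\<ge>0. \<forall>t\<^sub>2\<ge>0.
          integrable Q (\<lambda>x. exp (- t\<^sub>1 * fst x - t\<^sub>2 * fst (snd x))) \<and>
          integrable P (\<lambda>\<omega>. exp (1/2 * stoch_int2 P S (phi W t\<^sub>1) \<omega>
                                 - (1 - exp (- t\<^sub>2)) * stoch_int1 P S (Delta W d) \<omega>)) \<and>
          prob_space.expectation Q (\<lambda>x. exp (- t\<^sub>1 * fst x - t\<^sub>2 * fst (snd x))) =
          prob_space.expectation P (\<lambda>\<omega>. exp (1/2 * stoch_int2 P S (phi W t\<^sub>1) \<omega>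
                                 - (1 - exp (- t\<^sub>2)) * stoch_int1 P S (Delta W d) \<omega>))"
    using law(3) Laplace_integrable qF unfolding law(4) F_def by blast
  have Q: "prob_space Q" unfolding Q_def by (rule measure_pmf.prob_space_axioms)
  have meas: "g \<in> borel_measurable Q" for g :: "real \<times> real \<times> real \<Rightarrow> real" by (simp add: Q_def)
  show ?thesis
    by (intro exI[of _ Q] exI[of _ fst] exI[of _ "\<lambda>x. fst (snd x)"] exI[of _ "\<lambda>x. snd (snd x)"] conjI fin Q meas law(1,2) conv transform)
qed

end
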